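(* Let $d\in\mathbb N$, let $\mathbf Q$ be a word in $\mathcal E_{\operatorname{Pol}_1(A)}$, and let $\mathbf i,\mathbf j\in\Gamma_{d,\mathbf Q}$. Then the set ${}_{\mathbf j}\mathcal B_{\mathbf i}=\{\mathbf a_{\mathbf j}\,\mathbf x_{\mathbf j}^{\alpha}\,\sigma_{\mathbf j,w,\mathbf i} : \mathbf a\in B^{\otimes d},\ \alpha\in\mathbb N^d,\ w\in S_d\}$ is a $\Bbbk$-basis of $\operatorname{Hom}_{\mathcal{LAW}(A)}(\mathbf i,\mathbf j)$.
   Context: Conventions. $\Bbbk$ is a commutative ring. All algebras are associative unital $\Bbbk$-superalgebras; $\bar f\in\mathbb Z_2$ is the parity of $f$; formulas with parities are for homogeneous elements and extended linearly. $\mathbb N=\{0,1,\dots\}$. Tensor products of superalgebras: $(f'\otimes g)(f\otimes g')=(-1)^{\bar f\bar g}f'f\otimes gg'$. For an algebra $F$, $Z(F)=\{f: fg=(-1)^{\bar f\bar g}gf\ \forall g\in F\}$; $f\in F$ is regular if it is neither a left nor a right zero-divisor. $\mathcal E_F$ is the set of even, central, regular elements of $F$, and $\widehat{\mathcal E}_F=\mathcal E_F\cup\{\mathsf I\}$ with $\mathsf I$ a formal symbol. Frobenius superalgebra. $A$ is a fixed Frobenius superalgebra, free over $\Bbbk$ with homogeneous (finite) basis $B$, with homogeneous trace map $\operatorname{tr}\colon A\to\Bbbk$ of parity $\varepsilon\in\mathbb Z_2$, Nakayama automorphism $\psi$ (so $\operatorname{tr}(ab)=(-1)^{\bar a\bar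 b}\operatorname{tr}(b\psi(a))$), and left dual basis $\{b^\vee:b\in B\}$ with $\operatorname{tr}(b^\vee c)=\delta_{b,c}$. For $a\in A$, $a_i=1^{\otimes(i-1)}\otimes a\otimes 1^{\otimes(n-i)}\in A^{\otimes n}$. $B^{\otimes d}=\{b_1\otimes\cdots\otimes b_d: b_k\in B\}$. Frobenius polynomial algebra. $\operatorname{Pol}_n(A)$ is the superalgebra generated by $A^{\otimes n}$ and $x_1,\dots,x_n$ of parity $\varepsilon$ subject to $x_ix_j=(-1)^{\varepsilon}x_jx_i$ ($i\ne j$) and $\mathbf a x_i=(-1)^{\varepsilon\bar{\mathbf a}}x_i\psi_i(\mathbf a)$ for $\mathbf a\in A^{\otimes n}$, where $\psi_i$ applies $\psi$ to the $i$-th factor. Write $x=x_1\in\operatorname{Pol}_1(A)$. For $f=\sum_k a_{(k)}x^k\in\operatorname{Pol}_1(A)$ put $f_i=\sum_k (a_{(k)})_i x_i^k\in\operatorname{Pol}_n(A)$. $S_n$ acts on $\operatorname{Pol}_n(A)$ by superalgebra automorphisms: superpermutation of factors on $A^{\otimes n}$ and $w(x_i)=x_{w(i)}$. Put $t_{i,j}=\sum_{b\in B}(-1)^{\varepsilon\bar b}b_i(b^\vee)_j$. The Frobenius Demazure operators $\partial_i$ ($1\le i\le n-1$) are the $\Bbbk$-linear endomorphisms of $\operatorname{Pol}_n(A)$ determined by $\partial_i(\mathbf a)=0$ for $\mathbf a\in A^{\otimes n}$, $\partial_i(x_i)=t_{i,i+1}$, $\partial_i(x_{i+1})=-t_{i+1,i}$,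 $\partial_i(x_j)=0$ for $j\neq i,i+1$, and $\partial_i(fg)=\partial_i(f)g+s_i(f)\partial_i(g)$. A strict $\Bbbk$-linear monoidal supercategory is a strict monoidal category enriched in $\Bbbk$-supermodules with super interchange law $(f'\otimes g)\circ(f\otimes g')=(-1)^{\bar f\bar g}(f'\circ f)\otimes(g\circ g')$; juxtaposition denotes composition. $\mathcal{LAW}(A)$ (higher-level affine wreath product category) is the strict $\Bbbk$-linear monoidal supercategory whose objects are generated by $\widehat{\mathcal E}_{\operatorname{Pol}_1(A)}$ (objects are words in this set, tensor product is concatenation), with generating morphisms $\sigma\colon\mathsf I\otimes\mathsf I\to\mathsf I\otimes\mathsf I$ (black-black crossing, even), $\langle a\rangle\colon\mathsf I\to\mathsf I$ for $a\in A$ (token, parity $\bar a$), $\mathsf x\colon\mathsf I\to\mathsf I$ (dot, parity $\varepsilon$), and even red-black crossings $\rho_Q\colon Q\otimes\mathsf I\to\mathsf I\otimes Q$, $\lambda_Q\colon\mathsf I\otimes Q\to Q\otimes\mathsf I$ for $Q\in\mathcal E_{\operatorname{Pol}_1(A)}$. For $f=\sum_r a_{(r)}x^r\in\operatorname{Pol}_1(A)$ put $[f]=\sum_r\langle a_{(r)}\rangle\mathsf x^r$. For $f=\sum\mu_{b,c,r,s}(b\otimes c)x_1^rx_2^s\in\operatorname{Pol}_2(A)$ put $[f]_Q=\sum\mu_{b,c,r,s}(\langle b\rangle\otimes1_Q\otimes\langle c\rangle)(\mathsf x^r\otimes1_Q\otimes\mathsf x^s)\in\operatorname{End}(\mathsf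 I\otimes Q\otimes\mathsf I)$. Relations, for all $a,b\in A$, $\lambda,\mu\in\Bbbk$, $Q\in\mathcal E_{\operatorname{Pol}_1(A)}$: $\langle 1\rangle=1_{\mathsf I}$, $\lambda\langle a\rangle+\mu\langle b\rangle=\langle\lambda a+\mu b\rangle$, $\langle a\rangle\langle b\rangle=\langle ab\rangle$; $\sigma^2=1$; $(\sigma\otimes1_{\mathsf I})(1_{\mathsf I}\otimes\sigma)(\sigma\otimes1_{\mathsf I})=(1_{\mathsf I}\otimes\sigma)(\sigma\otimes1_{\mathsf I})(1_{\mathsf I}\otimes\sigma)$; $\sigma(\langle a\rangle\otimes1_{\mathsf I})=(1_{\mathsf I}\otimes\langle a\rangle)\sigma$; $\sigma(\mathsf x\otimes1_{\mathsf I})=(1_{\mathsf I}\otimes\mathsf x)\sigma-\sum_{b\in B}(-1)^{\varepsilon\bar b}\langle b\rangle\otimes\langle b^\vee\rangle$; $\langle a\rangle\mathsf x=(-1)^{\varepsilon\bar a}\mathsf x\langle\psi(a)\rangle$; $\lambda_Q(\langle a\rangle\otimes1_Q)=(1_Q\otimes\langle a\rangle)\lambda_Q$; $\rho_Q(1_Q\otimes\langle a\rangle)=(\langle a\rangle\otimes1_Q)\rho_Q$; the same two relations with $\langle a\rangle$ replaced by $\mathsf x$; $\rho_Q\lambda_Q=[Q]\otimes1_Q$; $\lambda_Q\rho_Q=1_Q\otimes[Q]$; $(\sigma\otimes1_Q)(1_{\mathsf I}\otimes\rho_Q)(\rho_Q\otimes1_{\mathsf I})=(1_{\mathsf I}\otimes\rho_Q)(\rho_Q\otimes1_{\mathsf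 I})(1_Q\otimes\sigma)$; $(\lambda_Q\otimes1_{\mathsf I})(1_{\mathsf I}\otimes\lambda_Q)(\sigma\otimes1_Q)=(1_Q\otimes\sigma)(\lambda_Q\otimes1_{\mathsf I})(1_{\mathsf I}\otimes\lambda_Q)$; $(\rho_Q\otimes1_{\mathsf I})(1_Q\otimes\sigma)(\lambda_Q\otimes1_{\mathsf I})=(1_{\mathsf I}\otimes\lambda_Q)(\sigma\otimes1_Q)(1_{\mathsf I}\otimes\rho_Q)-[\partial_1(Q_1)]_Q$. Shuffles. For a word $\mathbf Q$ in $\mathcal E_{\operatorname{Pol}_1(A)}$ (of length $|\mathbf Q|$), $\Gamma_{d,\mathbf Q}$ is the set of words of length $d+|\mathbf Q|$ in $\widehat{\mathcal E}_{\operatorname{Pol}_1(A)}$ containing both $\mathsf I^d$ and $\mathbf Q$ as subwords (a subword is obtained by deleting some, not necessarily consecutive, letters). Letters $\mathsf I$ correspond to black strands and letters $Q\in\mathcal E_{\operatorname{Pol}_1(A)}$ to red strands; strands are numbered from left to right. Chosen diagrams. For each $\mathbf i,\mathbf j\in\Gamma_{d,\mathbf Q}$ and $w\in S_d$, fix a diagram $\sigma_{\mathbf j,w,\mathbf i}\in\operatorname{Hom}_{\mathcal{LAW}(A)}(\mathbf i,\mathbf j)$, i.e. a composite of morphisms $1\otimes g\otimes1$ with $g$ a crossing $\sigma$, $\rho_Q$ or $\lambda_Q$ (no tokens or dots), such that the sequence of transpositions on the black strands (the crossing of the $r$-th and $(r+1)$-st black strands giving $s_r$, multiplied in the order of composition)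 is a reduced expression for $w$, and each pair of a red and a black strand crosses at most once. The choice is arbitrary. For $\mathbf i\in\Gamma_{d,\mathbf Q}$, $\mathbf a\mapsto\mathbf a_{\mathbf i}$ is the algebra homomorphism $A^{\otimes d}\to\operatorname{End}_{\mathcal{LAW}(A)}(\mathbf i)$ sending $a_k$ to the token $\langle a\rangle$ on the $k$-th black strand; $x_{k,\mathbf i}\in\operatorname{End}_{\mathcal{LAW}(A)}(\mathbf i)$ is the dot on the $k$-th black strand; $\mathbf x_{\mathbf i}^\alpha=(x_{1,\mathbf i})^{\alpha_1}\cdots(x_{d,\mathbf i})^{\alpha_d}$ for $\alpha\in\mathbb N^d$. *)

theory Defs
  imports
    Complex_Main
    "HOL-Library.Z2"
    "HOL-Library.Sublist"
    "HOL-Combinatorics.Permutations"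
    "HOL-Algebra.Module"
begin

text \<open>
  Parities live in the field \<^typ>\<open>bit\<close> of two elements, so that sums and products of parities
  are taken in it. The sign \<open>koszul p\<close> is \<open>(-1)\<close> to the power \<open>p\<close>.
\<close>

definition koszul :: "bit \<Rightarrow> 'k::comm_ring_1" where
  "koszul p = (if p = 0 then 1 else - 1)"


section \<open>Frobenius superalgebras\<close>

text \<open>
  The algebra is the whole type \<open>'a\<close>. Its sort is not \<open>ring_1\<close>, because that would exclude the
  zero algebra. The basis is given as a list without repetitions (that is, with an arbitrary
  enumeration), because the sums over it below are formal sums of terms.
\<close>

record ('k, 'a) frob =
  smul :: "'k \<Rightarrow> 'a \<Rightarrow> 'a"
  homog :: "bit \<Rightarrow> 'a set"
  eps :: bit
  trace :: "'a \<Rightarrow> 'k"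
  nak :: "'a \<Rightarrow> 'a"
  basis :: "'a list"
  dual :: "'a \<Rightarrow> 'a"

locale frobenius_superalgebra =
  fixes A :: "('k::comm_ring_1, 'a::{ring,monoid_mult}) frob"
  assumes smul_module: "Modules.module (smul A)"
    and smul_mult_left: "smul A c a * b = smul A c (a * b)"
    and smul_mult_right: "a * smul A c b = smul A c (a * b)"
    and homog_subspace: "Modules.module.subspace (smul A) (homog A p)"
    and homog_direct_sum: "\<exists>!u. fst u \<in> homog A 0 \<and> snd u \<in> homog A 1 \<and> a = fst u + snd u"
    and homog_one: "1 \<in> homog A 0"
    and homog_mult: "\<lbrakk>a \<in> homog A p; b \<in> homog A q\<rbrakk> \<Longrightarrow> a * b \<in> homog A (p + q)"
    and basis_distinct: "distinct (basis A)"
    and basis_homog: "b \<in> set (basis A) \<Longrightarrow> b \<in> homog A 0 \<or> b \<in> homog A 1"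
    and basis_independent: "\<not> Modules.module.dependent (smul A) (set (basis A))"
    and basis_span: "Modules.module.span (smul A) (set (basis A)) = UNIV"
    and trace_add: "trace A (a + b) = trace A a + trace A b"
    and trace_smul: "trace A (smul A c a) = c * trace A a"
    and trace_parity: "\<lbrakk>a \<in> homog A p; p \<noteq> eps A\<rbrakk> \<Longrightarrow> trace A a = 0"
    and trace_nondegenerate: "(\<And>b. trace A (a * b) = 0) \<Longrightarrow> a = 0"
    and dual_basis:
      "\<lbrakk>b \<in> set (basis A); b' \<in> set (basis A)\<rbrakk> \<Longrightarrow> trace A (dual A b * b') = (if b = b' then 1 else 0)"
    and nak_bij: "bij (nak A)"
    and nak_add: "nak A (a + b) = nak A a + nak A b"
    and nak_smul: "nak A (smul A c a) = smul A c (nak A a)"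
    and nak_one: "nak A 1 = 1"
    and nak_mult: "nak A (a * b) = nak A a * nak A b"
    and nak_homog: "a \<in> homog A p \<Longrightarrow> nak A a \<in> homog A p"
    and nak_trace:
      "\<lbrakk>a \<in> homog A p; b \<in> homog A q\<rbrakk> \<Longrightarrow> trace A (a * b) = koszul (p * q) * trace A (b * nak A a)"

text \<open>The parity of a nonzero homogeneous element.\<close>

definition parity :: "('k, 'a) frob \<Rightarrow> 'a \<Rightarrow> bit" where
  "parity A a = (if a \<in> homog A 0 then 0 else 1)"


section \<open>Frobenius polynomial algebras\<close>

text \<open>
  \<open>Pol\<^sub>n(A)\<close> is given by its presentation: it is the set of terms of \<open>pol_terms n\<close> modulo the
  congruence \<open>pol_eq A n\<close>. The generators are \<open>x\<^sub>i\<close> (\<open>PX i\<close>) and the elements \<open>a\<^sub>i\<close> (\<open>PTok i a\<close>)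
  of the \<open>n\<close>-th tensor power of \<open>A\<close>, for \<open>1 \<le> i \<le> n\<close>. The relations \<open>pol_tok_one\<close>, \<open>pol_tok_linear\<close>,
  \<open>pol_tok_mult\<close> and \<open>pol_tok_commute\<close> present the superalgebra given by that tensor power.
\<close>

datatype ('k, 'a) pterm =
    PTok nat 'a
  | PX nat
  | PZero
  | POne
  | PAdd "('k, 'a) pterm" "('k, 'a) pterm"
  | PMul "('k, 'a) pterm" "('k, 'a) pterm"
  | PSmul 'k "('k, 'a) pterm"

primrec psum :: "('k, 'a) pterm list \<Rightarrow> ('k, 'a) pterm" where
  "psum [] = PZero"
| "psum (f # fs) = PAdd f (psum fs)"

primrec ppow :: "('k, 'a) pterm \<Rightarrow> nat \<Rightarrow> ('k, 'a) pterm" where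
  "ppow f 0 = POne"
| "ppow f (Suc r) = PMul f (ppow f r)"

inductive_set pol_terms :: "nat \<Rightarrow> ('k, 'a) pterm set" for n :: nat where
  "i \<in> {1..n} \<Longrightarrow> PTok i a \<in> pol_terms n"
| "i \<in> {1..n} \<Longrightarrow> PX i \<in> pol_terms n"
| "PZero \<in> pol_terms n"
| "POne \<in> pol_terms n"
| "\<lbrakk>f \<in> pol_terms n; g \<in> pol_terms n\<rbrakk> \<Longrightarrow> PAdd f g \<in> pol_terms n"
| "\<lbrakk>f \<in> pol_terms n; g \<in> pol_terms n\<rbrakk> \<Longrightarrow> PMul f g \<in> pol_terms n"
| "f \<in> pol_terms n \<Longrightarrow> PSmul c f \<in> pol_terms n"

inductive pol_eq ::
  "('k::comm_ring_1, 'a::{ring,monoid_mult}) frob \<Rightarrow> nat \<Rightarrow> ('k, 'a) pterm \<Rightarrow> ('k, 'a) pterm \<Rightarrow> bool"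
  for A n where
  pol_refl: "f \<in> pol_terms n \<Longrightarrow> pol_eq A n f f"
| pol_sym: "pol_eq A n f g \<Longrightarrow> pol_eq A n g f"
| pol_trans: "\<lbrakk>pol_eq A n f g; pol_eq A n g h\<rbrakk> \<Longrightarrow> pol_eq A n f h"
| pol_cong_add: "\<lbrakk>pol_eq A n f f'; pol_eq A n g g'\<rbrakk> \<Longrightarrow> pol_eq A n (PAdd f g) (PAdd f' g')"
| pol_cong_mul: "\<lbrakk>pol_eq A n f f'; pol_eq A n g g'\<rbrakk> \<Longrightarrow> pol_eq A n (PMul f g) (PMul f' g')"
| pol_cong_smul: "pol_eq A n f f' \<Longrightarrow> pol_eq A n (PSmul c f) (PSmul c f')"
  \<comment> \<open>associative unital algebra over the ground ring\<close>
| pol_add_assoc: "\<lbrakk>f \<in> pol_terms n; g \<in> pol_terms n; h \<in> pol_terms n\<rbrakk> \<Longrightarrow>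
    pol_eq A n (PAdd (PAdd f g) h) (PAdd f (PAdd g h))"
| pol_add_comm: "\<lbrakk>f \<in> pol_terms n; g \<in> pol_terms n\<rbrakk> \<Longrightarrow> pol_eq A n (PAdd f g) (PAdd g f)"
| pol_add_zero: "f \<in> pol_terms n \<Longrightarrow> pol_eq A n (PAdd f PZero) f"
| pol_add_neg: "f \<in> pol_terms n \<Longrightarrow> pol_eq A n (PAdd f (PSmul (- 1) f)) PZero"
| pol_smul_add: "\<lbrakk>f \<in> pol_terms n; g \<in> pol_terms n\<rbrakk> \<Longrightarrow>
    pol_eq A n (PSmul c (PAdd f g)) (PAdd (PSmul c f) (PSmul c g))"
| pol_add_smul: "f \<in> pol_terms n \<Longrightarrow> pol_eq A n (PSmul (c + d) f) (PAdd (PSmul c f) (PSmul d f))"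
| pol_smul_smul: "f \<in> pol_terms n \<Longrightarrow> pol_eq A n (PSmul c (PSmul d f)) (PSmul (c * d) f)"
| pol_one_smul: "f \<in> pol_terms n \<Longrightarrow> pol_eq A n (PSmul 1 f) f"
| pol_mul_assoc: "\<lbrakk>f \<in> pol_terms n; g \<in> pol_terms n; h \<in> pol_terms n\<rbrakk> \<Longrightarrow>
    pol_eq A n (PMul (PMul f g) h) (PMul f (PMul g h))"
| pol_one_mul: "f \<in> pol_terms n \<Longrightarrow> pol_eq A n (PMul POne f) f"
| pol_mul_one: "f \<in> pol_terms n \<Longrightarrow> pol_eq A n (PMul f POne) f"
| pol_mul_add: "\<lbrakk>f \<in> pol_terms n; g \<in> pol_terms n; h \<in> pol_terms n\<rbrakk> \<Longrightarrow>
    pol_eq A n (PMul f (PAdd g h)) (PAdd (PMul f g) (PMul f h))"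
| pol_add_mul: "\<lbrakk>f \<in> pol_terms n; g \<in> pol_terms n; h \<in> pol_terms n\<rbrakk> \<Longrightarrow>
    pol_eq A n (PMul (PAdd f g) h) (PAdd (PMul f h) (PMul g h))"
| pol_smul_mul: "\<lbrakk>f \<in> pol_terms n; g \<in> pol_terms n\<rbrakk> \<Longrightarrow>
    pol_eq A n (PMul (PSmul c f) g) (PSmul c (PMul f g))"
| pol_mul_smul: "\<lbrakk>f \<in> pol_terms n; g \<in> pol_terms n\<rbrakk> \<Longrightarrow>
    pol_eq A n (PMul f (PSmul c g)) (PSmul c (PMul f g))"
  \<comment> \<open>the tensor power of \<open>A\<close>\<close>
| pol_tok_one: "i \<in> {1..n} \<Longrightarrow> pol_eq A n (PTok i 1) POne"
| pol_tok_linear: "i \<in> {1..n} \<Longrightarrow>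
    pol_eq A n (PTok i (smul A c a + smul A d b)) (PAdd (PSmul c (PTok i a)) (PSmul d (PTok i b)))"
| pol_tok_mult: "i \<in> {1..n} \<Longrightarrow> pol_eq A n (PMul (PTok i a) (PTok i b)) (PTok i (a * b))"
| pol_tok_commute: "\<lbrakk>i \<in> {1..n}; j \<in> {1..n}; i \<noteq> j; a \<in> homog A p; b \<in> homog A q\<rbrakk> \<Longrightarrow>
    pol_eq A n (PMul (PTok i a) (PTok j b)) (PSmul (koszul (p * q)) (PMul (PTok j b) (PTok i a)))"
  \<comment> \<open>relations involving the \<open>x\<^sub>i\<close>\<close>
| pol_x_commute: "\<lbrakk>i \<in> {1..n}; j \<in> {1..n}; i \<noteq> j\<rbrakk> \<Longrightarrow>
    pol_eq A n (PMul (PX i) (PX j)) (PSmul (koszul (eps A)) (PMul (PX j) (PX i)))"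
| pol_tok_x: "\<lbrakk>i \<in> {1..n}; j \<in> {1..n}; a \<in> homog A p\<rbrakk> \<Longrightarrow>
    pol_eq A n (PMul (PTok j a) (PX i))
      (PSmul (koszul (eps A * p)) (PMul (PX i) (PTok j (if j = i then nak A a else a))))"

definition pol_class ::
  "('k::comm_ring_1, 'a::{ring,monoid_mult}) frob \<Rightarrow> nat \<Rightarrow> ('k, 'a) pterm \<Rightarrow> ('k, 'a) pterm set" where
  "pol_class A n f = {g. pol_eq A n f g}"

text \<open>
  The homogeneous component of parity \<open>p\<close> of \<open>Pol\<^sub>n(A)\<close> consists of the classes of the terms
  \<open>f\<close> with \<open>pol_homog A p f\<close>.
\<close>

inductive pol_homog :: "('k, 'a) frob \<Rightarrow> bit \<Rightarrow> ('k, 'a) pterm \<Rightarrow> bool" for A where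
  "a \<in> homog A p \<Longrightarrow> pol_homog A p (PTok i a)"
| "pol_homog A (eps A) (PX i)"
| "pol_homog A p PZero"
| "pol_homog A 0 POne"
| "\<lbrakk>pol_homog A p f; pol_homog A p g\<rbrakk> \<Longrightarrow> pol_homog A p (PAdd f g)"
| "\<lbrakk>pol_homog A p f; pol_homog A q g\<rbrakk> \<Longrightarrow> pol_homog A (p + q) (PMul f g)"
| "pol_homog A p f \<Longrightarrow> pol_homog A p (PSmul c f)"

definition pol_even ::
  "('k::comm_ring_1, 'a::{ring,monoid_mult}) frob \<Rightarrow> nat \<Rightarrow> ('k, 'a) pterm \<Rightarrow> bool" where
  "pol_even A n f \<longleftrightarrow> (\<exists>f'. pol_eq A n f f' \<and> pol_homog A 0 f')"

text \<open>
  Membership in the supercenter; \<open>f0\<close> and \<open>f1\<close> are the even and the odd part of \<open>f\<close>.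
\<close>

definition pol_central ::
  "('k::comm_ring_1, 'a::{ring,monoid_mult}) frob \<Rightarrow> nat \<Rightarrow> ('k, 'a) pterm \<Rightarrow> bool" where
  "pol_central A n f \<longleftrightarrow>
    (\<exists>f0 f1. pol_homog A 0 f0 \<and> pol_homog A 1 f1 \<and> pol_eq A n f (PAdd f0 f1) \<and>
      (\<forall>q g. g \<in> pol_terms n \<longrightarrow> pol_homog A q g \<longrightarrow>
        pol_eq A n (PMul f g) (PAdd (PMul g f0) (PSmul (koszul q) (PMul g f1)))))"

definition pol_regular ::
  "('k::comm_ring_1, 'a::{ring,monoid_mult}) frob \<Rightarrow> nat \<Rightarrow> ('k, 'a) pterm \<Rightarrow> bool" where
  "pol_regular A n f \<longleftrightarrow>
    (\<forall>g \<in> pol_terms n.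
      (pol_eq A n (PMul f g) PZero \<longrightarrow> pol_eq A n g PZero) \<and>
      (pol_eq A n (PMul g f) PZero \<longrightarrow> pol_eq A n g PZero))"

definition pol_E ::
  "('k::comm_ring_1, 'a::{ring,monoid_mult}) frob \<Rightarrow> nat \<Rightarrow> ('k, 'a) pterm set set" where
  "pol_E A n = {pol_class A n f | f.
     f \<in> pol_terms n \<and> pol_even A n f \<and> pol_central A n f \<and> pol_regular A n f}"

text \<open>
  The action of a permutation of the indices. Being an algebra automorphism, it is determined by
  its values on the generators; on the tensor power it is the superpermutation of the factors.
\<close>

primrec pol_perm :: "(nat \<Rightarrow> nat) \<Rightarrow> ('k, 'a) pterm \<Rightarrow> ('k, 'a) pterm" where
  "pol_perm w (PTok i a) = PTok (w i) a"
| "pol_perm w (PX i) = PX (w i)"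
| "pol_perm w PZero = PZero"
| "pol_perm w POne = POne"
| "pol_perm w (PAdd f g) = PAdd (pol_perm w f) (pol_perm w g)"
| "pol_perm w (PMul f g) = PMul (pol_perm w f) (pol_perm w g)"
| "pol_perm w (PSmul c f) = PSmul c (pol_perm w f)"

definition teleporter ::
  "('k::comm_ring_1, 'a) frob \<Rightarrow> nat \<Rightarrow> nat \<Rightarrow> ('k, 'a) pterm" where
  "teleporter A i j =
    psum (map (\<lambda>b. PSmul (koszul (eps A * parity A b)) (PMul (PTok i b) (PTok j (dual A b)))) (basis A))"

text \<open>
  The Frobenius Demazure operator \<open>\<partial>\<^sub>i\<close>, computed on terms from the values on the generators by
  linearity and the twisted Leibniz rule.
\<close>

primrec demazure ::
  "('k::comm_ring_1, 'a) frob \<Rightarrow> nat \<Rightarrow> ('k, 'a) pterm \<Rightarrow> ('k, 'a) pterm" where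
  "demazure A i (PTok j a) = PZero"
| "demazure A i (PX j) =
    (if j = i then teleporter A i (Suc i)
     else if j = Suc i then PSmul (- 1) (teleporter A (Suc i) i)
     else PZero)"
| "demazure A i PZero = PZero"
| "demazure A i POne = PZero"
| "demazure A i (PAdd f g) = PAdd (demazure A i f) (demazure A i g)"
| "demazure A i (PMul f g) =
    PAdd (PMul (demazure A i f) g) (PMul (pol_perm (transpose i (Suc i)) f) (demazure A i g))"
| "demazure A i (PSmul c f) = PSmul c (demazure A i f)"

text \<open>
  \<open>pol_coeffs i [a\<^sub>0, \<dots>, a\<^sub>m]\<close> is the sum of the elements \<open>(a\<^sub>k)\<^sub>i x\<^sub>i\<^sup>k\<close>. For \<open>i = 1\<close> in
  \<open>Pol\<^sub>1(A)\<close> it is the polynomial \<open>f\<close> with coefficients \<open>a\<^sub>k\<close>, and in general it is \<open>f\<^sub>i\<close>.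
\<close>

definition pol_coeffs :: "nat \<Rightarrow> 'a list \<Rightarrow> ('k, 'a) pterm" where
  "pol_coeffs i as = psum (map (\<lambda>k. PMul (PTok i (as ! k)) (ppow (PX i) k)) [0..<length as])"

text \<open>
  The element of \<open>Pol\<^sub>2(A)\<close> that is the sum of the \<open>\<mu> (b \<otimes> c) x\<^sub>1\<^sup>r x\<^sub>2\<^sup>s\<close> over the entries
  \<open>(\<mu>, b, c, r, s)\<close> of a list.
\<close>

definition pol2_coeffs :: "('k \<times> 'a \<times> 'a \<times> nat \<times> nat) list \<Rightarrow> ('k, 'a) pterm" where
  "pol2_coeffs ms =
    psum (map (\<lambda>(\<mu>, b, c, r, s).
      PSmul \<mu> (PMul (PMul (PTok 1 b) (PTok 2 c)) (PMul (ppow (PX 1) r) (ppow (PX 2) s)))) ms)"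


section \<open>The higher-level affine wreath product category\<close>

text \<open>
  A letter is \<open>None\<close> (the symbol \<open>I\<close>, a black strand) or \<open>Some Q\<close> with \<open>Q\<close> an element of
  \<open>Pol\<^sub>1(A)\<close> (a red strand); objects are words. Morphisms are terms modulo the congruence
  \<open>law_eq\<close>. \<open>Rho Q\<close> is \<open>Q \<otimes> I \<rightarrow> I \<otimes> Q\<close> and \<open>Lam Q\<close> is \<open>I \<otimes> Q \<rightarrow> Q \<otimes> I\<close>.
\<close>

type_synonym ('k, 'a) letter = "('k, 'a) pterm set option"
type_synonym ('k, 'a) word = "('k, 'a) letter list"

datatype ('k, 'a) mor =
    Ident "('k, 'a) word"
  | Cross
  | Tok 'a
  | Dot
  | Rho "('k, 'a) pterm set"
  | Lam "('k, 'a) pterm set"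
  | Comp "('k, 'a) mor" "('k, 'a) mor"  (infixl "\<circ>\<^sub>m" 65)
  | Tens "('k, 'a) mor" "('k, 'a) mor"  (infixl "\<otimes>\<^sub>m" 70)
  | Zero "('k, 'a) word" "('k, 'a) word"
  | Add "('k, 'a) mor" "('k, 'a) mor"
  | Smul 'k "('k, 'a) mor"

abbreviation Ident_I :: "('k, 'a) mor" where
  "Ident_I \<equiv> Ident [None]"

abbreviation Ident_red :: "('k, 'a) pterm set \<Rightarrow> ('k, 'a) mor" where
  "Ident_red Q \<equiv> Ident [Some Q]"

primrec mpow :: "('k, 'a) mor \<Rightarrow> ('k, 'a) word \<Rightarrow> nat \<Rightarrow> ('k, 'a) mor" where
  "mpow f u 0 = Ident u"
| "mpow f u (Suc r) = f \<circ>\<^sub>m mpow f u r"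

primrec msum :: "('k, 'a) word \<Rightarrow> ('k, 'a) word \<Rightarrow> ('k, 'a) mor list \<Rightarrow> ('k, 'a) mor" where
  "msum u v [] = Zero u v"
| "msum u v (f # fs) = Add f (msum u v fs)"

definition law_objects :: "('k::comm_ring_1, 'a::{ring,monoid_mult}) frob \<Rightarrow> ('k, 'a) word set" where
  "law_objects A = lists (insert None (Some ` pol_E A 1))"

text \<open>\<open>law_term A u v f\<close> says that \<open>f\<close> is a term denoting a morphism from \<open>u\<close> to \<open>v\<close>.\<close>

inductive law_term ::
  "('k::comm_ring_1, 'a::{ring,monoid_mult}) frob \<Rightarrow> ('k, 'a) word \<Rightarrow> ('k, 'a) word \<Rightarrow> ('k, 'a) mor \<Rightarrow> bool"
  for A where
  "u \<in> law_objects A \<Longrightarrow> law_term A u u (Ident u)"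
| "law_term A [None, None] [None, None] Cross"
| "law_term A [None] [None] (Tok a)"
| "law_term A [None] [None] Dot"
| "Q \<in> pol_E A 1 \<Longrightarrow> law_term A [Some Q, None] [None, Some Q] (Rho Q)"
| "Q \<in> pol_E A 1 \<Longrightarrow> law_term A [None, Some Q] [Some Q, None] (Lam Q)"
| "\<lbrakk>law_term A v w g; law_term A u v f\<rbrakk> \<Longrightarrow> law_term A u w (g \<circ>\<^sub>m f)"
| "\<lbrakk>law_term A u v f; law_term A u' v' g\<rbrakk> \<Longrightarrow> law_term A (u @ u') (v @ v') (f \<otimes>\<^sub>m g)"
| "\<lbrakk>u \<in> law_objects A; v \<in> law_objects A\<rbrakk> \<Longrightarrow> law_term A u v (Zero u v)"
| "\<lbrakk>law_term A u v f; law_term A u v g\<rbrakk> \<Longrightarrow> law_term A u v (Add f g)"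
| "law_term A u v f \<Longrightarrow> law_term A u v (Smul c f)"

text \<open>
  The homogeneous component of parity \<open>p\<close> of a space of morphisms consists of the classes of the
  terms \<open>f\<close> with \<open>law_homog A p f\<close>.
\<close>

inductive law_homog :: "('k, 'a) frob \<Rightarrow> bit \<Rightarrow> ('k, 'a) mor \<Rightarrow> bool" for A where
  "law_homog A 0 (Ident u)"
| "law_homog A 0 Cross"
| "a \<in> homog A p \<Longrightarrow> law_homog A p (Tok a)"
| "law_homog A (eps A) Dot"
| "law_homog A 0 (Rho Q)"
| "law_homog A 0 (Lam Q)"
| "\<lbrakk>law_homog A p f; law_homog A q g\<rbrakk> \<Longrightarrow> law_homog A (p + q) (f \<circ>\<^sub>m g)"
| "\<lbrakk>law_homog A p f; law_homog A q g\<rbrakk> \<Longrightarrow> law_homog A (p + q) (f \<otimes>\<^sub>m g)"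
| "law_homog A p (Zero u v)"
| "\<lbrakk>law_homog A p f; law_homog A p g\<rbrakk> \<Longrightarrow> law_homog A p (Add f g)"
| "law_homog A p f \<Longrightarrow> law_homog A p (Smul c f)"

text \<open>The morphism \<open>[f]\<close> for the element \<open>f\<close> of \<open>Pol\<^sub>1(A)\<close> with the given coefficients.\<close>

definition bracket :: "'a list \<Rightarrow> ('k, 'a) mor" where
  "bracket as = msum [None] [None] (map (\<lambda>r. Tok (as ! r) \<circ>\<^sub>m mpow Dot [None] r) [0..<length as])"

text \<open>The morphism \<open>[f]\<^sub>Q\<close> for \<open>f = pol2_coeffs ms\<close>.\<close>

definition bracket2 ::
  "('k, 'a) pterm set \<Rightarrow> ('k \<times> 'a \<times> 'a \<times> nat \<times> nat) list \<Rightarrow> ('k, 'a) mor" where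
  "bracket2 Q ms =
    msum [None, Some Q, None] [None, Some Q, None]
      (map (\<lambda>(\<mu>, b, c, r, s).
        Smul \<mu> ((Tok b \<otimes>\<^sub>m Ident_red Q \<otimes>\<^sub>m Tok c) \<circ>\<^sub>m
                (mpow Dot [None] r \<otimes>\<^sub>m Ident_red Q \<otimes>\<^sub>m mpow Dot [None] s))) ms)"

text \<open>
  \<open>law_eq A u v f g\<close> says that \<open>f\<close> and \<open>g\<close> denote the same morphism from \<open>u\<close> to \<open>v\<close>. It is the
  smallest congruence containing the axioms of a strict monoidal supercategory and the defining
  relations. In \<open>law_rho_lam\<close>, \<open>law_lam_rho\<close> and \<open>law_rho_sigma_lam\<close> the lists \<open>as\<close> and \<open>ms\<close> express \<open>Q\<close>,
  respectively \<open>\<partial>\<^sub>1(Q\<^sub>1)\<close>, in terms of monomials.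
\<close>

inductive law_eq ::
  "('k::comm_ring_1, 'a::{ring,monoid_mult}) frob \<Rightarrow> ('k, 'a) word \<Rightarrow> ('k, 'a) word \<Rightarrow>
    ('k, 'a) mor \<Rightarrow> ('k, 'a) mor \<Rightarrow> bool"
  for A where
  law_refl: "law_term A u v f \<Longrightarrow> law_eq A u v f f"
| law_sym: "law_eq A u v f g \<Longrightarrow> law_eq A u v g f"
| law_trans: "\<lbrakk>law_eq A u v f g; law_eq A u v g h\<rbrakk> \<Longrightarrow> law_eq A u v f h"
| law_cong_comp: "\<lbrakk>law_eq A v w g g'; law_eq A u v f f'\<rbrakk> \<Longrightarrow> law_eq A u w (g \<circ>\<^sub>m f) (g' \<circ>\<^sub>m f')"
| law_cong_tens: "\<lbrakk>law_eq A u v f f'; law_eq A u' v' g g'\<rbrakk> \<Longrightarrow>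
    law_eq A (u @ u') (v @ v') (f \<otimes>\<^sub>m g) (f' \<otimes>\<^sub>m g')"
| law_cong_add: "\<lbrakk>law_eq A u v f f'; law_eq A u v g g'\<rbrakk> \<Longrightarrow> law_eq A u v (Add f g) (Add f' g')"
| law_cong_smul: "law_eq A u v f f' \<Longrightarrow> law_eq A u v (Smul c f) (Smul c f')"
  \<comment> \<open>spaces of morphisms are modules\<close>
| law_add_assoc: "\<lbrakk>law_term A u v f; law_term A u v g; law_term A u v h\<rbrakk> \<Longrightarrow>
    law_eq A u v (Add (Add f g) h) (Add f (Add g h))"
| law_add_comm: "\<lbrakk>law_term A u v f; law_term A u v g\<rbrakk> \<Longrightarrow> law_eq A u v (Add f g) (Add g f)"
| law_add_zero: "law_term A u v f \<Longrightarrow> law_eq A u v (Add f (Zero u v)) f"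
| law_add_neg: "law_term A u v f \<Longrightarrow> law_eq A u v (Add f (Smul (- 1) f)) (Zero u v)"
| law_smul_add: "\<lbrakk>law_term A u v f; law_term A u v g\<rbrakk> \<Longrightarrow>
    law_eq A u v (Smul c (Add f g)) (Add (Smul c f) (Smul c g))"
| law_add_smul: "law_term A u v f \<Longrightarrow> law_eq A u v (Smul (c + d) f) (Add (Smul c f) (Smul d f))"
| law_smul_smul: "law_term A u v f \<Longrightarrow> law_eq A u v (Smul c (Smul d f)) (Smul (c * d) f)"
| law_one_smul: "law_term A u v f \<Longrightarrow> law_eq A u v (Smul 1 f) f"
  \<comment> \<open>composition and tensor product are bilinear\<close>
| law_comp_add: "\<lbrakk>law_term A v w g; law_term A u v f; law_term A u v f'\<rbrakk> \<Longrightarrow>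
    law_eq A u w (g \<circ>\<^sub>m Add f f') (Add (g \<circ>\<^sub>m f) (g \<circ>\<^sub>m f'))"
| law_add_comp: "\<lbrakk>law_term A v w g; law_term A v w g'; law_term A u v f\<rbrakk> \<Longrightarrow>
    law_eq A u w (Add g g' \<circ>\<^sub>m f) (Add (g \<circ>\<^sub>m f) (g' \<circ>\<^sub>m f))"
| law_comp_smul: "\<lbrakk>law_term A v w g; law_term A u v f\<rbrakk> \<Longrightarrow>
    law_eq A u w (g \<circ>\<^sub>m Smul c f) (Smul c (g \<circ>\<^sub>m f))"
| law_smul_comp: "\<lbrakk>law_term A v w g; law_term A u v f\<rbrakk> \<Longrightarrow>
    law_eq A u w (Smul c g \<circ>\<^sub>m f) (Smul c (g \<circ>\<^sub>m f))"
| law_tens_add: "\<lbrakk>law_term A u v f; law_term A u' v' g; law_term A u' v' g'\<rbrakk> \<Longrightarrow>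
    law_eq A (u @ u') (v @ v') (f \<otimes>\<^sub>m Add g g') (Add (f \<otimes>\<^sub>m g) (f \<otimes>\<^sub>m g'))"
| law_add_tens: "\<lbrakk>law_term A u v f; law_term A u v f'; law_term A u' v' g\<rbrakk> \<Longrightarrow>
    law_eq A (u @ u') (v @ v') (Add f f' \<otimes>\<^sub>m g) (Add (f \<otimes>\<^sub>m g) (f' \<otimes>\<^sub>m g))"
| law_tens_smul: "\<lbrakk>law_term A u v f; law_term A u' v' g\<rbrakk> \<Longrightarrow>
    law_eq A (u @ u') (v @ v') (f \<otimes>\<^sub>m Smul c g) (Smul c (f \<otimes>\<^sub>m g))"
| law_smul_tens: "\<lbrakk>law_term A u v f; law_term A u' v' g\<rbrakk> \<Longrightarrow>
    law_eq A (u @ u') (v @ v') (Smul c f \<otimes>\<^sub>m g) (Smul c (f \<otimes>\<^sub>m g))"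
  \<comment> \<open>strict monoidal supercategory\<close>
| law_comp_assoc: "\<lbrakk>law_term A v w h; law_term A u v g; law_term A t u f\<rbrakk> \<Longrightarrow>
    law_eq A t w (h \<circ>\<^sub>m g \<circ>\<^sub>m f) (h \<circ>\<^sub>m (g \<circ>\<^sub>m f))"
| law_id_comp: "law_term A u v f \<Longrightarrow> law_eq A u v (Ident v \<circ>\<^sub>m f) f"
| law_comp_id: "law_term A u v f \<Longrightarrow> law_eq A u v (f \<circ>\<^sub>m Ident u) f"
| law_tens_assoc: "\<lbrakk>law_term A u v f; law_term A u' v' g; law_term A u'' v'' h\<rbrakk> \<Longrightarrow>
    law_eq A (u @ u' @ u'') (v @ v' @ v'') (f \<otimes>\<^sub>m g \<otimes>\<^sub>m h) (f \<otimes>\<^sub>m (g \<otimes>\<^sub>m h))"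
| law_unit_tens: "law_term A u v f \<Longrightarrow> law_eq A u v (Ident [] \<otimes>\<^sub>m f) f"
| law_tens_unit: "law_term A u v f \<Longrightarrow> law_eq A u v (f \<otimes>\<^sub>m Ident []) f"
| law_id_tens_id: "\<lbrakk>u \<in> law_objects A; v \<in> law_objects A\<rbrakk> \<Longrightarrow>
    law_eq A (u @ v) (u @ v) (Ident u \<otimes>\<^sub>m Ident v) (Ident (u @ v))"
| law_super_interchange:
    "\<lbrakk>law_term A v w f'; law_term A u v f; law_term A v' w' g; law_term A u' v' g';
      law_homog A p f; law_homog A q g\<rbrakk> \<Longrightarrow>
    law_eq A (u @ u') (w @ w')
      ((f' \<otimes>\<^sub>m g) \<circ>\<^sub>m (f \<otimes>\<^sub>m g')) (Smul (koszul (p * q)) ((f' \<circ>\<^sub>m f) \<otimes>\<^sub>m (g \<circ>\<^sub>m g')))"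
  \<comment> \<open>tokens, dots and black crossings\<close>
| law_tok_one: "law_eq A [None] [None] (Tok 1) Ident_I"
| law_tok_linear: "law_eq A [None] [None]
    (Add (Smul c (Tok a)) (Smul d (Tok b))) (Tok (smul A c a + smul A d b))"
| law_tok_mult: "law_eq A [None] [None] (Tok a \<circ>\<^sub>m Tok b) (Tok (a * b))"
| law_sigma_sigma: "law_eq A [None, None] [None, None] (Cross \<circ>\<^sub>m Cross) (Ident [None, None])"
| law_braid: "law_eq A [None, None, None] [None, None, None]
    ((Cross \<otimes>\<^sub>m Ident_I) \<circ>\<^sub>m (Ident_I \<otimes>\<^sub>m Cross) \<circ>\<^sub>m (Cross \<otimes>\<^sub>m Ident_I))
    ((Ident_I \<otimes>\<^sub>m Cross) \<circ>\<^sub>m (Cross \<otimes>\<^sub>m Ident_I) \<circ>\<^sub>m (Ident_I \<otimes>\<^sub>m Cross))"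
| law_sigma_tok: "law_eq A [None, None] [None, None]
    (Cross \<circ>\<^sub>m (Tok a \<otimes>\<^sub>m Ident_I)) ((Ident_I \<otimes>\<^sub>m Tok a) \<circ>\<^sub>m Cross)"
| law_sigma_dot: "law_eq A [None, None] [None, None]
    (Cross \<circ>\<^sub>m (Dot \<otimes>\<^sub>m Ident_I))
    (Add ((Ident_I \<otimes>\<^sub>m Dot) \<circ>\<^sub>m Cross)
      (Smul (- 1) (msum [None, None] [None, None]
        (map (\<lambda>b. Smul (koszul (eps A * parity A b)) (Tok b \<otimes>\<^sub>m Tok (dual A b))) (basis A)))))"
| law_tok_dot: "a \<in> homog A p \<Longrightarrow> law_eq A [None] [None]
    (Tok a \<circ>\<^sub>m Dot) (Smul (koszul (eps A * p)) (Dot \<circ>\<^sub>m Tok (nak A a)))"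
  \<comment> \<open>red-black crossings\<close>
| law_lam_tok: "Q \<in> pol_E A 1 \<Longrightarrow> law_eq A [None, Some Q] [Some Q, None]
    (Lam Q \<circ>\<^sub>m (Tok a \<otimes>\<^sub>m Ident_red Q)) ((Ident_red Q \<otimes>\<^sub>m Tok a) \<circ>\<^sub>m Lam Q)"
| law_rho_tok: "Q \<in> pol_E A 1 \<Longrightarrow> law_eq A [Some Q, None] [None, Some Q]
    (Rho Q \<circ>\<^sub>m (Ident_red Q \<otimes>\<^sub>m Tok a)) ((Tok a \<otimes>\<^sub>m Ident_red Q) \<circ>\<^sub>m Rho Q)"
| law_lam_dot: "Q \<in> pol_E A 1 \<Longrightarrow> law_eq A [None, Some Q] [Some Q, None]
    (Lam Q \<circ>\<^sub>m (Dot \<otimes>\<^sub>m Ident_red Q)) ((Ident_red Q \<otimes>\<^sub>m Dot) \<circ>\<^sub>m Lam Q)"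
| law_rho_dot: "Q \<in> pol_E A 1 \<Longrightarrow> law_eq A [Some Q, None] [None, Some Q]
    (Rho Q \<circ>\<^sub>m (Ident_red Q \<otimes>\<^sub>m Dot)) ((Dot \<otimes>\<^sub>m Ident_red Q) \<circ>\<^sub>m Rho Q)"
| law_rho_lam: "\<lbrakk>Q \<in> pol_E A 1; Q = pol_class A 1 (pol_coeffs 1 as)\<rbrakk> \<Longrightarrow>
    law_eq A [None, Some Q] [None, Some Q] (Rho Q \<circ>\<^sub>m Lam Q) (bracket as \<otimes>\<^sub>m Ident_red Q)"
| law_lam_rho: "\<lbrakk>Q \<in> pol_E A 1; Q = pol_class A 1 (pol_coeffs 1 as)\<rbrakk> \<Longrightarrow>
    law_eq A [Some Q, None] [Some Q, None] (Lam Q \<circ>\<^sub>m Rho Q) (Ident_red Q \<otimes>\<^sub>m bracket as)"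
| law_sigma_rho: "Q \<in> pol_E A 1 \<Longrightarrow> law_eq A [Some Q, None, None] [None, None, Some Q]
    ((Cross \<otimes>\<^sub>m Ident_red Q) \<circ>\<^sub>m (Ident_I \<otimes>\<^sub>m Rho Q) \<circ>\<^sub>m (Rho Q \<otimes>\<^sub>m Ident_I))
    ((Ident_I \<otimes>\<^sub>m Rho Q) \<circ>\<^sub>m (Rho Q \<otimes>\<^sub>m Ident_I) \<circ>\<^sub>m (Ident_red Q \<otimes>\<^sub>m Cross))"
| law_lam_sigma: "Q \<in> pol_E A 1 \<Longrightarrow> law_eq A [None, None, Some Q] [Some Q, None, None]
    ((Lam Q \<otimes>\<^sub>m Ident_I) \<circ>\<^sub>m (Ident_I \<otimes>\<^sub>m Lam Q) \<circ>\<^sub>m (Cross \<otimes>\<^sub>m Ident_red Q))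
    ((Ident_red Q \<otimes>\<^sub>m Cross) \<circ>\<^sub>m (Lam Q \<otimes>\<^sub>m Ident_I) \<circ>\<^sub>m (Ident_I \<otimes>\<^sub>m Lam Q))"
| law_rho_sigma_lam:
    "\<lbrakk>Q \<in> pol_E A 1; Q = pol_class A 1 (pol_coeffs 1 as);
      \<forall>(\<mu>, b, c, r, s) \<in> set ms. b \<in> set (basis A) \<and> c \<in> set (basis A);
      pol_eq A 2 (demazure A 1 (pol_coeffs 1 as)) (pol2_coeffs ms)\<rbrakk> \<Longrightarrow>
    law_eq A [None, Some Q, None] [None, Some Q, None]
      ((Rho Q \<otimes>\<^sub>m Ident_I) \<circ>\<^sub>m (Ident_red Q \<otimes>\<^sub>m Cross) \<circ>\<^sub>m (Lam Q \<otimes>\<^sub>m Ident_I))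
      (Add ((Ident_I \<otimes>\<^sub>m Lam Q) \<circ>\<^sub>m (Cross \<otimes>\<^sub>m Ident_red Q) \<circ>\<^sub>m (Ident_I \<otimes>\<^sub>m Rho Q))
        (Smul (- 1) (bracket2 Q ms)))"

definition law_class ::
  "('k::comm_ring_1, 'a::{ring,monoid_mult}) frob \<Rightarrow> ('k, 'a) word \<Rightarrow> ('k, 'a) word \<Rightarrow>
    ('k, 'a) mor \<Rightarrow> ('k, 'a) mor set" where
  "law_class A u v f = {g. law_eq A u v f g}"

text \<open>
  The module of morphisms from \<open>u\<close> to \<open>v\<close>. The multiplicative fields of the record type are
  irrelevant.
\<close>

definition law_hom ::
  "('k::comm_ring_1, 'a::{ring,monoid_mult}) frob \<Rightarrow> ('k, 'a) word \<Rightarrow> ('k, 'a) word \<Rightarrow>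
    ('k, ('k, 'a) mor set) Module.module" where
  "law_hom A u v =
    \<lparr>carrier = law_class A u v ` {f. law_term A u v f},
     mult = undefined, one = undefined,
     zero = law_class A u v (Zero u v),
     add = (\<lambda>X Y. {h. \<exists>f\<in>X. \<exists>g\<in>Y. law_eq A u v (Add f g) h}),
     smult = (\<lambda>c X. {h. \<exists>f\<in>X. law_eq A u v (Smul c f) h})\<rparr>"

text \<open>
  A set \<open>S\<close> is a basis if every element is a finite linear combination of elements of \<open>S\<close> in
  exactly one way.
\<close>

definition is_basis :: "('k::comm_ring_1, 'b, 'm) module_scheme \<Rightarrow> 'b set \<Rightarrow> bool" where
  "is_basis M S \<longleftrightarrow>
    S \<subseteq> carrier M \<and>
    (\<forall>v \<in> carrier M.
      \<exists>!c. finite {s. c s \<noteq> 0} \<and> {s. c s \<noteq> 0} \<subseteq> S \<and>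
           v = (\<Oplus>\<^bsub>M\<^esub>s\<in>{s. c s \<noteq> 0}. c s \<odot>\<^bsub>M\<^esub> s))"


section \<open>Shuffles and diagrams\<close>

definition shuffle_words ::
  "('k::comm_ring_1, 'a::{ring,monoid_mult}) frob \<Rightarrow> nat \<Rightarrow> ('k, 'a) pterm set list \<Rightarrow> ('k, 'a) word set" where
  "shuffle_words A d Qs =
    {u \<in> law_objects A. length u = d + length Qs \<and>
       subseq (replicate d None) u \<and> subseq (map Some Qs) u}"

text \<open>
  A diagram with bottom word \<open>u\<close> is encoded as the list of the positions of its crossings from
  bottom to top: the entry \<open>p\<close> is a crossing of the strands in positions \<open>p\<close> and \<open>p + 1\<close>,
  counted from \<open>0\<close>. The type of the crossing is determined by the colors of these strands.
\<close>

definition swap_at :: "nat \<Rightarrow> 'b list \<Rightarrow> 'b list" where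
  "swap_at p u = u[p := u ! Suc p, Suc p := u ! p]"

fun is_diagram :: "('k, 'a) word \<Rightarrow> nat list \<Rightarrow> ('k, 'a) word \<Rightarrow> bool" where
  "is_diagram u [] v \<longleftrightarrow> u = v"
| "is_diagram u (p # ps) v \<longleftrightarrow>
    Suc p < length u \<and> (u ! p = None \<or> u ! Suc p = None) \<and> is_diagram (swap_at p u) ps v"

fun crossing :: "('k, 'a) letter \<Rightarrow> ('k, 'a) letter \<Rightarrow> ('k, 'a) mor" where
  "crossing None None = Cross"
| "crossing (Some Q) None = Rho Q"
| "crossing None (Some Q) = Lam Q"
| "crossing (Some Q) (Some R) = undefined"

fun diagram_mor :: "('k, 'a) word \<Rightarrow> nat list \<Rightarrow> ('k, 'a) mor" where
  "diagram_mor u [] = Ident u"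
| "diagram_mor u (p # ps) =
    diagram_mor (swap_at p u) ps \<circ>\<^sub>m
    (Ident (take p u) \<otimes>\<^sub>m crossing (u ! p) (u ! Suc p) \<otimes>\<^sub>m Ident (drop (Suc (Suc p)) u))"

text \<open>
  The indices \<open>r\<close> of the simple transpositions given by the crossings of the \<open>r\<close>-th and the
  \<open>r + 1\<close>-st black strand, from bottom to top. Black strands are counted from \<open>1\<close>.
\<close>

fun black_word :: "('k, 'a) word \<Rightarrow> nat list \<Rightarrow> nat list" where
  "black_word u [] = []"
| "black_word u (p # ps) =
    (if u ! p = None \<and> u ! Suc p = None
     then [Suc (length (filter (\<lambda>l. l = None) (take p u)))] else [])
    @ black_word (swap_at p u) ps"

text \<open>The first entry is the bottom crossing and hence the rightmost factor.\<close>

primrec word_perm :: "nat list \<Rightarrow> nat \<Rightarrow> nat" where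
  "word_perm [] = id"
| "word_perm (r # rs) = word_perm rs \<circ> transpose r (Suc r)"

definition reduced_expression :: "nat \<Rightarrow> nat list \<Rightarrow> (nat \<Rightarrow> nat) \<Rightarrow> bool" where
  "reduced_expression d rs w \<longleftrightarrow>
    set rs \<subseteq> {1..<d} \<and> word_perm rs = w \<and>
    (\<forall>rs'. set rs' \<subseteq> {1..<d} \<longrightarrow> word_perm rs' = w \<longrightarrow> length rs \<le> length rs')"

text \<open>
  The pairs of a red and a black strand that cross, listed with multiplicity. The word carries a
  label for each strand, which is moved along with the strand.
\<close>

fun red_black_crossings :: "(nat \<times> ('k, 'a) letter) list \<Rightarrow> nat list \<Rightarrow> nat set list" where
  "red_black_crossings u [] = []"
| "red_black_crossings u (p # ps) =
    (if (snd (u ! p) = None) \<noteq> (snd (u ! Suc p) = None)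
     then [{fst (u ! p), fst (u ! Suc p)}] else [])
    @ red_black_crossings (swap_at p u) ps"

definition chosen_diagram ::
  "nat \<Rightarrow> ('k, 'a) word \<Rightarrow> ('k, 'a) word \<Rightarrow> (nat \<Rightarrow> nat) \<Rightarrow> nat list \<Rightarrow> bool" where
  "chosen_diagram d j i w ps \<longleftrightarrow>
    is_diagram i ps j \<and>
    reduced_expression d (black_word i ps) w \<and>
    distinct (red_black_crossings (zip [0..<length i] i) ps)"


section \<open>Tokens and dots on black strands\<close>

text \<open>The endomorphism of \<open>u\<close> with \<open>f\<close> on the \<open>k\<close>-th black strand, counted from \<open>1\<close>.\<close>

definition on_black :: "('k, 'a) word \<Rightarrow> nat \<Rightarrow> ('k, 'a) mor \<Rightarrow> ('k, 'a) mor" where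
  "on_black u k f =
    (let p = filter (\<lambda>p. u ! p = None) [0..<length u] ! (k - 1)
     in Ident (take p u) \<otimes>\<^sub>m f \<otimes>\<^sub>m Ident (drop (Suc p) u))"

primrec mprod :: "('k, 'a) word \<Rightarrow> ('k, 'a) mor list \<Rightarrow> ('k, 'a) mor" where
  "mprod u [] = Ident u"
| "mprod u (f # fs) = f \<circ>\<^sub>m mprod u fs"

text \<open>
  A pure tensor is encoded as the list \<open>[b\<^sub>1, \<dots>, b\<^sub>d]\<close> of its factors. It is the product of the
  elements with \<open>b\<^sub>k\<close> in the \<open>k\<close>-th factor and \<open>1\<close> elsewhere, in this order and without a sign.
\<close>

definition tokens :: "('k, 'a) word \<Rightarrow> 'a list \<Rightarrow> ('k, 'a) mor" where
  "tokens u bs = mprod u (map (\<lambda>k. on_black u k (Tok (bs ! (k - 1)))) [1..<Suc (length bs)])"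

definition dots :: "('k, 'a) word \<Rightarrow> nat list \<Rightarrow> ('k, 'a) mor" where
  "dots u \<alpha> = mprod u (map (\<lambda>k. mpow (on_black u k Dot) u (\<alpha> ! (k - 1))) [1..<Suc (length \<alpha>)])"

definition basis_index :: "('k, 'a) frob \<Rightarrow> nat \<Rightarrow> ('a list \<times> nat list \<times> (nat \<Rightarrow> nat)) set" where
  "basis_index A d =
    {bs. length bs = d \<and> set bs \<subseteq> set (basis A)} \<times> {\<alpha>. length \<alpha> = d} \<times> {w. w permutes {1..d}}"

definition basis_element ::
  "('k::comm_ring_1, 'a::{ring,monoid_mult}) frob \<Rightarrow> ('k, 'a) word \<Rightarrow> ('k, 'a) word \<Rightarrow>
    ((nat \<Rightarrow> nat) \<Rightarrow> nat list) \<Rightarrow> 'a list \<times> nat list \<times> (nat \<Rightarrow> nat) \<Rightarrow> ('k, 'a) mor set" where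
  "basis_element A j i \<sigma> = (\<lambda>(bs, \<alpha>, w).
    law_class A i j (tokens j bs \<circ>\<^sub>m dots j \<alpha> \<circ>\<^sub>m diagram_mor i (\<sigma> w)))"

end

theory Submission
 imports Defs
begin

text \<open>
  Spanning. Filter the morphisms by the number of crossings. A token or a dot slides through a
  crossing up to terms without crossings; modulo fewer crossings, all braid relations hold and a
  double crossing vanishes. By the theorem of Matsumoto and Tits a diagram is therefore, modulo
  fewer crossings, either the chosen diagram with the same permutation or zero. Tokens and dots
  on top of the chosen diagrams are put in normal form in \<open>Pol\<^sub>d(A)\<close>.

  Independence. The category acts on functions on \<open>S\<^sub>d\<close> with values in the regular
  representation of \<open>Pol\<^sub>d(A)\<close>: the black strands act through the affine wreath product
  algebra, \<open>\<rho>\<^sub>Q\<close> acts as multiplication by \<open>Q\<close> and \<open>\<lambda>\<^sub>Q\<close> as the identity. At the identity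
  permutation, the image under a diagram for \<open>w\<close> of a function depends only on the values at
  \<open>w\<close>, through a product of elements \<open>Q\<close> in single variables, and at permutations of smaller
  length. In a linear relation one tests a term of maximal length with a function supported at its
  permutation. The product can be cancelled, because the elements \<open>Q\<close> are central and regular.
\<close>

text \<open>Independence needs a representation in which all relations are verified explicitly, over
  an arbitrary commutative ring and for an algebra that may be zero. Hence the operators act on
  functions, coordinates are read off by the trace, the unit is only an idempotent, and strings of
  parity operators produce the Koszul signs. Three points are delicate. The dots act by Dunkl
  operators and must supercommute: their supercommutator is intertwined by the crossings and is zero
  at the identity permutation, which has no inversions, hence everywhere. The relation moving a
  black crossing \<open>T\<close> through a red strand needs
  \<open>T Q\<^sub>2 = Q\<^sub>1 T + \<partial>\<^sub>1(Q\<^sub>1)\<close>, that is,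
  \<open>\<partial>\<^sub>1(Q\<^sub>1 + Q\<^sub>2) = 0\<close>; this follows from centrality by an
  argument on degrees. Finally, \<open>Q\<close> is known to be regular only in
  \<open>Pol\<^sub>1(A)\<close>. In \<open>d\<close> variables one freezes all coordinates but one:
  the vectors concerned have finite support, so what remains is a polynomial in one
  variable.\<close>

notation Comp (infixl "\<cdot>" 65) and Tens (infixl "\<star>" 70)

declare add_bit_eq_xor [simp del] mult_bit_eq_and [simp del]

lemma koszul_simps [simp]:
 "koszul 0 = 1" "koszul 1 = - 1"
 by (auto simp: koszul_def)

lemma koszul_add: "koszul (p + q) = koszul p * koszul q"
 by (cases p; cases q) (auto simp: koszul_def)

lemma koszul_self [simp]: "koszul p * koszul p = 1" "koszul p * (koszul p * c) = c"
 by (auto simp: koszul_def)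

lemma bit_add_self [simp]: "(p::bit) + p = 0" "p + (p + q) = q"
 by (cases p; cases q; simp)+

lemma bit_mult_self [simp]: "(p::bit) * p = p"
 by (cases p) auto

section \<open>Explicit operators for one strand and for several strands\<close>

subsection \<open>The ring of linear operators on a function space\<close>

text \<open>Admitting all functions instead of the finitely supported ones makes the operators a
  ring type, so that ring automation applies without carrier conditions. Row finiteness and finite
  support are imposed later, where they matter.\<close>

typedef (overloaded) ('i, 'k) lop =
 "{f :: ('i => 'k::comm_ring_1) => 'i => 'k. \<forall>c v w. f (\<lambda>i. c * v i + w i) = (\<lambda>i. c * f v i + f w i)}"
 morphisms app Lop
 by (intro exI[of _ id]) auto

setup_lifting type_definition_lop

instantiation lop :: (type, comm_ring_1) ring_1
begin
lift_definition zero_lop :: "('a, 'b) lop" is "\<lambda>v i. 0" by auto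
lift_definition one_lop :: "('a, 'b) lop" is "\<lambda>v. v" by auto
lift_definition plus_lop :: "('a, 'b) lop => ('a, 'b) lop => ('a, 'b) lop" is "\<lambda>f g v i. f v i + g v i"
 by (auto simp: algebra_simps)
lift_definition minus_lop :: "('a, 'b) lop => ('a, 'b) lop => ('a, 'b) lop" is "\<lambda>f g v i. f v i - g v i"
 by (auto simp: algebra_simps)
lift_definition uminus_lop :: "('a, 'b) lop => ('a, 'b) lop" is "\<lambda>f v i. - f v i"
 by (auto simp: algebra_simps)
lift_definition times_lop :: "('a, 'b) lop => ('a, 'b) lop => ('a, 'b) lop" is "\<lambda>f g v. f (g v)"
 by (auto simp: algebra_simps)
lemma app_lin: "app f (\<lambda>i. c * v i + w i) = (\<lambda>i. c * app f v i + app f w i)"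
 using app[of f] by auto
lemma app_zero: "app f (\<lambda>i. 0) = (\<lambda>i. 0)"
 using app_lin[of f 0 "\<lambda>i. 0" "\<lambda>i. 0"] app_lin[of f "-1" "\<lambda>i. 0" "\<lambda>i. 0"] by auto
lemma app_add: "app f (\<lambda>i. v i + w i) = (\<lambda>i. app f v i + app f w i)"
 using app_lin[of f 1 v w] by auto
lemma app_cmult: "app f (\<lambda>i. c * v i) = (\<lambda>i. c * app f v i)"
 using app_lin[of f c v "\<lambda>i. 0"] by (auto simp: app_zero)
lemma lop_eqI: "(\<And>v i. app f v i = app g v i) ==> f = g"
 by (metis app_inject ext)
lemmas app_rep = zero_lop.rep_eq one_lop.rep_eq plus_lop.rep_eq minus_lop.rep_eq
 uminus_lop.rep_eq times_lop.rep_eq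
instance
proof
 fix a b c :: "('a, 'b) lop"
 show "a * b * c = a * (b * c)" by (rule lop_eqI) (simp add: app_rep)
 show "(a + b) * c = a * c + b * c" by (rule lop_eqI) (simp add: app_rep)
 show "a * (b + c) = a * b + a * c" by (rule lop_eqI) (simp add: app_rep app_add)
 show "1 * a = a" "a * 1 = a" by (rule lop_eqI, simp add: app_rep)+
 show "a + b + c = a + (b + c)" "a + b = b + a" "0 + a = a" "- a + a = 0" "a - b = a + - b"
  by (rule lop_eqI, simp add: app_rep algebra_simps)+
 have "app 0 (\<lambda>i. 1) undefined \<noteq> app (1 :: ('a, 'b) lop) (\<lambda>i. 1) undefined"
  by (simp add: app_rep)
 then show "(0 :: ('a, 'b) lop) \<noteq> 1" by metis
qed
end

lift_definition sm :: "'k::comm_ring_1 => ('i, 'k) lop => ('i, 'k) lop" is "\<lambda>c f v i. c * f v i"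
 by (auto simp: algebra_simps)

lemmas app_simps [simp] = app_rep sm.rep_eq

lemma app_sum: "app (sum f I) v i = (\<Sum>j\<in>I. app (f j) v i)"
 by (induction I rule: infinite_finite_induct) auto

lemma app_sum_arg: "app f (\<lambda>i. \<Sum>j\<in>J. v j i) = (\<lambda>i. \<Sum>j\<in>J. app f (v j) i)"
 by (induction J rule: infinite_finite_induct) (auto simp: app_zero app_add)

lemma sm_simps [simp]:
 "sm c f * g = sm c (f * g)" "f * sm c g = sm c (f * g)" "sm c (sm c' f) = sm (c * c') f"
 "sm 1 f = f" "sm 0 f = 0" "sm c 0 = 0" "sm (- c) f = - sm c f" "sm c (- f) = - sm c f"
 by (rule lop_eqI; simp add: app_cmult algebra_simps)+

lemma sm_distrib: "sm c (f + g) = sm c f + sm c g" "sm c (f - g) = sm c f - sm c g"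
 "sm (c + c') f = sm c f + sm c' f"
 by (rule lop_eqI; simp add: algebra_simps)+

lemma sm_sum: "sm c (sum f I) = (\<Sum>i\<in>I. sm c (f i))"
 by (induction I rule: infinite_finite_induct) (auto simp: sm_distrib)

subsection \<open>Frobenius superalgebras\<close>

context frobenius_superalgebra
begin

sublocale smul: Modules.module "smul A" by (rule smul_module)

abbreviation BB where "BB \<equiv> set (basis A)"
abbreviation tr where "tr \<equiv> trace A"
abbreviation dl where "dl \<equiv> dual A"
abbreviation \<epsilon> where "\<epsilon> \<equiv> eps A"
abbreviation par where "par \<equiv> parity A"
abbreviation psi where "psi \<equiv> nak A"

lemma trace_0 [simp]: "tr 0 = 0"
 using trace_smul[of 0 0] by simp
lemma trace_sum: "tr (sum f I) = (\<Sum>i\<in>I. tr (f i))"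
 by (induction I rule: infinite_finite_induct) (auto simp: trace_add)
lemma nak_0 [simp]: "psi 0 = 0"
 using nak_smul[of 0 0] by simp
lemma nak_sum: "psi (sum f I) = (\<Sum>i\<in>I. psi (f i))"
 by (induction I rule: infinite_finite_induct) (auto simp: nak_add)

lemma homog_0 [simp]: "0 \<in> homog A p"
 using homog_subspace smul.subspace_0 by blast
lemma homog_add: "a \<in> homog A p ==> b \<in> homog A p ==> a + b \<in> homog A p"
 using homog_subspace smul.subspace_add by blast
lemma homog_smul: "a \<in> homog A p ==> smul A c a \<in> homog A p"
 using homog_subspace smul.subspace_scale by blast
definition part :: "bit => 'a => 'a" where
 "part p a = (let u = (THE u. fst u \<in> homog A 0 \<and> snd u \<in> homog A 1 \<and> a = fst u + snd u)
   in if p = 0 then fst u else snd u)"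

lemma part_props: "part p a \<in> homog A p" "part 0 a + part 1 a = a"
proof -
 let ?P = "\<lambda>u. fst u \<in> homog A 0 \<and> snd u \<in> homog A 1 \<and> a = fst u + snd u"
 have "?P (THE u. ?P u)" using homog_direct_sum by (rule theI')
 then show "part p a \<in> homog A p" "part 0 a + part 1 a = a"
  unfolding part_def Let_def by (cases p; auto)+
qed

lemma part_unique:
 assumes "x \<in> homog A 0" "y \<in> homog A 1" "a = x + y"
 shows "part 0 a = x" "part 1 a = y"
proof -
 have "(part 0 a, part 1 a) = (x, y)"
  using homog_direct_sum[of a] part_props(1)[of 0 a] part_props(1)[of 1 a] part_props(2)[of a] assms
  by (metis fst_conv snd_conv)
 then show "part 0 a = x" "part 1 a = y" by auto
qed

lemma part_homog: "a \<in> homog A p ==> part q a = (if q = p then a else 0)"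
 using part_unique[of a 0 a] part_unique[of 0 a a]
 by (cases p; cases q) auto

lemma part_add: "part p (a + b) = part p a + part p b"
proof -
 have "a + b = (part 0 a + part 0 b) + (part 1 a + part 1 b)"
  using part_props(2)[of a] part_props(2)[of b] by (metis (no_types) add.assoc add.commute)
 then show ?thesis
  using part_unique[of "part 0 a + part 0 b" "part 1 a + part 1 b" "a + b"]
  by (cases p) (auto intro: homog_add part_props)
qed

lemma part_smul: "part p (smul A c a) = smul A c (part p a)"
proof -
 have "smul A c a = smul A c (part 0 a) + smul A c (part 1 a)"
  using part_props(2)[of a] by (metis smul.scale_right_distrib)
 then show ?thesis
  using part_unique[of "smul A c (part 0 a)" "smul A c (part 1 a)" "smul A c a"]
  by (cases p) (auto intro: homog_smul part_props)
qed

lemma homog_induct [case_names add homog]: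
 assumes "\<And>a b. P a ==> P b ==> P (a + b)" "\<And>a p. a \<in> homog A p ==> P a"
 shows "P a"
 using assms part_props by metis

lemma basis_par: "b \<in> BB ==> b \<in> homog A (par b)"
 using basis_homog[of b] by (auto simp: parity_def)

lemma basis_expand_ex: "\<exists>c. a = (\<Sum>b\<in>BB. smul A (c b) b)"
 using basis_span smul.span_finite[of BB] by auto

text \<open>The left dual basis reads off coordinates under the trace form. Coordinates thus have
  the closed form \<open>tr (dl b * a)\<close>, and all operators below are written through
  it.\<close>

lemma basis_expand: "a = (\<Sum>b\<in>BB. smul A (tr (dl b * a)) b)"
proof -
 obtain c where a: "a = (\<Sum>b\<in>BB. smul A (c b) b)" using basis_expand_ex by blast
 have "tr (dl b * a) = c b" if "b \<in> BB" for b
 proof -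
  have "tr (dl b * a) = (\<Sum>b'\<in>BB. c b' * tr (dl b * b'))"
   unfolding a by (simp add: sum_distrib_left trace_sum smul_mult_right trace_smul)
  also have "... = (\<Sum>b'\<in>BB. if b = b' then c b' else 0)"
   using that by (intro sum.cong) (auto simp: dual_basis)
  finally show ?thesis using that by simp
 qed
 then show ?thesis using a by (metis (no_types, lifting) sum.cong)
qed

lemma coords_unique:
 assumes "(\<Sum>b\<in>BB. smul A (c b) b) = 0" "b \<in> BB"
 shows "c b = 0"
proof -
 have "tr (dl b * (\<Sum>b\<in>BB. smul A (c b) b)) = (\<Sum>b'\<in>BB. c b' * tr (dl b * b'))"
  by (simp add: sum_distrib_left trace_sum smul_mult_right trace_smul)
 also have "... = (\<Sum>b'\<in>BB. if b = b' then c b' else 0)"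
  using assms by (intro sum.cong) (auto simp: dual_basis)
 finally show ?thesis using assms by simp
qed

text \<open>The difference of the two sides pairs to zero with every basis element, so nondegeneracy
  of the trace form kills it.\<close>

lemma dual_expand: "a = (\<Sum>b\<in>BB. smul A (tr (a * b)) (dl b))"
proof -
 have "a - (\<Sum>b\<in>BB. smul A (tr (a * b)) (dl b)) = 0" (is "?d = 0")
 proof (rule trace_nondegenerate)
  fix y
  have *: "tr (?d * b) = 0" if "b \<in> BB" for b
  proof -
   have "tr ((\<Sum>b\<in>BB. smul A (tr (a * b)) (dl b)) * b) = (\<Sum>b'\<in>BB. tr (a * b') * tr (dl b' * b))"
    by (simp add: sum_distrib_right trace_sum smul_mult_left trace_smul)
   also have "... = (\<Sum>b'\<in>BB. if b' = b then tr (a * b') else 0)"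
    using that by (intro sum.cong) (auto simp: dual_basis)
   also have "... = tr (a * b)" using that by simp
   finally have "tr (a * b) = tr ((\<Sum>b\<in>BB. smul A (tr (a * b)) (dl b)) * b)" by simp
   moreover have "a * b = ?d * b + (\<Sum>b\<in>BB. smul A (tr (a * b)) (dl b)) * b"
    by (simp add: algebra_simps)
   ultimately show ?thesis using trace_add by (metis add_cancel_left_left)
  qed
  show "tr (?d * y) = 0"
   by (subst basis_expand[of y])
    (simp add: sum_distrib_left trace_sum smul_mult_right trace_smul * )
 qed
 then show ?thesis by simp
qed

text \<open>The component of the wrong parity pairs to zero with each basis element: by the parity
  of the trace if that element has the parity of \<open>b\<close>, and otherwise because both the
  value prescribed by duality and the contribution of the right component are zero. Nondegeneracy
  does the rest.\<close>

lemma dual_homog: "b \<in> BB ==> dl b \<in> homog A (\<epsilon> + par b)"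
proof -
 assume b: "b \<in> BB"
 let ?q = "\<epsilon> + par b"
 have "part (?q + 1) (dl b) = 0"
 proof (rule trace_nondegenerate)
  fix y
  have *: "tr (part (?q + 1) (dl b) * b') = 0" if b': "b' \<in> BB" for b'
  proof (cases "par b' = par b")
   case True
   then have "part (?q + 1) (dl b) * b' \<in> homog A (\<epsilon> + 1)"
    using homog_mult[OF part_props(1) basis_par[OF b'], of "?q + 1" "dl b"]
    by (cases "par b"; cases \<epsilon>) auto
   then show ?thesis using trace_parity by (metis add_cancel_left_right zero_neq_one)
  next
   case False
   then have "part ?q (dl b) * b' \<in> homog A (\<epsilon> + 1)"
    using homog_mult[OF part_props(1) basis_par[OF b'], of ?q "dl b"]
    by (cases "par b"; cases "par b'"; cases \<epsilon>) auto
   then have 1: "tr (part ?q (dl b) * b') = 0"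
    using trace_parity by (metis add_cancel_left_right zero_neq_one)
   have "dl b = part ?q (dl b) + part (?q + 1) (dl b)"
    using part_props(2)[of "dl b"] by (cases ?q) (auto simp: add.commute)
   then have "tr (dl b * b') = tr (part ?q (dl b) * b') + tr (part (?q + 1) (dl b) * b')"
    by (metis distrib_right trace_add)
   moreover have "b \<noteq> b'" using False by auto
   ultimately show ?thesis using 1 dual_basis[OF b b'] by auto
  qed
  show "tr (part (?q + 1) (dl b) * y) = 0"
   by (subst basis_expand[of y])
    (simp add: sum_distrib_left trace_sum smul_mult_right trace_smul * )
 qed
 moreover have "dl b = part ?q (dl b) + part (?q + 1) (dl b)"
  using part_props(2)[of "dl b"] by (cases ?q) (auto simp: add.commute)
 ultimately show ?thesis using part_props(1) by (metis add.right_neutral)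
qed

lemma coord_parity: "b \<in> BB ==> a \<in> homog A p ==> p \<noteq> par b ==> tr (dl b * a) = 0"
 using trace_parity[OF homog_mult[OF dual_homog], of b a p]
 by (cases p; cases "par b"; cases \<epsilon>) auto

definition ipsi :: "'a => 'a" where "ipsi = inv_into UNIV psi"
lemma ipsi [simp]: "ipsi (psi a) = a" "psi (ipsi a) = a"
 unfolding ipsi_def using nak_bij by (simp_all add: bij_is_inj bij_is_surj surj_f_inv_f)
lemma ipsi_mult: "ipsi (a * b) = ipsi a * ipsi b" and ipsi_add: "ipsi (a + b) = ipsi a + ipsi b"
 and ipsi_smul: "ipsi (smul A c a) = smul A c (ipsi a)" and ipsi_one [simp]: "ipsi 1 = 1"
 by (metis ipsi nak_mult nak_add nak_smul nak_one)+
lemma ipsi_0 [simp]: "ipsi 0 = 0" by (metis ipsi nak_0)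
lemma ipsi_homog: "a \<in> homog A p ==> ipsi a \<in> homog A p"
proof -
 assume a: "a \<in> homog A p"
 have "psi (part (p + 1) (ipsi a)) + psi (part p (ipsi a)) = a"
  using part_props(2)[of "ipsi a"] by (cases p) (auto simp: nak_add[symmetric] add.commute)
 moreover have "psi (part (p + 1) (ipsi a)) \<in> homog A (p + 1)" "psi (part p (ipsi a)) \<in> homog A p"
  using nak_homog part_props by blast+
 ultimately have "psi (part (p + 1) (ipsi a)) = 0"
  using part_unique[of "psi (part 0 (ipsi a))" "psi (part 1 (ipsi a))" a] part_homog[OF a]
  by (cases p) (auto simp: add.commute)
 then have "part (p + 1) (ipsi a) = 0" by (metis ipsi(1) ipsi_0)
 then show ?thesis
  using part_props(1)[of p "ipsi a"] part_props(2)[of "ipsi a"] by (cases p) auto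
qed

subsection \<open>The action on one strand\<close>

text \<open>
 These operators give the left regular representation of \<open>Pol\<^sub>1(A)\<close>, in coordinates with
 respect to the monomials \<open>b x\<^sup>r\<close>; the pair \<open>(b, r)\<close> stands for this monomial.
\<close>

lift_definition Mop :: "'a => ('a \<times> nat, 'k) lop" is
 "\<lambda>a v (b, r). if b \<in> BB then (\<Sum>c\<in>BB. tr (dl b * (a * c)) * v (c, r)) else 0"
 by (auto simp: fun_eq_iff algebra_simps sum.distrib sum_distrib_left)

text \<open>The relation between tokens and dots, read from right to left, says that
  \<open>x\<close> times \<open>c\<close> equals \<open>koszul (\<epsilon> * par c)\<close> times
  \<open>ipsi c\<close> times \<open>x\<close>. This is the source of the sign and of the inverse
  Nakayama automorphism.\<close>

lift_definition Nop :: "('a \<times> nat, 'k) lop" is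
 "\<lambda>v (b, r). if b \<in> BB \<and> r > 0
   then (\<Sum>c\<in>BB. koszul (\<epsilon> * par c) * tr (dl b * ipsi c) * v (c, r - 1)) else 0"
 by (auto simp: fun_eq_iff algebra_simps sum.distrib sum_distrib_left)

definition mpar :: "'a \<times> nat => bit" where
 "mpar m = par (fst m) + \<epsilon> * of_nat (snd m)"

text \<open>The sign that something of parity \<open>p\<close> picks up when it passes a monomial.
  Strings of these operators will supply the Koszul signs between strands.\<close>

lift_definition Jop :: "bit => ('a \<times> nat, 'k) lop" is
 "\<lambda>p v m. koszul (p * mpar m) * v m"
 by (auto simp: fun_eq_iff algebra_simps)

text \<open>The index type contains pairs whose first entry is no basis element. The projection onto
  genuine monomials is the unit of the one-strand algebra.\<close>

lift_definition Eop :: "('a \<times> nat, 'k) lop" is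
 "\<lambda>v (b, r). if b \<in> BB then v (b, r) else 0"
 by (auto simp: fun_eq_iff)

text \<open>A linear functional may be evaluated through coordinates. Applied to traces, this
  contracts the inner sum whenever two of the operators are composed.\<close>

lemma sum_coords:
 assumes "\<And>a b. f (a + b) = f a + f b" "\<And>c a. f (smul A c a) = c * (f a :: 'k)"
 shows "(\<Sum>b\<in>BB. f b * tr (dl b * a)) = f a"
proof -
 have f0: "f 0 = 0" using assms(2)[of 0 0] by simp
 have "f (sum g I) = (\<Sum>i\<in>I. f (g i))" for g :: "'a => 'a" and I
  by (induction I rule: infinite_finite_induct) (auto simp: assms f0)
 then have "f (\<Sum>b\<in>BB. smul A (tr (dl b * a)) b) = (\<Sum>b\<in>BB. tr (dl b * a) * f b)"
  by (simp add: assms)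
 then show ?thesis using basis_expand[of a] by (simp add: mult.commute)
qed

lemma Mop_mult: "Mop a * Mop b = Mop (a * b)"
proof (rule lop_eqI)
 fix v and m :: "'a \<times> nat"
 obtain x r where m: "m = (x, r)" by force
 have "(\<Sum>c\<in>BB. tr (dl x * (a * c)) * (\<Sum>c'\<in>BB. tr (dl c * (b * c')) * v (c', r)))
  = (\<Sum>c'\<in>BB. (\<Sum>c\<in>BB. tr (dl x * (a * c)) * tr (dl c * (b * c'))) * v (c', r))"
  unfolding sum_distrib_left sum_distrib_right by (subst sum.swap) (simp add: mult.assoc)
 also have "... = (\<Sum>c'\<in>BB. tr (dl x * (a * (b * c'))) * v (c', r))"
  by (subst sum_coords) (auto simp: distrib_left trace_add trace_smul smul_mult_right)
 finally show "app (Mop a * Mop b) v m = app (Mop (a * b)) v m"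
  by (auto simp: m Mop.rep_eq mult.assoc)
qed

lemma Mop_add: "Mop (a + b) = Mop a + Mop b"
 by (rule lop_eqI) (auto simp: Mop.rep_eq algebra_simps trace_add sum.distrib)
lemma Mop_smul: "Mop (smul A c a) = sm c (Mop a)"
 by (rule lop_eqI) (auto simp: Mop.rep_eq algebra_simps trace_smul smul_mult_right smul_mult_left sum_distrib_left)
lemma Mop_one: "Mop 1 = Eop"
proof (rule lop_eqI)
 fix v and m :: "'a \<times> nat"
 show "app (Mop 1) v m = app Eop v m"
  by (cases m) (auto simp: Mop.rep_eq Eop.rep_eq dual_basis if_distrib[of "\<lambda>x. x * _"] cong: if_cong)
qed

lemma Eop_absorb [simp]: "Eop * Mop a = Mop a" "Mop a * Eop = Mop a" "Eop * Nop = Nop" "Nop * Eop = Nop"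
 "Eop * Eop = Eop" "Eop * Jop p = Jop p * Eop"
 by (rule lop_eqI; auto simp: Mop.rep_eq Nop.rep_eq Eop.rep_eq Jop.rep_eq)+

text \<open>Both kernels contract to a coordinate of \<open>a * ipsi c'\<close>, because
  \<open>ipsi (psi a * c') = a * ipsi c'\<close>. The sign can be pulled out of the sum since
  coordinates of the wrong parity vanish.\<close>

lemma Nop_Mop: "a \<in> homog A p ==> Mop a * Nop = sm (koszul (\<epsilon> * p)) (Nop * Mop (psi a))"
proof (rule lop_eqI)
 fix v and m :: "'a \<times> nat"
 assume a: "a \<in> homog A p"
 obtain x r where m: "m = (x, r)" by force
 let ?s = "koszul (\<epsilon> * p) :: 'k"
 have *: "(\<Sum>c\<in>BB. tr (dl x * (a * c)) * (koszul (\<epsilon> * par c') * tr (dl c * ipsi c')))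
   = koszul (\<epsilon> * par c') * tr (dl x * (a * ipsi c'))" for c'
 proof -
  have "(\<Sum>c\<in>BB. tr (dl x * (a * c)) * tr (dl c * ipsi c')) = tr (dl x * (a * ipsi c'))"
   using sum_coords[of "\<lambda>c. tr (dl x * (a * c))" "ipsi c'"]
   by (auto simp: distrib_left trace_add trace_smul smul_mult_right)
  from arg_cong[OF this, of "\<lambda>z. koszul (\<epsilon> * par c') * z"] show ?thesis
   by (simp add: sum_distrib_left mult.left_commute)
 qed
 have **: "(\<Sum>c\<in>BB. ?s * (koszul (\<epsilon> * par c) * tr (dl x * ipsi c) * tr (dl c * (psi a * c'))))
   = koszul (\<epsilon> * par c') * tr (dl x * (a * ipsi c'))" if c': "c' \<in> BB" for c'
 proof -
  have "?s * (koszul (\<epsilon> * par c) * tr (dl x * ipsi c) * tr (dl c * (psi a * c')))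
    = koszul (\<epsilon> * par c') * (tr (dl x * ipsi c) * tr (dl c * (psi a * c')))" if c: "c \<in> BB" for c
  proof (cases "par c = p + par c'")
   case True
   then show ?thesis by (auto simp: distrib_left koszul_add mult_ac)
  next
   case False
   have "psi a * c' \<in> homog A (p + par c')"
    using a c' by (intro homog_mult nak_homog basis_par)
   then have "tr (dl c * (psi a * c')) = 0" using coord_parity[OF c] False by metis
   then show ?thesis by simp
  qed
  then have "(\<Sum>c\<in>BB. ?s * (koszul (\<epsilon> * par c) * tr (dl x * ipsi c) * tr (dl c * (psi a * c'))))
   = koszul (\<epsilon> * par c') * (\<Sum>c\<in>BB. tr (dl x * ipsi c) * tr (dl c * (psi a * c')))"
   by (simp add: sum_distrib_left)
  also have "... = koszul (\<epsilon> * par c') * tr (dl x * (a * ipsi c'))"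
   using sum_coords[of "\<lambda>c. tr (dl x * ipsi c)" "psi a * c'"]
   by (simp add: ipsi_add ipsi_smul ipsi_mult distrib_left trace_add trace_smul smul_mult_right)
  finally show ?thesis .
 qed
 have "(\<Sum>c\<in>BB. tr (dl x * (a * c)) * (\<Sum>c'\<in>BB. koszul (\<epsilon> * par c') * tr (dl c * ipsi c') * v (c', r - 1)))
  = (\<Sum>c'\<in>BB. (\<Sum>c\<in>BB. tr (dl x * (a * c)) * (koszul (\<epsilon> * par c') * tr (dl c * ipsi c'))) * v (c', r - 1))"
  unfolding sum_distrib_left sum_distrib_right by (subst sum.swap) (simp add: mult.assoc)
 also have "... = (\<Sum>c'\<in>BB. (\<Sum>c\<in>BB. ?s * (koszul (\<epsilon> * par c) * tr (dl x * ipsi c) * tr (dl c * (psi a * c')))) * v (c', r - 1))"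
  by (intro sum.cong refl) (simp only: * ** )
 also have "... = ?s * (\<Sum>c\<in>BB. koszul (\<epsilon> * par c) * tr (dl x * ipsi c) * (\<Sum>c'\<in>BB. tr (dl c * (psi a * c')) * v (c', r - 1)))"
  unfolding sum_distrib_left sum_distrib_right by (subst sum.swap) (simp add: mult.assoc)
 finally show "app (Mop a * Nop) v m = app (sm ?s (Nop * Mop (psi a))) v m"
  by (auto simp: m Mop.rep_eq Nop.rep_eq)
qed

lemma Jop_add: "Jop p * Jop q = Jop (p + q)"
 by (rule lop_eqI) (auto simp: Jop.rep_eq distrib_right koszul_add mult.assoc)
lemma Jop_0: "Jop 0 = 1"
 by (rule lop_eqI) (auto simp: Jop.rep_eq)

lemma Jop_Mop: "a \<in> homog A p ==> Jop q * Mop a = sm (koszul (q * p)) (Mop a * Jop q)"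
proof (rule lop_eqI)
 fix v and m :: "'a \<times> nat"
 assume a: "a \<in> homog A p"
 obtain x r where m: "m = (x, r)" by force
 have "koszul (q * mpar (x, r)) * (tr (dl x * (a * c)) * v (c, r)) =
   koszul (q * p) * (tr (dl x * (a * c)) * (koszul (q * mpar (c, r)) * v (c, r)))"
  if "x \<in> BB" "c \<in> BB" for c
 proof (cases "par x = p + par c")
  case True
  then show ?thesis by (auto simp: mpar_def distrib_left koszul_add mult_ac)
 next
  case False
  have "a * c \<in> homog A (p + par c)"
   using a that by (intro homog_mult basis_par)
  then have "tr (dl x * (a * c)) = 0" using coord_parity[OF that(1)] False by metis
  then show ?thesis by simp
 qed
 then show "app (Jop q * Mop a) v m = app (sm (koszul (q * p)) (Mop a * Jop q)) v m"
  by (auto simp: m Jop.rep_eq Mop.rep_eq sum_distrib_left intro!: sum.cong)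
qed

lemma Jop_Nop: "Jop q * Nop = sm (koszul (q * \<epsilon>)) (Nop * Jop q)"
proof (rule lop_eqI)
 fix v and m :: "'a \<times> nat"
 obtain x r where m: "m = (x, r)" by force
 have "koszul (q * mpar (x, r)) * (koszul (\<epsilon> * par c) * tr (dl x * ipsi c) * v (c, r - 1)) =
   koszul (q * \<epsilon>) * (koszul (\<epsilon> * par c) * tr (dl x * ipsi c) * (koszul (q * mpar (c, r - 1)) * v (c, r - 1)))"
  if "x \<in> BB" "c \<in> BB" "r > 0" for c
 proof (cases "par x = par c")
  case True
  have "r > 0" using that by simp
  then obtain r' where "r = Suc r'" by (cases r) auto
  then show ?thesis using True by (auto simp: mpar_def distrib_left koszul_add mult_ac)
 next
  case False
  have "ipsi c \<in> homog A (par c)"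
   using that by (intro ipsi_homog basis_par)
  then have "tr (dl x * ipsi c) = 0" using coord_parity[OF that(1)] False by metis
  then show ?thesis by simp
 qed
 then show "app (Jop q * Nop) v m = app (sm (koszul (q * \<epsilon>)) (Nop * Jop q)) v m"
  by (auto simp: m Jop.rep_eq Nop.rep_eq sum_distrib_left intro!: sum.cong)
qed

text \<open>In degree \<open>Suc r\<close> the image consists of the coordinates of a combination of
  the elements \<open>ipsi c\<close> with the coefficients of \<open>v\<close>, up to signs.
  Applying \<open>psi\<close> turns it into a combination of the basis itself.\<close>

lemma Nop_injective:
 assumes "\<And>m. app Nop v m = 0" "b \<in> BB"
 shows "v (b, r) = 0"
proof -
 let ?y = "\<Sum>c\<in>BB. smul A (koszul (\<epsilon> * par c) * v (c, r)) (ipsi c)"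
 have "tr (dl x * ?y) = 0" if "x \<in> BB" for x
 proof -
  have "tr (dl x * ?y) = app Nop v (x, Suc r)"
   using that by (simp add: Nop.rep_eq sum_distrib_left trace_sum smul_mult_right trace_smul mult_ac)
  then show ?thesis using assms by simp
 qed
 then have "?y = 0" using basis_expand[of ?y] by simp
 then have "psi ?y = 0" by simp
 then have "(\<Sum>c\<in>BB. smul A (koszul (\<epsilon> * par c) * v (c, r)) c) = 0"
  by (simp add: nak_sum nak_smul)
 then have "koszul (\<epsilon> * par b) * v (b, r) = 0" using coords_unique[of "\<lambda>c. koszul (\<epsilon> * par c) * v (c, r)" b] assms(2) by blast
 then show ?thesis by (metis koszul_self(2) mult_zero_right)
qed

end

subsection \<open>Representations of the Frobenius polynomial algebras\<close>

primrec pint :: "('i, 'k::comm_ring_1) lop => (nat => 'a => ('i, 'k) lop) => (nat => ('i, 'k) lop) =>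
  ('k, 'a) pterm => ('i, 'k) lop" where
 "pint e t y (PTok i a) = t i a"
| "pint e t y (PX i) = y i"
| "pint e t y PZero = 0"
| "pint e t y POne = e"
| "pint e t y (PAdd f g) = pint e t y f + pint e t y g"
| "pint e t y (PMul f g) = pint e t y f * pint e t y g"
| "pint e t y (PSmul c f) = sm c (pint e t y f)"

lemma pint_psum: "pint e t y (psum fs) = sum_list (map (pint e t y) fs)"
 by (induction fs) auto

text \<open>
 The unit of the represented algebra is an idempotent \<open>e\<close> and not necessarily the identity
 operator.
\<close>

locale tokrep = frobenius_superalgebra A
 for A :: "('k::comm_ring_1, 'a::{ring,monoid_mult}) frob" +
 fixes n :: nat and e :: "('i, 'k) lop" and t :: "nat => 'a => ('i, 'k) lop"
 assumes e_idem: "e * e = e"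
  and e_tok: "i \<in> {1..n} ==> e * t i a = t i a" and tok_e: "i \<in> {1..n} ==> t i a * e = t i a"
  and tok_one: "i \<in> {1..n} ==> t i 1 = e"
  and tok_add: "i \<in> {1..n} ==> t i (a + b) = t i a + t i b"
  and tok_smul: "i \<in> {1..n} ==> t i (smul A c a) = sm c (t i a)"
  and tok_mult: "i \<in> {1..n} ==> t i a * t i b = t i (a * b)"
  and tok_commute: "[|i \<in> {1..n}; j \<in> {1..n}; i \<noteq> j; a \<in> homog A p; b \<in> homog A q|] ==>
   t i a * t j b = sm (koszul (p * q)) (t j b * t i a)"

locale polrep = tokrep A n e t
 for A :: "('k::comm_ring_1, 'a::{ring,monoid_mult}) frob" and n e and t :: "nat => 'a => ('i, 'k) lop" +
 fixes y :: "nat => ('i, 'k) lop"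
 assumes e_x: "i \<in> {1..n} ==> e * y i = y i" and x_e: "i \<in> {1..n} ==> y i * e = y i"
  and x_commute: "[|i \<in> {1..n}; j \<in> {1..n}; i \<noteq> j|] ==> y i * y j = sm (koszul (eps A)) (y j * y i)"
  and tok_x: "[|i \<in> {1..n}; j \<in> {1..n}; a \<in> homog A p|] ==>
   t j a * y i = sm (koszul (eps A * p)) (y i * t j (if j = i then nak A a else a))"
begin

abbreviation "pI \<equiv> pint e t y"

lemma pint_e: "f \<in> pol_terms n ==> e * pI f = pI f \<and> pI f * e = pI f"
 by (induction rule: pol_terms.induct)
  (auto simp: e_x x_e e_tok tok_e e_idem mult.assoc algebra_simps simp del: atLeastAtMost_iff,
   metis mult.assoc)

text \<open>The universal property of the presentation: the locale assumptions are the defining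
  relations, so evaluation factors through classes of terms.\<close>

lemma pint_cong: "pol_eq A n f g ==> pI f = pI g"
proof (induction rule: pol_eq.induct)
 case (pol_tok_linear i c a d b)
 then show ?case by (simp add: tok_add tok_smul del: atLeastAtMost_iff)
next
 case (pol_tok_x i j a p)
 then show ?case using tok_x[of i j a p] by (simp del: atLeastAtMost_iff)
qed (auto simp: algebra_simps sm_distrib pint_e tok_one tok_mult simp del: atLeastAtMost_iff
   intro: tok_commute x_commute)

end

text \<open>A polynomial in \<open>m\<close> variables can thus be evaluated on the strands
  \<open>l + 1\<close> to \<open>l + m\<close>. With \<open>m = 1\<close> this places an element of
  \<open>Pol\<^sub>1(A)\<close> on a single strand.\<close>

lemma polrep_shift:
 assumes "polrep A n e t y" "l + m \<le> n"
 shows "polrep A m e (\<lambda>i. t (l + i)) (\<lambda>i. y (l + i))"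
proof -
 interpret polrep A n e t y by fact
 have I: "l + i \<in> {1..n}" if "i \<in> {1..m}" for i using that assms(2) by simp
 show ?thesis
  apply unfold_locales
       apply (rule e_idem)
       apply (rule e_tok tok_e tok_one tok_add tok_smul tok_mult e_x x_e; rule I; assumption)+
    apply (rule tok_commute; (rule I)?; simp)
   apply (rule e_x x_e; rule I; assumption)+
   apply (rule x_commute; (rule I)?; simp)
  subgoal for i j a p using tok_x[OF I I, of i j a p] by (simp cong: if_cong)
  done
qed

subsection \<open>Several strands\<close>

text \<open>Functions of an index function on all naturals stand in for a tensor power, so that the
  number of strands does not enter the type.\<close>

lift_definition Lop :: "nat => ('m, 'k::comm_ring_1) lop => (nat => 'm, 'k) lop" is
 "\<lambda>k f v \<iota>. f (\<lambda>m. v (\<iota>(k := m))) (\<iota> k)"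
 by simp

lemma Lop_mult: "Lop k f * Lop k g = Lop k (f * g)"
 by (rule lop_eqI) (simp add: Lop.rep_eq)
lemma Lop_one: "Lop k 1 = 1"
 by (rule lop_eqI) (simp add: Lop.rep_eq)
lemma Lop_add: "Lop k (f + g) = Lop k f + Lop k g"
 by (rule lop_eqI) (simp add: Lop.rep_eq)
lemma Lop_sm: "Lop k (sm c f) = sm c (Lop k f)"
 by (rule lop_eqI) (simp add: Lop.rep_eq)
lemma Lop_zero: "Lop k 0 = 0"
 by (rule lop_eqI) (simp add: Lop.rep_eq)

text \<open>On arbitrary functions, operators in different factors are interchanged by writing one
  of them as finite sums of values and using the linearity of the other. This condition provides the
  finite sums.\<close>

definition finite_kernel :: "('m, 'k::comm_ring_1) lop => bool" where
 "finite_kernel f \<longleftrightarrow> (\<exists>S K. (\<forall>m. finite (S m)) \<and> (\<forall>v m. app f v m = (\<Sum>m'\<in>S m. K m m' * v m')))"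

lemma finite_kernelI:
 "(\<And>m. finite (S m)) ==> (\<And>v m. app f v m = (\<Sum>m'\<in>S m. K m m' * v m')) ==> finite_kernel f"
 unfolding finite_kernel_def by blast

lemma Lop_commute:
 assumes "finite_kernel f" "i \<noteq> j"
 shows "Lop i f * Lop j g = Lop j g * Lop i f"
proof (rule lop_eqI)
 fix v and \<iota> :: "nat => 'a"
 obtain S K where f: "\<And>v m. app f v m = (\<Sum>m'\<in>S m. K m m' * v m')"
  using assms(1) unfolding finite_kernel_def by blast
 have "app (Lop i f * Lop j g) v \<iota> = (\<Sum>m'\<in>S (\<iota> i). K (\<iota> i) m' * app g (\<lambda>m. v (\<iota>(i := m', j := m))) (\<iota> j))"
  using assms(2) by (simp add: Lop.rep_eq f)
 also have "... = app g (\<lambda>m. \<Sum>m'\<in>S (\<iota> i). K (\<iota> i) m' * v (\<iota>(i := m', j := m))) (\<iota> j)"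
  by (subst app_sum_arg) (simp add: app_cmult)
 also have "... = app (Lop j g * Lop i f) v \<iota>"
  using assms(2) by (simp add: Lop.rep_eq f fun_upd_twist)
 finally show "app (Lop i f * Lop j g) v \<iota> = app (Lop j g * Lop i f) v \<iota>" .
qed

lemma comm_mult: "z * x = x * z ==> z * y = y * z ==> z * (x * y) = (x * y) * (z :: 'r::semigroup_mult)"
 by (metis mult.assoc)
lemma mult_comm: "x * z = z * x ==> y * z = z * y ==> (x * y) * z = z * (x * (y :: 'r::semigroup_mult))"
 by (metis mult.assoc)
lemma sm_comm_left: "x * y = sm c (y * x) ==> x * (y * z) = sm c (y * (x * z))"
 by (metis mult.assoc sm_simps(1))

context frobenius_superalgebra
begin

lemma kernel_ops: "finite_kernel (Mop a)" "finite_kernel Nop" "finite_kernel (Jop p)" "finite_kernel Eop"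
proof -
 show "finite_kernel (Mop a)"
 proof (rule finite_kernelI)
  show "app (Mop a) v m = (\<Sum>m'\<in>(\<lambda>c. (c, snd m)) ` BB.
   (\<lambda>m m'. if fst m \<in> BB then tr (dl (fst m) * (a * fst m')) else 0) m m' * v m')" for v m
   by (cases m) (simp add: Mop.rep_eq sum.reindex inj_on_def)
 qed auto
 show "finite_kernel Nop"
 proof (rule finite_kernelI)
  show "app Nop v m = (\<Sum>m'\<in>(\<lambda>c. (c, snd m - 1)) ` BB.
   (\<lambda>m m'. if fst m \<in> BB \<and> snd m > 0 then koszul (\<epsilon> * par (fst m')) * tr (dl (fst m) * ipsi (fst m')) else 0) m m'
    * v m')" for v m
   by (cases m) (auto simp: Nop.rep_eq sum.reindex inj_on_def)
 qed auto
 show "finite_kernel (Jop p)"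
  by (rule finite_kernelI[of "\<lambda>m. {m}" _ "\<lambda>m m'. koszul (p * mpar m)"]) (auto simp: Jop.rep_eq)
 show "finite_kernel Eop"
  by (rule finite_kernelI[of "\<lambda>m. {m}" _ "\<lambda>m m'. if fst m \<in> BB then 1 else 0"]) (auto simp: Eop.rep_eq)
qed

text \<open>What a one-strand operator must satisfy to be placed beside others. Passing
  \<open>Jop q\<close> up to the Koszul sign expresses that it is homogeneous of parity
  \<open>p\<close>.\<close>

definition goodop :: "bit => ('a \<times> nat, 'k) lop => bool" where
 "goodop p f \<longleftrightarrow> finite_kernel f \<and> Eop * f = f \<and> f * Eop = f \<and>
   (\<forall>q. Jop q * f = sm (koszul (q * p)) (f * Jop q))"

lemma goodop_M: "a \<in> homog A p ==> goodop p (Mop a)"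
 unfolding goodop_def by (simp add: kernel_ops Jop_Mop)
lemma goodop_N: "goodop \<epsilon> Nop"
 unfolding goodop_def by (simp add: kernel_ops Jop_Nop)

primrec E0 :: "nat => (nat => 'a \<times> nat, 'k) lop" where
 "E0 0 = 1"
| "E0 (Suc d) = E0 d * Lop (Suc d) Eop"

text \<open>A Jordan-Wigner string: parity operators on all factors before the \<open>k\<close>-th.
  It also covers the factor 0, which carries no strand.\<close>

primrec JW :: "nat => bit => (nat => 'a \<times> nat, 'k) lop" where
 "JW 0 p = 1"
| "JW (Suc k) p = JW k p * Lop k (Jop p)"

lemma E0_Lop:
 assumes "finite_kernel f" "Eop * f = f * Eop"
 shows "E0 d * Lop k f = Lop k f * E0 d"
proof (induction d)
 case (Suc d)
 have "Lop (Suc d) Eop * Lop k f = Lop k f * Lop (Suc d) Eop"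
  using assms Lop_commute[OF kernel_ops(4), of "Suc d" k f] by (cases "k = Suc d") (auto simp: Lop_mult)
 with Suc show ?case unfolding E0.simps by (rule mult_comm)
qed simp

lemma E0_idem: "E0 d * E0 d = E0 d"
proof (induction d)
 case (Suc d)
 have "E0 d * Lop (Suc d) Eop = Lop (Suc d) Eop * E0 d"
  by (rule E0_Lop) (auto simp: kernel_ops)
 then show ?case using Suc by (simp add: Lop_mult) (metis (no_types, lifting) Eop_absorb(5) Lop_mult mult.assoc)
qed simp

lemma E0_Lop_E: "k \<in> {1..d} ==> E0 d * Lop k Eop = E0 d"
proof (induction d)
 case (Suc d)
 show ?case
 proof (cases "k = Suc d")
  case False
  then have "Lop (Suc d) Eop * Lop k Eop = Lop k Eop * Lop (Suc d) Eop"
   by (auto simp: Lop_commute kernel_ops)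
  then show ?thesis using Suc False by (simp add: mult.assoc) (metis Suc.IH le_Suc_eq mult.assoc Suc.prems atLeastAtMost_iff)
 qed (simp add: mult.assoc Lop_mult)
qed simp

lemma E0_JW: "E0 d * JW k p = JW k p * E0 d"
proof (induction k)
 case (Suc k)
 have "E0 d * Lop k (Jop p) = Lop k (Jop p) * E0 d"
  by (rule E0_Lop) (auto simp: kernel_ops)
 with Suc show ?case unfolding JW.simps by (rule comm_mult)
qed simp

lemma JW_Lop_ge: "k \<le> j ==> JW k p * Lop j f = Lop j f * JW k p"
proof (induction k)
 case (Suc k)
 then have "Lop k (Jop p) * Lop j f = Lop j f * Lop k (Jop p)"
  by (auto simp: Lop_commute kernel_ops)
 with Suc show ?case unfolding JW.simps by (intro mult_comm) auto
qed simp

lemma JW_Lop_less: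
 assumes "finite_kernel f" "\<And>q. Jop q * f = sm (koszul (q * p)) (f * Jop q)"
 shows "j < k ==> JW k q * Lop j f = sm (koszul (q * p)) (Lop j f * JW k q)"
proof (induction k)
 case (Suc k)
 show ?case
 proof (cases "j = k")
  case True
  then have "JW (Suc k) q * Lop j f = JW k q * Lop j (Jop q * f)"
   by (simp add: mult.assoc Lop_mult)
  also have "... = sm (koszul (q * p)) ((JW k q * Lop j f) * Lop j (Jop q))"
   by (simp add: assms Lop_sm mult.assoc Lop_mult)
  also have "... = sm (koszul (q * p)) (Lop j f * JW (Suc k) q)"
   using True by (simp add: JW_Lop_ge mult.assoc)
  finally show ?thesis .
 next
  case False
  then have "Lop k (Jop q) * Lop j f = Lop j f * Lop k (Jop q)"
   by (auto simp: Lop_commute kernel_ops)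
  then have "JW (Suc k) q * Lop j f = (JW k q * Lop j f) * Lop k (Jop q)"
   by (simp add: mult.assoc)
  also have "... = sm (koszul (q * p)) (Lop j f * JW (Suc k) q)"
   using False Suc by (simp add: mult.assoc)
  finally show ?thesis .
 qed
qed simp

lemma JW_add: "JW k p * JW k q = JW k (p + q)"
proof (induction k)
 case (Suc k)
 have "JW (Suc k) p * JW (Suc k) q = JW k p * (Lop k (Jop p) * JW k q) * Lop k (Jop q)"
  by (simp add: mult.assoc)
 also have "... = (JW k p * JW k q) * (Lop k (Jop p) * Lop k (Jop q))"
  by (simp add: JW_Lop_ge[symmetric] mult.assoc)
 finally show ?case using Suc by (simp add: Lop_mult Jop_add)
qed simp

lemma JW_0: "JW k 0 = 1"
 by (induction k) (auto simp: Jop_0 Lop_one)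

lemma JW_Jop: "JW k p * Lop j (Jop q) = Lop j (Jop q) * JW k p"
proof (cases "j < k")
 case True
 then show ?thesis
  using JW_Lop_less[of "Jop q" 0 j k p] by (simp add: kernel_ops Jop_add add.commute)
qed (simp add: JW_Lop_ge)

lemma JW_JW: "JW k p * JW j q = JW j q * JW k p"
proof (induction j)
 case (Suc j)
 with JW_Jop show ?case unfolding JW.simps by (intro comm_mult) auto
qed simp

text \<open>The sign for moving an operator to the \<open>k\<close>-th factor is realized by the
  string on the factors to its left. Multiplying by \<open>E0 d\<close> gives all these operators
  one common unit.\<close>

definition gop :: "nat => nat => bit => ('a \<times> nat, 'k) lop => (nat => 'a \<times> nat, 'k) lop" where
 "gop d k p f = E0 d * (JW k p * Lop k f)"

lemma gop_E0:
 assumes "goodop p f"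
 shows "E0 d * gop d k q f = gop d k q f" "gop d k q f * E0 d = gop d k q f"
proof -
 show "E0 d * gop d k q f = gop d k q f" by (simp add: gop_def mult.assoc[symmetric] E0_idem)
 have "E0 d * Lop k f = Lop k f * E0 d"
  using assms by (intro E0_Lop) (auto simp: goodop_def)
 then have "E0 d * (JW k q * Lop k f) = (JW k q * Lop k f) * E0 d"
  by (rule comm_mult[OF E0_JW])
 note c = this
 have "gop d k q f * E0 d = E0 d * ((JW k q * Lop k f) * E0 d)"
  by (simp add: gop_def mult.assoc)
 also have "... = E0 d * (E0 d * (JW k q * Lop k f))"
  by (simp only: c)
 finally have "gop d k q f * E0 d = E0 d * (E0 d * (JW k q * Lop k f))" .
 then show "gop d k q f * E0 d = gop d k q f"
  by (simp add: gop_def mult.assoc[symmetric] E0_idem)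
qed

lemma gop_mult:
 assumes "goodop p f" "goodop q g"
 shows "gop d k p f * gop d k q g = gop d k (p + q) (f * g)"
proof -
 have "gop d k p f * gop d k q g = (gop d k p f * E0 d) * (JW k q * Lop k g)"
  by (simp add: gop_def mult.assoc)
 also have "... = E0 d * (JW k p * ((Lop k f * JW k q) * Lop k g))"
  using gop_E0(2)[OF assms(1)] by (simp add: gop_def mult.assoc)
 also have "Lop k f * JW k q = JW k q * Lop k f" by (simp add: JW_Lop_ge)
 also have "E0 d * (JW k p * (JW k q * Lop k f * Lop k g)) = E0 d * ((JW k p * JW k q) * (Lop k f * Lop k g))"
  by (simp add: mult.assoc)
 finally show ?thesis by (simp add: gop_def JW_add Lop_mult)
qed

text \<open>Only one string matters: \<open>f\<close> sits in a factor covered by the string of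
  \<open>g\<close>, which produces the sign, while the string of \<open>f\<close> ends before the
  factor \<open>j\<close>.\<close>

lemma gop_commute_less:
 assumes "goodop p f" "goodop q g" "i < j"
 shows "gop d i p f * gop d j q g = sm (koszul (p * q)) (gop d j q g * gop d i p f)"
proof -
 have 1: "Lop i f * JW j q = sm (koszul (p * q)) (JW j q * Lop i f)"
  using JW_Lop_less[of f p i j q] assms by (simp add: goodop_def mult.commute)
 have 2: "Lop i f * Lop j g = Lop j g * Lop i f"
  using assms by (auto simp: goodop_def Lop_commute)
 have "gop d i p f * gop d j q g = (gop d i p f * E0 d) * (JW j q * Lop j g)"
  by (simp add: gop_def mult.assoc)
 also have "... = E0 d * (JW i p * ((Lop i f * JW j q) * Lop j g))"
  using gop_E0(2)[OF assms(1)] by (simp add: gop_def mult.assoc)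
 also have "... = sm (koszul (p * q)) (E0 d * ((JW i p * JW j q) * (Lop i f * Lop j g)))"
  by (simp add: 1 mult.assoc)
 also have "... = sm (koszul (p * q)) (E0 d * (JW j q * ((JW i p * Lop j g) * Lop i f)))"
  by (simp add: 2 JW_JW[of i p] mult.assoc)
 also have "JW i p * Lop j g = Lop j g * JW i p" using assms by (simp add: JW_Lop_ge)
 also have "E0 d * (JW j q * (Lop j g * JW i p * Lop i f)) = (gop d j q g * E0 d) * (JW i p * Lop i f)"
  using gop_E0(2)[OF assms(2)] by (simp add: gop_def mult.assoc)
 finally show ?thesis by (simp add: gop_def mult.assoc)
qed

lemma gop_commute:
 assumes "goodop p f" "goodop q g" "i \<noteq> j"
 shows "gop d i p f * gop d j q g = sm (koszul (p * q)) (gop d j q g * gop d i p f)"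
proof (cases "i < j")
 case True then show ?thesis using gop_commute_less assms by blast
next
 case False
 then have "gop d j q g * gop d i p f = sm (koszul (q * p)) (gop d i p f * gop d j q g)"
  using gop_commute_less[of q g p f j i d] assms by auto
 then show ?thesis by (simp add: mult.commute)
qed

lemma gop_linear: "gop d k p (f + g) = gop d k p f + gop d k p g" "gop d k p (sm c f) = sm c (gop d k p f)"
 "gop d k p 0 = 0"
 by (auto simp: gop_def Lop_add Lop_sm Lop_zero distrib_left)

lemma gop_E: "k \<in> {1..d} ==> gop d k 0 Eop = E0 d"
 by (simp add: gop_def JW_0 E0_Lop_E del: atLeastAtMost_iff)

text \<open>The string depends on the parity, so an arbitrary element is treated component by
  component.\<close>

definition tok0 :: "nat => nat => 'a => (nat => 'a \<times> nat, 'k) lop" where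
 "tok0 d k a = gop d k 0 (Mop (part 0 a)) + gop d k 1 (Mop (part 1 a))"

definition x0 :: "nat => nat => (nat => 'a \<times> nat, 'k) lop" where
 "x0 d k = gop d k \<epsilon> Nop"

lemma Mop_0: "Mop 0 = 0"
 by (rule lop_eqI) (auto simp: Mop.rep_eq split: prod.split)

lemma tok0_homog: "a \<in> homog A p ==> tok0 d k a = gop d k p (Mop a)"
 by (cases p) (auto simp: tok0_def part_homog Mop_0 gop_linear)

lemma tok0_add: "tok0 d k (a + b) = tok0 d k a + tok0 d k b"
 by (simp add: tok0_def part_add Mop_add gop_linear algebra_simps)

text \<open>Relations on a single strand are inherited from the one-strand operators; relations
  between two strands come from \<open>gop_commute\<close>, where the strings yield the
  signs.\<close>

lemma polrep0: "polrep A d (E0 d) (tok0 d) (x0 d)"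
proof unfold_locales
 fix i j p q c and a b :: 'a
 show "E0 d * E0 d = E0 d" by (rule E0_idem)
 show "E0 d * tok0 d i a = tok0 d i a" "tok0 d i a * E0 d = tok0 d i a"
  using gop_E0[OF goodop_M[OF part_props(1)]] by (auto simp: tok0_def algebra_simps)
 show "tok0 d i (smul A c a) = sm c (tok0 d i a)"
  by (simp add: tok0_def part_smul Mop_smul gop_linear sm_distrib)
 show "tok0 d i (a + b) = tok0 d i a + tok0 d i b" by (rule tok0_add)
 show "tok0 d i a * tok0 d i b = tok0 d i (a * b)"
 proof (induction a rule: homog_induct)
  case (add a a')
  then show ?case by (simp add: tok0_add distrib_right)
 next
  case (homog a p)
  then show ?case
  proof (induction b rule: homog_induct)
   case (add b b')
   then show ?case by (simp add: tok0_add distrib_left)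
  next
   case (homog b q)
   then show ?case
    by (simp add: tok0_homog[of _ p] tok0_homog[of _ q] tok0_homog[OF homog_mult] gop_mult goodop_M Mop_mult)
  qed
 qed
 show "E0 d * x0 d i = x0 d i" "x0 d i * E0 d = x0 d i"
  using gop_E0[OF goodop_N] by (auto simp: x0_def)
 {
  assume i: "i \<in> {1..d}"
  then show "tok0 d i 1 = E0 d" using tok0_homog[OF homog_one] by (simp add: Mop_one gop_E)
  assume j: "j \<in> {1..d}"
  {
   assume "i \<noteq> j"
   then show "x0 d i * x0 d j = sm (koszul \<epsilon>) (x0 d j * x0 d i)"
    using gop_commute[OF goodop_N goodop_N, of i j d] by (simp add: x0_def)
   assume ab: "a \<in> homog A p" "b \<in> homog A q"
   then show "tok0 d i a * tok0 d j b = sm (koszul (p * q)) (tok0 d j b * tok0 d i a)"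
    using gop_commute[OF goodop_M goodop_M \<open>i \<noteq> j\<close>, OF ab, of d] tok0_homog[OF ab(1)] tok0_homog[OF ab(2)] by simp
  }
  assume a: "a \<in> homog A p"
  show "tok0 d j a * x0 d i = sm (koszul (\<epsilon> * p)) (x0 d i * tok0 d j (if j = i then psi a else a))"
  proof (cases "j = i")
   case True
   then show ?thesis using a
    by (simp add: tok0_homog[of _ p] nak_homog x0_def gop_mult goodop_M goodop_N Nop_Mop gop_linear add.commute)
  next
   case False
   then show ?thesis using a
    by (simp add: tok0_homog[of _ p] x0_def gop_commute[OF goodop_M goodop_N] mult.commute)
  qed
 }
qed

lemma polrep1: "polrep A 1 Eop (\<lambda>i. Mop) (\<lambda>i. Nop)"
 by unfold_locales (auto simp: Mop_one Mop_mult Mop_add Mop_smul Nop_Mop)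

end

subsection \<open>Monomials\<close>

text \<open>Folded with a final unit in exactly the shape of \<open>tokens\<close>, as
  \<open>pdots\<close> is in the shape of \<open>dots\<close>. The morphism attached to a monomial
  will then be literally the upper part of a basis element.\<close>

definition ptokens :: "'a list => ('k, 'a) pterm" where
 "ptokens bs = foldr PMul (map (\<lambda>k. PTok k (bs ! (k - 1))) [1..<Suc (length bs)]) POne"

definition pdots :: "nat list => ('k, 'a) pterm" where
 "pdots \<alpha> = foldr PMul (map (\<lambda>k. ppow (PX k) (\<alpha> ! (k - 1))) [1..<Suc (length \<alpha>)]) POne"

definition pmono :: "'a list => nat list => ('k, 'a) pterm" where
 "pmono bs \<alpha> = PMul (ptokens bs) (pdots \<alpha>)"

context frobenius_superalgebra
begin

abbreviation "pint0 d \<equiv> pint (E0 d) (tok0 d) (x0 d)"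

text \<open>Coordinates of a pure tensor of the elements \<open>a\<^sub>k x\<^sup>\<alpha>\<close>.\<close>

definition factor :: "'a => nat => 'a \<times> nat => 'k" where
 "factor a r m = (if fst m \<in> BB \<and> snd m = r then tr (dl (fst m) * a) else 0)"

text \<open>Requiring \<open>undefined\<close> off \<open>{1..d}\<close> leaves a single index
  function for each monomial, so that pure tensors have finite support although the index type is
  infinite.\<close>

definition pure :: "nat => (nat => 'a) => (nat => nat) => (nat => 'a \<times> nat) => 'k" where
 "pure d as \<alpha> = (\<lambda>\<iota>. (\<Prod>k\<in>{1..d}. factor (as k) (\<alpha> k) (\<iota> k)) *
   (if \<forall>k. k \<notin> {1..d} \<longrightarrow> \<iota> k = undefined then 1 else 0))"

lemma Lop_pure:
 assumes k: "k \<in> {1..d}" and f: "\<And>m. app f (factor (as k) (\<alpha> k)) m = factor b r m"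
 shows "app (Lop k f) (pure d as \<alpha>) = pure d (as(k := b)) (\<alpha>(k := r))"
proof
 fix \<iota> :: "nat => 'a \<times> nat"
 let ?c = "(\<Prod>l\<in>{1..d} - {k}. factor (as l) (\<alpha> l) (\<iota> l)) * (if \<forall>k. k \<notin> {1..d} \<longrightarrow> \<iota> k = undefined then 1 else 0)"
 have "pure d as \<alpha> (\<iota>(k := m)) = ?c * factor (as k) (\<alpha> k) m" for m
 proof -
  have "(\<Prod>l\<in>{1..d}. factor (as l) (\<alpha> l) ((\<iota>(k := m)) l))
   = factor (as k) (\<alpha> k) m * (\<Prod>l\<in>{1..d} - {k}. factor (as l) (\<alpha> l) (\<iota> l))"
   using k by (subst prod.remove[of _ k]) (auto intro!: prod.cong)
  moreover have "(\<forall>l. l \<notin> {1..d} \<longrightarrow> (\<iota>(k := m)) l = undefined) \<longleftrightarrow> (\<forall>l. l \<notin> {1..d} \<longrightarrow> \<iota> l = undefined)"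
   using k by auto
  ultimately show ?thesis by (simp add: pure_def mult_ac)
 qed
 then have "app (Lop k f) (pure d as \<alpha>) \<iota> = ?c * factor b r (\<iota> k)"
  by (simp add: Lop.rep_eq app_cmult f)
 also have "... = pure d (as(k := b)) (\<alpha>(k := r)) \<iota>"
 proof -
  have "(\<Prod>l\<in>{1..d}. factor ((as(k := b)) l) ((\<alpha>(k := r)) l) (\<iota> l))
   = factor b r (\<iota> k) * (\<Prod>l\<in>{1..d} - {k}. factor (as l) (\<alpha> l) (\<iota> l))"
   using k by (subst prod.remove[of _ k]) (auto intro!: prod.cong)
  then show ?thesis by (simp add: pure_def mult_ac)
 qed
 finally show "app (Lop k f) (pure d as \<alpha>) \<iota> = pure d (as(k := b)) (\<alpha>(k := r)) \<iota>" .
qed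

lemma Mop_factor: "app (Mop b) (factor a r) m = factor (b * a) r m"
proof (cases m)
 case (Pair x s)
 have "(\<Sum>c\<in>BB. tr (dl x * (b * c)) * tr (dl c * a)) = tr (dl x * (b * a))"
  by (subst sum_coords) (auto simp: distrib_left trace_add trace_smul smul_mult_right)
 then show ?thesis using Pair by (cases "s = r") (auto simp: Mop.rep_eq factor_def)
qed

text \<open>Moving \<open>x\<close> past the coefficient 1 costs nothing, since 1 is even and fixed
  by \<open>ipsi\<close>. For this reason dots are evaluated before tokens.\<close>

lemma Nop_factor: "app Nop (factor 1 r) m = factor 1 (Suc r) m"
proof (cases m)
 case (Pair x s)
 have "koszul (\<epsilon> * par c) * tr (dl x * ipsi c) * tr (dl c * 1) = tr (dl x * ipsi c) * tr (dl c * 1)"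
  if c: "c \<in> BB" for c
  using coord_parity[OF c homog_one] by (cases "par c = 0") auto
 then have "(\<Sum>c\<in>BB. koszul (\<epsilon> * par c) * tr (dl x * ipsi c) * tr (dl c * 1)) = tr (dl x * 1)"
  using sum_coords[of "\<lambda>c. tr (dl x * ipsi c)" 1]
  by (simp add: ipsi_add ipsi_smul distrib_left trace_add trace_smul smul_mult_right)
 then show ?thesis using Pair by (cases s; cases "s = Suc r") (auto simp: Nop.rep_eq factor_def)
qed

lemma Jop_factor:
 assumes "a \<in> homog A q"
 shows "app (Jop p) (factor a r) m = koszul (p * (q + \<epsilon> * of_nat r)) * factor a r m"
proof (cases m)
 case (Pair x s)
 then show ?thesis
  using coord_parity[OF _ assms, of x] by (cases "par x = q") (auto simp: Jop.rep_eq factor_def mpar_def)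
qed

lemma Eop_factor: "app Eop (factor a r) m = factor a r m"
 by (cases m) (auto simp: Eop.rep_eq factor_def)

lemma E0_pure: "k \<le> d ==> app (E0 k) (pure d as \<alpha>) = pure d as \<alpha>"
proof (induction k)
 case (Suc k)
 have "app (Lop (Suc k) Eop) (pure d as \<alpha>) = pure d as \<alpha>"
  using Suc.prems by (subst Lop_pure[of _ _ _ _ _ "as (Suc k)" "\<alpha> (Suc k)"]) (auto simp: Eop_factor)
 then show ?case using Suc by simp
qed (simp add: fun_eq_iff)

definition homogs :: "nat => (nat => 'a) => bool" where
 "homogs d as \<longleftrightarrow> (\<forall>k\<in>{1..d}. \<exists>p. as k \<in> homog A p)"

text \<open>Pure tensors of homogeneous elements are eigenvectors of parity operators. It suffices
  that the eigenvalue squares to one, so the product of signs is not recorded.\<close>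

lemma JW_pure:
 assumes "homogs d as" "k \<le> Suc d"
 shows "\<exists>c. c * c = 1 \<and> app (JW k p) (pure d as \<alpha>) = (\<lambda>\<iota>. c * pure d as \<alpha> \<iota>)"
 using assms(2)
proof (induction k)
 case 0
 show ?case by (intro exI[of _ 1]) (simp add: fun_eq_iff)
next
 case (Suc k)
 have "\<exists>c. c * c = 1 \<and> app (Lop k (Jop p)) (pure d as \<alpha>) = (\<lambda>\<iota>. c * pure d as \<alpha> \<iota>)"
 proof (cases "k = 0")
  \<comment> \<open>Position 0 carries no strand: a pure tensor is supported where the index there
    is \<open>undefined\<close>, so the parity operator acts by one fixed sign.\<close>
  case True
  show ?thesis
  proof (intro exI conjI ext)
   fix \<iota> :: "nat => 'a \<times> nat"
   have "\<iota> 0 \<noteq> undefined ==> pure d as \<alpha> \<iota> = 0" unfolding pure_def by auto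
   then show "app (Lop k (Jop p)) (pure d as \<alpha>) \<iota> = koszul (p * mpar undefined) * pure d as \<alpha> \<iota>"
    using True by (cases "\<iota> 0 = undefined") (auto simp: Lop.rep_eq Jop.rep_eq)
  qed simp
 next
  case False
  then have k: "k \<in> {1..d}" using Suc.prems by auto
  then obtain q where q: "as k \<in> homog A q" using assms unfolding homogs_def by blast
  let ?c = "koszul (p * (q + \<epsilon> * of_nat (\<alpha> k))) :: 'k"
  have "app (Lop k (sm ?c (Jop p))) (pure d as \<alpha>) = pure d as \<alpha>"
   using k by (subst Lop_pure[of _ _ _ _ _ "as k" "\<alpha> k"]) (auto simp: Jop_factor[OF q])
  then have h: "(\<lambda>i. ?c * app (Lop k (Jop p)) (pure d as \<alpha>) i) = pure d as \<alpha>"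
   by (simp only: Lop_sm app_simps)
  have "app (Lop k (Jop p)) (pure d as \<alpha>) = (\<lambda>\<iota>. ?c * pure d as \<alpha> \<iota>)"
   by (subst (2) h[symmetric]) simp
  then show ?thesis by (intro exI[of _ ?c]) auto
 qed
 then obtain c where c: "c * c = 1" "app (Lop k (Jop p)) (pure d as \<alpha>) = (\<lambda>\<iota>. c * pure d as \<alpha> \<iota>)" by blast
 obtain c' where c': "c' * c' = 1" "app (JW k p) (pure d as \<alpha>) = (\<lambda>\<iota>. c' * pure d as \<alpha> \<iota>)"
  using Suc by auto
 have "app (JW (Suc k) p) (pure d as \<alpha>) = (\<lambda>\<iota>. (c * c') * pure d as \<alpha> \<iota>)"
  by (simp add: c(2) app_cmult c'(2) mult.assoc)
 moreover have "(c * c') * (c * c') = 1" using c(1) c'(1) by (metis mult.assoc mult.commute mult_1)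
 ultimately show ?case by blast
qed

lemma gop_pure:
 assumes "k \<in> {1..d}" "\<And>m. app f (factor (as k) (\<alpha> k)) m = factor b r m" "homogs d as" "b \<in> homog A q"
 shows "\<exists>c. c * c = 1 \<and> app (gop d k p f) (pure d as \<alpha>) = (\<lambda>\<iota>. c * pure d (as(k := b)) (\<alpha>(k := r)) \<iota>)"
proof -
 have "homogs d (as(k := b))" using assms(3,4) unfolding homogs_def by auto
 then obtain c where "c * c = 1"
  "app (JW k p) (pure d (as(k := b)) (\<alpha>(k := r))) = (\<lambda>\<iota>. c * pure d (as(k := b)) (\<alpha>(k := r)) \<iota>)"
  using JW_pure[of d _ k] assms(1) by fastforce
 moreover have "app (Lop k f) (pure d as \<alpha>) = pure d (as(k := b)) (\<alpha>(k := r))"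
  by (rule Lop_pure[OF assms(1)]) (rule assms(2))
 ultimately show ?thesis
  by (intro exI[of _ c]) (simp add: gop_def app_cmult E0_pure)
qed

lemma tokens_pure:
 assumes "set ks \<subseteq> {1..d}" "distinct ks" "homogs d as" "homogs d b"
 shows "\<exists>c. c * c = 1 \<and> app (pint0 d (foldr PMul (map (\<lambda>k. PTok k (b k)) ks) POne)) (pure d as \<alpha>)
  = (\<lambda>\<iota>. c * pure d (\<lambda>k. if k \<in> set ks then b k * as k else as k) \<alpha> \<iota>)"
 using assms(1,2)
proof (induction ks)
 case Nil
 show ?case by (intro exI[of _ 1]) (simp add: E0_pure)
next
 case (Cons k ks)
 let ?as = "\<lambda>k. if k \<in> set ks then b k * as k else as k"
 obtain c where c: "c * c = 1"
  "app (pint0 d (foldr PMul (map (\<lambda>k. PTok k (b k)) ks) POne)) (pure d as \<alpha>) = (\<lambda>\<iota>. c * pure d ?as \<alpha> \<iota>)"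
  using Cons by auto
 have k: "k \<in> {1..d}" "k \<notin> set ks" using Cons by auto
 obtain p q where pq: "b k \<in> homog A p" "as k \<in> homog A q"
  using assms(3,4) k unfolding homogs_def by blast
 have "homogs d ?as" unfolding homogs_def
 proof
  fix l assume "l \<in> {1..d}"
  then obtain p q where "b l \<in> homog A p" "as l \<in> homog A q"
   using assms(3,4) unfolding homogs_def by blast
  then have "b l * as l \<in> homog A (p + q)" "as l \<in> homog A q" using homog_mult by auto
  then show "\<exists>p. ?as l \<in> homog A p" by (cases "l \<in> set ks") auto
 qed
 then obtain c' where c': "c' * c' = 1"
  "app (gop d k p (Mop (b k))) (pure d ?as \<alpha>) = (\<lambda>\<iota>. c' * pure d (?as(k := b k * ?as k)) (\<alpha>(k := \<alpha> k)) \<iota>)"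
  using gop_pure[of k d "Mop (b k)" ?as \<alpha> "b k * ?as k" "\<alpha> k" "p + q" p] k pq homog_mult[OF pq]
  by (auto simp: Mop_factor)
 have "?as(k := b k * ?as k) = (\<lambda>l. if l \<in> set (k # ks) then b l * as l else as l)"
  using k by auto
 then have "app (pint0 d (foldr PMul (map (\<lambda>k. PTok k (b k)) (k # ks)) POne)) (pure d as \<alpha>)
   = (\<lambda>\<iota>. (c * c') * pure d (\<lambda>l. if l \<in> set (k # ks) then b l * as l else as l) \<alpha> \<iota>)"
  using c'(2) by (simp add: c(2) app_cmult tok0_homog[OF pq(1)] mult.assoc)
 moreover have "(c * c') * (c * c') = 1" using c(1) c'(1) by (metis mult.assoc mult.commute mult_1)
 ultimately show ?case by blast
qed

lemma homogs_one: "homogs d (\<lambda>_. 1)"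
 unfolding homogs_def using homog_one by blast

lemma x0_pure:
 assumes "k \<in> {1..d}"
 shows "\<exists>c. c * c = 1 \<and> app (x0 d k) (pure d (\<lambda>_. 1) \<alpha>) = (\<lambda>\<iota>. c * pure d (\<lambda>_. 1) (\<alpha>(k := Suc (\<alpha> k))) \<iota>)"
 using gop_pure[of k d Nop "\<lambda>_. 1" \<alpha> 1 "Suc (\<alpha> k)" 0 \<epsilon>, OF assms _ homogs_one homog_one]
 by (auto simp: x0_def Nop_factor fun_upd_idem)

lemma ppow_pure:
 assumes "k \<in> {1..d}"
 shows "\<exists>c. c * c = 1 \<and> app (pint0 d (ppow (PX k) r)) (pure d (\<lambda>_. 1) \<alpha>)
  = (\<lambda>\<iota>. c * pure d (\<lambda>_. 1) (\<alpha>(k := \<alpha> k + r)) \<iota>)"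
proof (induction r)
 case 0
 show ?case by (intro exI[of _ 1]) (simp add: E0_pure fun_upd_idem)
next
 case (Suc r)
 then obtain c where c: "c * c = 1" "app (pint0 d (ppow (PX k) r)) (pure d (\<lambda>_. 1) \<alpha>)
  = (\<lambda>\<iota>. c * pure d (\<lambda>_. 1) (\<alpha>(k := \<alpha> k + r)) \<iota>)" by blast
 obtain c' where c': "c' * c' = 1" "app (x0 d k) (pure d (\<lambda>_. 1) (\<alpha>(k := \<alpha> k + r)))
  = (\<lambda>\<iota>. c' * pure d (\<lambda>_. 1) (\<alpha>(k := \<alpha> k + Suc r)) \<iota>)"
  using x0_pure[OF assms, of "\<alpha>(k := \<alpha> k + r)"] by auto
 have "app (pint0 d (ppow (PX k) (Suc r))) (pure d (\<lambda>_. 1) \<alpha>)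
   = (\<lambda>\<iota>. (c * c') * pure d (\<lambda>_. 1) (\<alpha>(k := \<alpha> k + Suc r)) \<iota>)"
  using c'(2) by (simp add: c(2) app_cmult mult.assoc)
 moreover have "(c * c') * (c * c') = 1" using c(1) c'(1) by (metis mult.assoc mult.commute mult_1)
 ultimately show ?case by blast
qed

lemma dots_pure:
 assumes "set ks \<subseteq> {1..d}" "distinct ks"
 shows "\<exists>c. c * c = 1 \<and> app (pint0 d (foldr PMul (map (\<lambda>k. ppow (PX k) (r k)) ks) POne)) (pure d (\<lambda>_. 1) \<alpha>)
  = (\<lambda>\<iota>. c * pure d (\<lambda>_. 1) (\<lambda>k. if k \<in> set ks then \<alpha> k + r k else \<alpha> k) \<iota>)"
 using assms
proof (induction ks)
 case Nil
 show ?case by (intro exI[of _ 1]) (simp add: E0_pure)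
next
 case (Cons k ks)
 let ?\<alpha> = "\<lambda>k. if k \<in> set ks then \<alpha> k + r k else \<alpha> k"
 obtain c where c: "c * c = 1"
  "app (pint0 d (foldr PMul (map (\<lambda>k. ppow (PX k) (r k)) ks) POne)) (pure d (\<lambda>_. 1) \<alpha>) = (\<lambda>\<iota>. c * pure d (\<lambda>_. 1) ?\<alpha> \<iota>)"
  using Cons by auto
 have k: "k \<in> {1..d}" "k \<notin> set ks" using Cons by auto
 obtain c' where c': "c' * c' = 1"
  "app (pint0 d (ppow (PX k) (r k))) (pure d (\<lambda>_. 1) ?\<alpha>) = (\<lambda>\<iota>. c' * pure d (\<lambda>_. 1) (?\<alpha>(k := ?\<alpha> k + r k)) \<iota>)"
  using ppow_pure[OF k(1)] by blast
 have "?\<alpha>(k := ?\<alpha> k + r k) = (\<lambda>l. if l \<in> set (k # ks) then \<alpha> l + r l else \<alpha> l)"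
  using k by auto
 then have "app (pint0 d (foldr PMul (map (\<lambda>k. ppow (PX k) (r k)) (k # ks)) POne)) (pure d (\<lambda>_. 1) \<alpha>)
   = (\<lambda>\<iota>. (c * c') * pure d (\<lambda>_. 1) (\<lambda>l. if l \<in> set (k # ks) then \<alpha> l + r l else \<alpha> l) \<iota>)"
  using c'(2) by (simp add: c(2) app_cmult mult.assoc)
 moreover have "(c * c') * (c * c') = 1" using c(1) c'(1) by (metis mult.assoc mult.commute mult_1)
 ultimately show ?case by blast
qed

text \<open>The coordinates of the unit of \<open>Pol\<^sub>d(A)\<close>. The operator of an
  element, applied to this vector, reads off the coordinates of the element up to signs.\<close>

definition vac :: "nat => (nat => 'a \<times> nat) => 'k" where
 "vac d = pure d (\<lambda>_. 1) (\<lambda>_. 0)"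

definition mono_index :: "nat => 'a list => nat list => nat => 'a \<times> nat" where
 "mono_index d bs \<alpha> = (\<lambda>k. if k \<in> {1..d} then (bs ! (k - 1), \<alpha> ! (k - 1)) else undefined)"

definition mono_indices :: "nat => ('a list \<times> nat list) set" where
 "mono_indices d = {bs. length bs = d \<and> set bs \<subseteq> BB} \<times> {\<alpha>. length \<alpha> = d}"

lemma mono_index_inj:
 assumes "(bs, \<alpha>) \<in> mono_indices d" "(bs', \<alpha>') \<in> mono_indices d" "mono_index d bs \<alpha> = mono_index d bs' \<alpha>'"
 shows "bs = bs' \<and> \<alpha> = \<alpha>'"
proof -
 have "bs ! i = bs' ! i \<and> \<alpha> ! i = \<alpha>' ! i" if "i < d" for i
  using fun_cong[OF assms(3), of "Suc i"] that by (auto simp: mono_index_def)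
 then show ?thesis using assms(1,2) unfolding mono_indices_def by (auto intro: nth_equalityI)
qed

text \<open>The dots act first and raise the powers while all coefficients are still 1; then each
  token multiplies one coefficient. Beyond that every operator contributes only a sign.\<close>

lemma pmono_vac:
 assumes "(bs, \<alpha>) \<in> mono_indices d"
 shows "\<exists>c. c * c = 1 \<and> app (pint0 d (pmono bs \<alpha>)) (vac d) = (\<lambda>\<iota>. if \<iota> = mono_index d bs \<alpha> then c else 0)"
proof -
 have len: "length bs = d" "length \<alpha> = d" and bs: "\<And>k. k \<in> {1..d} ==> bs ! (k - 1) \<in> BB"
  using assms unfolding mono_indices_def by auto
 let ?b = "\<lambda>k. bs ! (k - 1)" and ?r = "\<lambda>k. \<alpha> ! (k - 1)" and ?ks = "[1..<Suc d]"
 have b: "homogs d ?b" unfolding homogs_def using bs basis_par by blast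
 define as al where "as = (\<lambda>k. if k \<in> set ?ks then ?b k * 1 else 1)"
  and "al = (\<lambda>k. if k \<in> set ?ks then 0 + ?r k else 0)"
 have ks: "set ?ks \<subseteq> {1..d}" "distinct ?ks" by auto
 have as: "as k = ?b k" "al k = ?r k" if "k \<in> {1..d}" for k using that by (auto simp: as_def al_def)
 obtain c where c: "c * c = 1" "app (pint0 d (pdots \<alpha>)) (vac d) = (\<lambda>\<iota>. c * pure d (\<lambda>_. 1) al \<iota>)"
  using dots_pure[OF ks, of ?r "\<lambda>_. 0"] unfolding pdots_def vac_def len al_def by metis
 obtain c' where c': "c' * c' = 1" "app (pint0 d (ptokens bs)) (pure d (\<lambda>_. 1) al) = (\<lambda>\<iota>. c' * pure d as al \<iota>)"
  using tokens_pure[OF ks homogs_one b, of al] unfolding ptokens_def len as_def by metis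
 have *: "pure d as al \<iota> = (if \<iota> = mono_index d bs \<alpha> then 1 else 0)" for \<iota>
 proof (cases "\<iota> = mono_index d bs \<alpha>")
  case True
  have "factor (as k) (al k) (\<iota> k) = 1" if "k \<in> {1..d}" for k
   using that bs[OF that] unfolding True mono_index_def factor_def as[OF that] by (simp add: dual_basis)
  then show ?thesis using True by (simp add: pure_def mono_index_def)
 next
  case False
  show ?thesis
  proof (cases "\<forall>k. k \<notin> {1..d} \<longrightarrow> \<iota> k = undefined")
   case True
   have "\<exists>k\<in>{1..d}. \<iota> k \<noteq> (?b k, ?r k)"
   proof (rule ccontr)
    assume "\<not> ?thesis"
    then have "\<iota> k = mono_index d bs \<alpha> k" for k
     using True unfolding mono_index_def by (cases "k \<in> {1..d}") auto
    then show False using False by blast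
   qed
   then obtain k where k: "k \<in> {1..d}" "\<iota> k \<noteq> (?b k, ?r k)" by blast
   then have "factor (as k) (al k) (\<iota> k) = 0"
    using bs[OF k(1)] unfolding as[OF k(1)] by (cases "\<iota> k") (auto simp: factor_def dual_basis)
   then have "(\<Prod>k\<in>{1..d}. factor (as k) (al k) (\<iota> k)) = 0"
    using k(1) by (metis finite_atLeastAtMost prod_zero)
   then show ?thesis using False by (simp add: pure_def)
  qed (use False in \<open>auto simp: pure_def\<close>)
 qed
 have "app (pint0 d (pmono bs \<alpha>)) (vac d) = (\<lambda>\<iota>. if \<iota> = mono_index d bs \<alpha> then c * c' else 0)"
  unfolding pmono_def pint.simps times_lop.rep_eq c(2) app_cmult c'(2) * by auto
 moreover have "(c * c') * (c * c') = 1" using c(1) c'(1) by (metis mult.assoc mult.commute mult_1)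
 ultimately show ?thesis by blast
qed

lemma monomials_independent:
 assumes "finite S" "S \<subseteq> mono_indices d"
  and "\<And>\<iota>. app (\<Sum>(bs, \<alpha>)\<in>S. sm (c bs \<alpha>) (pint0 d (pmono bs \<alpha>))) (vac d) \<iota> = 0"
  and "(bs, \<alpha>) \<in> S"
 shows "c bs \<alpha> = 0"
proof -
 have "\<exists>s. s * s = 1 \<and> app (pint0 d (pmono (fst m) (snd m))) (vac d) =
   (\<lambda>\<iota>. if \<iota> = mono_index d (fst m) (snd m) then s else 0)" if "m \<in> S" for m
  using pmono_vac[of "fst m" "snd m"] assms(2) that by auto
 then obtain s where s: "\<And>m. m \<in> S ==> s m * s m = 1" "\<And>m. m \<in> S ==>
   app (pint0 d (pmono (fst m) (snd m))) (vac d) = (\<lambda>\<iota>. if \<iota> = mono_index d (fst m) (snd m) then s m else 0)"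
  by metis
 let ?i = "mono_index d bs \<alpha>"
 have i: "?i = mono_index d (fst m) (snd m) \<longleftrightarrow> m = (bs, \<alpha>)" if "m \<in> S" for m
  using mono_index_inj[of bs \<alpha> d "fst m" "snd m"] that assms(2,4) by (cases m) auto
 have "0 = (\<Sum>m\<in>S. c (fst m) (snd m) * (if ?i = mono_index d (fst m) (snd m) then s m else 0))"
  using assms(3)[of ?i] s(2) by (simp add: app_sum split_def)
 also have "... = (\<Sum>m\<in>S. if m = (bs, \<alpha>) then c bs \<alpha> * s (bs, \<alpha>) else 0)"
  by (intro sum.cong refl) (simp add: i)
 also have "... = c bs \<alpha> * s (bs, \<alpha>)" using assms(1,4) by simp
 finally have "c bs \<alpha> * (s (bs, \<alpha>) * s (bs, \<alpha>)) = 0" by (metis mult.assoc mult_zero_left)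
 then show ?thesis using s(1)[OF assms(4)] by simp
qed

end

section \<open>Presented modules and normal forms in \<open>Pol\<^sub>n(A)\<close>\<close>

subsection \<open>Modules given by a congruence on terms\<close>

text \<open>Both \<open>Pol\<^sub>n(A)\<close> and the spaces of morphisms are terms modulo a
  congruence. Sums, spans and coefficient lists are developed once for such presentations.\<close>

locale term_module =
 fixes T :: "'t set" and eq :: "'t => 't => bool"
  and ad :: "'t => 't => 't" and sc :: "'k::comm_ring_1 => 't => 't" and ze :: 't
 assumes eq_T: "eq f g ==> f \<in> T \<and> g \<in> T"
  and ze_T: "ze \<in> T" and ad_T: "f \<in> T ==> g \<in> T ==> ad f g \<in> T" and sc_T: "f \<in> T ==> sc c f \<in> T"
  and eq_refl: "f \<in> T ==> eq f f" and eq_sym: "eq f g ==> eq g f"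
  and eq_trans [trans]: "eq f g ==> eq g h ==> eq f h"
  and cong_ad: "eq f f' ==> eq g g' ==> eq (ad f g) (ad f' g')"
  and cong_sc: "eq f f' ==> eq (sc c f) (sc c f')"
  and ad_assoc: "f \<in> T ==> g \<in> T ==> h \<in> T ==> eq (ad (ad f g) h) (ad f (ad g h))"
  and ad_comm: "f \<in> T ==> g \<in> T ==> eq (ad f g) (ad g f)"
  and ad_zero: "f \<in> T ==> eq (ad f ze) f"
  and ad_neg: "f \<in> T ==> eq (ad f (sc (- 1) f)) ze"
  and sc_ad: "f \<in> T ==> g \<in> T ==> eq (sc c (ad f g)) (ad (sc c f) (sc c g))"
  and ad_sc: "f \<in> T ==> eq (sc (c + c') f) (ad (sc c f) (sc c' f))"
  and sc_sc: "f \<in> T ==> eq (sc c (sc c' f)) (sc (c * c') f)"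
  and one_sc: "f \<in> T ==> eq (sc 1 f) f"
begin

lemmas in_T = ze_T ad_T sc_T

lemma zero_ad: "f \<in> T ==> eq (ad ze f) f"
 using ad_comm ad_zero eq_trans in_T by blast

lemma zero_sc: "f \<in> T ==> eq (sc 0 f) ze"
proof -
 assume f: "f \<in> T"
 have "eq (sc (1 + - 1) f) (ad (sc 1 f) (sc (- 1) f))" using f by (rule ad_sc)
 also have "eq ... (ad f (sc (- 1) f))" using f by (intro cong_ad one_sc eq_refl in_T)
 also have "eq ... ze" using f by (rule ad_neg)
 finally show ?thesis by simp
qed

lemma sc_zero: "eq (sc c ze) ze"
proof -
 have "eq (sc c ze) (sc c (sc 0 ze))" by (intro cong_sc eq_sym[OF zero_sc] ze_T)
 also have "eq ... (sc 0 ze)" using sc_sc[OF ze_T, of c 0] by simp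
 also have "eq ... ze" by (intro zero_sc ze_T)
 finally show ?thesis .
qed

lemma cancel: "f \<in> T ==> g \<in> T ==> eq (ad (ad f (sc (- 1) g)) g) f"
proof -
 assume fg: "f \<in> T" "g \<in> T"
 have "eq (ad (ad f (sc (- 1) g)) g) (ad f (ad (sc (- 1) g) g))" using fg by (intro ad_assoc in_T)
 also have "eq ... (ad f (ad g (sc (- 1) g)))" using fg by (intro cong_ad eq_refl ad_comm in_T)
 also have "eq ... (ad f ze)" using fg by (intro cong_ad eq_refl ad_neg in_T)
 also have "eq ... f" using fg by (intro ad_zero)
 finally show ?thesis .
qed

lemma ad_swap: "f \<in> T ==> g \<in> T ==> h \<in> T ==> eq (ad f (ad g h)) (ad g (ad f h))"
proof -
 assume T: "f \<in> T" "g \<in> T" "h \<in> T"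
 have "eq (ad f (ad g h)) (ad (ad f g) h)" using T by (intro eq_sym[OF ad_assoc])
 also have "eq ... (ad (ad g f) h)" using T by (intro cong_ad ad_comm eq_refl)
 also have "eq ... (ad g (ad f h))" using T by (intro ad_assoc)
 finally show ?thesis .
qed

definition lsum :: "'t list => 't" where "lsum fs = foldr ad fs ze"

lemma lsum_simps [simp]: "lsum [] = ze" "lsum (f # fs) = ad f (lsum fs)"
 by (auto simp: lsum_def)

lemma lsum_T: "set fs \<subseteq> T ==> lsum fs \<in> T"
 by (induction fs) (auto intro: in_T)

lemma lsum_cong: "(\<And>m. m \<in> set ms ==> eq (f m) (g m)) ==> eq (lsum (map f ms)) (lsum (map g ms))"
 by (induction ms) (auto intro: cong_ad eq_refl ze_T)

lemma lsum_add:
 "(\<And>m. m \<in> set ms ==> f m \<in> T \<and> g m \<in> T) ==>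
  eq (ad (lsum (map f ms)) (lsum (map g ms))) (lsum (map (\<lambda>m. ad (f m) (g m)) ms))"
proof (induction ms)
 case (Cons m ms)
 let ?f = "lsum (map f ms)" and ?g = "lsum (map g ms)"
 have T: "f m \<in> T" "g m \<in> T" "?f \<in> T" "?g \<in> T" using Cons.prems by (auto intro!: lsum_T)
 have "eq (ad (ad (f m) ?f) (ad (g m) ?g)) (ad (f m) (ad ?f (ad (g m) ?g)))" using T by (intro ad_assoc in_T)
 also have "eq ... (ad (f m) (ad (g m) (ad ?f ?g)))" using T by (intro cong_ad eq_refl ad_swap)
 also have "eq ... (ad (ad (f m) (g m)) (ad ?f ?g))" using T by (intro eq_sym[OF ad_assoc] in_T)
 also have "eq ... (ad (ad (f m) (g m)) (lsum (map (\<lambda>m. ad (f m) (g m)) ms)))"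
  using T Cons by (intro cong_ad eq_refl in_T) auto
 finally show ?case by simp
qed (auto intro: ad_zero ze_T)

lemma lsum_sc: "(\<And>m. m \<in> set ms ==> f m \<in> T) ==> eq (sc c (lsum (map f ms))) (lsum (map (\<lambda>m. sc c (f m)) ms))"
proof (induction ms)
 case (Cons m ms)
 let ?f = "lsum (map f ms)"
 have T: "f m \<in> T" "?f \<in> T" using Cons.prems by (auto intro!: lsum_T)
 have "eq (sc c (ad (f m) ?f)) (ad (sc c (f m)) (sc c ?f))" using T by (intro sc_ad)
 also have "eq ... (ad (sc c (f m)) (lsum (map (\<lambda>m. sc c (f m)) ms)))"
  using T Cons by (intro cong_ad eq_refl in_T) auto
 finally show ?case by simp
qed (auto intro: sc_zero)

lemma lsum_remove1:
 "m \<in> set ms ==> (\<And>m. m \<in> set ms ==> f m \<in> T) ==>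
  eq (lsum (map f ms)) (ad (f m) (lsum (map f (remove1 m ms))))"
proof (induction ms)
 case (Cons m' ms)
 show ?case
 proof (cases "m' = m")
  case False
  then have m: "m \<in> set ms" using Cons.prems by auto
  have "f m'' \<in> T" if "m'' \<in> set (remove1 m ms)" for m''
   using that set_remove1_subset[of m ms] Cons.prems by auto
  then have T: "f m \<in> T" "f m' \<in> T" "lsum (map f (remove1 m ms)) \<in> T"
   using Cons.prems m by (auto intro!: lsum_T)
  have "eq (ad (f m') (lsum (map f ms))) (ad (f m') (ad (f m) (lsum (map f (remove1 m ms)))))"
   using Cons m T by (intro cong_ad eq_refl) auto
  also have "eq ... (ad (f m) (ad (f m') (lsum (map f (remove1 m ms)))))" using T by (intro ad_swap)
  finally show ?thesis using False by simp
 next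
  case True
  have "lsum (map f (m' # ms)) \<in> T" using Cons.prems by (intro lsum_T) auto
  with True show ?thesis by (auto intro: eq_refl)
 qed
qed simp

text \<open>Padding with zero coefficients brings two combinations to a common index list, so that
  they can be added termwise.\<close>

lemma lsum_extend:
 assumes "distinct ms" "distinct ns" "set ms \<subseteq> set ns" "\<And>m. m \<in> set ns ==> b m \<in> T"
 shows "eq (lsum (map (\<lambda>m. sc (c m) (b m)) ms)) (lsum (map (\<lambda>m. sc (if m \<in> set ms then c m else 0) (b m)) ns))"
 using assms
proof (induction ns arbitrary: ms)
 case Nil
 then show ?case by (auto intro: eq_refl ze_T)
next
 case (Cons n ns)
 show ?case
 proof (cases "n \<in> set ms")
  case True
  let ?ms = "remove1 n ms"
  have ms: "distinct ?ms" "set ?ms = set ms - {n}" using Cons.prems by (auto simp: set_remove1_eq)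
  have "eq (lsum (map (\<lambda>m. sc (c m) (b m)) ms)) (ad (sc (c n) (b n)) (lsum (map (\<lambda>m. sc (c m) (b m)) ?ms)))"
   using Cons.prems True by (intro lsum_remove1 in_T) auto
  also have "eq ... (ad (sc (c n) (b n)) (lsum (map (\<lambda>m. sc (if m \<in> set ?ms then c m else 0) (b m)) ns)))"
   using Cons.prems ms by (intro cong_ad eq_refl in_T Cons.IH) auto
  also have "map (\<lambda>m. sc (if m \<in> set ?ms then c m else 0) (b m)) ns = map (\<lambda>m. sc (if m \<in> set ms then c m else 0) (b m)) ns"
   using Cons.prems ms by (intro map_cong) auto
  finally show ?thesis using True by simp
 next
  case False
  let ?S = "lsum (map (\<lambda>m. sc (if m \<in> set ms then c m else 0) (b m)) ns)"
  have S: "?S \<in> T" using Cons.prems by (auto intro!: lsum_T in_T)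
  have "eq (lsum (map (\<lambda>m. sc (c m) (b m)) ms)) ?S" using Cons False by auto
  also have "eq ?S (ad ze ?S)" using S by (intro eq_sym[OF zero_ad])
  also have "eq ... (ad (sc 0 (b n)) ?S)"
   using Cons.prems S by (intro cong_ad eq_refl eq_sym[OF zero_sc]) auto
  finally show ?thesis using False by simp
 qed
qed

text \<open>The rule \<open>span_eq\<close> closes the set under the congruence: membership is
  stated for terms but is a property of classes.\<close>

inductive_set span :: "'t set => 't set" for G where
 span_base: "g \<in> G ==> g \<in> span G"
| span_zero: "ze \<in> span G"
| span_ad: "f \<in> span G ==> g \<in> span G ==> ad f g \<in> span G"
| span_sc: "f \<in> span G ==> sc c f \<in> span G"
| span_eq: "f \<in> span G ==> eq f g ==> g \<in> span G"

lemma span_T: "f \<in> span G ==> G \<subseteq> T ==> f \<in> T"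
 by (induction rule: span.induct) (auto intro: in_T dest: eq_T)

lemma span_sub: "f \<in> span G ==> G \<subseteq> span H ==> f \<in> span H"
 by (induction rule: span.induct) (auto intro: span.intros)

lemma span_expand:
 assumes "f \<in> span (b ` I)" "b ` I \<subseteq> T"
 shows "\<exists>ms c. distinct ms \<and> set ms \<subseteq> I \<and> eq f (lsum (map (\<lambda>m. sc (c m) (b m)) ms))"
 using assms(1)
proof (induction rule: span.induct)
 case (span_base g)
 then obtain m where m: "m \<in> I" "g = b m" by blast
 then have g: "g \<in> T" using assms by auto
 have "eq g (sc 1 g)" using g by (intro eq_sym[OF one_sc])
 also have "eq ... (ad (sc 1 g) ze)" using g by (intro eq_sym[OF ad_zero] in_T)
 finally show ?case using m by (intro exI[of _ "[m]"] exI[of _ "\<lambda>_. 1"]) auto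
next
 case span_zero
 show ?case by (intro exI[of _ "[]"]) (auto intro: eq_refl ze_T)
next
 case (span_ad f g)
 then obtain ms c ms' c' where *: "distinct ms" "set ms \<subseteq> I" "eq f (lsum (map (\<lambda>m. sc (c m) (b m)) ms))"
  "distinct ms'" "set ms' \<subseteq> I" "eq g (lsum (map (\<lambda>m. sc (c' m) (b m)) ms'))" by blast
 define ns where "ns = remdups (ms @ ms')"
 let ?c = "\<lambda>m. if m \<in> set ms then c m else 0" and ?c' = "\<lambda>m. if m \<in> set ms' then c' m else 0"
 have ns: "distinct ns" "set ns = set ms \<union> set ms'" by (auto simp: ns_def)
 have T: "b m \<in> T" if "m \<in> set ns" for m
  using *(2,5) ns(2) assms(2) that by (metis Un_iff image_subset_iff subsetD)
 have "eq (ad f g) (ad (lsum (map (\<lambda>m. sc (c m) (b m)) ms)) (lsum (map (\<lambda>m. sc (c' m) (b m)) ms')))"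
  using * by (intro cong_ad)
 also have "eq ... (ad (lsum (map (\<lambda>m. sc (?c m) (b m)) ns)) (lsum (map (\<lambda>m. sc (?c' m) (b m)) ns)))"
 proof (intro cong_ad lsum_extend)
  show "set ms \<subseteq> set ns" "set ms' \<subseteq> set ns" using ns by auto
 qed (rule *(1) *(4) ns(1) T | assumption)+
 also have "eq ... (lsum (map (\<lambda>m. ad (sc (?c m) (b m)) (sc (?c' m) (b m))) ns))"
  using T by (intro lsum_add) (auto intro: in_T)
 also have "eq ... (lsum (map (\<lambda>m. sc (?c m + ?c' m) (b m)) ns))"
  using T by (intro lsum_cong eq_sym[OF ad_sc]) auto
 finally show ?case using * ns by (intro exI[of _ ns] exI[of _ "\<lambda>m. ?c m + ?c' m"]) auto
next
 case (span_sc f x)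
 then obtain ms c where *: "distinct ms" "set ms \<subseteq> I" "eq f (lsum (map (\<lambda>m. sc (c m) (b m)) ms))" by blast
 then have T: "b m \<in> T" if "m \<in> set ms" for m using assms(2) that by auto
 have "eq (sc x f) (sc x (lsum (map (\<lambda>m. sc (c m) (b m)) ms)))" using * by (intro cong_sc)
 also have "eq ... (lsum (map (\<lambda>m. sc x (sc (c m) (b m))) ms))" using T by (intro lsum_sc in_T)
 also have "eq ... (lsum (map (\<lambda>m. sc (x * c m) (b m)) ms))" using T by (intro lsum_cong sc_sc)
 finally show ?case using * by (intro exI[of _ ms] exI[of _ "\<lambda>m. x * c m"]) auto
next
 case (span_eq f g)
 then show ?case using eq_sym eq_trans by blast
qed

end

text \<open>A map that is linear only up to the congruences still carries spans to spans. It serves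
  for left multiplication by a fixed element.\<close>

lemma span_map:
 assumes "term_module T eqv ad sc ze" "term_module T' eqv' ad' sc' ze'"
  and f: "f \<in> term_module.span eqv ad sc ze G" and G: "G \<subseteq> T"
  and h: "\<And>g. g \<in> G ==> h g \<in> term_module.span eqv' ad' sc' ze' G'"
  and z: "eqv' ze' (h ze)"
  and a: "\<And>f g. f \<in> T ==> g \<in> T ==> eqv' (ad' (h f) (h g)) (h (ad f g))"
  and s: "\<And>f c. f \<in> T ==> eqv' (sc' c (h f)) (h (sc c f))"
  and e: "\<And>f g. eqv f g ==> eqv' (h f) (h g)"
 shows "h f \<in> term_module.span eqv' ad' sc' ze' G'"
proof -
 interpret M: term_module T eqv ad sc ze by fact
 interpret N: term_module T' eqv' ad' sc' ze' by fact
 from f show ?thesis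
 proof (induction rule: M.span.induct)
  case (span_ad f g)
  then show ?case using a M.span_T[OF _ G] N.span_ad N.span_eq by meson
 next
  case (span_sc f c)
  then show ?case using s M.span_T[OF _ G] N.span_sc N.span_eq by meson
 qed (use h z e N.span_zero N.span_eq in blast)+
qed

subsection \<open>Normal forms in the Frobenius polynomial algebras\<close>

declare One_nat_def [simp del]
declare pol_trans [trans]

lemma pol_eq_terms: "pol_eq A n f g ==> f \<in> pol_terms n \<and> g \<in> pol_terms n"
 by (induction rule: pol_eq.induct) (auto intro: pol_terms.intros simp del: atLeastAtMost_iff)

context frobenius_superalgebra
begin

sublocale pol: term_module "pol_terms n" "pol_eq A n" PAdd PSmul PZero for n
 by unfold_locales (auto intro: pol_terms.intros pol_eq.intros dest: pol_eq_terms)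

abbreviation polspan where "polspan n \<equiv> pol.span n"

lemma lsum_psum: "pol.lsum fs = psum (fs :: ('k, 'a) pterm list)"
 by (induction fs) auto

lemma psum_terms: "set fs \<subseteq> pol_terms n ==> psum (fs :: ('k, 'a) pterm list) \<in> pol_terms n"
 using pol.lsum_T[of fs n] by (simp add: lsum_psum)

lemma mul_zero: "f \<in> pol_terms n ==> pol_eq A n (PMul f PZero) PZero"
 "f \<in> pol_terms n ==> pol_eq A n (PMul PZero f) PZero"
proof -
 assume f: "f \<in> pol_terms n"
 have "pol_eq A n (PMul f PZero) (PMul f (PSmul 0 PZero))"
  by (intro pol_cong_mul pol_refl f pol.eq_sym[OF pol.zero_sc] pol_terms.intros)
 also have "pol_eq A n ... (PSmul 0 (PMul f PZero))" using f by (intro pol_mul_smul pol_terms.intros)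
 also have "pol_eq A n ... PZero" using f by (intro pol.zero_sc pol_terms.intros)
 finally show "pol_eq A n (PMul f PZero) PZero" .
 have "pol_eq A n (PMul PZero f) (PMul (PSmul 0 PZero) f)"
  by (intro pol_cong_mul pol_refl f pol.eq_sym[OF pol.zero_sc] pol_terms.intros)
 also have "pol_eq A n ... (PSmul 0 (PMul PZero f))" using f by (intro pol_smul_mul pol_terms.intros)
 also have "pol_eq A n ... PZero" using f by (intro pol.zero_sc pol_terms.intros)
 finally show "pol_eq A n (PMul PZero f) PZero" .
qed

lemma polspan_mul:
 assumes "f \<in> polspan n G" "G \<subseteq> pol_terms n" "h \<in> pol_terms n" "\<And>g. g \<in> G ==> PMul h g \<in> polspan n H"
 shows "PMul h f \<in> polspan n H"
 using pol.term_module_axioms pol.term_module_axioms assms(1,2,4)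
proof (rule span_map)
 show "pol_eq A n PZero (PMul h PZero)" using mul_zero(1)[OF assms(3)] by (rule pol_sym)
qed (use assms(3) in \<open>auto intro: pol_sym pol_mul_add pol_mul_smul pol_cong_mul pol_refl\<close>)

lemma tok_linear:
 assumes "i \<in> {1..n}"
 shows "pol_eq A n (PTok i (a + b)) (PAdd (PTok i a) (PTok i b))"
  and "pol_eq A n (PTok i (smul A c a)) (PSmul c (PTok i a))"
  and "pol_eq A n (PTok i 0) PZero"
proof -
 note T = pol_terms.intros(1)[OF assms]
 have "pol_eq A n (PTok i (a + b)) (PAdd (PSmul 1 (PTok i a)) (PSmul 1 (PTok i b)))"
  using pol_tok_linear[OF assms, of A 1 a 1 b] by simp
 also have "pol_eq A n ... (PAdd (PTok i a) (PTok i b))"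
  by (intro pol_cong_add pol_one_smul T)
 finally show "pol_eq A n (PTok i (a + b)) (PAdd (PTok i a) (PTok i b))" .
 have "pol_eq A n (PTok i (smul A c a)) (PAdd (PSmul c (PTok i a)) (PSmul 0 (PTok i 0)))"
  using pol_tok_linear[OF assms, of A c a 0 0] by simp
 also have "pol_eq A n ... (PAdd (PSmul c (PTok i a)) PZero)"
  by (intro pol_cong_add pol_cong_smul pol_refl pol.zero_sc T)
 also have "pol_eq A n ... (PSmul c (PTok i a))"
  by (intro pol_add_zero pol_terms.intros T)
 finally show "pol_eq A n (PTok i (smul A c a)) (PSmul c (PTok i a))" .
 have "pol_eq A n (PTok i 0) (PAdd (PSmul 0 (PTok i 0)) (PSmul 0 (PTok i 0)))"
  using pol_tok_linear[OF assms, of A 0 0 0 0] by simp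
 also have "pol_eq A n ... (PAdd PZero PZero)"
  by (intro pol_cong_add pol.zero_sc T)
 also have "pol_eq A n ... PZero" by (intro pol_add_zero pol_terms.intros)
 finally show "pol_eq A n (PTok i 0) PZero" .
qed

lemma tok_mul_span:
 assumes i: "i \<in> {1..n}" and g: "g \<in> pol_terms n" and "\<And>b. b \<in> BB ==> PMul (PTok i b) g \<in> polspan n H"
 shows "PMul (PTok i a) g \<in> polspan n H"
proof -
 note T = pol_terms.intros(1)[OF i]
 have *: "PMul (PTok i (\<Sum>b\<in>F. smul A (c b) b)) g \<in> polspan n H" if "F \<subseteq> BB" for F c
  using finite_subset[OF that finite_set] that
 proof (induction F rule: finite_induct)
  case empty
  have "pol_eq A n (PMul (PTok i 0) g) (PMul PZero g)" by (intro pol_cong_mul tok_linear(3) i pol_refl g)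
  from pol_sym[OF pol_trans[OF this mul_zero(2)[OF g]]] show ?case
   using pol.span_eq[OF pol.span_zero] by simp
 next
  case (insert b F)
  let ?s = "\<Sum>b\<in>F. smul A (c b) b"
  have "pol_eq A n (PMul (PTok i (smul A (c b) b + ?s)) g) (PMul (PAdd (PSmul (c b) (PTok i b)) (PTok i ?s)) g)"
  proof (intro pol_cong_mul pol_refl g)
   have "pol_eq A n (PTok i (smul A (c b) b + ?s)) (PAdd (PTok i (smul A (c b) b)) (PTok i ?s))"
    by (intro tok_linear i)
   also have "pol_eq A n ... (PAdd (PSmul (c b) (PTok i b)) (PTok i ?s))"
    by (intro pol_cong_add pol_refl tok_linear i T)
   finally show "pol_eq A n (PTok i (smul A (c b) b + ?s)) (PAdd (PSmul (c b) (PTok i b)) (PTok i ?s))" .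
  qed
  also have "pol_eq A n ... (PAdd (PMul (PSmul (c b) (PTok i b)) g) (PMul (PTok i ?s) g))"
   by (intro pol_add_mul g pol_terms.intros T)
  also have "pol_eq A n ... (PAdd (PSmul (c b) (PMul (PTok i b) g)) (PMul (PTok i ?s) g))"
   by (intro pol_cong_add pol_smul_mul g pol_terms.intros T pol_refl)
  finally have "pol_eq A n (PAdd (PSmul (c b) (PMul (PTok i b) g)) (PMul (PTok i ?s) g))
   (PMul (PTok i (smul A (c b) b + ?s)) g)" by (rule pol_sym)
  moreover have "PAdd (PSmul (c b) (PMul (PTok i b) g)) (PMul (PTok i ?s) g) \<in> polspan n H"
   using insert assms(3) by (intro pol.span_ad pol.span_sc) auto
  ultimately show ?case using insert pol.span_eq by simp
 qed
 obtain c where "a = (\<Sum>b\<in>BB. smul A (c b) b)" using basis_expand_ex by blast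
 then show ?thesis using *[of BB c] by simp
qed

lemma polspan_swap:
 assumes "pol_eq A n (PMul x y) (PSmul c (PMul y' x))"
  and T: "x \<in> pol_terms n" "y \<in> pol_terms n" "y' \<in> pol_terms n" "g \<in> pol_terms n"
  and "PMul y' (PMul x g) \<in> polspan n H"
 shows "PMul x (PMul y g) \<in> polspan n H"
proof -
 have "pol_eq A n (PMul x (PMul y g)) (PMul (PMul x y) g)" using T by (intro pol_sym[OF pol_mul_assoc])
 also have "pol_eq A n ... (PMul (PSmul c (PMul y' x)) g)" using T assms(1) by (intro pol_cong_mul pol_refl)
 also have "pol_eq A n ... (PSmul c (PMul (PMul y' x) g))" using T by (intro pol_smul_mul pol_terms.intros)
 also have "pol_eq A n ... (PSmul c (PMul y' (PMul x g)))" using T by (intro pol_cong_smul pol_mul_assoc)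
 finally show ?thesis using assms(6) pol.span_sc pol.span_eq pol_sym by metis
qed

lemma ppow_terms: "f \<in> pol_terms n ==> ppow f r \<in> pol_terms n"
 by (induction r) (auto intro: pol_terms.intros)

lemma ppow_commute:
 assumes xy: "pol_eq A n (PMul x y) (PSmul c (PMul y x))" and T: "x \<in> pol_terms n" "y \<in> pol_terms n"
 shows "\<exists>c. pol_eq A n (PMul x (ppow y r)) (PSmul c (PMul (ppow y r) x))"
proof (induction r)
 case 0
 have "pol_eq A n (PMul x POne) x" using T(1) by (rule pol_mul_one)
 also have "pol_eq A n ... (PMul POne x)" using T by (intro pol_sym[OF pol_one_mul])
 also have "pol_eq A n ... (PSmul 1 (PMul POne x))" using T by (intro pol_sym[OF pol_one_smul] pol_terms.intros)
 finally show ?case by auto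
next
 case (Suc r)
 then obtain c' where c': "pol_eq A n (PMul x (ppow y r)) (PSmul c' (PMul (ppow y r) x))" by blast
 let ?p = "ppow y r"
 note T = T ppow_terms[OF T(2), of r]
 have "pol_eq A n (PMul x (PMul y ?p)) (PMul (PMul x y) ?p)" using T by (intro pol_sym[OF pol_mul_assoc])
 also have "pol_eq A n ... (PMul (PSmul c (PMul y x)) ?p)" using T xy by (intro pol_cong_mul pol_refl)
 also have "pol_eq A n ... (PSmul c (PMul (PMul y x) ?p))" using T by (intro pol_smul_mul pol_terms.intros)
 also have "pol_eq A n ... (PSmul c (PMul y (PMul x ?p)))" using T by (intro pol_cong_smul pol_mul_assoc)
 also have "pol_eq A n ... (PSmul c (PMul y (PSmul c' (PMul ?p x))))"
  using T c' by (intro pol_cong_smul pol_cong_mul pol_refl)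
 also have "pol_eq A n ... (PSmul c (PSmul c' (PMul y (PMul ?p x))))"
  using T by (intro pol_cong_smul pol_mul_smul pol_terms.intros)
 also have "pol_eq A n ... (PSmul c (PSmul c' (PMul (PMul y ?p) x)))"
  using T by (intro pol_cong_smul pol_sym[OF pol_mul_assoc])
 also have "pol_eq A n ... (PSmul (c * c') (PMul (PMul y ?p) x))"
  using T by (intro pol_smul_smul pol_terms.intros)
 finally show ?case by auto
qed

text \<open>One span per variable, nested along the list. Left multiplication by a generator can
  then be followed through the variables one at a time, by induction on the list.\<close>

primrec dspan :: "nat => nat list => ('k, 'a) pterm set" where
 "dspan n [] = polspan n {POne}"
| "dspan n (k # ks) = polspan n {PMul (ppow (PX k) r) g | r g. g \<in> dspan n ks}"

primrec tspan :: "nat => nat list => nat list => ('k, 'a) pterm set" where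
 "tspan n ls [] = dspan n ls"
| "tspan n ls (k # ks) = polspan n {PMul (PTok k b) g | b g. b \<in> BB \<and> g \<in> tspan n ls ks}"

lemma dspan_terms: "set ks \<subseteq> {1..n} ==> dspan n ks \<subseteq> pol_terms n"
proof (induction ks)
 case (Cons k ks)
 then have "{PMul (ppow (PX k) r) g | r g. g \<in> dspan n ks} \<subseteq> pol_terms n"
  by (auto intro!: pol_terms.intros ppow_terms)
 then show ?case using pol.span_T by auto
qed (use pol.span_T in \<open>auto intro: pol_terms.intros\<close>)

lemma tspan_terms: "set ks \<subseteq> {1..n} ==> set ls \<subseteq> {1..n} ==> tspan n ls ks \<subseteq> pol_terms n"
proof (induction ks)
 case (Cons k ks)
 then have "{PMul (PTok k b) g | b g. b \<in> BB \<and> g \<in> tspan n ls ks} \<subseteq> pol_terms n"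
  by (auto intro!: pol_terms.intros)
 then show ?case using pol.span_T by auto
qed (use dspan_terms in auto)

lemma x_dspan:
 assumes "set ks \<subseteq> {1..n}" "i \<in> set ks" "f \<in> dspan n ks"
 shows "PMul (PX i) f \<in> dspan n ks"
 using assms
proof (induction ks arbitrary: f)
 case (Cons k ks)
 let ?G = "{PMul (ppow (PX k) r) g | r g. g \<in> dspan n ks}"
 have k: "k \<in> {1..n}" "i \<in> {1..n}" and ks: "dspan n ks \<subseteq> pol_terms n" using Cons.prems dspan_terms by auto
 have G: "?G \<subseteq> pol_terms n" using ks k by (auto intro!: pol_terms.intros ppow_terms simp del: atLeastAtMost_iff)
 have f: "f \<in> polspan n ?G" using Cons.prems by simp
 have "PMul (PX i) f \<in> polspan n ?G"
 proof (rule polspan_mul[OF f G])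
  show "PX i \<in> pol_terms n" using k by (intro pol_terms.intros)
  fix g assume "g \<in> ?G"
  then obtain r h where g: "g = PMul (ppow (PX k) r) h" "h \<in> dspan n ks" by blast
  then have h: "h \<in> pol_terms n" using ks by auto
  show "PMul (PX i) g \<in> polspan n ?G"
  proof (cases "i = k")
   case True
   have "pol_eq A n (PMul (ppow (PX k) (Suc r)) h) (PMul (PX k) (PMul (ppow (PX k) r) h))"
    using h k by (simp del: atLeastAtMost_iff) (intro pol_mul_assoc pol_terms.intros ppow_terms)
   moreover have "PMul (ppow (PX k) (Suc r)) h \<in> polspan n ?G"
    using g by (intro pol.span_base) blast
   ultimately show ?thesis using True g pol.span_eq by simp
  next
   case False
   have "\<exists>c. pol_eq A n (PMul (PX i) (ppow (PX k) r)) (PSmul c (PMul (ppow (PX k) r) (PX i)))"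
    using False k by (intro ppow_commute[OF pol_x_commute] pol_terms.intros)
   then obtain c where c: "pol_eq A n (PMul (PX i) (ppow (PX k) r)) (PSmul c (PMul (ppow (PX k) r) (PX i)))" by blast
   show ?thesis unfolding g(1)
   proof (rule polspan_swap[OF c])
    show "PMul (ppow (PX k) r) (PMul (PX i) h) \<in> polspan n ?G"
     using Cons False g by (intro pol.span_base) auto
   qed (use h k in \<open>auto intro!: pol_terms.intros ppow_terms simp del: atLeastAtMost_iff\<close>)
  qed
 qed
 then show ?case by simp
qed simp

text \<open>A dot moves to the right past the tokens at the cost of a sign, and changes the token on
  its own strand by \<open>ipsi\<close>. The changed token is expanded in the basis again.\<close>

lemma x_tspan:
 assumes "set ks \<subseteq> {1..n}" "set ls \<subseteq> {1..n}" "i \<in> set ls" "f \<in> tspan n ls ks"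
 shows "PMul (PX i) f \<in> tspan n ls ks"
 using assms
proof (induction ks arbitrary: f)
 case (Cons k ks)
 let ?G = "{PMul (PTok k b) g | b g. b \<in> BB \<and> g \<in> tspan n ls ks}"
 have k: "k \<in> {1..n}" "i \<in> {1..n}" and ks: "tspan n ls ks \<subseteq> pol_terms n" using Cons.prems tspan_terms by auto
 have G: "?G \<subseteq> pol_terms n" using ks k by (auto intro!: pol_terms.intros ppow_terms simp del: atLeastAtMost_iff)
 have f: "f \<in> polspan n ?G" using Cons.prems by simp
 have "PMul (PX i) f \<in> polspan n ?G"
 proof (rule polspan_mul[OF f G])
  show x: "PX i \<in> pol_terms n" using k by (intro pol_terms.intros)
  fix g assume "g \<in> ?G"
  then obtain b h where g: "g = PMul (PTok k b) h" "b \<in> BB" "h \<in> tspan n ls ks" by blast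
  then have h: "h \<in> pol_terms n" using ks by auto
  \<comment> \<open>Chosen so that moving \<open>a\<close> past the dot produces \<open>b\<close>:
    on the strand of the dot, \<open>psi a = b\<close>.\<close>
  define a where "a = (if k = i then ipsi b else b)"
  let ?p = "par b"
  have a: "a \<in> homog A ?p" using g basis_par ipsi_homog by (auto simp: a_def)
  have "pol_eq A n (PMul (PTok k a) (PX i)) (PSmul (koszul (\<epsilon> * ?p)) (PMul (PX i) (PTok k (if k = i then psi a else a))))"
   using k a by (intro pol_tok_x)
  moreover have "(if k = i then psi a else a) = b" by (simp add: a_def)
  ultimately have "pol_eq A n (PSmul (koszul (\<epsilon> * ?p)) (PMul (PTok k a) (PX i)))
    (PSmul (koszul (\<epsilon> * ?p)) (PSmul (koszul (\<epsilon> * ?p)) (PMul (PX i) (PTok k b))))"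
   by (intro pol_cong_smul) simp
  also have "pol_eq A n ... (PSmul 1 (PMul (PX i) (PTok k b)))"
   using pol_smul_smul[of "PMul (PX i) (PTok k b)" n A "koszul (\<epsilon> * ?p)" "koszul (\<epsilon> * ?p)"] x k
   by (simp add: pol_terms.intros del: atLeastAtMost_iff)
  also have "pol_eq A n ... (PMul (PX i) (PTok k b))"
   using x k by (intro pol_one_smul pol_terms.intros)
  finally have c: "pol_eq A n (PMul (PX i) (PTok k b)) (PSmul (koszul (\<epsilon> * ?p)) (PMul (PTok k a) (PX i)))"
   by (rule pol_sym)
  have xh: "PMul (PX i) h \<in> tspan n ls ks" using Cons g by auto
  show "PMul (PX i) g \<in> polspan n ?G" unfolding g(1)
  proof (rule polspan_swap[OF c])
   show "PMul (PTok k a) (PMul (PX i) h) \<in> polspan n ?G"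
   proof (rule tok_mul_span[OF k(1)])
    show "PMul (PX i) h \<in> pol_terms n" using xh ks by blast
    show "PMul (PTok k b) (PMul (PX i) h) \<in> polspan n ?G" if "b \<in> BB" for b
     using xh that by (intro pol.span_base) blast
   qed
  qed (use h k in \<open>auto intro!: pol_terms.intros simp del: atLeastAtMost_iff\<close>)
 qed
 then show ?case by simp
qed (simp add: x_dspan)

lemma tok_tspan:
 assumes "set ks \<subseteq> {1..n}" "set ls \<subseteq> {1..n}" "i \<in> set ks" "f \<in> tspan n ls ks"
 shows "PMul (PTok i a) f \<in> tspan n ls ks"
 using assms
proof (induction ks arbitrary: f a)
 case (Cons k ks)
 let ?G = "{PMul (PTok k b) g | b g. b \<in> BB \<and> g \<in> tspan n ls ks}"
 have k: "k \<in> {1..n}" "i \<in> {1..n}" and ks: "tspan n ls ks \<subseteq> pol_terms n" using Cons.prems tspan_terms by auto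
 have G: "?G \<subseteq> pol_terms n" using ks k by (auto intro!: pol_terms.intros ppow_terms simp del: atLeastAtMost_iff)
 have f: "f \<in> polspan n ?G" using Cons.prems by simp
 have fT: "f \<in> pol_terms n" using pol.span_T[OF f G] .
 have "PMul (PTok i a) f \<in> polspan n ?G"
 proof (rule tok_mul_span[OF k(2) fT])
  fix a assume a: "a \<in> BB"
  show "PMul (PTok i a) f \<in> polspan n ?G"
  proof (rule polspan_mul[OF f G])
   show x: "PTok i a \<in> pol_terms n" using k by (intro pol_terms.intros)
   fix g assume "g \<in> ?G"
   then obtain b h where g: "g = PMul (PTok k b) h" "b \<in> BB" "h \<in> tspan n ls ks" by blast
   then have h: "h \<in> pol_terms n" using ks by auto
   show "PMul (PTok i a) g \<in> polspan n ?G"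
   proof (cases "i = k")
    case True
    have "pol_eq A n (PMul (PTok k a) (PMul (PTok k b) h)) (PMul (PMul (PTok k a) (PTok k b)) h)"
     using h k by (intro pol_sym[OF pol_mul_assoc] pol_terms.intros)
    also have "pol_eq A n ... (PMul (PTok k (a * b)) h)"
     using h k by (intro pol_cong_mul pol_tok_mult pol_refl)
    finally have "pol_eq A n (PMul (PTok k (a * b)) h) (PMul (PTok i a) g)"
     unfolding g(1) True by (rule pol_sym)
    moreover have "PMul (PTok k (a * b)) h \<in> polspan n ?G"
    proof (rule tok_mul_span[OF k(1) h])
     show "PMul (PTok k b) h \<in> polspan n ?G" if "b \<in> BB" for b
      using g that by (intro pol.span_base) blast
    qed
    ultimately show ?thesis using pol.span_eq by blast
   next
    case False
    have c: "pol_eq A n (PMul (PTok i a) (PTok k b)) (PSmul (koszul (par a * par b)) (PMul (PTok k b) (PTok i a)))"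
     using False k a g basis_par by (intro pol_tok_commute)
    have xh: "PMul (PTok i a) h \<in> tspan n ls ks" using Cons g False by auto
    show ?thesis unfolding g(1)
    proof (rule polspan_swap[OF c])
     show "PMul (PTok k b) (PMul (PTok i a) h) \<in> polspan n ?G"
      using xh g by (intro pol.span_base) auto
    qed (use h k in \<open>auto intro!: pol_terms.intros simp del: atLeastAtMost_iff\<close>)
   qed
  qed
 qed
 then show ?case by simp
qed simp

lemma dspan_one: "set ks \<subseteq> {1..n} ==> POne \<in> dspan n ks"
proof (induction ks)
 case (Cons k ks)
 then have "PMul (ppow (PX k) 0) POne \<in> dspan n (k # ks)"
  by (simp, intro pol.span_base) (auto intro: exI[of _ 0])
 moreover have "pol_eq A n (PMul (ppow (PX k) 0) POne) POne"
  by (simp, intro pol_one_mul pol_terms.intros)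
 ultimately show ?case unfolding dspan.simps by (rule pol.span_eq)
qed (simp add: pol.span_base)

lemma tspan_one: "set ks \<subseteq> {1..n} ==> set ls \<subseteq> {1..n} ==> POne \<in> tspan n ls ks"
proof (induction ks)
 case (Cons k ks)
 then have k: "k \<in> {1..n}" by simp
 have "PMul (PTok k 1) POne \<in> tspan n ls (k # ks)" unfolding tspan.simps
 proof (rule tok_mul_span[OF k])
  show "PMul (PTok k b) POne \<in> polspan n {PMul (PTok k b) g | b g. b \<in> BB \<and> g \<in> tspan n ls ks}"
   if "b \<in> BB" for b using Cons that by (intro pol.span_base) auto
 qed (rule pol_terms.intros)
 moreover have "pol_eq A n (PMul (PTok k 1) POne) POne"
 proof -
  have "pol_eq A n (PMul (PTok k 1) POne) (PTok k 1)" using k by (intro pol_mul_one pol_terms.intros)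
  also have "pol_eq A n ... POne" using k by (intro pol_tok_one)
  finally show ?thesis .
 qed
 ultimately show ?case unfolding tspan.simps by (rule pol.span_eq)
qed (simp add: dspan_one)

text \<open>The nested span contains the unit and is stable under left multiplication by every
  generator, hence by every term.\<close>

lemma pol_in_tspan:
 assumes "f \<in> pol_terms n"
 shows "f \<in> tspan n [1..<Suc n] [1..<Suc n]"
proof -
 let ?ks = "[1..<Suc n]"
 let ?W = "tspan n ?ks ?ks"
 have ks: "set ?ks \<subseteq> {1..n}" by auto
 have W: "?W = polspan n ?W"
 proof
  show "?W \<subseteq> polspan n ?W" using pol.span_base by blast
  have *: "polspan n (polspan n G) \<subseteq> polspan n G" for G using pol.span_sub by blast
  show "polspan n ?W \<subseteq> ?W"
  proof (cases ?ks)
   case Nil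
   show ?thesis unfolding Nil tspan.simps dspan.simps by (rule *)
  next
   case (Cons k ls)
   show ?thesis unfolding Cons tspan.simps by (rule *)
  qed
 qed
 have eqW: "h' \<in> ?W" if "h \<in> ?W" "pol_eq A n h h'" for h h'
  using that W pol.span_eq by blast
 have "g \<in> ?W ==> PMul f g \<in> ?W" for g
  using assms
 proof (induction f arbitrary: g rule: pol_terms.induct)
  case (1 i a)
  then show ?case using ks by (intro tok_tspan) auto
 next
  case (2 i)
  then show ?case using ks by (intro x_tspan) auto
 next
  case 3
  then have "g \<in> pol_terms n" using tspan_terms[OF ks ks] by auto
  from pol_sym[OF mul_zero(2)[OF this]] show ?case using pol.span_eq[OF pol.span_zero] W by blast
 next
  case 4
  then have "g \<in> pol_terms n" using tspan_terms[OF ks ks] by auto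
  from pol_sym[OF pol_one_mul[OF this]] show ?case using 4 eqW by blast
 next
  case (5 f f')
  then have g: "g \<in> pol_terms n" using tspan_terms[OF ks ks] by auto
  have "PMul f g \<in> ?W" "PMul f' g \<in> ?W" using 5 by blast+
  then have "PAdd (PMul f g) (PMul f' g) \<in> polspan n ?W" by (intro pol.span_ad pol.span_base)
  then show ?case using pol_sym[OF pol_add_mul[OF 5(1,2) g]] pol.span_eq W by blast
 next
  case (6 f f')
  then have g: "g \<in> pol_terms n" using tspan_terms[OF ks ks] by auto
  have "PMul f (PMul f' g) \<in> ?W" using 6 by blast
  then show ?case using pol_sym[OF pol_mul_assoc[OF 6(1,2) g]] eqW by blast
 next
  case (7 f c)
  then have g: "g \<in> pol_terms n" using tspan_terms[OF ks ks] by auto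
  have "PMul f g \<in> ?W" using 7 by blast
  then have "PSmul c (PMul f g) \<in> polspan n ?W" by (intro pol.span_sc pol.span_base)
  then show ?case using pol_sym[OF pol_smul_mul[OF 7(1) g]] pol.span_eq W by blast
 qed
 then have "PMul f POne \<in> ?W" using tspan_one[OF ks ks] by blast
 then show ?thesis using pol_mul_one[OF assms] eqW by blast
qed

definition fold_dots :: "nat list => (nat => nat) => ('k, 'a) pterm" where
 "fold_dots ks r = foldr PMul (map (\<lambda>k. ppow (PX k) (r k)) ks) POne"
definition fold_toks :: "nat list => (nat => 'a) => ('k, 'a) pterm" where
 "fold_toks ks b = foldr PMul (map (\<lambda>k. PTok k (b k)) ks) POne"

lemma fold_terms: "set ks \<subseteq> {1..n} ==> fold_dots ks r \<in> pol_terms n"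
 "set ks \<subseteq> {1..n} ==> fold_toks ks b \<in> pol_terms n"
 by (induction ks) (auto simp: fold_dots_def fold_toks_def intro!: pol_terms.intros ppow_terms)

text \<open>Flattening the nested spans. Exponents are kept as functions of the index, so that a
  further variable is a function update; distinctness of the list protects the earlier
  values.\<close>

lemma dspan_fold: "set ks \<subseteq> {1..n} ==> distinct ks ==> dspan n ks \<subseteq> polspan n (range (fold_dots ks))"
proof (induction ks)
 case Nil
 then show ?case by (auto simp: fold_dots_def)
next
 case (Cons k ks)
 have k: "PX k \<in> pol_terms n" using Cons by (intro pol_terms.intros) auto
 have R: "range (fold_dots ks) \<subseteq> pol_terms n" using fold_terms Cons by auto
 have "PMul (ppow (PX k) r) g \<in> polspan n (range (fold_dots (k # ks)))" if g: "g \<in> dspan n ks" for r g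
 proof (rule polspan_mul[OF _ R])
  show "g \<in> polspan n (range (fold_dots ks))" using Cons g by auto
  show "ppow (PX k) r \<in> pol_terms n" using k by (rule ppow_terms)
  fix h assume "h \<in> range (fold_dots ks)"
  then obtain s where s: "h = fold_dots ks s" by blast
  have m: "map (\<lambda>l. ppow (PX l) ((s(k := r)) l)) ks = map (\<lambda>l. ppow (PX l) (s l) :: ('k, 'a) pterm) ks"
   using Cons.prems by (intro map_cong) auto
  have "PMul (ppow (PX k) r) h = fold_dots (k # ks) (s(k := r))"
   by (simp only: s fold_dots_def list.map foldr.simps o_apply m fun_upd_same)
  then show "PMul (ppow (PX k) r) h \<in> polspan n (range (fold_dots (k # ks)))"
   using pol.span_base[OF rangeI[of "fold_dots (k # ks)" "s(k := r)"]] by (simp only:)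
 qed
 then have "{PMul (ppow (PX k) r) g | r g. g \<in> dspan n ks} \<subseteq> polspan n (range (fold_dots (k # ks)))" by blast
 then show ?case using pol.span_sub by auto
qed

lemma tspan_fold:
 "set ks \<subseteq> {1..n} ==> distinct ks ==> set ls \<subseteq> {1..n} ==> distinct ls ==>
  tspan n ls ks \<subseteq> polspan n {PMul (fold_toks ks b) (fold_dots ls r) | b r. \<forall>k\<in>set ks. b k \<in> BB}"
proof (induction ks)
 case Nil
 have R: "range (fold_dots ls) \<subseteq> pol_terms n" using fold_terms Nil by auto
 let ?G = "{PMul (fold_toks [] b) (fold_dots ls r) | b r. \<forall>k\<in>set []. b k \<in> BB}"
 have "fold_dots ls r \<in> polspan n ?G" for r
 proof -
  have "PMul POne (fold_dots ls r) \<in> polspan n ?G" by (intro pol.span_base) (auto simp: fold_toks_def)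
  then show ?thesis using pol_one_mul R pol.span_eq by blast
 qed
 then have "range (fold_dots ls) \<subseteq> polspan n ?G" by blast
 from pol.span_sub[OF subsetD[OF dspan_fold[OF Nil(3,4)]] this] show ?case
  unfolding tspan.simps by (rule subsetI)
next
 case (Cons k ks)
 have k: "k \<in> {1..n}" using Cons by auto
 let ?G = "{PMul (fold_toks ks b) (fold_dots ls r) | b r. \<forall>k\<in>set ks. b k \<in> BB}"
 let ?G' = "{PMul (fold_toks (k # ks) b) (fold_dots ls r) | b r. \<forall>k\<in>set (k # ks). b k \<in> BB}"
 have R: "?G \<subseteq> pol_terms n" using fold_terms Cons by (auto intro!: pol_terms.intros)
 have "PMul (PTok k b) g \<in> polspan n ?G'" if g: "g \<in> tspan n ls ks" and b: "b \<in> BB" for b g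
 proof (rule polspan_mul[OF _ R])
  show "g \<in> polspan n ?G" using Cons g by auto
  show T: "PTok k b \<in> pol_terms n" using k by (rule pol_terms.intros)
  fix h assume "h \<in> ?G"
  then obtain b' r where s: "h = PMul (fold_toks ks b') (fold_dots ls r)" "\<forall>k\<in>set ks. b' k \<in> BB" by blast
  have m: "map (\<lambda>l. PTok l ((b'(k := b)) l)) ks = map (\<lambda>l. PTok l (b' l) :: ('k, 'a) pterm) ks"
   using Cons.prems by (intro map_cong) auto
  have F: "PMul (PTok k b) (fold_toks ks b') = fold_toks (k # ks) (b'(k := b))"
   by (simp only: fold_toks_def list.map foldr.simps o_apply m fun_upd_same)
  have "pol_eq A n (PMul (PMul (PTok k b) (fold_toks ks b')) (fold_dots ls r)) (PMul (PTok k b) h)"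
   unfolding s using T Cons.prems by (intro pol_mul_assoc fold_terms) auto
  moreover have "PMul (PMul (PTok k b) (fold_toks ks b')) (fold_dots ls r) \<in> polspan n ?G'"
   unfolding F using s b by (intro pol.span_base) (auto intro!: exI[of _ "b'(k := b)"])
  ultimately show "PMul (PTok k b) h \<in> polspan n ?G'" using pol.span_eq by blast
 qed
 then have "{PMul (PTok k b) g | b g. b \<in> BB \<and> g \<in> tspan n ls ks} \<subseteq> polspan n ?G'" by blast
 then show ?case using pol.span_sub by auto
qed

abbreviation pmon :: "'a list => nat list => ('k, 'a) pterm" where "pmon \<equiv> pmono"

lemma pol_normal_form:
 assumes "f \<in> pol_terms n"
 shows "f \<in> polspan n ((\<lambda>(bs, \<alpha>). pmon bs \<alpha>) ` mono_indices n)"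
proof -
 let ?ks = "[1..<Suc n]"
 let ?H = "(\<lambda>(bs, \<alpha>). pmon bs \<alpha>) ` mono_indices n"
 have "PMul (fold_toks ?ks b) (fold_dots ?ks r) \<in> ?H" if b: "\<forall>k\<in>set ?ks. b k \<in> BB" for b r
 proof -
  let ?bs = "map b ?ks" and ?al = "map r ?ks"
  have m: "map (\<lambda>k. PTok k (?bs ! (k - 1))) ?ks = map (\<lambda>k. PTok k (b k) :: ('k, 'a) pterm) ?ks"
   "map (\<lambda>k. ppow (PX k) (?al ! (k - 1))) ?ks = map (\<lambda>k. ppow (PX k) (r k) :: ('k, 'a) pterm) ?ks"
   by (auto simp: nth_map simp del: upt_Suc)
  have len: "length ?bs = n" "length ?al = n" by auto
  have "PMul (fold_toks ?ks b) (fold_dots ?ks r) = pmon ?bs ?al"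
   unfolding pmono_def ptokens_def pdots_def fold_toks_def fold_dots_def len m ..
  moreover have "(?bs, ?al) \<in> mono_indices n" using b by (auto simp: mono_indices_def)
  ultimately show ?thesis by (metis (no_types, lifting) case_prod_conv image_iff)
 qed
 then have "{PMul (fold_toks ?ks b) (fold_dots ?ks r) | b r. \<forall>k\<in>set ?ks. b k \<in> BB} \<subseteq> polspan n ?H"
  using pol.span_base by blast
 moreover have "f \<in> polspan n {PMul (fold_toks ?ks b) (fold_dots ?ks r) | b r. \<forall>k\<in>set ?ks. b k \<in> BB}"
 proof -
  have ks: "set ?ks \<subseteq> {1..n}" "distinct ?ks" by auto
  show ?thesis using subsetD[OF tspan_fold[OF ks ks] pol_in_tspan[OF assms]] .
 qed
 ultimately show ?thesis using pol.span_sub by blast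
qed

lemma pmono_terms: "(bs, \<alpha>) \<in> mono_indices n ==> (pmon bs \<alpha> :: ('k, 'a) pterm) \<in> pol_terms n"
proof -
 assume *: "(bs, \<alpha>) \<in> mono_indices n"
 have ks: "set [1..<Suc n] \<subseteq> {1..n}" by auto
 show ?thesis
  using fold_terms(1)[OF ks, of "\<lambda>k. \<alpha> ! (k - 1)"] fold_terms(2)[OF ks, of "\<lambda>k. bs ! (k - 1)"] *
  by (auto simp: mono_indices_def pmono_def ptokens_def pdots_def fold_toks_def fold_dots_def
    simp del: upt_Suc intro!: pol_terms.intros)
qed

lemma pol_normal_form_list:
 assumes "f \<in> pol_terms n"
 obtains ms c where "distinct ms" "set ms \<subseteq> mono_indices n"
  "pol_eq A n f (psum (map (\<lambda>m. PSmul (c m) (pmon (fst m) (snd m))) ms))"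
proof -
 have sub: "(\<lambda>m. pmon (fst m) (snd m)) ` mono_indices n \<subseteq> pol_terms n"
  using pmono_terms by auto
 have "f \<in> polspan n ((\<lambda>m. pmon (fst m) (snd m)) ` mono_indices n)"
  using pol_normal_form[OF assms] by (simp add: split_def)
 from pol.span_expand[OF this sub] show ?thesis using that unfolding lsum_psum by blast
qed

text \<open>Monomials span by the normal form, and their values on \<open>vac n\<close> are
  independent. An element is therefore determined by what it does to this single vector.\<close>

lemma pol_faithful:
 assumes "f \<in> pol_terms n" "\<And>\<iota>. app (pint0 n f) (vac n) \<iota> = 0"
 shows "pol_eq A n f PZero"
proof -
 interpret R: polrep A n "E0 n" "tok0 n" "x0 n" by (rule polrep0)
 obtain ms c where ms: "distinct ms" "set ms \<subseteq> mono_indices n"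
  "pol_eq A n f (psum (map (\<lambda>m. PSmul (c m) (pmon (fst m) (snd m))) ms))"
  using pol_normal_form_list[OF assms(1)] .
 have "pint0 n f = (\<Sum>m\<in>set ms. sm (c m) (pint0 n (pmon (fst m) (snd m))))"
  using R.pint_cong[OF ms(3)] ms(1) by (simp add: pint_psum o_def sum_list_distinct_conv_sum_set)
 then have *: "app (\<Sum>(bs, \<alpha>)\<in>set ms. sm (c (bs, \<alpha>)) (pint0 n (pmon bs \<alpha>))) (vac n) \<iota> = 0" for \<iota>
  using assms(2)[of \<iota>] by (simp add: split_def)
 have c: "c m = 0" if "m \<in> set ms" for m
  using monomials_independent[OF finite_set ms(2), of "\<lambda>bs \<alpha>. c (bs, \<alpha>)" "fst m" "snd m"] * that by simp
 have "pol_eq A n (psum (map (\<lambda>m. PSmul (c m) (pmon (fst m) (snd m))) ms)) PZero"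
  using c ms(2)
 proof (induction ms)
  case Nil
  show ?case by (simp, intro pol_refl pol_terms.intros)
 next
  case (Cons m ms)
  let ?s = "psum (map (\<lambda>m. PSmul (c m) (pmon (fst m) (snd m))) ms)"
  have m: "pmon (fst m) (snd m) \<in> pol_terms n"
   using Cons.prems pmono_terms[of "fst m" "snd m" n] by auto
  have "pol_eq A n (PAdd (PSmul (c m) (pmon (fst m) (snd m))) ?s) (PAdd PZero PZero)"
   using Cons m pol.zero_sc[OF m] by (intro pol_cong_add) auto
  also have "pol_eq A n ... PZero" by (intro pol_add_zero pol_terms.intros)
  finally show ?case by simp
 qed
 then show ?thesis using ms(3) pol_trans by blast
qed

end

section \<open>The affine wreath product algebra on functions on the symmetric group\<close>

subsection \<open>Teleporters\<close>

context tokrep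
begin

definition tele :: "nat => nat => ('i, 'k) lop" where
 "tele i j = (\<Sum>b\<in>BB. sm (koszul (\<epsilon> * par b)) (t i b * t j (dl b)))"

lemma tok_zero: "i \<in> {1..n} ==> t i 0 = 0"
 using tok_smul[of i 0 0] by simp
lemma tok_sum: "i \<in> {1..n} ==> t i (sum f I) = (\<Sum>k\<in>I. t i (f k))"
 by (induction I rule: infinite_finite_induct) (auto simp: tok_zero tok_add simp del: atLeastAtMost_iff)
lemma tok_basis: "i \<in> {1..n} ==> t i a = (\<Sum>b\<in>BB. sm (tr (dl b * a)) (t i b))"
 by (subst basis_expand[of a]) (simp add: tok_sum tok_smul del: atLeastAtMost_iff)
lemma tok_dual: "i \<in> {1..n} ==> t i a = (\<Sum>b\<in>BB. sm (tr (a * b)) (t i (dl b)))"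
 by (subst dual_expand[of a]) (simp add: tok_sum tok_smul del: atLeastAtMost_iff)

lemma tele_e: "i \<in> {1..n} ==> j \<in> {1..n} ==> e * tele i j = tele i j \<and> tele i j * e = tele i j"
 by (simp add: tele_def sum_distrib_left sum_distrib_right e_tok mult.assoc tok_e del: atLeastAtMost_iff)
  (simp add: mult.assoc[symmetric] e_tok del: atLeastAtMost_iff)

text \<open>Expanding \<open>a * b\<close> in the basis on the first leg, or \<open>dl c * a\<close>
  in the dual basis on the second, leads to the same coefficients \<open>tr (dl c * a * b)\<close>.
  A nonzero coefficient fixes the parities and thereby the sign.\<close>

lemma tele_left:
 assumes ij: "i \<in> {1..n}" "j \<in> {1..n}" "i \<noteq> j" and a: "a \<in> homog A p"
 shows "t i a * tele i j = sm (koszul (\<epsilon> * p)) (tele i j * t j a)"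
proof -
 have *: "sm (koszul (\<epsilon> * par b)) (sm (tr (dl c * (a * b))) (t i c * t j (dl b)))
   = sm (koszul (\<epsilon> * p)) (sm (koszul (\<epsilon> * par c)) (sm (tr (dl c * a * b)) (t i c * t j (dl b))))"
  if "b \<in> BB" "c \<in> BB" for b c
 proof (cases "par c = p + par b")
  case True
  then show ?thesis by (simp add: distrib_left koszul_add mult.assoc mult.left_commute)
 next
  case False
  then have "tr (dl c * (a * b)) = 0"
   using coord_parity[OF that(2) homog_mult[OF a basis_par[OF that(1)]]] by auto
  then show ?thesis by (simp add: mult.assoc)
 qed
 have "t i a * tele i j = (\<Sum>b\<in>BB. sm (koszul (\<epsilon> * par b)) (t i (a * b) * t j (dl b)))"
  using ij by (simp add: tele_def sum_distrib_left mult.assoc[symmetric] tok_mult del: atLeastAtMost_iff)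
 also have "... = (\<Sum>b\<in>BB. \<Sum>c\<in>BB. sm (koszul (\<epsilon> * par b)) (sm (tr (dl c * (a * b))) (t i c * t j (dl b))))"
  by (subst tok_basis[OF ij(1)]) (simp add: sum_distrib_right sm_sum)
 also have "... = (\<Sum>b\<in>BB. \<Sum>c\<in>BB. sm (koszul (\<epsilon> * p)) (sm (koszul (\<epsilon> * par c)) (sm (tr (dl c * a * b)) (t i c * t j (dl b)))))"
  by (intro sum.cong refl *)
 also have "... = (\<Sum>c\<in>BB. sm (koszul (\<epsilon> * p)) (sm (koszul (\<epsilon> * par c)) (t i c * t j (dl c * a))))"
  by (subst sum.swap, subst (2) tok_dual[OF ij(2)]) (simp add: sum_distrib_left sm_sum)
 also have "... = sm (koszul (\<epsilon> * p)) (tele i j * t j a)"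
  using ij by (simp add: tele_def sm_sum sum_distrib_right mult.assoc tok_mult del: atLeastAtMost_iff)
 finally show ?thesis .
qed

text \<open>Coefficients are compared again, but now \<open>a\<close> has to be carried around the
  trace, and this is where the Nakayama automorphism enters.\<close>

lemma tele_right:
 assumes ij: "i \<in> {1..n}" "j \<in> {1..n}" "i \<noteq> j" and a: "a \<in> homog A p"
 shows "t j a * tele i j = sm (koszul (\<epsilon> * p)) (tele i j * t i (psi a))"
proof -
 have *: "sm (koszul (\<epsilon> * par b) * koszul (p * par b)) (sm (tr (a * dl b * c)) (t i b * t j (dl c)))
   = sm (koszul (\<epsilon> * p)) (sm (koszul (\<epsilon> * par c) * koszul (p * (\<epsilon> + par c))) (sm (tr (dl b * (c * psi a))) (t i b * t j (dl c))))"
  if "b \<in> BB" "c \<in> BB" for b c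
 proof -
  have "tr (a * (dl b * c)) = koszul (p * (\<epsilon> + par b + par c)) * tr (dl b * c * psi a)"
   using that by (intro nak_trace a homog_mult dual_homog basis_par)
  moreover have "tr (dl b * (c * psi a)) = 0" if "par b \<noteq> par c + p"
   using coord_parity[OF \<open>b \<in> BB\<close> homog_mult[OF basis_par nak_homog[OF a]], of c] that \<open>c \<in> BB\<close> by auto
  ultimately show ?thesis
   by (cases "par b = par c + p"; cases p; cases \<epsilon>; cases "par c") (auto simp: mult.assoc)
 qed
 have "t j a * tele i j = (\<Sum>b\<in>BB. sm (koszul (\<epsilon> * par b)) (t j a * (t i b * t j (dl b))))"
  by (simp add: tele_def sum_distrib_left)
 also have "... = (\<Sum>b\<in>BB. sm (koszul (\<epsilon> * par b) * koszul (p * par b)) (t i b * t j (a * dl b)))"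
 proof (intro sum.cong refl)
  fix b assume "b \<in> BB"
  then have "t j a * t i b = sm (koszul (p * par b)) (t i b * t j a)"
   using ij a basis_par by (intro tok_commute) auto
  then have "t j a * (t i b * t j (dl b)) = sm (koszul (p * par b)) (t i b * (t j a * t j (dl b)))"
   by (simp add: mult.assoc[symmetric])
  then show "sm (koszul (\<epsilon> * par b)) (t j a * (t i b * t j (dl b))) = sm (koszul (\<epsilon> * par b) * koszul (p * par b)) (t i b * t j (a * dl b))"
   using ij by (simp add: tok_mult del: atLeastAtMost_iff)
 qed
 also have "... = (\<Sum>b\<in>BB. \<Sum>c\<in>BB. sm (koszul (\<epsilon> * par b) * koszul (p * par b)) (sm (tr (a * dl b * c)) (t i b * t j (dl c))))"
  by (subst tok_dual[OF ij(2)]) (simp add: sum_distrib_left sm_sum)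
 also have "... = (\<Sum>b\<in>BB. \<Sum>c\<in>BB. sm (koszul (\<epsilon> * p)) (sm (koszul (\<epsilon> * par c) * koszul (p * (\<epsilon> + par c))) (sm (tr (dl b * (c * psi a))) (t i b * t j (dl c)))))"
  by (intro sum.cong refl *)
 also have "... = (\<Sum>c\<in>BB. sm (koszul (\<epsilon> * p)) (sm (koszul (\<epsilon> * par c) * koszul (p * (\<epsilon> + par c))) (t i (c * psi a) * t j (dl c))))"
  by (subst sum.swap, subst (2) tok_basis[OF ij(1)]) (simp add: sum_distrib_right sm_sum)
 also have "... = sm (koszul (\<epsilon> * p)) (tele i j * t i (psi a))"
  unfolding tele_def sm_sum sum_distrib_right
 proof (intro sum.cong refl arg_cong[of _ _ "sm _"])
  fix c assume c: "c \<in> BB"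
  have "t j (dl c) * t i (psi a) = sm (koszul ((\<epsilon> + par c) * p)) (t i (psi a) * t j (dl c))"
   using ij c a nak_homog dual_homog by (intro tok_commute) auto
  then have "(t i c * t j (dl c)) * t i (psi a) = sm (koszul ((\<epsilon> + par c) * p)) ((t i c * t i (psi a)) * t j (dl c))"
   by (simp add: mult.assoc)
  then show "sm (koszul (\<epsilon> * par c) * koszul (p * (\<epsilon> + par c))) (t i (c * psi a) * t j (dl c)) =
    sm (koszul (\<epsilon> * par c)) (t i c * t j (dl c)) * t i (psi a)"
   using ij by (simp add: tok_mult mult.commute[of p] del: atLeastAtMost_iff)
 qed
 finally show ?thesis .
qed

text \<open>The roles of basis and dual basis are exchanged: \<open>b\<close> is expanded in the
  dual basis, and the coefficients recombine to \<open>ipsi c\<close>, because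
  \<open>tr (ipsi c * b)\<close> and \<open>tr (b * c)\<close> agree up to sign.\<close>

lemma tele_flip:
 assumes ij: "i \<in> {1..n}" "j \<in> {1..n}" "i \<noteq> j"
 shows "(\<Sum>b\<in>BB. sm (koszul (\<epsilon> * par b)) (t i b * t j (psi (dl b)))) = sm (koszul \<epsilon>) (tele j i)"
proof -
 have dual_psi: "ipsi c = (\<Sum>b\<in>BB. sm' b)" if c: "c \<in> BB" "sm' = (\<lambda>b. smul A (koszul (par b * par c) * tr (b * c)) (dl b))" for c sm'
 proof -
  have "tr (b * c) = koszul (par b * par c) * tr (ipsi c * b)" if b: "b \<in> BB" for b
  proof -
   have "tr (ipsi c * b) = koszul (par c * par b) * tr (b * psi (ipsi c))"
    using b c by (intro nak_trace ipsi_homog basis_par)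
   then show ?thesis by (cases "par b"; cases "par c") auto
  qed
  then have "(\<Sum>b\<in>BB. sm' b) = (\<Sum>b\<in>BB. smul A (tr (ipsi c * b)) (dl b))"
   unfolding c(2) by (intro sum.cong refl) simp
  then show ?thesis using dual_expand[of "ipsi c"] by simp
 qed
 have *: "sm (koszul (\<epsilon> * par b)) (sm (tr (b * c)) (t i (dl c) * t j (psi (dl b))))
   = sm (koszul \<epsilon>) (sm (koszul (\<epsilon> * par c) * koszul (par c * (\<epsilon> + par c))) (sm (koszul (par b * par c) * tr (b * c)) (t i (dl c) * t j (psi (dl b)))))"
  if "b \<in> BB" "c \<in> BB" for b c
 proof -
  have "tr (b * c) = 0" if "par b + par c \<noteq> \<epsilon>"
   using trace_parity[OF homog_mult[OF basis_par basis_par]] \<open>b \<in> BB\<close> \<open>c \<in> BB\<close> that by blast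
  then show ?thesis by (cases "par b"; cases \<epsilon>; cases "par c") auto
 qed
 have "(\<Sum>b\<in>BB. sm (koszul (\<epsilon> * par b)) (t i b * t j (psi (dl b))))
  = (\<Sum>b\<in>BB. \<Sum>c\<in>BB. sm (koszul (\<epsilon> * par b)) (sm (tr (b * c)) (t i (dl c) * t j (psi (dl b)))))"
  by (subst tok_dual[OF ij(1)]) (simp add: sum_distrib_right sm_sum)
 also have "... = (\<Sum>b\<in>BB. \<Sum>c\<in>BB. sm (koszul \<epsilon>) (sm (koszul (\<epsilon> * par c) * koszul (par c * (\<epsilon> + par c))) (sm (koszul (par b * par c) * tr (b * c)) (t i (dl c) * t j (psi (dl b))))))"
  by (intro sum.cong refl *)
 also have "... = (\<Sum>c\<in>BB. sm (koszul \<epsilon>) (sm (koszul (\<epsilon> * par c) * koszul (par c * (\<epsilon> + par c)))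
   (t i (dl c) * t j (psi (\<Sum>b\<in>BB. smul A (koszul (par b * par c) * tr (b * c)) (dl b))))))"
  using ij by (subst sum.swap) (simp add: nak_sum nak_smul tok_sum tok_smul sum_distrib_left sm_sum mult.assoc del: atLeastAtMost_iff)
 also have "... = (\<Sum>c\<in>BB. sm (koszul \<epsilon>) (sm (koszul (\<epsilon> * par c)) (t j c * t i (dl c))))"
 proof (intro sum.cong refl arg_cong[of _ _ "sm _"])
  fix c assume c: "c \<in> BB"
  have "t j c * t i (dl c) = sm (koszul (par c * (\<epsilon> + par c))) (t i (dl c) * t j c)"
   using ij c basis_par dual_homog by (intro tok_commute) auto
  then show "sm (koszul (\<epsilon> * par c) * koszul (par c * (\<epsilon> + par c)))
   (t i (dl c) * t j (psi (\<Sum>b\<in>BB. smul A (koszul (par b * par c) * tr (b * c)) (dl b))))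
   = sm (koszul (\<epsilon> * par c)) (t j c * t i (dl c))"
   unfolding dual_psi[OF c refl, symmetric] by simp
 qed
 finally show ?thesis by (simp add: tele_def sm_sum)
qed

text \<open>The two tokens of a summand have parities \<open>par b\<close> and
  \<open>\<epsilon> + par b\<close>, so their signs combine to one that depends on
  \<open>\<epsilon>\<close> only.\<close>

lemma tele_pass:
 assumes ij: "i \<in> {1..n}" "j \<in> {1..n}"
  and "\<And>a p. a \<in> homog A p ==> t i a * z = sm (koszul (q * p)) (z * t i a)"
  and "\<And>a p. a \<in> homog A p ==> t j a * z = sm (koszul (q * p)) (z * t j a)"
 shows "tele i j * z = sm (koszul (q * \<epsilon>)) (z * tele i j)"
 unfolding tele_def sum_distrib_left sum_distrib_right sm_sum
proof (intro sum.cong refl)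
 fix b assume b: "b \<in> BB"
 have "t i b * t j (dl b) * z = sm (koszul (q * (\<epsilon> + par b)) * koszul (q * par b)) (z * (t i b * t j (dl b)))"
  using assms(3)[OF basis_par[OF b]] assms(4)[OF dual_homog[OF b]] by (simp add: mult.assoc sm_comm_left)
 also have "koszul (q * (\<epsilon> + par b)) * koszul (q * par b) = (koszul (q * \<epsilon>) :: 'k)"
  by (simp add: distrib_left koszul_add mult.assoc)
 finally show "sm (koszul (\<epsilon> * par b)) (t i b * t j (dl b)) * z =
   sm (koszul (q * \<epsilon>)) (z * sm (koszul (\<epsilon> * par b)) (t i b * t j (dl b)))"
  by (simp add: mult.commute)
qed

text \<open>A dot on the strand \<open>j\<close> twists only the second leg by \<open>psi\<close>,
  and \<open>tele_flip\<close> turns the twisted teleporter into the opposite one. The two signs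
  cancel.\<close>

lemma tele_x:
 assumes ij: "i \<in> {1..n}" "j \<in> {1..n}" "i \<noteq> j"
  and zj: "\<And>a p. a \<in> homog A p ==> t j a * z = sm (koszul (\<epsilon> * p)) (z * t j (psi a))"
  and zi: "\<And>a p. a \<in> homog A p ==> t i a * z = sm (koszul (\<epsilon> * p)) (z * t i a)"
 shows "tele i j * z = z * tele j i"
proof -
 have "tele i j * z = (\<Sum>b\<in>BB. sm (koszul (\<epsilon> * par b)) (t i b * t j (dl b) * z))"
  by (simp add: tele_def sum_distrib_right)
 also have "... = (\<Sum>b\<in>BB. sm (koszul \<epsilon>) (z * sm (koszul (\<epsilon> * par b)) (t i b * t j (psi (dl b)))))"
 proof (intro sum.cong refl)
  fix b assume b: "b \<in> BB"
  have "t j (dl b) * z = sm (koszul (\<epsilon> * (\<epsilon> + par b))) (z * t j (psi (dl b)))"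
   using zj[OF dual_homog[OF b]] .
  moreover have "t i b * z = sm (koszul (\<epsilon> * par b)) (z * t i b)"
   using zi[OF basis_par[OF b]] .
  ultimately have "t i b * t j (dl b) * z
   = sm (koszul (\<epsilon> * (\<epsilon> + par b)) * koszul (\<epsilon> * par b)) (z * (t i b * t j (psi (dl b))))"
   by (simp add: mult.assoc sm_comm_left)
  also have "koszul (\<epsilon> * (\<epsilon> + par b)) * koszul (\<epsilon> * par b) = (koszul \<epsilon> :: 'k)"
   by (simp add: distrib_left koszul_add mult.assoc)
  finally show "sm (koszul (\<epsilon> * par b)) (t i b * t j (dl b) * z) =
    sm (koszul \<epsilon>) (z * sm (koszul (\<epsilon> * par b)) (t i b * t j (psi (dl b))))"
   by (simp add: mult.commute)
 qed
 also have "... = sm (koszul \<epsilon>) (z * (\<Sum>b\<in>BB. sm (koszul (\<epsilon> * par b)) (t i b * t j (psi (dl b)))))"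
  by (simp only: sum_distrib_left sm_sum)
 also have "... = z * tele j i" by (simp only: tele_flip[OF ij]) simp
 finally show ?thesis .
qed

end

subsection \<open>Adjacent transpositions\<close>

text \<open>If \<open>b = Suc c\<close> with \<open>a < c\<close>, the transposition of
  \<open>a\<close> and \<open>b\<close> is the one of \<open>a\<close> and \<open>c\<close>
  conjugated by an adjacent one; so adjacent transpositions reach everything. This will spread an
  identity from \<open>id\<close> to all permutations.\<close>

lemma permutes_adjacent_induct [consumes 1, case_names id adjacent]:
 assumes "u permutes {1..d}" and id: "P id"
  and step: "\<And>u k. u permutes {1..d} ==> k \<in> {1..<d} ==> P u ==> P (u \<circ> transpose k (Suc k))"
 shows "P u"
proof -
 have adj: "P (u \<circ> transpose a b)" if "a \<in> {1..d}" "b \<in> {1..d}" "a < b" "u permutes {1..d}" "P u" for a b u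
  using that
 proof (induction "b - a" arbitrary: b u)
  case (Suc n)
  show ?case
  proof (cases "b = Suc a")
   case True
   then show ?thesis using Suc.prems step by auto
  next
   case False
   then obtain c where c: "b = Suc c" "a < c" using Suc.prems by (cases b) auto
   have s: "transpose c (Suc c) permutes {1..d}" "transpose a c permutes {1..d}"
    using Suc.prems c by (auto intro: permutes_swap_id)
   have "P (u \<circ> transpose c (Suc c))" using Suc.prems c by (intro step) auto
   then have "P (u \<circ> transpose c (Suc c) \<circ> transpose a c)"
    using Suc.prems Suc.hyps(2) c s by (intro Suc.hyps(1)) (auto intro: permutes_compose)
   then have "P (u \<circ> transpose c (Suc c) \<circ> transpose a c \<circ> transpose c (Suc c))"
    using Suc.prems c s by (intro step) (auto intro: permutes_compose)
   moreover have "transpose c (Suc c) \<circ> transpose a c \<circ> transpose c (Suc c) = transpose a b"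
    using c by (auto simp: fun_eq_iff transpose_def)
   ultimately show ?thesis by (simp add: comp_assoc)
  qed
 qed simp
 have "finite {1..d}" by simp
 then show ?thesis using assms(1)
 proof (induction rule: permutes_rev_induct)
  case id
  then show ?case by (rule assms(2))
 next
  case (swap a b p)
  then show ?case
   using adj[of a b p] adj[of b a p] by (metis nat_neq_iff transpose_commute)
 qed
qed

subsection \<open>Crossed products with the symmetric group\<close>

text \<open>Multiplication by an operator-valued function of the permutation. The index type
  contains all maps on the naturals, so the projection to permutations is built in here, whereas
  \<open>Sh\<close> is plain right translation.\<close>

lift_definition Dg :: "nat => ((nat => nat) => ('j, 'k::comm_ring_1) lop) => ((nat => nat) \<times> 'j, 'k) lop" is
 "\<lambda>d h \<phi> (u, \<iota>). if u permutes {1..d} then h u (\<lambda>\<iota>'. \<phi> (u, \<iota>')) \<iota> else 0"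
 by (auto simp: fun_eq_iff)

lift_definition Sh :: "(nat => nat) => ((nat => nat) \<times> 'j, 'k::comm_ring_1) lop" is
 "\<lambda>\<tau> \<phi> (u, \<iota>). \<phi> (u \<circ> \<tau>, \<iota>)"
 by (auto simp: fun_eq_iff)

lemma Dg_cong: "(\<And>u. u permutes {1..d} ==> h u = h' u) ==> Dg d h = Dg d h'"
 by (rule lop_eqI) (auto simp: Dg.rep_eq)
lemma Dg_mult: "Dg d h * Dg d h' = Dg d (\<lambda>u. h u * h' u)"
 by (rule lop_eqI) (auto simp: Dg.rep_eq)
lemma Dg_add: "Dg d (\<lambda>u. h u + h' u) = Dg d h + Dg d h'"
 by (rule lop_eqI) (auto simp: Dg.rep_eq)
lemma Dg_sm: "Dg d (\<lambda>u. sm c (h u)) = sm c (Dg d h)"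
 by (rule lop_eqI) (auto simp: Dg.rep_eq)
lemma Dg_zero: "Dg d (\<lambda>u. 0) = 0"
 by (rule lop_eqI) (auto simp: Dg.rep_eq)
lemma Dg_sum: "Dg d (\<lambda>u. \<Sum>i\<in>I. h i u) = (\<Sum>i\<in>I. Dg d (h i))"
 by (induction I rule: infinite_finite_induct) (auto simp: Dg_zero Dg_add)
lemma Sh_Sh: "Sh \<tau> * Sh \<tau>' = Sh (\<tau> \<circ> \<tau>')"
 by (rule lop_eqI) (auto simp: Sh.rep_eq comp_assoc)
lemma Sh_id: "Sh id = 1"
 by (rule lop_eqI) (auto simp: Sh.rep_eq)
lemma Sh_Dg:
 assumes "\<tau> permutes {1..d}"
 shows "Sh \<tau> * Dg d h = Dg d (\<lambda>u. h (u \<circ> \<tau>)) * Sh \<tau>"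
proof (rule lop_eqI)
 fix v i
 have "u \<circ> \<tau> permutes {1..d} \<longleftrightarrow> u permutes {1..d}" for u
 proof
  assume "u \<circ> \<tau> permutes {1..d}"
  then have "u \<circ> \<tau> \<circ> inv_into UNIV \<tau> permutes {1..d}"
   using permutes_compose[OF permutes_inv[OF assms]] by blast
  then show "u permutes {1..d}" using permutes_inv_o(1)[OF assms] by (simp add: comp_assoc)
 qed (use assms permutes_compose in blast)
 then show "app (Sh \<tau> * Dg d h) v i = app (Dg d (\<lambda>u. h (u \<circ> \<tau>)) * Sh \<tau>) v i"
  by (cases i) (simp add: Sh.rep_eq Dg.rep_eq)
qed

lemma app_Dg_Sh: "u permutes {1..d} ==> app (Dg d h * Sh \<tau>) \<phi> (u, \<iota>) = app (h u) (\<lambda>\<iota>'. \<phi> (u \<circ> \<tau>, \<iota>')) \<iota>"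
 by (simp add: Dg.rep_eq Sh.rep_eq)

subsection \<open>The affine wreath product algebra\<close>

text \<open>
 \<open>W = Pol\<^sub>d(A) \<otimes> \<k>[S\<^sub>d]\<close> is realized on functions on \<open>S\<^sub>d\<close>. The dots act as Dunkl operators:
 moving \<open>x\<^sub>j\<close> across the permutation \<open>u\<close> produces a teleporter and a transposition for each
 inversion of \<open>u\<close> that involves \<open>j\<close>.
\<close>

context frobenius_superalgebra
begin

abbreviation "tele0 d \<equiv> tokrep.tele A (tok0 d)"
abbreviation st :: "nat => nat => nat" where "st k \<equiv> transpose k (Suc k)"

definition ev :: "nat => ((nat => nat) \<times> (nat => 'a \<times> nat), 'k) lop" where
 "ev d = Dg d (\<lambda>_. E0 d)"
definition tokv where "tokv d j a = Dg d (\<lambda>u. tok0 d (u j) a)"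
text \<open>The sign is the one of the teleporter when a crossing moves past a dot: negative if
  \<open>j\<close> is the left strand of the inverted pair, positive if it is the right one.\<close>

definition eta :: "nat => nat => (nat => nat) => 'k" where
 "eta l j u = (if l < j \<and> u j < u l then 1 else if j < l \<and> u l < u j then - 1 else 0)"
definition xterm where
 "xterm d j l = Dg d (\<lambda>u. sm (eta l j u) (tele0 d (u l) (u j))) * Sh (transpose l j)"
definition xv where "xv d j = Dg d (\<lambda>u. x0 d (u j)) + (\<Sum>l\<in>{1..d} - {j}. xterm d j l)"
text \<open>Crossings act purely by translation; the teleporters of the dot relation all sit in
  \<open>xv\<close>.\<close>

definition Tv where "Tv d k = Sh (st k) * ev d"

context
 fixes d :: nat
begin

interpretation R0: polrep A d "E0 d" "tok0 d" "x0 d" by (rule polrep0)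

lemma perm_in: "u permutes {1..d} ==> j \<in> {1..d} ==> u j \<in> {1..d}"
 by (simp only: permutes_in_image)

lemma tokrepv: "tokrep A d (ev d) (tokv d)"
proof unfold_locales
 fix i j p q c and a b :: 'a
 show "ev d * ev d = ev d" by (simp add: ev_def Dg_mult R0.e_idem)
 {
  assume i: "i \<in> {1..d}"
  note u = perm_in[OF _ i]
  show "ev d * tokv d i a = tokv d i a" "tokv d i a * ev d = tokv d i a" "tokv d i 1 = ev d"
   unfolding ev_def tokv_def Dg_mult
   by (rule Dg_cong; simp add: R0.e_tok R0.tok_e R0.tok_one u del: atLeastAtMost_iff)+
  show "tokv d i (smul A c a) = sm c (tokv d i a)" unfolding tokv_def Dg_sm[symmetric]
   by (rule Dg_cong) (simp add: R0.tok_smul u del: atLeastAtMost_iff)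
  show "tokv d i (a + b) = tokv d i a + tokv d i b" unfolding tokv_def Dg_add[symmetric]
   by (rule Dg_cong) (simp add: R0.tok_add u del: atLeastAtMost_iff)
  show "tokv d i a * tokv d i b = tokv d i (a * b)" unfolding tokv_def Dg_mult
   by (rule Dg_cong) (simp add: R0.tok_mult u del: atLeastAtMost_iff)
  assume j: "j \<in> {1..d}" "i \<noteq> j" "a \<in> homog A p" "b \<in> homog A q"
  have "tok0 d (u i) a * tok0 d (u j) b = sm (koszul (p * q)) (tok0 d (u j) b * tok0 d (u i) a)"
   if u: "u permutes {1..d}" for u
  proof -
   have "u i \<noteq> u j" using permutes_inj[OF u] j(2) by (auto dest: injD)
   then show ?thesis by (rule R0.tok_commute[OF perm_in[OF u i] perm_in[OF u j(1)] _ j(3,4)])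
  qed
  then have "Dg d (\<lambda>u. tok0 d (u i) a * tok0 d (u j) b) = Dg d (\<lambda>u. sm (koszul (p * q)) (tok0 d (u j) b * tok0 d (u i) a))"
   by (rule Dg_cong)
  then show "tokv d i a * tokv d j b = sm (koszul (p * q)) (tokv d j b * tokv d i a)"
   by (simp only: tokv_def Dg_mult Dg_sm)
 }
qed

interpretation V: tokrep A d "ev d" "tokv d" by (rule tokrepv)

abbreviation "telev \<equiv> V.tele"

lemma telev_Dg: "telev i j = Dg d (\<lambda>u. tele0 d (u i) (u j))"
 unfolding V.tele_def R0.tele_def Dg_sum Dg_sm tokv_def Dg_mult ..

lemma st_permutes: "k \<in> {1..<d} ==> st k permutes {1..d}"
 by (intro permutes_swap_id) auto

lemma transpose_permutes: "l \<in> {1..d} ==> j \<in> {1..d} ==> transpose l j permutes {1..d}"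
 by (intro permutes_swap_id)

lemma ev_Sh: "\<tau> permutes {1..d} ==> ev d * Sh \<tau> = Sh \<tau> * ev d"
 by (simp add: ev_def Sh_Dg)

lemma xv_ev:
 assumes "j \<in> {1..d}"
 shows "ev d * xv d j = xv d j" "xv d j * ev d = xv d j"
proof -
 have 1: "ev d * Dg d (\<lambda>u. x0 d (u j)) = Dg d (\<lambda>u. x0 d (u j))" "Dg d (\<lambda>u. x0 d (u j)) * ev d = Dg d (\<lambda>u. x0 d (u j))"
  unfolding ev_def Dg_mult using assms
  by (auto intro!: Dg_cong simp: R0.e_x R0.x_e perm_in simp del: atLeastAtMost_iff)
 have 2: "ev d * xterm d j l = xterm d j l" "xterm d j l * ev d = xterm d j l" if l: "l \<in> {1..d} - {j}" for l
 proof -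
  have l': "l \<in> {1..d}" using l by blast
  let ?D = "Dg d (\<lambda>u. sm (eta l j u) (tele0 d (u l) (u j)))"
  have D: "ev d * ?D = ?D" "?D * ev d = ?D"
   unfolding ev_def Dg_mult using assms l'
   by (auto intro!: Dg_cong simp: R0.tele_e perm_in simp del: atLeastAtMost_iff)
  show "ev d * xterm d j l = xterm d j l"
   by (simp only: xterm_def mult.assoc[symmetric] D)
  have "xterm d j l * ev d = (?D * ev d) * Sh (transpose l j)"
   by (simp only: xterm_def mult.assoc ev_Sh[OF transpose_permutes[OF l' assms]])
  then show "xterm d j l * ev d = xterm d j l" by (simp only: D xterm_def)
 qed
 have "(\<Sum>l\<in>{1..d} - {j}. ev d * xterm d j l) = (\<Sum>l\<in>{1..d} - {j}. xterm d j l)"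
  "(\<Sum>l\<in>{1..d} - {j}. xterm d j l * ev d) = (\<Sum>l\<in>{1..d} - {j}. xterm d j l)"
  using 2 by (auto intro!: sum.cong)
 then show "ev d * xv d j = xv d j" "xv d j * ev d = xv d j"
  unfolding xv_def by (simp_all only: distrib_left distrib_right sum_distrib_left sum_distrib_right 1)
qed

lemma Tv_ev: "k \<in> {1..<d} ==> ev d * Tv d k = Tv d k" "Tv d k * ev d = Tv d k"
 by (simp_all add: Tv_def mult.assoc V.e_idem) (simp add: mult.assoc[symmetric] ev_Sh st_permutes, simp add: mult.assoc V.e_idem)

lemma st_st: "st k \<circ> st k = id" "st k a = st k b \<longleftrightarrow> a = b"
 by (simp, metis transpose_involutory)

lemma Tv_Tv: "k \<in> {1..<d} ==> Tv d k * Tv d k = ev d"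
proof -
 assume k: "k \<in> {1..<d}"
 have "Tv d k * Tv d k = Sh (st k) * (ev d * Sh (st k)) * ev d" by (simp only: Tv_def mult.assoc)
 also have "... = (Sh (st k) * Sh (st k)) * (ev d * ev d)"
  by (simp only: ev_Sh[OF st_permutes[OF k]] mult.assoc)
 finally show ?thesis by (simp only: V.e_idem Sh_Sh st_st Sh_id mult_1_left)
qed

lemma Tv_Sh: "k \<in> {1..<d} ==> \<tau> permutes {1..d} ==> Tv d k * (Sh \<tau> * ev d) = Sh (st k \<circ> \<tau>) * ev d"
 by (simp add: Tv_def mult.assoc Sh_Sh[symmetric]) (simp add: ev_Sh mult.assoc[symmetric] V.e_idem, simp add: mult.assoc V.e_idem)

lemma Tv_Tv': "k \<in> {1..<d} ==> l \<in> {1..<d} ==> Tv d k * Tv d l = Sh (st k \<circ> st l) * ev d"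
 unfolding Tv_def[of d l] by (rule Tv_Sh[OF _ st_permutes])

lemma Tv_far: "k \<in> {1..<d} ==> l \<in> {1..<d} ==> Suc k < l ==> Tv d k * Tv d l = Tv d l * Tv d k"
proof -
 assume *: "k \<in> {1..<d}" "l \<in> {1..<d}" "Suc k < l"
 then have "st k \<circ> st l = st l \<circ> st k" by (auto simp: fun_eq_iff transpose_def)
 then show ?thesis using * by (simp add: Tv_Tv')
qed

lemma Tv_braid: "k \<in> {1..<d} ==> Suc k \<in> {1..<d} ==>
 Tv d k * Tv d (Suc k) * Tv d k = Tv d (Suc k) * Tv d k * Tv d (Suc k)"
proof -
 assume *: "k \<in> {1..<d}" "Suc k \<in> {1..<d}"
 then have "st k \<circ> (st (Suc k) \<circ> st k) = st (Suc k) \<circ> (st k \<circ> st (Suc k))"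
  by (auto simp: fun_eq_iff transpose_def)
 moreover have "st k \<circ> st (Suc k) permutes {1..d}" "st (Suc k) \<circ> st k permutes {1..d}"
  using * st_permutes permutes_compose by blast+
 ultimately show ?thesis
  by (simp only: mult.assoc) (simp only: Tv_Tv'[OF *] Tv_Tv'[OF *(2,1)] Tv_Sh[OF *(1)] Tv_Sh[OF *(2)])
qed

lemma Tv_tok: "k \<in> {1..<d} ==> j \<in> {1..d} ==> Tv d k * tokv d j a = tokv d (st k j) a * Tv d k"
proof -
 assume *: "k \<in> {1..<d}" "j \<in> {1..d}"
 then have s: "st k j \<in> {1..d}" by (auto simp: transpose_def)
 have "Tv d k * tokv d j a = Sh (st k) * tokv d j a" using * by (simp add: Tv_def mult.assoc V.e_tok del: atLeastAtMost_iff)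
 also have "... = tokv d (st k j) a * Sh (st k)" using * by (simp add: tokv_def Sh_Dg st_permutes)
 also have "... = tokv d (st k j) a * ev d * Sh (st k)" using s by (simp add: V.tok_e del: atLeastAtMost_iff)
 also have "... = tokv d (st k j) a * Tv d k" using * by (simp add: Tv_def ev_Sh st_permutes mult.assoc)
 finally show ?thesis .
qed

text \<open>In the Dunkl term for \<open>l\<close>, a token on the strand \<open>i\<close>, on
  \<open>l\<close> or elsewhere passes the teleporter by \<open>tele_right\<close>,
  \<open>tele_left\<close> or \<open>tele_pass\<close>. In the first two cases it changes its
  strand, and the translation by the transposition brings it back.\<close>

lemma tok_xv:
 assumes i: "i \<in> {1..d}" and j: "j \<in> {1..d}" and a: "a \<in> homog A p"
 shows "tokv d j a * xv d i = sm (koszul (\<epsilon> * p)) (xv d i * tokv d j (if j = i then psi a else a))"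
proof -
 let ?a = "if j = i then psi a else a"
 have 1: "tokv d j a * Dg d (\<lambda>u. x0 d (u i)) = sm (koszul (\<epsilon> * p)) (Dg d (\<lambda>u. x0 d (u i)) * tokv d j ?a)"
 proof -
  have "tok0 d (u j) a * x0 d (u i) = sm (koszul (\<epsilon> * p)) (x0 d (u i) * tok0 d (u j) ?a)"
   if u: "u permutes {1..d}" for u
  proof -
   have "(u j = u i) = (j = i)" using permutes_inj[OF u] by (auto dest: injD)
   then show ?thesis using R0.tok_x[OF perm_in[OF u i] perm_in[OF u j] a] by (simp only:)
  qed
  then have "Dg d (\<lambda>u. tok0 d (u j) a * x0 d (u i)) = Dg d (\<lambda>u. sm (koszul (\<epsilon> * p)) (x0 d (u i) * tok0 d (u j) ?a))"
   by (rule Dg_cong)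
  then show ?thesis by (simp only: tokv_def Dg_mult Dg_sm)
 qed
 have 2: "tokv d j a * xterm d i l = sm (koszul (\<epsilon> * p)) (xterm d i l * tokv d j ?a)"
  if l: "l \<in> {1..d} - {i}" for l
 proof -
  have l': "l \<in> {1..d}" "l \<noteq> i" using l by auto
  have "tok0 d (u j) a * tele0 d (u l) (u i) = sm (koszul (\<epsilon> * p)) (tele0 d (u l) (u i) * tok0 d (u (transpose l i j)) ?a)"
   if u: "u permutes {1..d}" for u
  proof -
   have inj: "u x = u y \<longleftrightarrow> x = y" for x y using permutes_inj[OF u] by (auto dest: injD)
   note r = perm_in[OF u l'(1)] perm_in[OF u i]
   consider "j = i" | "j = l" | "j \<noteq> i" "j \<noteq> l" by blast
   then show ?thesis
   proof cases
    case 1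
    then show ?thesis using R0.tele_right[OF r _ a] inj l' by (simp add: transpose_def)
   next
    case 2
    then show ?thesis using R0.tele_left[OF r _ a] inj l' by (simp add: transpose_def)
   next
    case 3
    have ne: "u l \<noteq> u j" "u i \<noteq> u j" using 3 inj by auto
    have "tele0 d (u l) (u i) * tok0 d (u j) a = sm (koszul (p * \<epsilon>)) (tok0 d (u j) a * tele0 d (u l) (u i))"
    proof (rule R0.tele_pass[OF r])
     fix c q assume c: "c \<in> homog A q"
     show "tok0 d (u l) c * tok0 d (u j) a = sm (koszul (p * q)) (tok0 d (u j) a * tok0 d (u l) c)"
      "tok0 d (u i) c * tok0 d (u j) a = sm (koszul (p * q)) (tok0 d (u j) a * tok0 d (u i) c)"
      using R0.tok_commute[OF r(1) perm_in[OF u j] ne(1) c a] R0.tok_commute[OF r(2) perm_in[OF u j] ne(2) c a]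
      by (simp_all only: mult.commute[of p])
    qed
    then show ?thesis using 3 by (simp add: transpose_def mult.commute)
   qed
  qed
  then have "Dg d (\<lambda>u. tok0 d (u j) a * sm (eta l i u) (tele0 d (u l) (u i))) =
   Dg d (\<lambda>u. sm (koszul (\<epsilon> * p)) (sm (eta l i u) (tele0 d (u l) (u i)) * tok0 d (u (transpose l i j)) ?a))"
   by (intro Dg_cong) (simp only: sm_simps mult.commute)
  then have "tokv d j a * Dg d (\<lambda>u. sm (eta l i u) (tele0 d (u l) (u i))) =
   sm (koszul (\<epsilon> * p)) (Dg d (\<lambda>u. sm (eta l i u) (tele0 d (u l) (u i))) * tokv d (transpose l i j) ?a)"
   by (simp only: tokv_def Dg_mult Dg_sm)
  moreover have "tokv d (transpose l i j) ?a * Sh (transpose l i) = Sh (transpose l i) * tokv d j ?a"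
   using transpose_permutes[OF l'(1) i] by (simp add: tokv_def Sh_Dg)
  ultimately show ?thesis unfolding xterm_def
   by (simp only: mult.assoc[symmetric] sm_simps) (simp only: mult.assoc sm_simps)
 qed
 show ?thesis
  unfolding xv_def distrib_left distrib_right sum_distrib_left sum_distrib_right sm_distrib sm_sum 1
  by (intro arg_cong2[of _ _ _ _ "(+)"] sum.cong refl 2)
qed

definition tau :: "nat => nat => ((nat => nat) \<times> (nat => 'a \<times> nat), 'k) lop" where
 "tau k j = (if j = k then telev k (Suc k) else if j = Suc k then - telev (Suc k) k else 0)"

text \<open>Translation by \<open>st k\<close> preserves the order of every pair of strands other
  than \<open>k\<close> and \<open>Suc k\<close>, so the inversion terms of both sides correspond.
  For that pair \<open>eta\<close> jumps by one, whichever way the values of \<open>u\<close>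
  compare, and the difference is the required teleporter.\<close>

lemma Tv_xv:
 assumes k: "k \<in> {1..<d}" and j: "j \<in> {1..d}"
 shows "Tv d k * xv d j = xv d (st k j) * Tv d k - tau k j"
proof -
 let ?s = "st k" and ?S = "Sh (st k) :: ((nat => nat) \<times> (nat => 'a \<times> nat), 'k) lop"
 note s = st_permutes[OF k]
 have sj: "?s j \<in> {1..d}" using perm_in[OF s j] .
 have 1: "Tv d k * xv d j = ?S * xv d j" using xv_ev[OF j] by (simp add: Tv_def mult.assoc)
 have 2: "xv d (?s j) * Tv d k = xv d (?s j) * ?S"
  using xv_ev[OF sj] by (simp add: Tv_def ev_Sh[OF s, symmetric] mult.assoc[symmetric])
 have S: "?S * xterm d j l = Dg d (\<lambda>u. sm (eta l j (u \<circ> ?s)) (tele0 d (u (?s l)) (u (?s j)))) * Sh (transpose (?s l) (?s j)) * ?S" for l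
 proof -
  have "?s \<circ> transpose l j = transpose (?s l) (?s j) \<circ> ?s"
  proof (rule ext)
   fix x
   show "(?s \<circ> transpose l j) x = (transpose (?s l) (?s j) \<circ> ?s) x"
    using st_st(2)[of k x l] st_st(2)[of k x j]
    by (cases "x = l"; cases "x = j") (simp_all only: comp_apply transpose_apply_first transpose_apply_second transpose_apply_other not_False_eq_True simp_thms)
  qed
  then have "?S * Sh (transpose l j) = Sh (transpose (?s l) (?s j)) * ?S" by (simp add: Sh_Sh)
  then show ?thesis unfolding xterm_def by (simp add: mult.assoc[symmetric] Sh_Dg[OF s]) (simp add: mult.assoc)
 qed
 have "(\<Sum>l\<in>{1..d} - {j}. ?S * xterm d j l) = (\<Sum>l\<in>{1..d} - {?s j}. ?S * xterm d j (?s l))"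
  by (rule sum.reindex_bij_witness[of _ ?s ?s]) (use perm_in[OF s] in \<open>auto simp: st_st simp del: atLeastAtMost_iff\<close>)
 also have "... = (\<Sum>l\<in>{1..d} - {?s j}. xterm d (?s j) l * ?S +
   Dg d (\<lambda>u. sm (eta (?s l) j (u \<circ> ?s) - eta l (?s j) u) (tele0 d (u l) (u (?s j)))) * Sh (transpose l (?s j)) * ?S)"
 proof (rule sum.cong[OF refl])
  fix l
  have "Dg d (\<lambda>u. sm (eta (?s l) j (u \<circ> ?s)) (tele0 d (u l) (u (?s j))))
   = Dg d (\<lambda>u. sm (eta l (?s j) u) (tele0 d (u l) (u (?s j))))
   + Dg d (\<lambda>u. sm (eta (?s l) j (u \<circ> ?s) - eta l (?s j) u) (tele0 d (u l) (u (?s j))))"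
   unfolding Dg_add[symmetric] sm_distrib(3)[symmetric] by simp
  then show "?S * xterm d j (?s l) = xterm d (?s j) l * ?S +
   Dg d (\<lambda>u. sm (eta (?s l) j (u \<circ> ?s) - eta l (?s j) u) (tele0 d (u l) (u (?s j)))) * Sh (transpose l (?s j)) * ?S"
   unfolding S by (simp add: xterm_def distrib_right)
 qed
 also have "... = (\<Sum>l\<in>{1..d} - {?s j}. xterm d (?s j) l * ?S) - tau k j"
 proof -
  define D where "D l = Dg d (\<lambda>u. sm (eta (?s l) j (u \<circ> ?s) - eta l (?s j) u) (tele0 d (u l) (u (?s j)))) * Sh (transpose l (?s j)) * ?S" for l
  have D0: "D l = 0" if "l \<in> {1..d} - {?s j}" "\<not> (l = j \<and> (j = k \<or> j = Suc k))" for l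
  proof -
   have "eta (?s l) j (u \<circ> ?s) = eta l (?s j) u" for u
    using that unfolding eta_def by (auto simp: transpose_def split: if_splits)
   then show ?thesis by (simp add: D_def Dg_zero)
  qed
  have ST: "Dg d h * Sh ?s * ?S = Dg d h" for h by (simp only: mult.assoc Sh_Sh Sh_id st_st mult_1_right)
  have "(\<Sum>l\<in>{1..d} - {?s j}. D l) = - tau k j"
  proof (cases "j = k \<or> j = Suc k")
   case True
   then have jj: "j \<in> {1..d} - {?s j}" using j by (auto simp: transpose_def)
   have "(\<Sum>l\<in>{1..d} - {?s j}. D l) = D j + (\<Sum>l\<in>{1..d} - {?s j} - {j}. D l)"
    using jj by (intro sum.remove) auto
   also have "(\<Sum>l\<in>{1..d} - {?s j} - {j}. D l) = 0" using D0 by (intro sum.neutral ballI) auto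
   finally have E: "(\<Sum>l\<in>{1..d} - {?s j}. D l) = D j" by simp
   have ne: "u k \<noteq> u (Suc k)" if "u permutes {1..d}" for u
    using injD[OF permutes_inj[OF that], of k "Suc k"] by auto
   show ?thesis
   proof (cases "j = k")
    case True
    have "eta (Suc k) k (u \<circ> ?s) - eta k (Suc k) u = - 1" if "u permutes {1..d}" for u
     using ne[OF that] by (cases "u k < u (Suc k)") (auto simp: eta_def)
    then have "Dg d (\<lambda>u. sm (eta (Suc k) k (u \<circ> ?s) - eta k (Suc k) u) (tele0 d (u k) (u (Suc k)))) = Dg d (\<lambda>u. sm (- 1) (tele0 d (u k) (u (Suc k))))"
     by (intro Dg_cong) simp
    moreover have "D k = Dg d (\<lambda>u. sm (eta (Suc k) k (u \<circ> ?s) - eta k (Suc k) u) (tele0 d (u k) (u (Suc k))))"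
     by (simp only: D_def True transpose_apply_first ST)
    ultimately have "D k = sm (- 1) (telev k (Suc k))" by (simp only: Dg_sm telev_Dg)
    then show ?thesis unfolding E using True by (simp add: tau_def)
   next
    case False
    then have j: "j = Suc k" using \<open>j = k \<or> j = Suc k\<close> by simp
    have "eta k (Suc k) (u \<circ> ?s) - eta (Suc k) k u = 1" if "u permutes {1..d}" for u
     using ne[OF that] by (cases "u k < u (Suc k)") (auto simp: eta_def)
    then have "Dg d (\<lambda>u. sm (eta k (Suc k) (u \<circ> ?s) - eta (Suc k) k u) (tele0 d (u (Suc k)) (u k))) = Dg d (\<lambda>u. tele0 d (u (Suc k)) (u k))"
     by (intro Dg_cong) simp
    then have "D (Suc k) = telev (Suc k) k"
     by (simp only: D_def j transpose_apply_second transpose_commute[of "Suc k" k] ST telev_Dg)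
    then show ?thesis unfolding E using j by (simp add: tau_def)
   qed
  next
   case False
   then show ?thesis using D0 by (auto simp: tau_def intro!: sum.neutral)
  qed
  then show ?thesis unfolding D_def by (simp only: sum.distrib) simp
 qed
 finally have "?S * xv d j = xv d (?s j) * ?S - tau k j"
  by (simp add: xv_def distrib_left distrib_right sum_distrib_left sum_distrib_right Sh_Dg[OF s] algebra_simps)
 then show ?thesis by (simp add: 1 2)
qed

lemma xv_id: "app (xv d j) \<phi> (id, \<iota>) = app (x0 d j) (\<lambda>\<iota>'. \<phi> (id, \<iota>')) \<iota>"
proof -
 have "app (xterm d j l) \<phi> (id, \<iota>) = 0" for l
  unfolding xterm_def using permutes_id by (subst app_Dg_Sh) (auto simp: eta_def)
 then show ?thesis by (simp add: xv_def app_sum Dg.rep_eq permutes_id)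
qed

text \<open>A direct check would run over pairs of inversions. Instead the supercommutator is shown
  to be intertwined by the crossings. At the identity the dots act plainly and it is zero, and each
  adjacent transposition carries the vanishing on.\<close>

lemma xv_commute:
 assumes "i \<in> {1..d}" "j \<in> {1..d}" "i \<noteq> j"
 shows "xv d i * xv d j = sm (koszul \<epsilon>) (xv d j * xv d i)"
proof -
 define C where "C i j = xv d i * xv d j - sm (koszul \<epsilon>) (xv d j * xv d i)" for i j
 let ?k = "koszul \<epsilon> :: 'k"
 have TC: "Tv d k * C i j = C (st k i) (st k j) * Tv d k"
  if k: "k \<in> {1..<d}" and ij: "i \<in> {1..d}" "j \<in> {1..d}" "i \<noteq> j" for k i j
 proof -
  have TX: "Tv d k * (xv d i * xv d j) = xv d (st k i) * (xv d (st k j) * Tv d k) - xv d (st k i) * tau k j - tau k i * xv d j"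
   if "i \<in> {1..d}" "j \<in> {1..d}" for i j
   using Tv_xv[OF k that(1)] Tv_xv[OF k that(2)]
   by (simp add: mult.assoc[symmetric] left_diff_distrib) (simp add: mult.assoc right_diff_distrib)
  have kk: "k \<in> {1..d}" "Suc k \<in> {1..d}" "k \<noteq> Suc k" using k by auto
  have a: "telev k (Suc k) * xv d (Suc k) = xv d (Suc k) * telev (Suc k) k"
   using kk by (intro V.tele_x) (use tok_xv[OF kk(2)] in \<open>auto simp del: atLeastAtMost_iff\<close>)
  have b: "telev (Suc k) k * xv d k = xv d k * telev k (Suc k)"
   using kk by (intro V.tele_x) (use tok_xv[OF kk(1)] in \<open>auto simp del: atLeastAtMost_iff\<close>)
  have c: "telev k (Suc k) * xv d l = sm ?k (xv d l * telev k (Suc k))"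
   "telev (Suc k) k * xv d l = sm ?k (xv d l * telev (Suc k) k)"
   if "l \<in> {1..d}" "l \<noteq> k" "l \<noteq> Suc k" for l
   using V.tele_pass[OF kk(1,2), of "xv d l" \<epsilon>] V.tele_pass[OF kk(2,1), of "xv d l" \<epsilon>]
    tok_xv[OF that(1) kk(1)] tok_xv[OF that(1) kk(2)] that by auto
  \<comment> \<open>The teleporters left over by the two orders agree: by \<open>tele_x\<close> if
    \<open>i\<close> and \<open>j\<close> are the two strands that cross, and by
    \<open>tele_pass\<close> if just one of them is.\<close>
  have "xv d (st k i) * tau k j + tau k i * xv d j = sm ?k (xv d (st k j) * tau k i + tau k j * xv d i)"
  proof -
   consider "i = k" "j = Suc k" | "i = Suc k" "j = k" | "i = k" "j \<noteq> k" "j \<noteq> Suc k" | "i = Suc k" "j \<noteq> k" "j \<noteq> Suc k"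
    | "j = k" "i \<noteq> k" "i \<noteq> Suc k" | "j = Suc k" "i \<noteq> k" "i \<noteq> Suc k" | "i \<notin> {k, Suc k}" "j \<notin> {k, Suc k}"
    using ij(3) by fastforce
   then show ?thesis
    using a b c(1)[OF ij(1)] c(1)[OF ij(2)] c(2)[OF ij(1)] c(2)[OF ij(2)]
    by cases (simp_all add: tau_def sm_distrib transpose_apply_other)
  qed
  then have "Tv d k * C i j - C (st k i) (st k j) * Tv d k = 0"
   unfolding C_def right_diff_distrib left_diff_distrib sm_simps TX[OF ij(1,2)] TX[OF ij(2,1)]
   by (simp add: sm_distrib mult.assoc algebra_simps)
  then show ?thesis by simp
 qed
 have evC: "ev d * C i j = C i j" if "i \<in> {1..d}" "j \<in> {1..d}" for i j
  unfolding C_def right_diff_distrib sm_simps using xv_ev that by (simp add: mult.assoc[symmetric])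
 have perm: "app (C i j) \<phi> (u, \<iota>) = 0"
  if "u permutes {1..d}" "i \<in> {1..d}" "j \<in> {1..d}" "i \<noteq> j" for u i j \<phi> \<iota>
  using that
 proof (induction u arbitrary: i j \<phi> \<iota> rule: permutes_adjacent_induct)
  case id
  have "app (C i j) \<phi> (id, \<iota>) = app (x0 d i * x0 d j - sm ?k (x0 d j * x0 d i)) (\<lambda>\<iota>'. \<phi> (id, \<iota>')) \<iota>"
   by (simp add: C_def xv_id)
  moreover have "x0 d i * x0 d j - sm ?k (x0 d j * x0 d i) = 0" using R0.x_commute[OF id] by simp
  ultimately show ?case by (simp only: zero_lop.rep_eq)
 next
  case (adjacent u k)
  have s: "st k i \<in> {1..d}" "st k j \<in> {1..d}" "st k i \<noteq> st k j"
   using perm_in[OF st_permutes[OF adjacent(2)]] adjacent(4,5,6) st_st(2)[of k i j] by blast+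
  have "app (C i j) \<phi> (u \<circ> st k, \<iota>) = app (Sh (st k) * (ev d * C i j)) \<phi> (u, \<iota>)"
   using evC adjacent by (simp add: Sh.rep_eq)
  also have "... = app (Tv d k * C i j) \<phi> (u, \<iota>)" by (simp add: Tv_def)
  also have "... = 0" unfolding TC[OF adjacent(2,4,5,6)] using adjacent.IH[OF s] by simp
  finally show ?case .
 qed
 have "C i j = 0"
 proof (rule lop_eqI)
  fix \<phi> and ui :: "(nat => nat) \<times> (nat => 'a \<times> nat)"
  obtain u \<iota> where ui: "ui = (u, \<iota>)" by force
  show "app (C i j) \<phi> ui = app 0 \<phi> ui"
  proof (cases "u permutes {1..d}")
   case True
   then show ?thesis using perm assms ui by simp
  next
   case False
   have "app (ev d * C i j) \<phi> ui = 0" using False ui by (simp add: ev_def Dg.rep_eq)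
   then show ?thesis unfolding evC[OF assms(1,2)] by simp
  qed
 qed
 then show ?thesis by (simp add: C_def)
qed

lemma polrepv: "polrep A d (ev d) (tokv d) (xv d)"
 by unfold_locales (rule xv_ev tok_xv xv_commute; assumption)+

end

end

declare Suc_eq_plus1 [symmetric, simp]

section \<open>Polynomials, locality and the elements \<open>Q\<close> on black strands\<close>

subsection \<open>Polynomials in the affine wreath product algebra\<close>

context frobenius_superalgebra
begin

definition pv :: "nat => nat => ('k, 'a) pterm => ((nat => nat) \<times> (nat => 'a \<times> nat), 'k) lop" where
 "pv d l = pint (ev d) (\<lambda>i. tokv d (l + i)) (\<lambda>i. xv d (l + i))"

lemma pv_simps [simp]:
 "pv d l (PTok i a) = tokv d (l + i) a" "pv d l (PX i) = xv d (l + i)" "pv d l PZero = 0" "pv d l POne = ev d"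
 "pv d l (PAdd f g) = pv d l f + pv d l g" "pv d l (PMul f g) = pv d l f * pv d l g"
 "pv d l (PSmul c f) = sm c (pv d l f)"
 by (simp_all add: pv_def)

lemma pv_cong: "pol_eq A m f g ==> l + m \<le> d ==> pv d l f = pv d l g"
 unfolding pv_def by (intro polrep.pint_cong[OF polrep_shift[OF polrepv]])

lemma pv_ev:
 assumes "f \<in> pol_terms m" "l + m \<le> d"
 shows "ev d * pv d l f = pv d l f" "pv d l f * ev d = pv d l f"
 using polrep.pint_e[OF polrep_shift[OF polrepv assms(2)] assms(1)] unfolding pv_def by auto

lemma pv_psum: "pv d l (psum fs) = sum_list (map (pv d l) fs)"
 by (induction fs) auto

text \<open>The identity has no inversions, so there the Dunkl operators reduce to the regular
  representation. In this way statements about operators on the symmetric group become statements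
  about \<open>Pol\<^sub>d(A)\<close>.\<close>

lemma pv_id: "app (pv d l f) \<phi> (id, \<iota>) = app (pint (E0 d) (\<lambda>i. tok0 d (l + i)) (\<lambda>i. x0 d (l + i)) f) (\<lambda>\<iota>'. \<phi> (id, \<iota>')) \<iota>"
proof (induction f arbitrary: \<phi> \<iota>)
 case (PTok i a)
 show ?case by (simp only: pv_simps pint.simps tokv_def Dg.rep_eq permutes_id prod.case if_True) (simp only: id_def)
next
 case (PX i)
 show ?case by (simp only: pv_simps pint.simps xv_id)
next
 case POne
 show ?case by (simp only: pv_simps pint.simps ev_def Dg.rep_eq permutes_id prod.case if_True)
qed (simp_all only: pv_simps pint.simps app_simps)

lemma pol_terms_induct_in [consumes 1]:
 assumes "f \<in> pol_terms n"
  and "\<And>i a. 1 \<le> i ==> i \<le> n ==> P (PTok i a)" "\<And>i. 1 \<le> i ==> i \<le> n ==> P (PX i)" "P PZero" "P POne"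
  and "\<And>f g. f \<in> pol_terms n ==> P f ==> g \<in> pol_terms n ==> P g ==> P (PAdd f g)"
  and "\<And>f g. f \<in> pol_terms n ==> P f ==> g \<in> pol_terms n ==> P g ==> P (PMul f g)"
  and "\<And>f c. f \<in> pol_terms n ==> P f ==> P (PSmul c f)"
 shows "P f"
 using assms(1) by (induction rule: pol_terms.induct) (use assms(2-) in auto)

lemma pol_perm_terms: "f \<in> pol_terms n ==> (\<And>i. i \<in> {1..n} ==> w i \<in> {1..m}) ==> pol_perm w f \<in> pol_terms m"
 by (induction rule: pol_terms.induct) (auto intro: pol_terms.intros)

lemma st_in: "k \<in> {1..<n} ==> i \<in> {1..n} ==> st k i \<in> {1..n}"
 by (auto simp: transpose_def)

lemma teleporter_terms: "i \<in> {1..n} ==> j \<in> {1..n} ==> teleporter A i j \<in> pol_terms n"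
 unfolding teleporter_def by (intro psum_terms) (auto intro!: pol_terms.intros)

lemma demazure_terms:
 assumes "k \<in> {1..<n}" "f \<in> pol_terms n"
 shows "demazure A k f \<in> pol_terms n"
 using assms(2)
proof (induction rule: pol_terms_induct_in)
 case (6 f g)
 then show ?case using pol_perm_terms[OF 6(1) st_in[OF assms(1)]] by (auto intro!: pol_terms.intros)
qed (use assms(1) in \<open>auto intro!: pol_terms.intros teleporter_terms\<close>)

lemma pv_teleporter:
 assumes "i \<in> {1..m}" "j \<in> {1..m}" "l + m \<le> d"
 shows "pv d l (teleporter A i j) = tokrep.tele A (tokv d) (l + i) (l + j)"
proof -
 interpret V: tokrep A d "ev d" "tokv d" by (rule tokrepv)
 show ?thesis
  by (simp add: teleporter_def pv_psum o_def V.tele_def sum_list_distinct_conv_sum_set basis_distinct)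
qed

text \<open>The twisted Leibniz rule is exactly what moving a crossing past a product yields, so the
  formula propagates from the generators to all terms.\<close>

lemma Tv_pv:
 assumes "f \<in> pol_terms m" "l + m \<le> d" "k \<in> {1..<m}"
 shows "Tv d (l + k) * pv d l f = pv d l (pol_perm (st k) f) * Tv d (l + k) - pv d l (demazure A k f)"
 using assms(1)
proof (induction rule: pol_terms_induct_in)
 case (1 i a)
 have "st (l + k) (l + i) = l + st k i" by (auto simp: transpose_def)
 then show ?case using Tv_tok[of "l + k" d "l + i" a] assms 1 by simp
next
 case (2 i)
 have s: "st (l + k) (l + i) = l + st k i" by (auto simp: transpose_def)
 have "tau d (l + k) (l + i) = pv d l (demazure A k (PX i))"
  using assms 2 pv_teleporter[of k m "Suc k" l d] pv_teleporter[of "Suc k" m k l d] by (auto simp: tau_def)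
 then show ?case using Tv_xv[of "l + k" d "l + i"] assms 2 s by simp
next
 case 4
 then show ?case using Tv_ev(1)[of "l + k" d] Tv_ev(2)[of d "l + k"] assms by simp
next
 case (6 f g)
 have "Tv d (l + k) * pv d l (PMul f g) = (Tv d (l + k) * pv d l f) * pv d l g" by (simp add: mult.assoc)
 also have "... = pv d l (pol_perm (st k) f) * (Tv d (l + k) * pv d l g) - pv d l (demazure A k f) * pv d l g"
  unfolding "6.IH"(1) by (simp only: left_diff_distrib mult.assoc)
 also have "... = pv d l (pol_perm (st k) (PMul f g)) * Tv d (l + k) - pv d l (demazure A k (PMul f g))"
  by (simp only: "6.IH"(2)) (simp add: right_diff_distrib mult.assoc algebra_simps)
 finally show ?case .
next
 case (7 f c)
 have "Tv d (l + k) * pv d l (PSmul c f) = sm c (Tv d (l + k) * pv d l f)" by simp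
 then show ?case by (simp only: "7.IH") (simp add: sm_distrib)
qed (simp_all add: algebra_simps)

subsection \<open>Locality\<close>

text \<open>Generation is recorded, not support: the operator of a dot involves other strands
  through its Dunkl terms, and yet it supercommutes with whatever is generated on other strands.
  This is what the super interchange law needs.\<close>

inductive Loc :: "nat => nat set => bit => ((nat => nat) \<times> (nat => 'a \<times> nat), 'k) lop => bool"
 for d S where
 Loc_tok: "j \<in> S ==> a \<in> homog A p ==> Loc d S p (tokv d j a)"
| Loc_x: "j \<in> S ==> Loc d S \<epsilon> (xv d j)"
| Loc_T: "k \<in> S ==> Suc k \<in> S ==> Loc d S 0 (Tv d k)"
| Loc_e: "Loc d S 0 (ev d)"
| Loc_0: "Loc d S p 0"
| Loc_add: "Loc d S p y ==> Loc d S p z ==> Loc d S p (y + z)"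
| Loc_sm: "Loc d S p y ==> Loc d S p (sm c y)"
| Loc_mult: "Loc d S p y ==> Loc d S q z ==> Loc d S (p + q) (y * z)"

lemma Loc_mono: "Loc d S p y ==> S \<subseteq> S' ==> Loc d S' p y"
 by (induction rule: Loc.induct) (auto intro: Loc.intros)

lemma Loc_pass:
 assumes "\<And>j a p. j \<in> S ==> a \<in> homog A p ==> z * tokv d j a = sm (koszul (p * q)) (tokv d j a * z)"
  and "\<And>j. j \<in> S ==> z * xv d j = sm (koszul (\<epsilon> * q)) (xv d j * z)"
  and "\<And>k. k \<in> S ==> Suc k \<in> S ==> z * Tv d k = Tv d k * z"
  and "z * ev d = ev d * z"
 shows "Loc d S p y ==> z * y = sm (koszul (p * q)) (y * z)"
proof (induction rule: Loc.induct)
 case (Loc_mult p y p' y')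
 have "z * (y * y') = sm (koszul (p * q)) (y * (z * y'))"
  using Loc_mult(3) by (simp add: mult.assoc[symmetric])
 also have "... = sm (koszul (p * q) * koszul (p' * q)) (y * y' * z)"
  using Loc_mult(4) by (simp add: mult.assoc)
 finally show ?case by (simp add: distrib_right koszul_add)
qed (use assms in \<open>simp_all add: distrib_left distrib_right sm_distrib mult.commute\<close>)

text \<open>\<open>Loc_pass\<close> is applied in both arguments: each generator on
  \<open>S'\<close> passes \<open>y\<close>, and therefore \<open>y\<close> passes \<open>z\<close>,
  which is built from these generators.\<close>

lemma Loc_commute:
 assumes y: "Loc d S p y" and z: "Loc d S' q z" and S: "S \<subseteq> {1..d}" "S' \<subseteq> {1..d}" "S \<inter> S' = {}"
 shows "z * y = sm (koszul (p * q)) (y * z)"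
proof -
 interpret V: polrep A d "ev d" "tokv d" "xv d" by (rule polrepv)
 have ey: "w * ev d = w" "ev d * w = w" if "Loc d S'' r w" "S'' \<subseteq> {1..d}" for w S'' r
 proof -
  have "w * ev d = w \<and> ev d * w = w" using that
  proof (induction rule: Loc.induct)
   case (Loc_mult p y q z)
   then show ?case by (simp add: mult.assoc) (simp add: mult.assoc[symmetric])
  next
   case (Loc_T k)
   then have "k \<in> {1..<d}" by auto
   then show ?case using Tv_ev by simp
  next
   case (Loc_tok j a p)
   then have "j \<in> {1..d}" by auto
   then show ?case using V.e_tok V.tok_e by blast
  next
   case (Loc_x j)
   then have "j \<in> {1..d}" by auto
   then show ?case using V.e_x V.x_e by blast
  qed (simp_all add: V.e_idem distrib_left distrib_right)
  then show "w * ev d = w" "ev d * w = w" by auto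
 qed
 have TT: "Tv d k * Tv d k' = Tv d k' * Tv d k" if "k \<in> S" "Suc k \<in> S" "k' \<in> S'" "Suc k' \<in> S'" for k k'
 proof -
  have k: "k \<in> {1..<d}" "k' \<in> {1..<d}" using that S by auto
  have "k \<noteq> k'" "Suc k \<noteq> k'" "k \<noteq> Suc k'" using that S by auto
  then have "Suc k < k' \<or> Suc k' < k" by linarith
  then show ?thesis using Tv_far k by metis
 qed
 have Tt: "Tv d k * tokv d j a = tokv d j a * Tv d k" "Tv d k * xv d j = xv d j * Tv d k"
  if "k \<in> {1..<d}" "j \<in> {1..d}" "j \<noteq> k" "j \<noteq> Suc k" for k j a
  using Tv_tok[OF that(1,2)] Tv_xv[OF that(1,2)] that by (simp_all add: tau_def transpose_apply_other)
 have tx: "tokv d j a * xv d i = sm (koszul (\<epsilon> * p)) (xv d i * tokv d j a)"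
  if "j \<in> {1..d}" "i \<in> {1..d}" "i \<noteq> j" "a \<in> homog A p" for i j a p
  using V.tok_x[OF that(2,1,4)] that(3) by simp
 have dis: "i \<noteq> j \<and> j \<noteq> i \<and> i \<in> {1..d} \<and> j \<in> {1..d}" if "i \<in> S" "j \<in> S'" for i j using S that by auto
 have kS': "k \<in> {1..<d}" if "k \<in> S'" "Suc k \<in> S'" for k using S that by fastforce
 have gen: "y * z = sm (koszul (q * p)) (z * y)"
 proof (rule Loc_pass[OF _ _ _ _ z])
  show "y * ev d = ev d * y" using ey[OF y S(1)] by simp
 next
  fix j a r assume j: "j \<in> S'" and a: "a \<in> homog A r"
  have "tokv d j a * y = sm (koszul (p * r)) (y * tokv d j a)"
  proof (rule Loc_pass[OF _ _ _ _ y])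
   fix i c s assume "i \<in> S" "c \<in> homog A s"
   then show "tokv d j a * tokv d i c = sm (koszul (s * r)) (tokv d i c * tokv d j a)"
    using dis[of i j] j a V.tok_commute[of j i a r c s] by (simp add: mult.commute)
  next
   fix i assume "i \<in> S"
   then show "tokv d j a * xv d i = sm (koszul (\<epsilon> * r)) (xv d i * tokv d j a)"
    using S j a by (intro tx) auto
  next
   fix k assume "k \<in> S" "Suc k \<in> S"
   then show "tokv d j a * Tv d k = Tv d k * tokv d j a"
    using S j by (intro Tt(1)[symmetric]) auto
  next
   show "tokv d j a * ev d = ev d * tokv d j a" using ey[OF Loc_tok[OF j a] S(2)] by simp
  qed
  then show "y * tokv d j a = sm (koszul (r * p)) (tokv d j a * y)" by (simp add: mult.commute)
 next
  fix j assume j: "j \<in> S'"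
  have "xv d j * y = sm (koszul (p * \<epsilon>)) (y * xv d j)"
  proof (rule Loc_pass[OF _ _ _ _ y])
   fix i c s assume *: "i \<in> S" "c \<in> homog A s"
   then have "tokv d i c * xv d j = sm (koszul (\<epsilon> * s)) (xv d j * tokv d i c)"
    using S j by (intro tx) auto
   then show "xv d j * tokv d i c = sm (koszul (s * \<epsilon>)) (tokv d i c * xv d j)" by (simp add: mult.commute)
  next
   fix i assume "i \<in> S"
   then show "xv d j * xv d i = sm (koszul (\<epsilon> * \<epsilon>)) (xv d i * xv d j)"
    using dis[of i j] j V.x_commute[of j i] by simp
  next
   fix k assume "k \<in> S" "Suc k \<in> S"
   then show "xv d j * Tv d k = Tv d k * xv d j"
    using S j by (intro Tt(2)[symmetric]) auto
  next
   show "xv d j * ev d = ev d * xv d j" using ey[OF Loc_x[OF j] S(2)] by simp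
  qed
  then show "y * xv d j = sm (koszul (\<epsilon> * p)) (xv d j * y)" by (simp add: mult.commute)
 next
  fix k assume k: "k \<in> S'" "Suc k \<in> S'"
  have "Tv d k * y = sm (koszul (p * 0)) (y * Tv d k)"
  proof (rule Loc_pass[OF _ _ _ _ y])
   fix i c s assume *: "i \<in> S" "c \<in> homog A s"
   then show "Tv d k * tokv d i c = sm (koszul (s * 0)) (tokv d i c * Tv d k)"
    using dis[of i k] dis[of i "Suc k"] k kS' Tt(1)[of k i c] by simp
  next
   fix i assume "i \<in> S"
   then show "Tv d k * xv d i = sm (koszul (\<epsilon> * 0)) (xv d i * Tv d k)"
    using dis[of i k] dis[of i "Suc k"] k kS' Tt(2)[of k i] by simp
  next
   fix k' assume "k' \<in> S" "Suc k' \<in> S"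
   then show "Tv d k * Tv d k' = Tv d k' * Tv d k" using TT[of k' k] k by simp
  next
   show "Tv d k * ev d = ev d * Tv d k" using ey[OF Loc_T[OF k] S(2)] by simp
  qed
  then show "y * Tv d k = Tv d k * y" by simp
 qed
 then show ?thesis by (simp add: mult.commute)
qed

lemma pv_Loc: "pol_homog A p f ==> f \<in> pol_terms m ==> Loc d {l + 1..l + m} p (pv d l f)"
proof (induction rule: pol_homog.induct)
 case (1 a p i)
 then have "i \<in> {1..m}" by (auto elim: pol_terms.cases)
 then show ?case using 1 by (auto intro!: Loc.intros)
next
 case (2 i)
 then have "i \<in> {1..m}" by (auto elim: pol_terms.cases)
 then show ?case by (auto intro!: Loc.intros)
next
 case (5 p f g)
 from 5(5) have "f \<in> pol_terms m" "g \<in> pol_terms m" by (auto elim: pol_terms.cases)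
 then show ?case using 5 by (auto intro!: Loc.intros)
next
 case (6 p f q g)
 from 6(5) have "f \<in> pol_terms m" "g \<in> pol_terms m" by (auto elim: pol_terms.cases)
 then show ?case using 6 by (auto intro!: Loc.intros)
next
 case (7 p f c)
 from 7(3) have "f \<in> pol_terms m" by (auto elim: pol_terms.cases)
 then show ?case using 7 by (auto intro!: Loc.intros)
qed (auto intro: Loc.intros)

subsection \<open>The grading\<close>

definition tpar :: "nat => (nat => 'a \<times> nat) => bit" where
 "tpar n \<iota> = (\<Sum>k\<in>{1..n}. mpar (\<iota> k))"

definition psupp :: "nat => bit => ((nat => 'a \<times> nat) => 'k) => bool" where
 "psupp n q v \<longleftrightarrow> (\<forall>\<iota>. v \<iota> \<noteq> 0 \<longrightarrow> tpar n \<iota> = q)"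

lemma E0_diag: "v \<iota> = 0 ==> app (E0 k) v \<iota> = 0"
proof (induction k arbitrary: v)
 case (Suc k)
 have "app (Lop (Suc k) Eop) v \<iota> = 0" using Suc.prems by (cases "\<iota> (Suc k)") (auto simp: Lop.rep_eq Eop.rep_eq fun_upd_idem)
 then show ?case using Suc.IH by simp
qed simp

lemma JW_diag: "v \<iota> = 0 ==> app (JW k p) v \<iota> = 0"
proof (induction k arbitrary: v)
 case (Suc k)
 have "app (Lop k (Jop p)) v \<iota> = 0" using Suc.prems by (auto simp: Lop.rep_eq Jop.rep_eq)
 then show ?case using Suc.IH by simp
qed simp

lemma gop_supp:
 assumes "app (gop d k p f) v \<iota> \<noteq> 0"
 shows "app f (\<lambda>m. v (\<iota>(k := m))) (\<iota> k) \<noteq> 0"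
 using assms E0_diag JW_diag unfolding gop_def times_lop.rep_eq by (metis Lop.rep_eq)

lemma Mop_supp: "app (Mop a) v (x, r) \<noteq> 0 ==> \<exists>c\<in>BB. x \<in> BB \<and> tr (dl x * (a * c)) \<noteq> 0 \<and> v (c, r) \<noteq> 0"
 by (auto simp: Mop.rep_eq split: if_splits) (metis (no_types, lifting) mult_zero_left mult_zero_right sum.not_neutral_contains_not_neutral)

lemma Nop_supp: "app Nop v (x, r) \<noteq> 0 ==> \<exists>c\<in>BB. x \<in> BB \<and> r > 0 \<and> tr (dl x * ipsi c) \<noteq> 0 \<and> v (c, r - 1) \<noteq> 0"
 by (auto simp: Nop.rep_eq split: if_splits) (metis (no_types, lifting) mult_zero_left mult_zero_right sum.not_neutral_contains_not_neutral)

lemma tpar_upd: "k \<in> {1..n} ==> tpar n (\<iota>(k := m)) = tpar n \<iota> + mpar (\<iota> k) + mpar m"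
proof -
 assume k: "k \<in> {1..n}"
 have "tpar n (\<iota>(k := m)) = mpar m + (\<Sum>l\<in>{1..n} - {k}. mpar (\<iota> l))"
  unfolding tpar_def using k by (subst sum.remove[of _ k]) (auto intro!: sum.cong)
 moreover have "tpar n \<iota> = mpar (\<iota> k) + (\<Sum>l\<in>{1..n} - {k}. mpar (\<iota> l))"
  unfolding tpar_def using k by (subst sum.remove[of _ k]) auto
 ultimately show ?thesis by (simp add: ac_simps)
qed

lemma pint0_psupp:
 "pol_homog A p f ==> f \<in> pol_terms n ==> psupp n q v ==> psupp n (p + q) (app (pint0 n f) v)"
proof (induction arbitrary: q v rule: pol_homog.induct)
 case (1 a p i)
 then have i: "i \<in> {1..n}" by (auto elim: pol_terms.cases)
 show ?case unfolding psupp_def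
 proof (intro allI impI)
  fix \<iota> assume "app (pint0 n (PTok i a)) v \<iota> \<noteq> 0"
  then have *: "app (Mop a) (\<lambda>m. v (\<iota>(i := m))) (\<iota> i) \<noteq> 0"
   using gop_supp by (simp add: tok0_homog[OF 1(1)])
  obtain x r where xr: "\<iota> i = (x, r)" by force
  obtain c where c: "c \<in> BB" "x \<in> BB" "tr (dl x * (a * c)) \<noteq> 0" "v (\<iota>(i := (c, r))) \<noteq> 0"
   using Mop_supp[of a _ x r] * xr by auto
  then have "par x = p + par c"
   using coord_parity[OF c(2) homog_mult[OF 1(1) basis_par[OF c(1)]]] c(3) by metis
  moreover have "tpar n (\<iota>(i := (c, r))) = q" using c(4) 1 unfolding psupp_def by blast
  ultimately show "tpar n \<iota> = p + q"
   unfolding tpar_upd[OF i] xr mpar_def by (auto simp: ac_simps)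
 qed
next
 case (2 i)
 then have i: "i \<in> {1..n}" by (auto elim: pol_terms.cases)
 show ?case unfolding psupp_def
 proof (intro allI impI)
  fix \<iota> assume "app (pint0 n (PX i)) v \<iota> \<noteq> 0"
  then have *: "app Nop (\<lambda>m. v (\<iota>(i := m))) (\<iota> i) \<noteq> 0"
   using gop_supp by (simp add: x0_def)
  obtain x r where xr: "\<iota> i = (x, r)" by force
  obtain c where c: "c \<in> BB" "x \<in> BB" "r > 0" "tr (dl x * ipsi c) \<noteq> 0" "v (\<iota>(i := (c, r - 1))) \<noteq> 0"
   using Nop_supp[of _ x r] * xr by auto
  then have "par x = par c"
   using coord_parity[OF c(2) ipsi_homog[OF basis_par[OF c(1)]]] c(4) by metis
  moreover obtain r' where "r = Suc r'" using c(3) by (cases r) auto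
  moreover have "tpar n (\<iota>(i := (c, r - 1))) = q" using c(5) 2 unfolding psupp_def by blast
  ultimately show "tpar n \<iota> = \<epsilon> + q"
   unfolding tpar_upd[OF i] xr mpar_def by (auto simp: ac_simps distrib_left)
 qed
next
 case (3 p)
 show ?case by (simp add: psupp_def)
next
 case 4
 then show ?case using E0_diag unfolding psupp_def by auto
next
 case (5 p f g)
 from 5(5) have fg: "f \<in> pol_terms n" "g \<in> pol_terms n" by (auto elim: pol_terms.cases)
 have "psupp n (p + q) (app (pint0 n f) v)" "psupp n (p + q) (app (pint0 n g) v)" using 5 fg by blast+
 then show ?case unfolding psupp_def by (auto, metis add.right_neutral)
next
 case (6 p f p' g)
 from 6(5) have fg: "f \<in> pol_terms n" "g \<in> pol_terms n" by (auto elim: pol_terms.cases)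
 have "psupp n (p + (p' + q)) (app (pint0 n f) (app (pint0 n g) v))" using 6 fg by blast
 then show ?case by (simp add: add.assoc)
next
 case (7 p f c)
 from 7(3) have "f \<in> pol_terms n" by (auto elim: pol_terms.cases)
 then have "psupp n (p + q) (app (pint0 n f) v)" using 7 by blast
 then show ?case by (simp add: psupp_def) (metis mult_zero_right)
qed

lemma vac_psupp: "psupp n 0 (vac n)"
 unfolding psupp_def
proof (intro allI impI)
 fix \<iota> assume v: "vac n \<iota> \<noteq> 0"
 have "mpar (\<iota> k) = 0" if k: "k \<in> {1..n}" for k
 proof -
  have "(\<Prod>k\<in>{1..n}. factor 1 0 (\<iota> k)) \<noteq> 0" using v by (auto simp: vac_def pure_def)
  then have "factor 1 0 (\<iota> k) \<noteq> 0" using k by (meson finite_atLeastAtMost prod_zero)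
  then have *: "fst (\<iota> k) \<in> BB" "snd (\<iota> k) = 0" "tr (dl (fst (\<iota> k)) * 1) \<noteq> 0"
   by (auto simp: factor_def split: if_splits)
  then have "par (fst (\<iota> k)) = 0" using coord_parity[OF *(1) homog_one] by metis
  then show ?thesis using * by (simp add: mpar_def)
 qed
 then show "tpar n \<iota> = 0" by (simp add: tpar_def)
qed

text \<open>Even and odd elements send \<open>vac n\<close> to functions supported on indices of
  total parity 0 and 1. The supports are disjoint, so if the sum has an even representative, the odd
  part acts by zero.\<close>

lemma even_odd_unique:
 assumes "pol_eq A n f (PAdd f0 f1)" "pol_homog A 0 f0" "pol_homog A 1 f1" "pol_eq A n f f'" "pol_homog A 0 f'"
 shows "pol_eq A n f1 PZero"
proof (rule pol_faithful)
 interpret R: polrep A n "E0 n" "tok0 n" "x0 n" by (rule polrep0)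
 have "PAdd f0 f1 \<in> pol_terms n" using assms(1) pol_eq_terms by blast
 then show f1: "f1 \<in> pol_terms n" by (auto elim: pol_terms.cases)
 have f0: "f0 \<in> pol_terms n" using \<open>PAdd f0 f1 \<in> pol_terms n\<close> by (auto elim: pol_terms.cases)
 have f': "f' \<in> pol_terms n" using assms(4) pol_eq_terms by blast
 have e: "pint0 n f' = pint0 n f0 + pint0 n f1"
  using R.pint_cong[OF assms(1)] R.pint_cong[OF assms(4)] by simp
 fix \<iota>
 show "app (pint0 n f1) (vac n) \<iota> = 0"
 proof (rule ccontr)
  assume *: "app (pint0 n f1) (vac n) \<iota> \<noteq> 0"
  then have "tpar n \<iota> = 1"
   using pint0_psupp[OF assms(3) f1 vac_psupp] unfolding psupp_def by auto
  then have "app (pint0 n f0) (vac n) \<iota> = 0" "app (pint0 n f') (vac n) \<iota> = 0"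
   using pint0_psupp[OF assms(2) f0 vac_psupp] pint0_psupp[OF assms(5) f' vac_psupp] unfolding psupp_def by auto
  then show False using * e by simp
 qed
qed

subsection \<open>Even central regular elements\<close>

definition qrep :: "('k, 'a) pterm set => ('k, 'a) pterm" where
 "qrep Q = (SOME f. Q = pol_class A 1 f \<and> f \<in> pol_terms 1 \<and> pol_even A 1 f \<and> pol_central A 1 f \<and> pol_regular A 1 f)"

lemma qrep:
 assumes "Q \<in> pol_E A 1"
 shows "Q = pol_class A 1 (qrep Q)" "qrep Q \<in> pol_terms 1" "pol_even A 1 (qrep Q)"
  "pol_central A 1 (qrep Q)" "pol_regular A 1 (qrep Q)"
proof -
 have "\<exists>f. Q = pol_class A 1 f \<and> f \<in> pol_terms 1 \<and> pol_even A 1 f \<and> pol_central A 1 f \<and> pol_regular A 1 f"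
  using assms unfolding pol_E_def by blast
 from someI_ex[OF this] show "Q = pol_class A 1 (qrep Q)" "qrep Q \<in> pol_terms 1" "pol_even A 1 (qrep Q)"
  "pol_central A 1 (qrep Q)" "pol_regular A 1 (qrep Q)" unfolding qrep_def by blast+
qed

lemma qrep_eq:
 assumes "Q \<in> pol_E A 1" "Q = pol_class A 1 f"
 shows "pol_eq A 1 (qrep Q) f"
proof -
 have "pol_class A 1 f = pol_class A 1 (qrep Q)" using qrep(1)[OF assms(1)] assms(2) by simp
 moreover have "qrep Q \<in> pol_class A 1 (qrep Q)"
  unfolding pol_class_def using qrep(2)[OF assms(1)] by (simp add: pol_refl)
 ultimately show ?thesis unfolding pol_class_def by (auto intro: pol_sym)
qed

text \<open>Evenness makes the odd part in the definition of the supercenter vanish; the sign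
  disappears and centrality becomes ordinary commutation.\<close>

lemma qrep_commute:
 assumes Q: "Q \<in> pol_E A 1" and g: "g \<in> pol_terms 1" "pol_homog A q g"
 shows "pol_eq A 1 (PMul (qrep Q) g) (PMul g (qrep Q))"
proof -
 obtain f0 f1 where f: "pol_homog A 0 f0" "pol_homog A 1 f1" "pol_eq A 1 (qrep Q) (PAdd f0 f1)"
  "pol_eq A 1 (PMul (qrep Q) g) (PAdd (PMul g f0) (PSmul (koszul q) (PMul g f1)))"
  using qrep(4)[OF Q] g unfolding pol_central_def by blast
 obtain f' where "pol_eq A 1 (qrep Q) f'" "pol_homog A 0 f'"
  using qrep(3)[OF Q] unfolding pol_even_def by blast
 then have f1: "pol_eq A 1 f1 PZero" using even_odd_unique f by blast
 have "PAdd f0 f1 \<in> pol_terms 1" using f(3) pol_eq_terms by blast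
 then have T: "f0 \<in> pol_terms 1" "f1 \<in> pol_terms 1" by (auto elim: pol_terms.cases)
 have "pol_eq A 1 (qrep Q) (PAdd f0 f1)" by (rule f)
 also have "pol_eq A 1 ... (PAdd f0 PZero)" using T f1 by (intro pol_cong_add pol_refl)
 also have "pol_eq A 1 ... f0" using T by (intro pol_add_zero)
 finally have f0: "pol_eq A 1 (qrep Q) f0" .
 have "pol_eq A 1 (PMul (qrep Q) g) (PAdd (PMul g f0) (PSmul (koszul q) (PMul g f1)))" by (rule f)
 also have "pol_eq A 1 ... (PAdd (PMul g (qrep Q)) (PSmul (koszul q) (PMul g PZero)))"
  using g f0 f1 by (intro pol_cong_add pol_cong_mul pol_cong_smul pol_refl pol_sym[OF f0])
 also have "pol_eq A 1 ... (PAdd (PMul g (qrep Q)) PZero)"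
  using g qrep(2)[OF Q] pol.sc_zero[of 1 "koszul q"] mul_zero(1)[OF g(1)]
  by (intro pol_cong_add pol_refl pol_terms.intros) (blast intro: pol_trans pol_cong_smul)+
 also have "pol_eq A 1 ... (PMul g (qrep Q))" using g qrep(2)[OF Q] by (intro pol_add_zero pol_terms.intros)
 finally show ?thesis .
qed

definition Qv where "Qv d l Q = pv d l (qrep Q)"

lemma Qv_Loc:
 assumes "Q \<in> pol_E A 1" "l < d"
 shows "Loc d {Suc l} 0 (Qv d l Q)"
proof -
 obtain f' where f': "pol_eq A 1 (qrep Q) f'" "pol_homog A 0 f'"
  using qrep(3)[OF assms(1)] unfolding pol_even_def by blast
 have "f' \<in> pol_terms 1" using f'(1) pol_eq_terms by blast
 moreover have "{l + 1..l + 1} = {Suc l}" by auto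
 ultimately have "Loc d {Suc l} 0 (pv d l f')" using pv_Loc[OF f'(2), of 1 d l] by simp
 then show ?thesis unfolding Qv_def using pv_cong[OF f'(1), of l d] assms by simp
qed

lemma Qv_ev: "Q \<in> pol_E A 1 ==> l < d ==> ev d * Qv d l Q = Qv d l Q \<and> Qv d l Q * ev d = Qv d l Q"
 unfolding Qv_def using pv_ev[OF qrep(2), of Q l d] by simp

text \<open>On its own strand this is centrality in \<open>Pol\<^sub>1(A)\<close>. On the other
  strands it is locality, with trivial sign because \<open>Q\<close> is even.\<close>

lemma Qv_tok:
 assumes Q: "Q \<in> pol_E A 1" and l: "l < d" and j: "j \<in> {1..d}"
 shows "Qv d l Q * tokv d j a = tokv d j a * Qv d l Q"
proof -
 interpret V: polrep A d "ev d" "tokv d" "xv d" by (rule polrepv)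
 show ?thesis
 proof (induction a rule: homog_induct)
  case (add a b)
  then show ?case using V.tok_add[OF j] by (simp add: distrib_left distrib_right)
 next
  case (homog a p)
  show ?case
  proof (cases "j = Suc l")
   case True
   have "pol_eq A 1 (PMul (qrep Q) (PTok 1 a)) (PMul (PTok 1 a) (qrep Q))"
    using homog by (intro qrep_commute[OF Q]) (auto intro: pol_terms.intros pol_homog.intros)
   then have "pv d l (PMul (qrep Q) (PTok 1 a)) = pv d l (PMul (PTok 1 a) (qrep Q))" using l by (intro pv_cong) auto
   then show ?thesis using True by (simp add: Qv_def)
  next
   case False
   have "Loc d {j} p (tokv d j a)" using homog by (intro Loc.intros) auto
   from Loc_commute[OF this Qv_Loc[OF Q l]] show ?thesis using False j l by auto
  qed
 qed
qed

lemma Qv_x: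
 assumes Q: "Q \<in> pol_E A 1" and l: "l < d" and j: "j \<in> {1..d}"
 shows "Qv d l Q * xv d j = xv d j * Qv d l Q"
proof (cases "j = Suc l")
 case True
 have "pol_eq A 1 (PMul (qrep Q) (PX 1)) (PMul (PX 1) (qrep Q))"
  by (intro qrep_commute[OF Q]) (auto intro: pol_terms.intros pol_homog.intros)
 then have "pv d l (PMul (qrep Q) (PX 1)) = pv d l (PMul (PX 1) (qrep Q))" using l by (intro pv_cong) auto
 then show ?thesis using True by (simp add: Qv_def)
next
 case False
 have "Loc d {j} \<epsilon> (xv d j)" by (intro Loc.intros) auto
 from Loc_commute[OF this Qv_Loc[OF Q l]] show ?thesis using False j l by auto
qed

lemma Qv_pv:
 assumes Q: "Q \<in> pol_E A 1" and l: "l < d" and f: "f \<in> pol_terms m" and lm: "l' + m \<le> d"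
 shows "Qv d l Q * pv d l' f = pv d l' f * Qv d l Q"
 using f
proof (induction rule: pol_terms_induct_in)
 case (1 i a)
 then show ?case using Qv_tok[OF Q l, of "l' + i" a] lm by simp
next
 case (2 i)
 then show ?case using Qv_x[OF Q l, of "l' + i"] lm by simp
next
 case 4
 then show ?case using Qv_ev[OF Q l] by simp
next
 case (6 f g)
 then show ?case unfolding pv_simps by (intro comm_mult)
qed (simp_all add: distrib_left distrib_right)

lemma qrep_shift: "g \<in> pol_terms 1 ==> pv d l (pol_perm (st 1) g) = pv d (Suc l) g"
proof (induction rule: pol_terms_induct_in)
 case (1 i a)
 then have "i = 1" by simp
 then show ?case by (simp add: numeral_2_eq_2)
next
 case (2 i)
 then have "i = 1" by simp
 then show ?case by simp
qed auto

text \<open>The string of signs is an involution and \<open>E0 d\<close> fixes \<open>v\<close>, so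
  both can be stripped off without changing the kernel.\<close>

lemma gop_kernel:
 assumes "goodop p f" "app (E0 d) v = v" "app (gop d k p f) v = (\<lambda>_. 0)"
 shows "app (Lop k f) v = (\<lambda>_. 0)"
proof -
 have "E0 d * Lop k f = Lop k f * E0 d"
  using assms(1) by (intro E0_Lop) (auto simp: goodop_def)
 then have "E0 d * (JW k p * Lop k f) = (JW k p * Lop k f) * E0 d"
  by (rule comm_mult[OF E0_JW])
 then have "app (gop d k p f) v = app (JW k p) (app (Lop k f) v)"
  unfolding gop_def using assms(2) by simp
 then have "app (JW k p) (app (Lop k f) v) = (\<lambda>_. 0)" using assms(3) by simp
 then have "app (JW k p * JW k p) (app (Lop k f) v) = (\<lambda>_. 0)"
  by (simp only: times_lop.rep_eq app_zero)
 then show ?thesis by (simp only: JW_add bit_add_self JW_0 one_lop.rep_eq)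
qed

lemma E0_bad: "i \<in> {1..d} ==> fst (\<iota> i) \<notin> BB ==> app (E0 d) v \<iota> = 0"
proof (induction d arbitrary: v)
 case (Suc d)
 show ?case
 proof (cases "i = Suc d")
  case True
  have "app (Lop (Suc d) Eop) v \<iota> = 0"
   using Suc.prems True by (cases "\<iota> (Suc d)") (auto simp: Lop.rep_eq Eop.rep_eq)
  then show ?thesis using E0_diag by simp
 next
  case False
  then show ?thesis using Suc by simp
 qed
qed simp

lemma x0_injective:
 assumes "i \<in> {1..d}" "app (E0 d) v = v" "app (x0 d i) v = (\<lambda>_. 0)"
 shows "v = (\<lambda>_. 0)"
proof
 fix \<iota>
 have L: "app (Lop i Nop) v = (\<lambda>_. 0)"
  using gop_kernel[OF goodop_N assms(2)] assms(3) by (simp add: x0_def)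
 show "v \<iota> = 0"
 proof (cases "fst (\<iota> i) \<in> BB")
  case True
  have "app Nop (\<lambda>m. v (\<iota>(i := m))) m = 0" for m
   using fun_cong[OF L, of "\<iota>(i := m)"] by (simp add: Lop.rep_eq)
  then have "v (\<iota>(i := (fst (\<iota> i), snd (\<iota> i)))) = 0" using True by (rule Nop_injective)
  then show ?thesis by (simp add: fun_upd_idem)
 next
  case False
  then show ?thesis using E0_bad[OF assms(1), of \<iota> v] assms(2) by simp
 qed
qed

definition dbound :: "nat => ((nat => 'a \<times> nat) => 'k) => bool" where
 "dbound m v \<longleftrightarrow> (\<forall>\<iota>. v \<iota> \<noteq> 0 \<longrightarrow> snd (\<iota> 2) \<le> m)"

lemma dbound_mono: "dbound m v ==> m \<le> n ==> dbound n v"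
 unfolding dbound_def by force

lemma gop_M_dbound: "dbound m v ==> dbound m (app (gop d i p (Mop a)) v)"
 unfolding dbound_def
proof (intro allI impI)
 fix \<iota> assume v: "\<forall>\<iota>. v \<iota> \<noteq> 0 \<longrightarrow> snd (\<iota> 2) \<le> m" and "app (gop d i p (Mop a)) v \<iota> \<noteq> 0"
 then have *: "app (Mop a) (\<lambda>m. v (\<iota>(i := m))) (\<iota> i) \<noteq> 0" by (intro gop_supp)
 obtain x r where xr: "\<iota> i = (x, r)" by force
 obtain c where "v (\<iota>(i := (c, r))) \<noteq> 0" using Mop_supp[of a _ x r] * xr by auto
 then have "snd ((\<iota>(i := (c, r))) 2) \<le> m" using v by blast
 then show "snd (\<iota> 2) \<le> m" using xr by (auto split: if_splits)
qed

lemma x0_dbound: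
 "dbound m v ==> dbound (m + 1) (app (x0 d i) v)" "dbound m v ==> i \<noteq> 2 ==> dbound m (app (x0 d i) v)"
proof -
 assume v: "dbound m v"
 have "snd (\<iota> 2) \<le> m + 1 \<and> (i \<noteq> 2 \<longrightarrow> snd (\<iota> 2) \<le> m)" if "app (x0 d i) v \<iota> \<noteq> 0" for \<iota>
 proof -
  have *: "app Nop (\<lambda>m. v (\<iota>(i := m))) (\<iota> i) \<noteq> 0" using that unfolding x0_def by (intro gop_supp)
  obtain x r where xr: "\<iota> i = (x, r)" by force
  obtain c where "r > 0" "v (\<iota>(i := (c, r - 1))) \<noteq> 0" using Nop_supp[of _ x r] * xr by auto
  then have "snd ((\<iota>(i := (c, r - 1))) 2) \<le> m" using v unfolding dbound_def by blast
  then show ?thesis using xr by (auto split: if_splits)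
 qed
 then show "dbound (m + 1) (app (x0 d i) v)" "i \<noteq> 2 ==> dbound m (app (x0 d i) v)"
  unfolding dbound_def by blast+
qed

lemma x0_lbound:
 assumes "\<And>\<iota>. v \<iota> \<noteq> 0 ==> N \<le> snd (\<iota> 2)" "app (x0 d 2) v \<iota> \<noteq> 0"
 shows "Suc N \<le> snd (\<iota> 2)"
proof -
 have *: "app Nop (\<lambda>m. v (\<iota>(2 := m))) (\<iota> 2) \<noteq> 0" using assms(2) unfolding x0_def by (intro gop_supp)
 obtain x r where xr: "\<iota> 2 = (x, r)" by force
 obtain c where c: "r > 0" "v (\<iota>(2 := (c, r - 1))) \<noteq> 0" using Nop_supp[of _ x r] * xr by auto
 then have "N \<le> r - 1" using assms(1)[OF c(2)] by simp
 then show ?thesis using xr c(1) by simp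
qed

lemma pint0_dbound: "f \<in> pol_terms 2 ==> \<exists>m. \<forall>n v. dbound n v \<longrightarrow> dbound (n + m) (app (pint0 2 f) v)"
proof (induction rule: pol_terms_induct_in)
 case (1 i a)
 have "dbound n (app (pint0 2 (PTok i a)) v)" if "dbound n v" for n v
 proof -
  have "dbound n (app (gop 2 i 0 (Mop (part 0 a))) v)" "dbound n (app (gop 2 i 1 (Mop (part 1 a))) v)"
   using that by (auto intro: gop_M_dbound)
  then show ?thesis unfolding dbound_def by (auto simp: tok0_def) (metis add.left_neutral)
 qed
 then show ?case by (intro exI[of _ 0]) auto
next
 case (2 i)
 then show ?case using x0_dbound(1) by (intro exI[of _ 1]) auto
next
 case 4
 have "dbound n (app (E0 2) v)" if "dbound n v" for n v
  using that E0_diag unfolding dbound_def by blast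
 then show ?case by (intro exI[of _ 0]) auto
next
 case (5 f g)
 then obtain m m' where *: "\<And>n v. dbound n v ==> dbound (n + m) (app (pint0 2 f) v)"
  "\<And>n v. dbound n v ==> dbound (n + m') (app (pint0 2 g) v)" by blast
 have "dbound (n + (m + m')) (app (pint0 2 (PAdd f g)) v)" if "dbound n v" for n v
 proof -
  have "dbound (n + (m + m')) (app (pint0 2 f) v)" "dbound (n + (m + m')) (app (pint0 2 g) v)"
   using *[OF that] by (auto elim: dbound_mono)
  then show ?thesis unfolding dbound_def by (auto, metis add.left_neutral)
 qed
 then show ?case by blast
next
 case (6 f g)
 then obtain m m' where *: "\<And>n v. dbound n v ==> dbound (n + m) (app (pint0 2 f) v)"
  "\<And>n v. dbound n v ==> dbound (n + m') (app (pint0 2 g) v)" by blast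
 have "dbound (n + (m' + m)) (app (pint0 2 (PMul f g)) v)" if "dbound n v" for n v
  using *(1)[OF *(2)[OF that]] by (simp add: add.assoc)
 then show ?case by blast
next
 case (7 f c)
 then obtain m where "\<And>n v. dbound n v ==> dbound (n + m) (app (pint0 2 f) v)" by blast
 then show ?case by (intro exI[of _ m]) (simp add: dbound_def, metis mult_zero_right)
qed (auto simp: dbound_def)

lemma pol_terms_mono: "f \<in> pol_terms m ==> m \<le> n ==> f \<in> pol_terms n"
 by (induction rule: pol_terms.induct) (auto intro: pol_terms.intros)

text \<open>
 Comparing degrees in the second variable shows that an element \<open>E\<close> of \<open>Pol\<^sub>2(A)\<close> with
 \<open>E x\<^sub>1 = x\<^sub>2 E\<close> vanishes.
\<close>

lemma swap_intertwiner_zero: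
 assumes E: "E \<in> pol_terms 2" and sw: "pint0 2 E * x0 2 1 = x0 2 2 * pint0 2 E"
 shows "pol_eq A 2 E PZero"
proof (rule pol_faithful[OF E])
 fix \<iota>
 interpret R: polrep A 2 "E0 2" "tok0 2" "x0 2" by (rule polrep0)
 obtain m where m: "\<And>n v. dbound n v ==> dbound (n + m) (app (pint0 2 E) v)" using pint0_dbound[OF E] by blast
 let ?x1 = "app (x0 2 1)" and ?x2 = "app (x0 2 2)" and ?v = "vac 2"
 \<comment> \<open>On the left the degree in the second variable stays bounded independently of
   \<open>N\<close>, on the right it is at least \<open>N\<close>. So a power of
   \<open>x\<^sub>2\<close> kills the image of the vacuum vector, and \<open>x\<^sub>2\<close> is
   injective.\<close>
 have pow: "app (pint0 2 E) ((?x1 ^^ N) v) = (?x2 ^^ N) (app (pint0 2 E) v)" for N v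
 proof (induction N arbitrary: v)
  case (Suc N)
  have "app (pint0 2 E) (?x1 ((?x1 ^^ N) v)) = app (pint0 2 E * x0 2 1) ((?x1 ^^ N) v)" by simp
  also have "... = ?x2 (app (pint0 2 E) ((?x1 ^^ N) v))" unfolding sw by simp
  finally show ?case using Suc by simp
 qed simp
 have v0: "dbound 0 ?v" unfolding dbound_def
 proof (intro allI impI)
  fix \<iota> assume "vac 2 \<iota> \<noteq> 0"
  then have "(\<Prod>k\<in>{1..2}. factor 1 0 (\<iota> k)) \<noteq> 0" by (auto simp: vac_def pure_def)
  then have "factor 1 0 (\<iota> 2) \<noteq> 0" by (meson atLeastAtMost_iff finite_atLeastAtMost one_le_numeral order_refl prod_zero)
  then show "snd (\<iota> 2) \<le> 0" by (auto simp: factor_def split: if_splits)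
 qed
 have "dbound 0 ((?x1 ^^ N) ?v)" for N
  by (induction N) (auto simp: v0 intro!: x0_dbound(2))
 then have ub: "dbound m ((?x2 ^^ N) (app (pint0 2 E) ?v))" for N
  using m[of 0 "(?x1 ^^ N) ?v"] by (simp add: pow)
 have lb: "(?x2 ^^ N) w \<iota> \<noteq> 0 ==> N \<le> snd (\<iota> 2)" for N w \<iota>
  by (induction N arbitrary: \<iota>) (auto intro: x0_lbound)
 have z: "(?x2 ^^ Suc m) (app (pint0 2 E) ?v) = (\<lambda>_. 0)"
 proof (rule ext, rule ccontr)
  fix \<iota> assume "(?x2 ^^ Suc m) (app (pint0 2 E) ?v) \<iota> \<noteq> 0"
  then show False using lb[of "Suc m" _ \<iota>] ub[of "Suc m"] unfolding dbound_def by fastforce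
 qed
 have e2: "app (E0 2) ((?x2 ^^ N) w) = (?x2 ^^ N) w" if "app (E0 2) w = w" for N w
 proof (cases N)
  case (Suc N')
  have "app (E0 2) (?x2 ((?x2 ^^ N') w)) = app (E0 2 * x0 2 2) ((?x2 ^^ N') w)" by simp
  also have "... = ?x2 ((?x2 ^^ N') w)" using R.e_x[of 2] by simp
  finally show ?thesis using Suc by simp
 qed (simp add: that)
 have inj: "(?x2 ^^ N) w = (\<lambda>_. 0) ==> app (E0 2) w = w ==> w = (\<lambda>_. 0)" for N w
 proof (induction N)
  case (Suc N)
  then show ?case using x0_injective[of 2 2 "(?x2 ^^ N) w"] e2[of w N] by simp
 qed simp
 have "app (E0 2) (app (pint0 2 E) ?v) = app (E0 2 * pint0 2 E) ?v" by simp
 also have "... = app (pint0 2 E) ?v" using R.pint_e[OF E] by simp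
 finally have "app (pint0 2 E) ?v = (\<lambda>_. 0)" using inj[OF z] by blast
 then show "app (pint0 2 E) ?v \<iota> = 0" by simp
qed

lemma pol_perm_involution: "pol_perm (st k) (pol_perm (st k) f) = f"
 by (induction f) auto

text \<open>With \<open>S = Q\<^sub>1 + Q\<^sub>2\<close> the element acts as the commutator
  \<open>S T - T S\<close> with the crossing \<open>T\<close>. Since \<open>S\<close> commutes with
  dots and teleporters, this commutator turns a dot on the first strand into a dot on the second
  without error, and \<open>swap_intertwiner_zero\<close> applies.\<close>

lemma demazure_symmetric:
 assumes Q: "Q \<in> pol_E A 1" and g: "pol_eq A 1 (qrep Q) g"
 shows "pol_eq A 2 (PAdd (demazure A 1 g) (demazure A 1 (pol_perm (st 1) g))) PZero"
proof (rule swap_intertwiner_zero)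
 interpret V: polrep A 2 "ev 2" "tokv 2" "xv 2" by (rule polrepv)
 have g1: "g \<in> pol_terms 1" using g pol_eq_terms by blast
 then have g2: "g \<in> pol_terms 2" by (rule pol_terms_mono) simp
 let ?g' = "pol_perm (st 1) g"
 have g': "?g' \<in> pol_terms 2" by (rule pol_perm_terms[OF g2 st_in]) auto
 define E where "E = PAdd (demazure A 1 g) (demazure A 1 ?g')"
 have E: "E \<in> pol_terms 2" unfolding E_def using g2 g' by (intro pol_terms.intros demazure_terms) auto
 then show "PAdd (demazure A 1 g) (demazure A 1 ?g') \<in> pol_terms 2" by (simp only: E_def)
 let ?T = "Tv 2 1" and ?Q1 = "Qv 2 0 Q" and ?Q2 = "Qv 2 1 Q"
 have q: "pv 2 0 g = ?Q1" "pv 2 0 ?g' = ?Q2"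
  using pv_cong[OF g, of 0 2] pv_cong[OF g, of 1 2] qrep_shift[OF g1, of 2 0]
  by (auto simp: Qv_def One_nat_def numeral_2_eq_2)
 have T1: "?T * ?Q1 = ?Q2 * ?T - pv 2 0 (demazure A 1 g)"
  using Tv_pv[OF g2, of 0 2 1] q by (simp add: One_nat_def numeral_2_eq_2)
 have T2: "?T * ?Q2 = ?Q1 * ?T - pv 2 0 (demazure A 1 ?g')"
  using Tv_pv[OF g', of 0 2 1] q pol_perm_involution[of 1 g] by (simp add: One_nat_def numeral_2_eq_2)
 define S where "S = ?Q1 + ?Q2"
 have Y: "pv 2 0 E = S * ?T - ?T * S"
  by (simp add: E_def S_def distrib_left distrib_right T1 T2)
 have Sx: "S * xv 2 j = xv 2 j * S" if "j \<in> {1..2}" for j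
  using Qv_x[OF Q _ that, of 0] Qv_x[OF Q _ that, of 1] by (simp add: S_def distrib_left distrib_right)
 have St: "S * tokv 2 j a = tokv 2 j a * S" if "j \<in> {1..2}" for j a
  using Qv_tok[OF Q _ that, of 0] Qv_tok[OF Q _ that, of 1] by (simp add: S_def distrib_left distrib_right)
 let ?t = "V.tele 1 2"
 have "V.tele 1 2 * S = sm (koszul (0 * \<epsilon>)) (S * V.tele 1 2)"
  using St by (intro V.tele_pass) auto
 then have tS: "?t * S = S * ?t" by simp
 have Tx: "?T * xv 2 1 = xv 2 2 * ?T - ?t"
  using Tv_xv[of 1 2 1] by (simp add: tau_def One_nat_def numeral_2_eq_2)
 have "pv 2 0 E * xv 2 1 = S * (?T * xv 2 1) - ?T * (S * xv 2 1)"
  by (simp only: Y left_diff_distrib mult.assoc)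
 also have "... = S * (?T * xv 2 1) - (?T * xv 2 1) * S" by (simp add: Sx mult.assoc)
 also have "... = (S * xv 2 2) * ?T - S * ?t - (xv 2 2 * ?T * S - ?t * S)"
  by (simp only: Tx right_diff_distrib left_diff_distrib mult.assoc)
 also have "... = xv 2 2 * (S * ?T - ?T * S)"
  by (simp add: Sx tS right_diff_distrib mult.assoc)
 finally have YX: "pv 2 0 (PMul E (PX 1)) = pv 2 0 (PMul (PX 2) E)" by (simp only: pv_simps(2,6) Y add_0)
 have "pint0 2 E * x0 2 1 = x0 2 2 * pint0 2 E"
 proof (rule lop_eqI)
  fix v \<iota>
  have "app (pint0 2 (PMul E (PX 1))) v \<iota> = app (pint0 2 (PMul (PX 2) E)) v \<iota>"
   using pv_id[of 2 0 "PMul E (PX 1)" "\<lambda>(u, \<iota>). v \<iota>" \<iota>] pv_id[of 2 0 "PMul (PX 2) E" "\<lambda>(u, \<iota>). v \<iota>" \<iota>]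
   unfolding YX by simp
  then show "app (pint0 2 E * x0 2 1) v \<iota> = app (x0 2 2 * pint0 2 E) v \<iota>" by simp
 qed
 then show "pint0 2 (PAdd (demazure A 1 g) (demazure A 1 ?g')) * x0 2 1 = x0 2 2 * pint0 2 (PAdd (demazure A 1 g) (demazure A 1 ?g'))"
  by (simp only: E_def)
qed

text \<open>The first formula is the Demazure rule. In the second the Demazure operator acts on
  \<open>Q\<^sub>2\<close>, and \<open>demazure_symmetric\<close> trades it for the one on
  \<open>Q\<^sub>1\<close> with the opposite sign.\<close>

lemma Tv_Qv:
 assumes Q: "Q \<in> pol_E A 1" and g: "pol_eq A 1 (qrep Q) g" and l: "Suc l < d"
 shows "Tv d (Suc l) * Qv d l Q = Qv d (Suc l) Q * Tv d (Suc l) - pv d l (demazure A 1 g)"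
  and "Tv d (Suc l) * Qv d (Suc l) Q = Qv d l Q * Tv d (Suc l) + pv d l (demazure A 1 g)"
proof -
 have g1: "g \<in> pol_terms 1" using g pol_eq_terms by blast
 then have g2: "g \<in> pol_terms 2" by (rule pol_terms_mono) simp
 let ?g' = "pol_perm (st 1) g"
 have g': "?g' \<in> pol_terms 2" by (rule pol_perm_terms[OF g2 st_in]) auto
 have q: "pv d l g = Qv d l Q" "pv d l ?g' = Qv d (Suc l) Q"
  using pv_cong[OF g, of l d] pv_cong[OF g, of "Suc l" d] qrep_shift[OF g1, of d l] l by (auto simp: Qv_def)
 show "Tv d (Suc l) * Qv d l Q = Qv d (Suc l) Q * Tv d (Suc l) - pv d l (demazure A 1 g)"
  using Tv_pv[OF g2, of l d 1] l q by (simp add: One_nat_def numeral_2_eq_2)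
 have "pv d l (PAdd (demazure A 1 g) (demazure A 1 ?g')) = pv d l PZero"
  using l by (intro pv_cong[OF demazure_symmetric[OF Q g]]) (simp add: numeral_2_eq_2)
 then have "pv d l (demazure A 1 ?g') = - pv d l (demazure A 1 g)"
  by (simp add: eq_neg_iff_add_eq_0 add.commute)
 then show "Tv d (Suc l) * Qv d (Suc l) Q = Qv d l Q * Tv d (Suc l) + pv d l (demazure A 1 g)"
  using Tv_pv[OF g', of l d 1] l q pol_perm_involution[of 1 g] by (simp add: One_nat_def numeral_2_eq_2)
qed

end

section \<open>Soundness of the representation of the category\<close>

subsection \<open>Typing of morphism terms\<close>

text \<open>Source, target and well-formedness computed by recursion replace the relation
  \<open>law_term\<close>, so that typing conditions are settled by simplification.\<close>

primrec msrc :: "('k, 'a) mor => ('k, 'a) word" where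
 "msrc (Ident u) = u"
| "msrc Cross = [None, None]"
| "msrc (Tok a) = [None]"
| "msrc Dot = [None]"
| "msrc (Rho Q) = [Some Q, None]"
| "msrc (Lam Q) = [None, Some Q]"
| "msrc (g \<cdot> f) = msrc f"
| "msrc (f \<star> g) = msrc f @ msrc g"
| "msrc (Zero u v) = u"
| "msrc (Add f g) = msrc f"
| "msrc (Smul c f) = msrc f"

primrec mtgt :: "('k, 'a) mor => ('k, 'a) word" where
 "mtgt (Ident u) = u"
| "mtgt Cross = [None, None]"
| "mtgt (Tok a) = [None]"
| "mtgt Dot = [None]"
| "mtgt (Rho Q) = [None, Some Q]"
| "mtgt (Lam Q) = [Some Q, None]"
| "mtgt (g \<cdot> f) = mtgt g"
| "mtgt (f \<star> g) = mtgt f @ mtgt g"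
| "mtgt (Zero u v) = v"
| "mtgt (Add f g) = mtgt f"
| "mtgt (Smul c f) = mtgt f"

primrec mwt :: "('k::comm_ring_1, 'a::{ring,monoid_mult}) frob => ('k, 'a) mor => bool" where
 "mwt A (Ident u) \<longleftrightarrow> u \<in> law_objects A"
| "mwt A Cross \<longleftrightarrow> True"
| "mwt A (Tok a) \<longleftrightarrow> True"
| "mwt A Dot \<longleftrightarrow> True"
| "mwt A (Rho Q) \<longleftrightarrow> Q \<in> pol_E A 1"
| "mwt A (Lam Q) \<longleftrightarrow> Q \<in> pol_E A 1"
| "mwt A (g \<cdot> f) \<longleftrightarrow> mwt A g \<and> mwt A f \<and> msrc g = mtgt f"
| "mwt A (f \<star> g) \<longleftrightarrow> mwt A f \<and> mwt A g"
| "mwt A (Zero u v) \<longleftrightarrow> u \<in> law_objects A \<and> v \<in> law_objects A"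
| "mwt A (Add f g) \<longleftrightarrow> mwt A f \<and> mwt A g \<and> msrc f = msrc g \<and> mtgt f = mtgt g"
| "mwt A (Smul c f) \<longleftrightarrow> mwt A f"

lemma law_term_iff: "law_term A u v f \<longleftrightarrow> mwt A f \<and> msrc f = u \<and> mtgt f = v"
proof
 show "law_term A u v f ==> mwt A f \<and> msrc f = u \<and> mtgt f = v"
  by (induction rule: law_term.induct) auto
 have "mwt A f ==> law_term A (msrc f) (mtgt f) f"
  by (induction f) (auto intro: law_term.intros)
 then show "mwt A f \<and> msrc f = u \<and> mtgt f = v ==> law_term A u v f" by blast
qed

lemma law_objects_simps [simp]:
 "[] \<in> law_objects A" "None # u \<in> law_objects A \<longleftrightarrow> u \<in> law_objects A"
 "Some Q # u \<in> law_objects A \<longleftrightarrow> Q \<in> pol_E A 1 \<and> u \<in> law_objects A"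
 "u @ v \<in> law_objects A \<longleftrightarrow> u \<in> law_objects A \<and> v \<in> law_objects A"
 by (auto simp: law_objects_def)

lemma mwt_objects: "mwt A f ==> msrc f \<in> law_objects A \<and> mtgt f \<in> law_objects A"
 by (induction f) auto

lemma msum_st:
 "(\<And>f. f \<in> set fs ==> msrc f = u) ==> msrc (msum u v fs) = u"
 "(\<And>f. f \<in> set fs ==> mtgt f = v) ==> mtgt (msum u v fs) = v"
 by (induction fs) auto

lemma msum_typed:
 assumes "\<And>f. f \<in> set fs ==> mwt A f \<and> msrc f = u \<and> mtgt f = v" "u \<in> law_objects A" "v \<in> law_objects A"
 shows "mwt A (msum u v fs)"
 using assms by (induction fs) (auto simp: msum_st)

lemma mpow_st [simp]: "msrc (mpow f u r) = u" "mtgt f = u ==> mtgt (mpow f u r) = u"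
 by (induction r) auto

lemma mpow_typed: "mwt A f ==> msrc f = u ==> mtgt f = u ==> u \<in> law_objects A ==> mwt A (mpow f u r)"
 by (induction r) auto

lemma bracket_typed [simp]: "mwt A (bracket as)" "msrc (bracket as) = [None]" "mtgt (bracket as) = [None]"
 unfolding bracket_def by (auto intro!: msum_typed msum_st simp: mpow_typed)

lemma bracket2_typed [simp]:
 "Q \<in> pol_E A 1 ==> mwt A (bracket2 Q ms)"
 "Q \<in> pol_E A 1 ==> msrc (bracket2 Q ms) = [None, Some Q, None]"
 "Q \<in> pol_E A 1 ==> mtgt (bracket2 Q ms) = [None, Some Q, None]"
 unfolding bracket2_def by (auto intro!: msum_typed msum_st simp: mpow_typed)

lemma sigma_dot_typed:
 "mwt A (msum [None, None] [None, None] (map (\<lambda>b. Smul (f b) (Tok b \<star> Tok (g b))) bs))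
  \<and> msrc (msum [None, None] [None, None] (map (\<lambda>b. Smul (f b) (Tok b \<star> Tok (g b))) bs)) = [None, None]
  \<and> mtgt (msum [None, None] [None, None] (map (\<lambda>b. Smul (f b) (Tok b \<star> Tok (g b))) bs)) = [None, None]"
 by (auto intro!: msum_typed msum_st)

lemma law_eq_typed: "law_eq A u v f g ==> law_term A u v f \<and> law_term A u v g"
proof (induction rule: law_eq.induct)
 case law_sigma_dot
 then show ?case unfolding law_term_iff by (auto simp: sigma_dot_typed intro!: msum_typed msum_st)
qed (auto simp: law_term_iff dest: mwt_objects)

abbreviation nb :: "('k, 'a) word => nat" where "nb u \<equiv> count_list u None"

subsection \<open>Interpretation of the category\<close>

context frobenius_superalgebra
begin

text \<open>
  \<open>Fi d f l\<close> is the operator of \<open>f\<close> placed to the right of \<open>l\<close> black strands. The number of black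
  strands to its right does not matter.
\<close>

primrec Fi :: "nat => ('k, 'a) mor => nat => ((nat => nat) \<times> (nat => 'a \<times> nat), 'k) lop" where
 "Fi d (Ident u) = (\<lambda>l. ev d)"
| "Fi d Cross = (\<lambda>l. Tv d (Suc l))"
| "Fi d (Tok a) = (\<lambda>l. tokv d (Suc l) a)"
| "Fi d Dot = (\<lambda>l. xv d (Suc l))"
| "Fi d (Rho Q) = (\<lambda>l. Qv d l Q)"
| "Fi d (Lam Q) = (\<lambda>l. ev d)"
| "Fi d (g \<cdot> f) = (\<lambda>l. Fi d g l * Fi d f l)"
| "Fi d (f \<star> g) = (\<lambda>l. Fi d f l * Fi d g (l + nb (msrc f)))"
| "Fi d (Zero u v) = (\<lambda>l. 0)"
| "Fi d (Add f g) = (\<lambda>l. Fi d f l + Fi d g l)"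
| "Fi d (Smul c f) = (\<lambda>l. sm c (Fi d f l))"

text \<open>All generating morphisms preserve the number of black strands, so only
  \<open>Zero\<close> can change it. Terms may still be composed through words with a different
  number, and such composites have to act as zero.\<close>

lemma Fi_zero: "mwt A f ==> nb (msrc f) \<noteq> nb (mtgt f) ==> Fi d f l = 0"
proof (induction f arbitrary: l)
 case (Comp g f)
 then show ?case by (cases "nb (msrc f) = nb (mtgt f)") auto
next
 case (Tens f g)
 then show ?case by (cases "nb (msrc f) = nb (mtgt f)") auto
qed auto

lemma Fi_ev: "mwt A f ==> l + nb (msrc f) \<le> d ==> ev d * Fi d f l = Fi d f l \<and> Fi d f l * ev d = Fi d f l"
proof (induction f arbitrary: l)
 interpret V: polrep A d "ev d" "tokv d" "xv d" by (rule polrepv)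
 {
  case Ident
  show ?case by (simp add: V.e_idem)
 next
  case Cross
  then show ?case using Tv_ev(1)[of "Suc l" d] Tv_ev(2)[of d "Suc l"] by simp
 next
  case Tok
  then show ?case by (simp add: V.e_tok V.tok_e)
 next
  case Dot
  then show ?case by (simp add: V.e_x V.x_e)
 next
  case (Rho Q)
  then show ?case using Qv_ev[of Q l d] by simp
 next
  case Lam
  show ?case by (simp add: V.e_idem)
 next
  case (Comp g f)
  show ?case
  proof (cases "nb (msrc f) = nb (mtgt f)")
   case True
   then have "ev d * Fi d g l = Fi d g l" "Fi d f l * ev d = Fi d f l" using Comp by auto
   then show ?thesis by (simp add: mult.assoc) (simp add: mult.assoc[symmetric])
  next
   case False
   then show ?thesis using Fi_zero Comp.prems by simp
  qed
 next
  case (Tens f g)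
  then have "ev d * Fi d f l = Fi d f l" "Fi d g (l + nb (msrc f)) * ev d = Fi d g (l + nb (msrc f))" by auto
  then show ?case by (simp add: mult.assoc) (simp add: mult.assoc[symmetric])
 }
qed (auto simp: distrib_left distrib_right)

text \<open>Red strands are invisible to the operators, so a morphism placed after \<open>l\<close>
  black strands is generated on the black strands that it occupies.\<close>

lemma Fi_Loc:
 "law_homog A p f ==> mwt A f ==> l + nb (msrc f) \<le> d ==> Loc d {l + 1..l + nb (msrc f)} p (Fi d f l)"
proof (induction arbitrary: l rule: law_homog.induct)
 case (5 Q)
 then have "Loc d {Suc l} 0 (Qv d l Q)" by (intro Qv_Loc) auto
 then show ?case by (auto elim: Loc_mono)
next
 case (7 p g q f)
 show ?case
 proof (cases "nb (msrc f) = nb (mtgt f)")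
  case True
  then show ?thesis using 7 by (auto intro!: Loc.intros)
 next
  case False
  then show ?thesis using Fi_zero 7 by (auto intro: Loc.intros)
 qed
next
 case (8 p f q g)
 then have "Loc d {l + 1..l + nb (msrc f)} p (Fi d f l)"
  "Loc d {l + nb (msrc f) + 1..l + nb (msrc f) + nb (msrc g)} q (Fi d g (l + nb (msrc f)))" by auto
 then have "Loc d {l + 1..l + nb (msrc (f \<star> g))} p (Fi d f l)"
  "Loc d {l + 1..l + nb (msrc (f \<star> g))} q (Fi d g (l + nb (msrc f)))" by (auto elim!: Loc_mono)
 then show ?case by (auto intro!: Loc.intros)
qed (auto intro: Loc.intros)

lemma Fi_commute:
 assumes "mwt A f" "mwt A g" "law_homog A p f" "law_homog A q g" "l + nb (msrc f) \<le> l'" "l' + nb (msrc g) \<le> d"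
 shows "Fi d g l' * Fi d f l = sm (koszul (p * q)) (Fi d f l * Fi d g l')"
 using Loc_commute[OF Fi_Loc[OF assms(3,1), of l d] Fi_Loc[OF assms(4,2), of l' d]] assms(5,6) by auto

lemma Fi_msum: "Fi d (msum u v fs) l = sum_list (map (\<lambda>f. Fi d f l) fs)"
 by (induction fs) auto

lemma Fi_mpow: "Fi d (mpow Dot [None] r) l = pv d l (ppow (PX 1) r)"
 by (induction r) auto

lemma Fi_bracket: "Fi d (bracket as) l = pv d l (pol_coeffs 1 as)"
 by (simp add: bracket_def pol_coeffs_def Fi_msum pv_psum o_def Fi_mpow)

lemma ppow_x_typed: "i \<in> {1..n} ==> ppow (PX i) r \<in> pol_terms n"
 by (intro ppow_terms pol_terms.intros)

lemma pv_ppow_shift: "pv d (Suc l) (ppow (PX 1) r) = pv d l (ppow (PX 2) r)"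
 by (induction r) (auto simp: numeral_2_eq_2)

lemma Fi_bracket2:
 assumes "l + 2 \<le> d"
 shows "Fi d (bracket2 Q ms) l = pv d l (pol2_coeffs ms)"
proof -
 have "Fi d (Smul \<mu> ((Tok b \<star> Ident_red Q \<star> Tok c) \<cdot> (mpow Dot [None] r \<star> Ident_red Q \<star> mpow Dot [None] s))) l
  = pv d l (PSmul \<mu> (PMul (PMul (PTok 1 b) (PTok 2 c)) (PMul (ppow (PX 1) r) (ppow (PX 2) s))))" for \<mu> b c r s
 proof -
  have e: "pv d l (PTok 1 b) * ev d = pv d l (PTok 1 b)" "pv d l (ppow (PX 1) r) * ev d = pv d l (ppow (PX 1) r)"
   using assms by (intro pv_ev(2)[of _ 2] ppow_x_typed pol_terms.intros; simp)+
  have e': "tokv d (Suc l) b * (ev d * z) = tokv d (Suc l) b * z"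
   "pv d l (ppow (PX 1) r) * (ev d * z) = pv d l (ppow (PX 1) r) * z" for z
   using e by (simp_all add: mult.assoc[symmetric])
  show ?thesis
   by (simp add: Fi_mpow pv_ppow_shift mult.assoc e')
 qed
 then show ?thesis by (simp add: bracket2_def pol2_coeffs_def Fi_msum pv_psum o_def split_def)
qed

lemma absorb_left: "e * x = x ==> e * (x * z) = (x * z :: 'r::semigroup_mult)"
 by (metis mult.assoc)

text \<open>As \<open>Lam Q\<close> acts by the unit, each relation with red strands becomes an
  identity between crossings, copies of \<open>Q\<close> and Demazure operators. The super
  interchange law becomes locality.\<close>

lemma Fi_sound: "law_eq A u v f g ==> l + nb u \<le> d ==> nb u = nb v ==> Fi d f l = Fi d g l"
proof (induction arbitrary: l rule: law_eq.induct)
 interpret V: polrep A d "ev d" "tokv d" "xv d" by (rule polrepv)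
 note T1 = Tv_ev(1)[of _ d] and T2 = Tv_ev(2)[of d]
 note T1' = absorb_left[OF T1]
 {
  \<comment> \<open>The middle word may have another number of black strands, and the induction
    hypothesis does not cover it; then both composites are zero.\<close>
  case (law_cong_comp v w g g' u f f')
  have "law_term A u v f" "law_term A u v f'"
   using law_cong_comp.hyps law_eq_typed by blast+
  then show ?case using law_cong_comp Fi_zero[of f d l] Fi_zero[of f' d l]
   by (cases "nb u = nb v") (auto simp: law_term_iff)
 next
  case (law_cong_tens u v f f' u' v' g g')
  have t: "law_term A u v f" "law_term A u v f'" "law_term A u' v' g" "law_term A u' v' g'"
   using law_cong_tens.hyps law_eq_typed by blast+
  show ?case
  proof (cases "nb u = nb v")
   case True
   then have "Fi d f l = Fi d f' l" "Fi d g (l + nb u) = Fi d g' (l + nb u)"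
    using law_cong_tens by auto
   then show ?thesis using t by (auto simp: law_term_iff)
  next
   case False
   then show ?thesis using t Fi_zero[of f d l] Fi_zero[of f' d l] by (auto simp: law_term_iff)
  qed
 next
  case (law_id_comp u v f)
  then show ?case using Fi_ev[of f l d] by (auto simp: law_term_iff)
 next
  case (law_comp_id u v f)
  then show ?case using Fi_ev[of f l d] by (auto simp: law_term_iff)
 next
  case (law_unit_tens u v f)
  then show ?case using Fi_ev[of f l d] by (auto simp: law_term_iff)
 next
  case (law_tens_unit u v f)
  then show ?case using Fi_ev[of f l d] by (auto simp: law_term_iff)
 next
  case (law_tens_assoc u v f u' v' g u'' v'' h)
  then show ?case by (auto simp: law_term_iff mult.assoc add.assoc)
 next
  case (law_super_interchange v w f' u f v' w' g u' g' p q)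
  then have t: "mwt A f'" "mwt A f" "mwt A g" "mwt A g'" "msrc f' = v" "mtgt f = v" "msrc f = u" "msrc g = v'" "mtgt g' = v'" "msrc g' = u'"
   by (auto simp: law_term_iff)
  show ?case
  proof (cases "nb u = nb v \<and> nb u' = nb v'")
   case True
   have "Fi d g (l + nb u) * Fi d f l = sm (koszul (p * q)) (Fi d f l * Fi d g (l + nb u))"
    using law_super_interchange True t by (intro Fi_commute) auto
   then have "Fi d g (l + nb u) * (Fi d f l * Fi d g' (l + nb u)) = sm (koszul (p * q)) (Fi d f l * (Fi d g (l + nb u) * Fi d g' (l + nb u)))"
    by (rule sm_comm_left)
   then show ?thesis using t True by (simp add: mult.assoc)
  next
   case False
   then show ?thesis using t Fi_zero[of f d l] Fi_zero[of g'] by auto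
  qed
 next
  case law_tok_one
  then show ?case by (simp add: V.tok_one)
 next
  case (law_tok_linear c a c' b)
  then show ?case by (simp add: V.tok_add V.tok_smul)
 next
  case (law_tok_mult a b)
  then show ?case by (simp add: V.tok_mult)
 next
  case law_sigma_sigma
  then show ?case by (simp add: Tv_Tv)
 next
  case law_braid
  then show ?case using Tv_braid[of "Suc l" d] T1[of "Suc l"] T1[of "Suc (Suc l)"] T2[of "Suc l"] T2[of "Suc (Suc l)"]
    T1'[of "Suc l"] T1'[of "Suc (Suc l)"]
   by (simp add: mult.assoc)
 next
  case (law_sigma_tok a)
  then show ?case using Tv_tok[of "Suc l" d "Suc l" a] T1[of "Suc l"]
   by (simp add: V.e_tok V.tok_e absorb_left[OF V.e_tok] mult.assoc)
 next
  case law_sigma_dot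
  have "V.tele (Suc l) (Suc (Suc l)) = sum_list (map (\<lambda>b. sm (koszul (\<epsilon> * par b)) (tokv d (Suc l) b * tokv d (Suc (Suc l)) (dl b))) (basis A))"
   by (simp add: V.tele_def sum_list_distinct_conv_sum_set basis_distinct)
  then show ?case using law_sigma_dot Tv_xv[of "Suc l" d "Suc l"]
   by (simp add: V.e_x V.x_e tau_def Fi_msum o_def)
 next
  case (law_tok_dot a p)
  then show ?case using V.tok_x[of "Suc l" "Suc l" a p] by simp
 next
  case (law_lam_tok Q a)
  then show ?case by (simp add: V.e_tok V.tok_e V.e_idem)
 next
  case (law_rho_tok Q a)
  then show ?case using Qv_tok[of Q l d "Suc l" a] by (simp add: V.e_tok V.tok_e V.e_idem)
 next
  case (law_lam_dot Q)
  then show ?case by (simp add: V.e_x V.x_e V.e_idem)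
 next
  case (law_rho_dot Q)
  then show ?case using Qv_x[of Q l d "Suc l"] by (simp add: V.e_x V.x_e V.e_idem)
 next
  case (law_rho_lam Q as)
  have "Qv d l Q = pv d l (pol_coeffs 1 as)"
   unfolding Qv_def using qrep_eq[OF law_rho_lam(1,2)] law_rho_lam by (intro pv_cong) auto
  then show ?case by (simp add: Fi_bracket)
 next
  case (law_lam_rho Q as)
  have "Qv d l Q = pv d l (pol_coeffs 1 as)"
   unfolding Qv_def using qrep_eq[OF law_lam_rho(1,2)] law_lam_rho by (intro pv_cong) auto
  then show ?case by (simp add: Fi_bracket)
 next
  case (law_sigma_rho Q)
  then have l: "Suc l < d" and Q: "Q \<in> pol_E A 1" by auto
  let ?T = "Tv d (Suc l)" and ?Q1 = "Qv d l Q" and ?Q2 = "Qv d (Suc l) Q" and ?D = "pv d l (demazure A 1 (qrep Q))"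
  have g: "pol_eq A 1 (qrep Q) (qrep Q)" using qrep(2)[OF Q] by (rule pol_refl)
  have "qrep Q \<in> pol_terms 2" by (rule pol_terms_mono[OF qrep(2)[OF Q]]) simp
  then have D: "?Q1 * ?D = ?D * ?Q1"
   using l by (intro Qv_pv[OF Q, of _ _ _ 2] demazure_terms) auto
  have QQ: "?Q1 * ?Q2 = ?Q2 * ?Q1"
   unfolding Qv_def[of d "Suc l"] using l by (intro Qv_pv[OF Q _ qrep(2)[OF Q]]) auto
  \<comment> \<open>The crossing passes the product of both copies because the two Demazure terms
    that arise have opposite signs and \<open>?D\<close> commutes with \<open>?Q1\<close>.\<close>
  have "?T * (?Q2 * ?Q1) = (?Q1 * ?T + ?D) * ?Q1"
   using Tv_Qv(2)[OF Q g l] by (simp add: mult.assoc[symmetric])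
  also have "... = ?Q1 * (?T * ?Q1) + ?D * ?Q1" by (simp add: distrib_right mult.assoc)
  also have "... = ?Q1 * (?Q2 * ?T) - ?Q1 * ?D + ?D * ?Q1"
   by (simp only: Tv_Qv(1)[OF Q g l] right_diff_distrib)
  also have "... = ?Q2 * ?Q1 * ?T" by (simp add: D QQ mult.assoc[symmetric])
  finally have E: "?T * (?Q2 * ?Q1) = ?Q2 * ?Q1 * ?T" .
  have e: "ev d * ?Q1 = ?Q1" "?Q1 * ev d = ?Q1" "ev d * ?Q2 = ?Q2" "?Q2 * ev d = ?Q2"
   using Qv_ev[OF Q] l by auto
  show ?case using T1[of "Suc l"] T2[of "Suc l"] T1'[of "Suc l"] l E
   by (simp add: e absorb_left[OF e(1)] absorb_left[OF e(3)] mult.assoc)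
 next
  case (law_lam_sigma Q)
  then show ?case using T1[of "Suc l"] T2[of "Suc l"] by (simp add: V.e_idem)
 next
  case (law_rho_sigma_lam Q as ms)
  then have l: "Suc l < d" and Q: "Q \<in> pol_E A 1" by auto
  have g: "pol_eq A 1 (qrep Q) (pol_coeffs 1 as)" using law_rho_sigma_lam by (intro qrep_eq)
  have "pv d l (demazure A 1 (pol_coeffs 1 as)) = pv d l (pol2_coeffs ms)"
   using law_rho_sigma_lam l by (intro pv_cong) auto
  \<comment> \<open>With \<open>Lam Q\<close> acting as the unit, the relation says
    \<open>Q\<^sub>1 T = T Q\<^sub>2 - \<partial>\<^sub>1(Q\<^sub>1)\<close>, the second form of
    \<open>Tv_Qv\<close>.\<close>
  then have "Qv d l Q * Tv d (Suc l) = Tv d (Suc l) * Qv d (Suc l) Q - Fi d (bracket2 Q ms) l"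
   using Tv_Qv(2)[OF Q g l] l by (simp add: Fi_bracket2)
  moreover have e: "ev d * Qv d l Q = Qv d l Q" "Qv d l Q * ev d = Qv d l Q"
   "ev d * Qv d (Suc l) Q = Qv d (Suc l) Q" "Qv d (Suc l) Q * ev d = Qv d (Suc l) Q"
   using Qv_ev[OF Q] l by auto
  ultimately show ?case using T1[of "Suc l"] T2[of "Suc l"] T1'[of "Suc l"] l
   by (simp add: V.e_idem absorb_left[OF V.e_idem] absorb_left[OF e(1)] absorb_left[OF e(3)] mult.assoc)
 next
  case law_id_tens_id
  show ?case by (simp add: V.e_idem)
 }
qed (auto simp: algebra_simps sm_distrib law_term_iff)

end

declare One_nat_def [simp] Suc_eq_plus1 [symmetric, simp del]

section \<open>Combinatorics of words and diagrams\<close>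

subsection \<open>Braid equivalence of words\<close>

inductive beq :: "nat list => nat list => bool" where
 beq_refl: "beq w w"
| beq_sym: "beq w w' ==> beq w' w"
| beq_trans: "beq w w' ==> beq w' w'' ==> beq w w''"
| beq_comm: "Suc p < q ==> beq (xs @ [p, q] @ ys) (xs @ [q, p] @ ys)"
| beq_braid: "beq (xs @ [p, Suc p, p] @ ys) (xs @ [Suc p, p, Suc p] @ ys)"

declare beq_trans [trans]

lemma beq_context: "beq w w' ==> beq (xs @ w @ ys) (xs @ w' @ ys)"
proof (induction rule: beq.induct)
 case (beq_comm p q xs' ys')
 then show ?case using beq.beq_comm[of p q "xs @ xs'" "ys' @ ys"] by simp
next
 case (beq_braid xs' p ys')
 then show ?case using beq.beq_braid[of "xs @ xs'" p "ys' @ ys"] by simp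
qed (blast intro: beq.intros)+

lemma beq_left: "beq w w' ==> beq (xs @ w) (xs @ w')" and beq_right: "beq w w' ==> beq (w @ ys) (w' @ ys)"
 using beq_context[of w w' xs "[]"] beq_context[of w w' "[]" ys] by simp_all

lemma beq_set: "beq w w' ==> set w = set w'"
 by (induction rule: beq.induct) auto

lemma beq_length: "beq w w' ==> length w = length w'"
 by (induction rule: beq.induct) auto

lemma beq_move: "(\<And>x. x \<in> set xs ==> Suc x < q \<or> Suc q < x) ==> beq (xs @ [q]) (q # xs)"
proof (induction xs)
 case (Cons x xs)
 have "beq (x # (xs @ [q])) (x # (q # xs))" using beq_left[of "xs @ [q]" "q # xs" "[x]"] Cons by simp
 also have "beq (x # (q # xs)) (q # x # xs)"
 proof -
  consider "Suc x < q" | "Suc q < x" using Cons.prems by auto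
  then show ?thesis
   using beq_comm[of x q "[]" xs] beq_sym[OF beq_comm[of q x "[]" xs]] by cases auto
 qed
 finally show ?case by simp
qed (simp add: beq_refl)

text \<open>The letter \<open>Suc r\<close> commutes with the letters of the run below
  \<open>r\<close>, undergoes one braid move with \<open>r\<close> and \<open>Suc r\<close>, and
  leaves as \<open>r\<close>, which commutes with the rest.\<close>

lemma beq_shift:
 assumes "p \<le> r" "Suc r < N"
 shows "beq (Suc r # [p..<N]) ([p..<N] @ [r])"
proof -
 have split: "[p..<N] = [p..<r] @ [r, Suc r] @ [Suc (Suc r)..<N]"
 proof -
  have "[p..<N] = [p..<r] @ [r..<N]" using assms upt_add_eq_append[of p r "N - r"] by simp
  moreover have "[r..<N] = r # Suc r # [Suc (Suc r)..<N]" using assms by (simp add: upt_conv_Cons)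
  ultimately show ?thesis by simp
 qed
 have "beq (Suc r # [p..<r]) ([p..<r] @ [Suc r])" by (intro beq_sym[OF beq_move]) auto
 then have "beq ((Suc r # [p..<r]) @ [r, Suc r] @ [Suc (Suc r)..<N]) (([p..<r] @ [Suc r]) @ [r, Suc r] @ [Suc (Suc r)..<N])"
  by (rule beq_right)
 also have "([p..<r] @ [Suc r]) @ [r, Suc r] @ [Suc (Suc r)..<N] = [p..<r] @ [Suc r, r, Suc r] @ [Suc (Suc r)..<N]" by simp
 also have "beq ... ([p..<r] @ [r, Suc r, r] @ [Suc (Suc r)..<N])" by (intro beq_sym[OF beq_braid])
 also have "[p..<r] @ [r, Suc r, r] @ [Suc (Suc r)..<N] = ([p..<r] @ [r, Suc r]) @ (r # [Suc (Suc r)..<N])" by simp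
 also have "beq ... (([p..<r] @ [r, Suc r]) @ ([Suc (Suc r)..<N] @ [r]))"
  by (intro beq_left beq_sym[OF beq_move]) auto
 finally show ?thesis unfolding split by simp
qed

text \<open>Two runs with the same end change places when the second starts lower:
  \<open>beq_shift\<close> carries each letter of the first through the second and lowers it by
  one.\<close>

lemma beq_cycles:
 assumes "p' < p" "p \<le> N"
 shows "beq ([p..<N] @ [p'..<N]) ([p'..<N] @ [p - 1..<N - 1])"
 using assms(2,1)
proof (induction rule: inc_induct)
 case base
 then show ?case by (simp add: beq_refl)
next
 case (step p)
 have "beq ([Suc p..<N] @ [p'..<N]) ([p'..<N] @ [p..<N - 1])" using step by simp
 from beq_left[OF this, of "[p]"]
 have "beq ([p..<N] @ [p'..<N]) ((p # [p'..<N]) @ [p..<N - 1])" using step by (simp add: upt_conv_Cons)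
 also have "beq ... (([p'..<N] @ [p - 1]) @ [p..<N - 1])"
  using beq_shift[of p' "p - 1" N] step by (intro beq_right) auto
 also have "([p'..<N] @ [p - 1]) @ [p..<N - 1] = [p'..<N] @ [p - 1..<N - 1]"
  using step upt_conv_Cons[of "p - 1" "N - 1"] by (cases p) auto
 finally show ?case .
qed

text \<open>
 Normal forms of words for the permutations of \<open>N + 1\<close> strands: the strand that ends up in the
 last position is moved there first.
\<close>

inductive canonical :: "nat => nat list => bool" where
 can_0: "canonical 0 []"
| can_Suc: "canonical N c ==> p \<le> Suc N ==> canonical (Suc N) ([p..<Suc N] @ c)"

lemma canonical_set: "canonical N c ==> set c \<subseteq> {..<N}"
 by (induction rule: canonical.induct) auto

definition square :: "nat list => bool" where
 "square w \<longleftrightarrow> (\<exists>xs q ys. beq w (xs @ [q, q] @ ys))"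

lemma square_context: "square w ==> square (xs @ w @ ys)"
 unfolding square_def using beq_context by (metis append.assoc)

lemma square_beq: "beq w w' ==> square w' ==> square w"
 unfolding square_def using beq_trans by blast

text \<open>A letter below the top one is absorbed by induction. The top letter commutes down to the
  second run and completes it, so two runs with the same end meet: if the second starts lower,
  exchanging them gives a normal form; otherwise, exchanging the first with the uncompleted second
  one doubles the top letter.\<close>

lemma canonical_snoc: "canonical N c ==> q < N ==> (\<exists>c'. canonical N c' \<and> beq (c @ [q]) c') \<or> square (c @ [q])"
proof (induction arbitrary: q rule: canonical.induct)
 case (can_Suc N c0 p)
 show ?case
 proof (cases "q < N")
  case True
  then consider c' where "canonical N c'" "beq (c0 @ [q]) c'" | "square (c0 @ [q])" using can_Suc by blast
  then show ?thesis
  proof cases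
   case 1
   then have "beq (([p..<Suc N] @ c0) @ [q]) ([p..<Suc N] @ c')" using beq_left[of "c0 @ [q]" c' "[p..<Suc N]"] by simp
   then show ?thesis using 1 can_Suc canonical.can_Suc by blast
  next
   case 2
   then show ?thesis using square_context[of "c0 @ [q]" "[p..<Suc N]" "[]"] by simp
  qed
 next
  case False
  then have q: "q = N" using can_Suc by simp
  from can_Suc(1) show ?thesis
  proof (cases rule: canonical.cases)
   case can_0
   show ?thesis
   proof (cases "p = 0")
    case True
    then show ?thesis using q can_0 by (auto simp: square_def intro!: exI[of _ "[]"] exI[of _ 0] beq_refl)
   next
    case False
    then have "([p..<Suc N] @ c0) @ [q] = [0..<Suc 0] @ []" using q can_0 can_Suc by auto
    moreover have "canonical (Suc N) ([0..<Suc 0] @ [])" using can_0 canonical.can_Suc[OF canonical.can_0, of 0] by simp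
    ultimately show ?thesis using beq_refl by metis
   qed
  next
   case (can_Suc M c1 p')
   have c1: "set c1 \<subseteq> {..<M}" using canonical_set can_Suc by blast
   have "beq (c1 @ [q]) (q # c1)" using c1 q can_Suc by (intro beq_move) auto
   from beq_left[OF this, of "[p..<Suc N] @ [p'..<N]"]
   have 1: "beq (([p..<Suc N] @ c0) @ [q]) ([p..<Suc N] @ [p'..<Suc N] @ c1)"
    using can_Suc q by simp
   show ?thesis
   proof (cases "p' < p")
    case True
    have "beq (([p..<Suc N] @ [p'..<Suc N]) @ c1) (([p'..<Suc N] @ [p - 1..<N]) @ c1)"
     using beq_cycles[OF True, of "Suc N"] can_Suc.prems \<open>p \<le> Suc N\<close> by (intro beq_right) auto
    then have "beq ([p..<Suc N] @ [p'..<Suc N] @ c1) ([p'..<Suc N] @ [p - 1..<N] @ c1)"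
     by (simp only: append_assoc)
    from beq_trans[OF 1 this]
    have "beq (([p..<Suc N] @ c0) @ [q]) ([p'..<Suc N] @ [p - 1..<N] @ c1)" .
    moreover have "canonical N ([p - 1..<N] @ c1)"
     unfolding can_Suc(1) using can_Suc \<open>p \<le> Suc N\<close> by (intro canonical.can_Suc) auto
    then have "canonical (Suc N) ([p'..<Suc N] @ [p - 1..<N] @ c1)"
     using can_Suc by (intro canonical.can_Suc) auto
    ultimately show ?thesis by blast
   next
    case False
    have "beq ([p..<Suc N] @ [p'..<N]) ([Suc p'..<Suc N] @ [p..<Suc N])"
     using beq_sym[OF beq_cycles[of p "Suc p'" "Suc N"]] False can_Suc by simp
    from beq_right[OF this, of "[N] @ c1"]
    have "beq ([p..<Suc N] @ [p'..<Suc N] @ c1) (([Suc p'..<Suc N] @ [p..<N]) @ [N, N] @ c1)"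
     using False can_Suc by simp
    then have "square (([p..<Suc N] @ c0) @ [q])" unfolding square_def using 1 beq_trans by blast
    then show ?thesis by blast
   qed
  qed
 qed
qed simp

lemma canonical_id: "canonical N []"
proof (induction N)
 case (Suc N)
 then show ?case using can_Suc[OF Suc, of "Suc N"] by simp
qed (rule can_0)

lemma canonical_or_square: "set w \<subseteq> {..<N} ==> (\<exists>c. canonical N c \<and> beq w c) \<or> square w"
proof (induction w rule: rev_induct)
 case Nil
 then show ?case using canonical_id beq_refl by blast
next
 case (snoc q w)
 then consider c where "canonical N c" "beq w c" | "square w" by auto
 then show ?case
 proof cases
  case 1
  then have "beq (w @ [q]) (c @ [q])" using beq_right by blast
  then show ?thesis using canonical_snoc[OF 1(1), of q] snoc.prems beq_trans square_beq by auto
 next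
  case 2
  then show ?thesis using square_context[of w "[]" "[q]"] by simp
 qed
qed

subsection \<open>The action of words on lists\<close>

primrec papply :: "nat list => 'b list => 'b list" where
 "papply [] xs = xs"
| "papply (p # ps) xs = papply ps (swap_at p xs)"

lemma length_swap_at [simp]: "length (swap_at p xs) = length xs"
 by (simp add: swap_at_def)

lemma papply_append [simp]: "papply (ps @ qs) xs = papply qs (papply ps xs)"
 by (induction ps arbitrary: xs) auto

lemma length_papply [simp]: "length (papply ps xs) = length xs"
 by (induction ps arbitrary: xs) auto

lemma swap_at_nth:
 "Suc p < length xs ==> k < length xs ==> swap_at p xs ! k = xs ! (transpose p (Suc p) k)"
 by (auto simp: swap_at_def nth_list_update transpose_def)

lemma map_swap_at: "Suc p < length xs ==> map f (swap_at p xs) = swap_at p (map f xs)"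
 by (simp add: swap_at_def map_update)

lemma map_papply: "(\<And>p. p \<in> set ps ==> Suc p < length xs) ==> map f (papply ps xs) = papply ps (map f xs)"
 by (induction ps arbitrary: xs) (auto simp: map_swap_at)

lemma swap_at_swap_at: "Suc p < length xs ==> swap_at p (swap_at p xs) = xs"
 by (rule nth_equalityI) (auto simp: swap_at_nth transpose_def)

lemma swap_at_comm: "Suc p < q ==> Suc q < length xs ==> swap_at p (swap_at q xs) = swap_at q (swap_at p xs)"
 by (rule nth_equalityI) (auto simp: swap_at_nth transpose_def)

lemma swap_at_braid: "Suc (Suc p) < length xs ==>
 swap_at p (swap_at (Suc p) (swap_at p xs)) = swap_at (Suc p) (swap_at p (swap_at (Suc p) xs))"
 by (rule nth_equalityI) (auto simp: swap_at_nth transpose_def)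

lemma distinct_swap_at: "Suc p < length xs ==> distinct (swap_at p xs) \<longleftrightarrow> distinct xs"
 unfolding swap_at_def by (rule distinct_swap) auto

lemma beq_papply: "beq a b ==> (\<And>p. p \<in> set a ==> Suc p < length xs) ==> papply a xs = papply b xs"
proof (induction rule: beq.induct)
 case (beq_sym w w')
 then show ?case using beq_set by metis
next
 case (beq_trans w w' w'')
 then show ?case using beq_set by metis
next
 case (beq_comm p q us ys)
 then show ?case using swap_at_comm[of p q "papply us xs"] by simp
next
 case (beq_braid us p ys)
 then show ?case using swap_at_braid[of p "papply us xs"] by simp
qed simp

lemma papply_butlast: "(\<And>p. p \<in> set ps ==> Suc p < length xs) ==> papply ps (xs @ [z]) = papply ps xs @ [z]"
proof (induction ps arbitrary: xs)
 case (Cons p ps)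
 then have "Suc p < length xs" "p < length xs" by (auto dest: Suc_lessD)
 then have "swap_at p (xs @ [z]) = swap_at p xs @ [z]"
  by (auto simp: swap_at_def nth_append list_update_append)
 then show ?case using Cons by simp
qed simp

lemma papply_cycle:
 assumes "p \<le> N" "length xs = Suc N"
 shows "papply [p..<N] xs = take p xs @ drop (Suc p) xs @ [xs ! p]"
 using assms(1) assms(2)
proof (induction arbitrary: xs rule: inc_induct)
 case base
 then show ?case by (simp add: take_Suc_conv_app_nth[symmetric])
next
 case (step p)
 let ?ys = "swap_at p xs"
 have "papply [p..<N] xs = papply [Suc p..<N] ?ys" using step by (simp add: upt_conv_Cons)
 also have "... = take (Suc p) ?ys @ drop (Suc (Suc p)) ?ys @ [?ys ! Suc p]" using step by simp
 also have "take (Suc p) ?ys = take p xs @ [xs ! Suc p]"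
  using step by (auto simp: swap_at_def take_Suc_conv_app_nth)
 also have "drop (Suc (Suc p)) ?ys = drop (Suc (Suc p)) xs" by (simp add: swap_at_def)
 also have "?ys ! Suc p = xs ! p" using step by (simp add: swap_at_def)
 finally show ?case using step by (simp add: Cons_nth_drop_Suc)
qed

text \<open>The entry that arrives in the last place reveals where the first run starts. After its
  removal the rest of the word acts on the remaining entries.\<close>

lemma canonical_unique:
 "canonical N c ==> canonical N c' ==> distinct xs ==> length xs = Suc N ==> papply c xs = papply c' xs ==> c = c'"
proof (induction arbitrary: c' xs rule: canonical.induct)
 case can_0
 from can_0(1) show ?case by (cases rule: canonical.cases) auto
next
 case (can_Suc N c p)
 from can_Suc.prems(1) obtain c0 p' where c': "canonical N c0" "p' \<le> Suc N" "c' = [p'..<Suc N] @ c0"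
  by (cases rule: canonical.cases) auto
 let ?ys = "\<lambda>p. take p xs @ drop (Suc p) xs"
 have len: "length (?ys p) = Suc N" if "p \<le> Suc N" for p using that can_Suc.prems by simp
 have ap: "papply ([p..<Suc N] @ c) xs = papply c (?ys p) @ [xs ! p]" if "p \<le> Suc N" "canonical N c" for p c
 proof -
  have "papply ([p..<Suc N] @ c) xs = papply c (?ys p @ [xs ! p])"
   using papply_cycle[OF that(1), of xs] can_Suc.prems by simp
  also have "... = papply c (?ys p) @ [xs ! p]"
   using canonical_set[OF that(2)] len[OF that(1)] by (intro papply_butlast) auto
  finally show ?thesis .
 qed
 have *: "papply c (?ys p) = papply c0 (?ys p')" "xs ! p = xs ! p'"
  using can_Suc.prems(4) unfolding c'(3) ap[OF can_Suc.hyps(2,1)] ap[OF c'(2,1)] by auto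
 have "p = p'" using *(2) can_Suc.prems can_Suc.hyps c' by (simp add: nth_eq_iff_index_eq)
 moreover have "distinct (?ys p)"
  using can_Suc.prems(2) by (metis append_take_drop_id distinct_append distinct_drop set_drop_subset_set_drop[of p "Suc p"]
    distinct_take inf_mono order_refl subset_empty le_SucI)
 ultimately have "c = c0" using can_Suc.IH[OF c'(1) _ len[OF can_Suc.hyps(2)]] * by simp
 then show ?case using c' \<open>p = p'\<close> by simp
qed

subsection \<open>Diagrams\<close>

lemma is_diagram_pos: "is_diagram u ps v ==> p \<in> set ps ==> Suc p < length u"
 by (induction u ps v rule: is_diagram.induct) auto

lemma is_diagram_papply: "is_diagram u ps v ==> v = papply ps u"
 by (induction u ps v rule: is_diagram.induct) auto

lemma is_diagram_append: "is_diagram u (ps @ qs) v \<longleftrightarrow> is_diagram u ps (papply ps u) \<and> is_diagram (papply ps u) qs v"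
 by (induction ps arbitrary: u) auto

lemma beq_is_diagram: "beq a b ==> is_diagram u a v = is_diagram u b v"
proof (induction rule: beq.induct)
 case (beq_comm p q xs ys)
 have *: "is_diagram m ([p, q] @ ys) v = is_diagram m ([q, p] @ ys) v" for m :: "('a, 'b) word"
  using beq_comm swap_at_comm[of p q m]
  by (auto simp: swap_at_nth transpose_def)
 show ?case by (simp only: is_diagram_append[of u xs] * )
next
 case (beq_braid xs p ys)
 have *: "is_diagram m ([p, Suc p, p] @ ys) v = is_diagram m ([Suc p, p, Suc p] @ ys) v" for m :: "('a, 'b) word"
  using swap_at_braid[of p m]
  by (auto simp: swap_at_nth transpose_def)
 show ?case by (simp only: is_diagram_append[of u xs] * )
qed auto

lemma is_diagram_square:
 assumes "is_diagram u (xs @ [q, q] @ ys) v"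
 shows "is_diagram u (xs @ ys) v"
 using assms swap_at_swap_at[of q "papply xs u"] unfolding is_diagram_append by auto

subsection \<open>Black crossings\<close>

lemma length_black_word: "is_diagram (map snd L) ps v ==>
 length ps = length (black_word (map snd L) ps) + length (red_black_crossings L ps)"
proof (induction ps arbitrary: L)
 case (Cons p ps)
 then have "is_diagram (map snd (swap_at p L)) ps v" "map snd (swap_at p L) = swap_at p (map snd L)"
  by (auto simp: map_swap_at)
 then show ?case using Cons.IH[of "swap_at p L"] Cons.prems by auto
qed simp

definition blacks :: "('c \<times> ('k, 'a) letter) list => ('c \<times> ('k, 'a) letter) list" where
 "blacks L = filter (\<lambda>x. snd x = None) L"
definition reds :: "('c \<times> ('k, 'a) letter) list => ('c \<times> ('k, 'a) letter) list" where
 "reds L = filter (\<lambda>x. snd x \<noteq> None) L"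

lemma swap_at_append: "swap_at (length as) (as @ [x, y] @ bs) = as @ [y, x] @ bs"
 by (simp add: swap_at_def nth_append list_update_append)

lemma swap_at_split:
 assumes "Suc p < length xs"
 shows "xs = take p xs @ [xs ! p, xs ! Suc p] @ drop (Suc (Suc p)) xs"
  "swap_at p xs = take p xs @ [xs ! Suc p, xs ! p] @ drop (Suc (Suc p)) xs"
proof -
 show 1: "xs = take p xs @ [xs ! p, xs ! Suc p] @ drop (Suc (Suc p)) xs"
  using assms by (simp add: Cons_nth_drop_Suc)
 have len: "length (take p xs) = p" using assms by simp
 have "swap_at p xs = swap_at (length (take p xs)) (take p xs @ [xs ! p, xs ! Suc p] @ drop (Suc (Suc p)) xs)"
  by (simp only: len 1[symmetric])
 then show "swap_at p xs = take p xs @ [xs ! Suc p, xs ! p] @ drop (Suc (Suc p)) xs"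
  by (simp only: swap_at_append)
qed

lemma swap_at_blacks:
 assumes "Suc p < length L" "snd (L ! p) = None \<or> snd (L ! Suc p) = None"
 shows "reds (swap_at p L) = reds L"
  and "blacks (swap_at p L) = (if snd (L ! p) = None \<and> snd (L ! Suc p) = None
   then swap_at (length (blacks (take p L))) (blacks L) else blacks L)"
proof -
 note * = swap_at_split[OF assms(1)]
 have r: "reds (as @ [x, y] @ bs) = reds as @ reds [x, y] @ reds bs" for as bs x y by (simp add: reds_def)
 have b: "blacks (as @ [x, y] @ bs) = blacks as @ blacks [x, y] @ blacks bs" for as bs x y by (simp add: blacks_def)
 show "reds (swap_at p L) = reds L"
  unfolding *(2) by (subst (5) *(1)) (use assms(2) in \<open>auto simp: r, auto simp: reds_def\<close>)
 have L: "blacks L = blacks (take p L) @ blacks [L ! p, L ! Suc p] @ blacks (drop (Suc (Suc p)) L)"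
  by (subst *(1)) (rule b)
 have S: "blacks (swap_at p L) = blacks (take p L) @ blacks [L ! Suc p, L ! p] @ blacks (drop (Suc (Suc p)) L)"
  unfolding *(2) by (rule b)
 show "blacks (swap_at p L) = (if snd (L ! p) = None \<and> snd (L ! Suc p) = None
   then swap_at (length (blacks (take p L))) (blacks L) else blacks L)"
  unfolding S using assms(2) L swap_at_append[of "blacks (take p L)" "L ! p" "L ! Suc p" "blacks (drop (Suc (Suc p)) L)"]
  by (auto simp: blacks_def)
qed

text \<open>Red strands never cross each other, so their order is fixed; among themselves the black
  strands see the black crossings only. Black words count from 1 and list positions from 0, whence
  the shift.\<close>

lemma papply_blacks:
 assumes "is_diagram (map snd L) ps v"
 shows "reds (papply ps L) = reds L"
  and "blacks (papply ps L) = papply (map (\<lambda>r. r - 1) (black_word (map snd L) ps)) (blacks L)"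
proof -
 have "reds (papply ps L) = reds L \<and> blacks (papply ps L) = papply (map (\<lambda>r. r - 1) (black_word (map snd L) ps)) (blacks L)"
  using assms
 proof (induction ps arbitrary: L)
  case (Cons p ps)
  have p: "Suc p < length L" "snd (L ! p) = None \<or> snd (L ! Suc p) = None" using Cons.prems by auto
  have m: "map snd (swap_at p L) = swap_at p (map snd L)" using p by (simp add: map_swap_at)
  have "length (filter (\<lambda>l. l = None) (take p (map snd L))) = length (blacks (take p L))"
   by (simp add: blacks_def take_map filter_map o_def)
  then show ?case using Cons.IH[of "swap_at p L"] Cons.prems swap_at_blacks[OF p] m p by auto
 qed simp
 then show "reds (papply ps L) = reds L" "blacks (papply ps L) = papply (map (\<lambda>r. r - 1) (black_word (map snd L) ps)) (blacks L)"
  by auto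
qed

text \<open>A shuffle is recovered from its color pattern and its two subsequences, so two diagrams
  can be compared on black and red strands separately.\<close>

lemma colored_list_eq:
 "map snd L = map snd L' ==> blacks L = blacks L' ==> reds L = reds L' ==> L = L'"
proof (induction L arbitrary: L')
 case (Cons x L)
 then obtain y M where "L' = y # M" by (cases L') auto
 then show ?case using Cons by (cases "snd x = None") (auto simp: blacks_def reds_def)
qed simp

lemma black_word_range:
 "is_diagram (map snd L) ps v ==> set (black_word (map snd L) ps) \<subseteq> {1..<length (blacks L)}"
proof (induction ps arbitrary: L)
 case (Cons p ps)
 have p: "Suc p < length L" "snd (L ! p) = None \<or> snd (L ! Suc p) = None" using Cons.prems by auto
 have m: "map snd (swap_at p L) = swap_at p (map snd L)" using p by (simp add: map_swap_at)
 have f: "length (filter (\<lambda>l. l = None) (take p (map snd L))) = length (blacks (take p L))"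
  by (simp add: blacks_def take_map filter_map o_def)
 have len: "length (blacks (swap_at p L)) = length (blacks L)" using swap_at_blacks(2)[OF p] by simp
 have "blacks L = blacks (take p L) @ blacks [L ! p, L ! Suc p] @ blacks (drop (Suc (Suc p)) L)"
  by (subst swap_at_split(1)[OF p(1)]) (simp add: blacks_def)
 then have "snd (L ! p) = None \<and> snd (L ! Suc p) = None ==> Suc (length (blacks (take p L))) < length (blacks L)"
  by (simp add: blacks_def)
 then show ?case using Cons.IH[of "swap_at p L"] Cons.prems m p f len by auto
qed simp

lemma word_perm_permutes: "set rs \<subseteq> {1..<d} ==> word_perm rs permutes {1..d}"
proof (induction rs)
 case (Cons r rs)
 then have t: "transpose r (Suc r) permutes {1..d}" "word_perm rs permutes {1..d}"
  by (auto intro!: permutes_swap_id)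
 show ?case unfolding word_perm.simps by (rule permutes_compose[OF t])
qed (simp add: permutes_id)

lemma papply_word_perm:
 "set rs \<subseteq> {1..<d} ==> length ys = d ==> k \<in> {1..d} ==>
  papply (map (\<lambda>r. r - 1) rs) ys ! (word_perm rs k - 1) = ys ! (k - 1)"
proof (induction rs arbitrary: ys k)
 case (Cons r rs)
 let ?k = "transpose r (Suc r) k"
 have r: "1 \<le> r" "Suc r \<le> d" using Cons.prems by auto
 have k: "?k \<in> {1..d}" using Cons.prems r by (auto simp: transpose_def)
 have "papply (map (\<lambda>r. r - 1) (r # rs)) ys ! (word_perm (r # rs) k - 1) = swap_at (r - 1) ys ! (?k - 1)"
  using Cons.IH[OF _ _ k, of "swap_at (r - 1) ys"] Cons.prems by simp
 also have "... = ys ! transpose (r - 1) (Suc (r - 1)) (?k - 1)"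
  using Cons.prems r k by (subst swap_at_nth) auto
 also have "transpose (r - 1) (Suc (r - 1)) (?k - 1) = k - 1"
  using r Cons.prems(3) by (auto simp: transpose_def)
 finally show ?case .
qed simp

text \<open>On a list without repetitions the places of the entries determine the permutation. This
  links the permutation in \<open>reduced_expression\<close> with the action of a diagram on
  labelled strands.\<close>

lemma word_perm_eq_iff:
 assumes "set rs \<subseteq> {1..<d}" "set rs' \<subseteq> {1..<d}" "length ys = d" "distinct ys"
 shows "word_perm rs = word_perm rs' \<longleftrightarrow> papply (map (\<lambda>r. r - 1) rs) ys = papply (map (\<lambda>r. r - 1) rs') ys"
proof -
 let ?a = "\<lambda>rs. papply (map (\<lambda>r. r - 1) rs) ys"
 note p = word_perm_permutes[OF assms(1)] word_perm_permutes[OF assms(2)]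
 have len: "length (?a rs) = d" for rs using assms(3) by simp
 show ?thesis
 proof
  assume eq: "word_perm rs = word_perm rs'"
  show "?a rs = ?a rs'"
  proof (rule nth_equalityI)
   fix i assume "i < length (?a rs)"
   then have i: "Suc i \<in> {1..d}" using len by auto
   obtain k where k: "k \<in> {1..d}" "word_perm rs k = Suc i"
    using permutes_image[OF p(1)] i by (metis imageE)
   show "?a rs ! i = ?a rs' ! i"
    using papply_word_perm[OF assms(1,3) k(1)] papply_word_perm[OF assms(2,3) k(1)] k eq by simp
  qed (simp add: len)
 next
  assume eq: "?a rs = ?a rs'"
  have d: "distinct (?a rs)"
  proof -
   have "distinct (papply ps ys)" if "\<And>p. p \<in> set ps ==> Suc p < d" for ps
    using that assms(3,4)
   proof (induction ps arbitrary: ys)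
    case (Cons p ps)
    then show ?case by (auto simp: distinct_swap_at)
   qed simp
   from this[of "map (\<lambda>r. r - 1) rs"] show ?thesis using assms(1) by force
  qed
  show "word_perm rs = word_perm rs'"
  proof
   fix k
   show "word_perm rs k = word_perm rs' k"
   proof (cases "k \<in> {1..d}")
    case True
    then have in_d: "word_perm rs k \<in> {1..d}" "word_perm rs' k \<in> {1..d}"
     using p by (simp_all only: permutes_in_image)
    have "?a rs ! (word_perm rs k - 1) = ?a rs ! (word_perm rs' k - 1)"
     using papply_word_perm[OF assms(1,3) True] papply_word_perm[OF assms(2,3) True] eq by simp
    then have "word_perm rs k - 1 = word_perm rs' k - 1"
     using d in_d len by (subst (asm) nth_eq_iff_index_eq) auto
    then show ?thesis using in_d by auto
   next
    case False
    then show ?thesis using p by (simp add: permutes_not_in)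
   qed
  qed
 qed
qed

subsection \<open>Minimality of the chosen diagrams\<close>

definition before :: "'b => 'b => 'b list => bool" where
 "before a b xs \<longleftrightarrow> (\<exists>i j. i < j \<and> j < length xs \<and> xs ! i = a \<and> xs ! j = b)"

lemma nb_filter: "nb u = length (filter (\<lambda>x. x = None) u)"
 by (induction u) auto

lemma transpose_less:
 "i \<noteq> j ==> transpose p (Suc p) i < transpose p (Suc p) j
  \<longleftrightarrow> ((i < j) \<noteq> ((i = p \<and> j = Suc p) \<or> (i = Suc p \<and> j = p)))"
 unfolding transpose_def by presburger

lemma before_swap_at:
 assumes "distinct xs" "Suc p < length xs" "a \<in> set xs" "b \<in> set xs" "a \<noteq> b"
 shows "before a b (swap_at p xs) \<longleftrightarrow> (before a b xs \<noteq> ({a, b} = {xs ! p, xs ! Suc p}))"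
proof -
 obtain i j where i: "i < length xs" "xs ! i = a" and j: "j < length xs" "xs ! j = b"
  using assms(3,4) by (auto simp: in_set_conv_nth)
 have u: "xs ! k = a \<longleftrightarrow> k = i" "xs ! k = b \<longleftrightarrow> k = j" if "k < length xs" for k
  using assms(1) i j that nth_eq_iff_index_eq by auto
 let ?t = "transpose p (Suc p)"
 have t: "?t k < length xs" if "k < length xs" for k using that assms(2) by (auto simp: transpose_def)
 have 1: "before a b xs \<longleftrightarrow> i < j" unfolding before_def
 proof
  assume "\<exists>i j. i < j \<and> j < length xs \<and> xs ! i = a \<and> xs ! j = b"
  then obtain i' j' where "i' < j'" "j' < length xs" "xs ! i' = a" "xs ! j' = b" by blast
  then show "i < j" using u[of i'] u[of j'] by auto
 qed (use i j in blast)
 have 2: "before a b (swap_at p xs) \<longleftrightarrow> ?t i < ?t j" unfolding before_def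
 proof
  assume "\<exists>i j. i < j \<and> j < length (swap_at p xs) \<and> swap_at p xs ! i = a \<and> swap_at p xs ! j = b"
  then obtain i' j' where ij': "i' < j'" "j' < length xs" "swap_at p xs ! i' = a" "swap_at p xs ! j' = b" by auto
  then have "?t i' = i" "?t j' = j" using u[OF t, of i'] u[OF t, of j'] swap_at_nth[OF assms(2)] by auto
  then show "?t i < ?t j" using ij'(1) by (metis transpose_involutory)
 next
  assume "?t i < ?t j"
  then show "\<exists>i j. i < j \<and> j < length (swap_at p xs) \<and> swap_at p xs ! i = a \<and> swap_at p xs ! j = b"
   using i j t swap_at_nth[OF assms(2) t, of i] swap_at_nth[OF assms(2) t, of j] by (intro exI[of _ "?t i"] exI[of _ "?t j"]) auto
 qed
 have pq: "xs ! p = a \<longleftrightarrow> p = i" "xs ! p = b \<longleftrightarrow> p = j" "xs ! Suc p = a \<longleftrightarrow> Suc p = i" "xs ! Suc p = b \<longleftrightarrow> Suc p = j"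
  using u[of p] u[of "Suc p"] assms(2) by simp_all
 have "{a, b} = {xs ! p, xs ! Suc p} \<longleftrightarrow> (xs ! p = a \<and> xs ! Suc p = b) \<or> (xs ! p = b \<and> xs ! Suc p = a)"
  unfolding doubleton_eq_iff by blast
 then have "{a, b} = {xs ! p, xs ! Suc p} \<longleftrightarrow> (i = p \<and> j = Suc p) \<or> (i = Suc p \<and> j = p)"
  unfolding pq by blast
 moreover have "i \<noteq> j" using i j assms(5) by auto
 then have "?t i < ?t j \<longleftrightarrow> ((i < j) \<noteq> ((i = p \<and> j = Suc p) \<or> (i = Suc p \<and> j = p)))"
  by (rule transpose_less)
 ultimately show ?thesis unfolding 1 2 by simp
qed

text \<open>Each crossing of the two strands toggles their relative order, so the labelled bottom
  and top alone determine how often they cross modulo 2.\<close>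

lemma before_papply:
 assumes "is_diagram (map snd L) ps v" "distinct (map fst L)" "(a, ca) \<in> set L" "(b, cb) \<in> set L" "(ca = None) \<noteq> (cb = None)"
 shows "before a b (map fst (papply ps L)) \<longleftrightarrow> (before a b (map fst L) \<noteq> odd (count_list (red_black_crossings L ps) {a, b}))"
 using assms
proof (induction ps arbitrary: L)
 case (Cons p ps)
 let ?L = "swap_at p L"
 have p: "Suc p < length L" using Cons.prems by auto
 have m: "map snd ?L = swap_at p (map snd L)" "map fst ?L = swap_at p (map fst L)" using p by (simp_all add: map_swap_at)
 have set: "set ?L = set L" unfolding swap_at_def using p by (intro set_swap) auto
 have ne: "a \<noteq> b" using Cons.prems(2-5) eq_key_imp_eq_value by fastforce
 have IH: "before a b (map fst (papply ps ?L)) \<longleftrightarrow> (before a b (map fst ?L) \<noteq> odd (count_list (red_black_crossings ?L ps) {a, b}))"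
  using Cons.prems p m set by (intro Cons.IH) (auto simp: distinct_swap_at)
 have "before a b (map fst ?L) \<longleftrightarrow> (before a b (map fst L) \<noteq> ({a, b} = {map fst L ! p, map fst L ! Suc p}))"
  unfolding m(2) using Cons.prems p ne by (intro before_swap_at) force+
 moreover have c: "{a, b} = {fst (L ! p), fst (L ! Suc p)} ==> (snd (L ! p) = None) \<noteq> (snd (L ! Suc p) = None)"
 proof -
  assume *: "{a, b} = {fst (L ! p), fst (L ! Suc p)}"
  have "(fst (L ! p), snd (L ! p)) \<in> set L" "(fst (L ! Suc p), snd (L ! Suc p)) \<in> set L" using p by auto
  then show ?thesis using * Cons.prems(2-5) eq_key_imp_eq_value by (metis doubleton_eq_iff)
 qed
 have "count_list (red_black_crossings L (p # ps)) {a, b}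
  = (if {a, b} = {fst (L ! p), fst (L ! Suc p)} then 1 else 0) + count_list (red_black_crossings ?L ps) {a, b}"
  by (cases "{a, b} = {fst (L ! p), fst (L ! Suc p)}") (use c in auto)
 ultimately show ?case using IH p
  by (cases "{a, b} = {fst (L ! p), fst (L ! Suc p)}") (simp_all del: red_black_crossings.simps)
qed simp

lemma count_list_distinct: "distinct xs ==> x \<in> set xs ==> count_list xs x = 1"
 by (induction xs) auto

text \<open>The black word of \<open>g\<close> is reduced. A red-black pair that crosses in
  \<open>g\<close> crosses there exactly once, hence by parity at least once in every diagram with
  the same effect. Every crossing is of one of these two kinds.\<close>

lemma diagram_minimal:
 assumes L: "distinct (map fst L)"
  and g: "is_diagram (map snd L) g v" "distinct (red_black_crossings L g)"
   "reduced_expression (length (blacks L)) (black_word (map snd L) g) w"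
  and h: "is_diagram (map snd L) h v" "papply h L = papply g L"
 shows "length g \<le> length h"
proof -
 let ?d = "length (blacks L)"
 have "distinct L" using L by (auto simp: distinct_map)
 then have dL: "distinct (blacks L)" by (simp add: blacks_def)
 note range = black_word_range[OF g(1)] black_word_range[OF h(1)]
 have "word_perm (black_word (map snd L) g) = word_perm (black_word (map snd L) h)"
  using word_perm_eq_iff[OF range refl dL] papply_blacks(2)[OF g(1)] papply_blacks(2)[OF h(1)] h(2) by simp
 then have "length (black_word (map snd L) g) \<le> length (black_word (map snd L) h)"
  using g(3) range unfolding reduced_expression_def by metis
 moreover have "set (red_black_crossings L g) \<subseteq> set (red_black_crossings L h)"
 proof
  fix z assume z: "z \<in> set (red_black_crossings L g)"
  have "\<exists>a ca b cb. z = {a, b} \<and> (a, ca) \<in> set M \<and> (b, cb) \<in> set M \<and> (ca = None) \<noteq> (cb = None)"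
   if "is_diagram (map snd M) ps v" "z \<in> set (red_black_crossings M ps)" for M ps
   using that
  proof (induction ps arbitrary: M)
   case (Cons p ps)
   then have p: "Suc p < length M" by simp
   have m: "map snd (swap_at p M) = swap_at p (map snd M)" using p by (simp add: map_swap_at)
   have set: "set (swap_at p M) = set M" unfolding swap_at_def using p by (intro set_swap) auto
   have M: "(fst (M ! p), snd (M ! p)) \<in> set M" "(fst (M ! Suc p), snd (M ! Suc p)) \<in> set M" using p by auto
   consider "z = {fst (M ! p), fst (M ! Suc p)}" "(snd (M ! p) = None) \<noteq> (snd (M ! Suc p) = None)"
    | "z \<in> set (red_black_crossings (swap_at p M) ps)"
    using Cons.prems(2) by (auto split: if_splits)
   then show ?case
   proof cases
    case 1
    then show ?thesis using M by blast
   next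
    case 2
    then show ?thesis using Cons.IH[of "swap_at p M"] Cons.prems m set by simp
   qed
  qed simp
  then obtain a ca b cb where ab: "z = {a, b}" "(a, ca) \<in> set L" "(b, cb) \<in> set L" "(ca = None) \<noteq> (cb = None)"
   using g(1) z by blast
  have "count_list (red_black_crossings L g) {a, b} = 1"
   using z g(2) ab(1) by (intro count_list_distinct) auto
  then have "odd (count_list (red_black_crossings L h) {a, b})"
   using before_papply[OF g(1) L ab(2-4)] before_papply[OF h(1) L ab(2-4)] h(2)
   by (cases "before a b (map fst L)") auto
  then show "z \<in> set (red_black_crossings L h)"
   unfolding ab(1) by (metis count_notin even_zero)
 qed
 then have "length (red_black_crossings L g) \<le> length (red_black_crossings L h)"
  using g(2) by (metis card_length card_mono distinct_card finite_set le_trans)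
 ultimately show ?thesis
  using length_black_word[OF g(1)] length_black_word[OF h(1)] by linarith
qed

text \<open>
 A weak form of the theorem of Matsumoto and Tits for diagrams: every diagram becomes, by braid
 moves, either the chosen diagram of its permutation or a diagram in which two strands cross
 twice in a row.
\<close>

lemma diagram_braid_chosen:
 assumes g: "is_diagram u g v" "distinct (red_black_crossings (zip [0..<length u] u) g)"
   "reduced_expression (nb u) (black_word u g) w"
  and ps: "is_diagram u ps v" "word_perm (black_word u ps) = w"
 shows "beq ps g \<or> square ps"
proof (cases "length u")
 \<comment> \<open>Normal forms are made for \<open>N + 1\<close> strands, so the empty word is
   treated separately.\<close>
 case 0
 then have "ps = []" "g = []" using is_diagram_pos[OF ps(1)] is_diagram_pos[OF g(1)] by (cases ps; force)+
 then show ?thesis by (simp add: beq_refl)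
next
 case (Suc N)
 define L where "L = zip [0..<length u] u"
 have snd_L: "map snd L = u" and L: "distinct (map fst L)" "length L = Suc N" by (simp_all add: L_def Suc)
 have "length (blacks L) = length (filter (\<lambda>x. x = None) (map snd L))" by (simp add: blacks_def filter_map o_def)
 then have d: "length (blacks L) = nb u" using snd_L by (simp add: nb_filter)
 have pos: "\<And>p. p \<in> set ps ==> Suc p < length L" "\<And>p. p \<in> set g ==> Suc p < length L"
  using is_diagram_pos[OF ps(1)] is_diagram_pos[OF g(1)] Suc L by auto
 have min: "length g \<le> length h" if "is_diagram u h v" "papply h L = papply g L" for h
  using diagram_minimal[OF L(1), of g v w h] g that unfolding snd_L d L_def[symmetric] by blast
 \<comment> \<open>Both diagrams move the labelled strands in the same way: the black ones by the
   common permutation, the red ones in their fixed order.\<close>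
 have eq: "papply ps L = papply g L"
 proof (rule colored_list_eq)
  show "map snd (papply ps L) = map snd (papply g L)"
   using map_papply[OF pos(1)] map_papply[OF pos(2)] is_diagram_papply[OF ps(1)] is_diagram_papply[OF g(1)] snd_L by metis
  have "distinct L" using L by (auto simp: distinct_map)
  then have dL: "distinct (blacks L)" by (simp add: blacks_def)
  have range: "set (black_word u ps) \<subseteq> {1..<nb u}" "set (black_word u g) \<subseteq> {1..<nb u}"
   using black_word_range[of L ps v] black_word_range[of L g v] ps(1) g(1) unfolding snd_L d by auto
  have "word_perm (black_word u ps) = word_perm (black_word u g)"
   using ps(2) g(3) unfolding reduced_expression_def by simp
  then show "blacks (papply ps L) = blacks (papply g L)"
   using word_perm_eq_iff[OF range d dL] papply_blacks(2)[of L ps v] papply_blacks(2)[of L g v] ps(1) g(1)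
   unfolding snd_L by simp
  show "reds (papply ps L) = reds (papply g L)"
   using papply_blacks(1)[of L ps v] papply_blacks(1)[of L g v] ps(1) g(1) unfolding snd_L by simp
 qed
 \<comment> \<open>A doubled letter could be deleted without changing the effect on the labelled
   strands, contrary to minimality.\<close>
 have "\<not> square g"
 proof
  assume "square g"
  then obtain xs q ys where b: "beq g (xs @ [q, q] @ ys)" unfolding square_def by blast
  have dia: "is_diagram u (xs @ [q, q] @ ys) v" using beq_is_diagram[OF b] g(1) by blast
  have q: "Suc q < length (papply xs L)" using is_diagram_pos[OF dia, of q] Suc L by simp
  have "papply g L = papply (xs @ [q, q] @ ys) L" by (rule beq_papply[OF b pos(2)])
  also have "... = papply (xs @ ys) L" using swap_at_swap_at[OF q] by simp
  finally have "length g \<le> length (xs @ ys)" using min[OF is_diagram_square[OF dia]] by simp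
  then show False using beq_length[OF b] by simp
 qed
 then obtain c where c: "canonical N c" "beq g c"
  using canonical_or_square[of g N] pos(2) L by force
 show ?thesis
 proof (cases "square ps")
  case False
  then obtain c' where c': "canonical N c'" "beq ps c'"
   using canonical_or_square[of ps N] pos(1) L by force
  have "papply c' L = papply c L"
   using beq_papply[OF c(2) pos(2)] beq_papply[OF c'(2) pos(1)] eq by simp
  moreover have "distinct L" using L by (auto simp: distinct_map)
  ultimately have "c' = c" using canonical_unique[OF c'(1) c(1) _ L(2)] by simp
  then show ?thesis using c c' beq_trans beq_sym by blast
 qed simp
qed

section \<open>Equational calculus in the category and the filtration by crossings\<close>

subsection \<open>Calculus of morphism terms\<close>

lemma msrc_object [simp]: "mwt A f ==> msrc f \<in> law_objects A"
 and mtgt_object [simp]: "mwt A f ==> mtgt f \<in> law_objects A"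
 using mwt_objects by auto

context frobenius_superalgebra
begin

abbreviation Ob where "Ob \<equiv> law_objects A"

text \<open>Source and target are computed from the left term, so that chains of equations need not
  carry words along.\<close>

definition leq :: "('k, 'a) mor => ('k, 'a) mor => bool" (infix "\<approx>" 50) where
 "f \<approx> g \<longleftrightarrow> law_eq A (msrc f) (mtgt f) f g"

lemma leqI: "law_eq A u v f g ==> f \<approx> g"
 unfolding leq_def using law_eq_typed law_term_iff by metis

lemma leqD: "f \<approx> g ==> msrc f = u ==> mtgt f = v ==> law_eq A u v f g"
 unfolding leq_def by simp

lemma leq_typed: "f \<approx> g ==> mwt A f \<and> mwt A g \<and> msrc g = msrc f \<and> mtgt g = mtgt f"
 unfolding leq_def using law_eq_typed law_term_iff by metis

lemma lrefl: "mwt A f ==> f \<approx> f"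
 unfolding leq_def by (intro law_refl) (simp add: law_term_iff)

lemma lsym: "f \<approx> g ==> g \<approx> f"
 unfolding leq_def by (metis law_sym leq_def leq_typed)

lemma ltrans [trans]: "f \<approx> g ==> g \<approx> h ==> f \<approx> h"
 by (rule leqI, rule law_trans[of A "msrc f" "mtgt f" f g]) (auto simp: leq_def dest: leq_typed, metis leq_def leq_typed)

lemma comp_cong: "g \<approx> g' ==> f \<approx> f' ==> msrc g = mtgt f ==> g \<cdot> f \<approx> g' \<cdot> f'"
 by (rule leqI, rule law_cong_comp) (auto simp: leq_def)

lemma tens_cong: "f \<approx> f' ==> g \<approx> g' ==> f \<star> g \<approx> f' \<star> g'"
 by (rule leqI, rule law_cong_tens) (auto simp: leq_def)

lemma add_cong: "f \<approx> f' ==> g \<approx> g' ==> msrc g = msrc f ==> mtgt g = mtgt f ==> Add f g \<approx> Add f' g'"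
 by (rule leqI, rule law_cong_add) (auto simp: leq_def)

lemma smul_cong: "f \<approx> f' ==> Smul c f \<approx> Smul c f'"
 by (rule leqI, rule law_cong_smul) (auto simp: leq_def)

lemma
 shows comp_assoc: "mwt A (h \<cdot> g \<cdot> f) ==> h \<cdot> g \<cdot> f \<approx> h \<cdot> (g \<cdot> f)"
  and id_comp: "mwt A f ==> mtgt f = v ==> Ident v \<cdot> f \<approx> f"
  and comp_id: "mwt A f ==> msrc f = u ==> f \<cdot> Ident u \<approx> f"
  and tens_assoc: "mwt A f ==> mwt A g ==> mwt A h ==> f \<star> g \<star> h \<approx> f \<star> (g \<star> h)"
  and unit_tens: "mwt A f ==> Ident [] \<star> f \<approx> f"
  and tens_unit: "mwt A f ==> f \<star> Ident [] \<approx> f"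
  and comp_add: "mwt A (g \<cdot> Add f f') ==> g \<cdot> Add f f' \<approx> Add (g \<cdot> f) (g \<cdot> f')"
  and add_comp: "mwt A (Add g g' \<cdot> f) ==> Add g g' \<cdot> f \<approx> Add (g \<cdot> f) (g' \<cdot> f)"
  and comp_smul: "mwt A (g \<cdot> f) ==> g \<cdot> Smul c f \<approx> Smul c (g \<cdot> f)"
  and smul_comp: "mwt A (g \<cdot> f) ==> Smul c g \<cdot> f \<approx> Smul c (g \<cdot> f)"
  and tens_add: "mwt A (f \<star> Add g g') ==> f \<star> Add g g' \<approx> Add (f \<star> g) (f \<star> g')"
  and add_tens: "mwt A (Add f f' \<star> g) ==> Add f f' \<star> g \<approx> Add (f \<star> g) (f' \<star> g)"
  and tens_smul: "mwt A (f \<star> g) ==> f \<star> Smul c g \<approx> Smul c (f \<star> g)"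
  and smul_tens: "mwt A (f \<star> g) ==> Smul c f \<star> g \<approx> Smul c (f \<star> g)"
  and add_comm: "mwt A (Add f g) ==> Add f g \<approx> Add g f"
  and add_assoc: "mwt A (Add (Add f g) h) ==> Add (Add f g) h \<approx> Add f (Add g h)"
  and smul_add: "mwt A (Add f g) ==> Smul c (Add f g) \<approx> Add (Smul c f) (Smul c g)"
  and add_smul: "mwt A f ==> Smul (c + d) f \<approx> Add (Smul c f) (Smul d f)"
  and smul_smul: "mwt A f ==> Smul c (Smul d f) \<approx> Smul (c * d) f"
  and one_smul: "mwt A f ==> Smul 1 f \<approx> f"
 unfolding leq_def msrc.simps mtgt.simps append_assoc append_Nil append_Nil2
 by (rule law_comp_assoc law_id_comp law_comp_id law_tens_assoc
  law_unit_tens law_tens_unit law_comp_add law_add_comp law_comp_smul law_smul_comp law_tens_add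
  law_add_tens law_tens_smul law_smul_tens law_add_comm law_add_assoc law_smul_add
  law_add_smul law_smul_smul law_one_smul; auto simp: law_term_iff)+

lemma ident_tens: "u \<in> Ob ==> v \<in> Ob ==> Ident u \<star> Ident v \<approx> Ident (u @ v)"
 by (rule leqI, rule law_id_tens_id)

lemma super_interchange:
 assumes "mwt A ((f' \<star> g) \<cdot> (f \<star> g'))" "msrc f' = mtgt f" "law_homog A p f" "law_homog A q g"
 shows "(f' \<star> g) \<cdot> (f \<star> g') \<approx> Smul (koszul (p * q)) ((f' \<cdot> f) \<star> (g \<cdot> g'))"
 by (rule leqI, rule law_super_interchange) (use assms in \<open>auto simp: law_term_iff\<close>)

lemma add_zero: "mwt A f ==> msrc f = u ==> mtgt f = v ==> Add f (Zero u v) \<approx> f"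
 by (rule leqI, rule law_add_zero) (auto simp: law_term_iff)

lemma add_neg: "mwt A f ==> msrc f = u ==> mtgt f = v ==> Add f (Smul (- 1) f) \<approx> Zero u v"
 by (rule leqI, rule law_add_neg) (auto simp: law_term_iff)

lemma law_module: "u \<in> Ob ==> v \<in> Ob ==>
 term_module {f. law_term A u v f} (law_eq A u v) Add Smul (Zero u v)"
 by unfold_locales (auto intro: law_term.intros law_eq.intros dest: law_eq_typed)

lemma zero_smul: "mwt A f ==> msrc f = u ==> mtgt f = v ==> Smul 0 f \<approx> Zero u v"
 using term_module.zero_sc[OF law_module, of u v f] leqI law_term_iff by (metis mem_Collect_eq mtgt_object msrc_object)

lemma comp_zero: "mwt A g ==> u \<in> Ob ==> msrc g = v ==> mtgt g = w ==> g \<cdot> Zero u v \<approx> Zero u w"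
proof -
 assume *: "mwt A g" "u \<in> Ob" "msrc g = v" "mtgt g = w"
 have "g \<cdot> Zero u v \<approx> g \<cdot> Smul 0 (Zero u v)"
  using * by (intro comp_cong lrefl lsym[OF zero_smul]) auto
 also have "... \<approx> Smul 0 (g \<cdot> Zero u v)" using * by (intro comp_smul) auto
 also have "... \<approx> Zero u w" using * by (intro zero_smul) auto
 finally show ?thesis .
qed

lemma zero_comp: "mwt A f ==> w \<in> Ob ==> msrc f = u ==> mtgt f = v ==> Zero v w \<cdot> f \<approx> Zero u w"
proof -
 assume *: "mwt A f" "w \<in> Ob" "msrc f = u" "mtgt f = v"
 have "Zero v w \<cdot> f \<approx> Smul 0 (Zero v w) \<cdot> f"
  using * by (intro comp_cong lrefl lsym[OF zero_smul]) auto
 also have "... \<approx> Smul 0 (Zero v w \<cdot> f)" using * by (intro smul_comp) auto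
 also have "... \<approx> Zero u w" using * by (intro zero_smul) auto
 finally show ?thesis .
qed

lemma add_shuffle:
 assumes "mwt A (Add (Add a b) (Add c d))"
 shows "Add (Add a b) (Add c d) \<approx> Add (Add a c) (Add b d)"
proof -
 have "Add (Add a b) (Add c d) \<approx> Add a (Add b (Add c d))" using assms by (intro add_assoc) auto
 also have "... \<approx> Add a (Add (Add b c) d)" using assms by (intro add_cong lrefl lsym[OF add_assoc]) auto
 also have "... \<approx> Add a (Add (Add c b) d)" using assms by (intro add_cong lrefl add_comm) auto
 also have "... \<approx> Add a (Add c (Add b d))" using assms by (intro add_cong lrefl add_assoc) auto
 also have "... \<approx> Add (Add a c) (Add b d)" using assms by (intro lsym[OF add_assoc]) auto
 finally show ?thesis .
qed

text \<open>The interchange law is given for homogeneous morphisms only. Splitting a morphism into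
  an even and an odd part extends it to all morphisms in the cases where no sign arises.\<close>

definition decomposes :: "('k, 'a) mor => bool" where
 "decomposes f \<longleftrightarrow> (\<exists>f0 f1. law_homog A 0 f0 \<and> law_homog A 1 f1 \<and> f \<approx> Add f0 f1)"

lemma decomposesI: "law_homog A 0 f0 ==> law_homog A 1 f1 ==> f \<approx> Add f0 f1 ==> decomposes f"
 unfolding decomposes_def by blast

lemma homog_decomposes:
 assumes "law_homog A p f" "mwt A f"
 shows "decomposes f"
proof -
 let ?z = "Zero (msrc f) (mtgt f)"
 have z: "Add f ?z \<approx> f" using assms(2) by (intro add_zero) auto
 have z': "Add ?z f \<approx> f" using assms(2) by (intro ltrans[OF add_comm z]) auto
 show ?thesis
 proof (cases p)
  case zero
  then show ?thesis using assms z by (intro decomposesI[of f ?z] lsym[OF z]) (auto intro: law_homog.intros)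
 next
  case one
  then show ?thesis using assms z' by (intro decomposesI[of ?z f] lsym[OF z']) (auto intro: law_homog.intros)
 qed
qed

lemma decomposes_bilinear:
 assumes op: "op = Comp \<or> op = Tens" and d: "decomposes g" "decomposes f" and wt: "mwt A (op g f)"
 shows "decomposes (op g f)"
proof -
 obtain f0 f1 g0 g1 where *: "law_homog A 0 f0" "law_homog A 1 f1" "f \<approx> Add f0 f1"
  "law_homog A 0 g0" "law_homog A 1 g1" "g \<approx> Add g0 g1"
  using d by (auto simp: decomposes_def)
 note t = leq_typed[OF *(3)] leq_typed[OF *(6)] wt
 have h: "law_homog A p a ==> law_homog A q b ==> law_homog A (p + q) (op a b)" for a b p q
  using op by (auto intro: law_homog.intros)
 have "op g f \<approx> op (Add g0 g1) (Add f0 f1)" using op * t by (auto intro!: comp_cong tens_cong)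
 also have "... \<approx> Add (op g0 (Add f0 f1)) (op g1 (Add f0 f1))" using op t by (auto intro!: add_comp add_tens)
 also have "... \<approx> Add (Add (op g0 f0) (op g0 f1)) (Add (op g1 f0) (op g1 f1))"
  using op t by (auto intro!: add_cong comp_add tens_add)
 also have "... \<approx> Add (Add (op g0 f0) (op g0 f1)) (Add (op g1 f1) (op g1 f0))"
  using op t by (auto intro!: add_cong add_comm lrefl)
 also have "... \<approx> Add (Add (op g0 f0) (op g1 f1)) (Add (op g0 f1) (op g1 f0))"
  using op t by (intro add_shuffle) auto
 finally show ?thesis
  using h[OF *(4,1)] h[OF *(5,2)] h[OF *(4,2)] h[OF *(5,1)]
  by (intro decomposesI) (auto intro: law_homog.intros)
qed

lemma mwt_decomposes: "mwt A f ==> decomposes f"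
proof (induction f)
 case (Tok a)
 obtain a0 a1 where a: "a0 \<in> homog A 0" "a1 \<in> homog A 1" "a = a0 + a1"
  using homog_direct_sum[of a] by auto
 have "smul A 1 b = b" for b using smul_module by (simp add: Modules.module_def)
 then have "Add (Smul 1 (Tok a0)) (Smul 1 (Tok a1)) \<approx> Tok a"
  using leqI[OF law_tok_linear[of A 1 a0 1 a1]] a(3) by simp
 then show ?case using a by (intro decomposesI[OF _ _ lsym]) (auto intro: law_homog.intros)
next
 case (Comp g f)
 then show ?case by (intro decomposes_bilinear[OF disjI1[OF refl]]) auto
next
 case (Tens g f)
 then show ?case by (intro decomposes_bilinear[OF disjI2[OF refl]]) auto
next
 case (Add f g)
 obtain f0 f1 g0 g1 where *: "law_homog A 0 f0" "law_homog A 1 f1" "f \<approx> Add f0 f1"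
  "law_homog A 0 g0" "law_homog A 1 g1" "g \<approx> Add g0 g1"
  using Add by (auto simp: decomposes_def)
 note t = leq_typed[OF *(3)] leq_typed[OF *(6)] Add.prems
 have "Add f g \<approx> Add (Add f0 f1) (Add g0 g1)" using * t by (intro add_cong) auto
 also have "... \<approx> Add (Add f0 g0) (Add f1 g1)" using t by (intro add_shuffle) auto
 finally show ?case using * by (intro decomposesI) (auto intro: law_homog.intros)
next
 case (Smul c f)
 obtain f0 f1 where *: "law_homog A 0 f0" "law_homog A 1 f1" "f \<approx> Add f0 f1"
  using Smul by (auto simp: decomposes_def)
 have "Smul c f \<approx> Smul c (Add f0 f1)" using * by (intro smul_cong)
 also have "... \<approx> Add (Smul c f0) (Smul c f1)" using leq_typed[OF *(3)] by (intro smul_add) auto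
 finally show ?case using * by (intro decomposesI) (auto intro: law_homog.intros)
qed (auto intro: homog_decomposes law_homog.intros)

lemma interchange_homog:
 assumes "mwt A ((f' \<star> g) \<cdot> (f \<star> g'))" "msrc f' = mtgt f" "law_homog A p f" "law_homog A q g" "p * q = 0"
 shows "(f' \<star> g) \<cdot> (f \<star> g') \<approx> (f' \<cdot> f) \<star> (g \<cdot> g')"
proof -
 have "(f' \<star> g) \<cdot> (f \<star> g') \<approx> Smul 1 ((f' \<cdot> f) \<star> (g \<cdot> g'))"
  using super_interchange[OF assms(1-4)] assms(5) by (simp add: koszul_def)
 also have "... \<approx> (f' \<cdot> f) \<star> (g \<cdot> g')" using assms by (intro one_smul) auto
 finally show ?thesis .
qed

text \<open>Both homogeneous parts of \<open>g\<close> pass the even \<open>f\<close> without a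
  sign, and bilinearity puts them together again.\<close>

lemma interchange_even_left:
 assumes "mwt A ((f' \<star> g) \<cdot> (f \<star> g'))" "msrc f' = mtgt f" "law_homog A 0 f"
 shows "(f' \<star> g) \<cdot> (f \<star> g') \<approx> (f' \<cdot> f) \<star> (g \<cdot> g')"
proof -
 obtain g0 g1 where g: "law_homog A 0 g0" "law_homog A 1 g1" "g \<approx> Add g0 g1"
  using mwt_decomposes[of g] assms(1) by (auto simp: decomposes_def)
 note t = leq_typed[OF g(3)] assms(1,2)
 have "(f' \<star> g) \<cdot> (f \<star> g') \<approx> (f' \<star> Add g0 g1) \<cdot> (f \<star> g')"
  using t g by (intro comp_cong tens_cong lrefl) auto
 also have "... \<approx> Add (f' \<star> g0) (f' \<star> g1) \<cdot> (f \<star> g')"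
  using t by (intro comp_cong tens_add lrefl) auto
 also have "... \<approx> Add ((f' \<star> g0) \<cdot> (f \<star> g')) ((f' \<star> g1) \<cdot> (f \<star> g'))"
  using t by (intro add_comp) auto
 also have "... \<approx> Add ((f' \<cdot> f) \<star> (g0 \<cdot> g')) ((f' \<cdot> f) \<star> (g1 \<cdot> g'))"
  using t by (intro add_cong interchange_homog[OF _ _ assms(3) g(1)] interchange_homog[OF _ _ assms(3) g(2)]) auto
 also have "... \<approx> (f' \<cdot> f) \<star> Add (g0 \<cdot> g') (g1 \<cdot> g')"
  using t by (intro lsym[OF tens_add]) auto
 also have "... \<approx> (f' \<cdot> f) \<star> (Add g0 g1 \<cdot> g')"
  using t by (intro tens_cong lrefl lsym[OF add_comp]) auto
 also have "... \<approx> (f' \<cdot> f) \<star> (g \<cdot> g')"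
  using t by (intro tens_cong lrefl comp_cong lsym[OF g(3)]) auto
 finally show ?thesis .
qed

lemma interchange_even_right:
 assumes "mwt A ((f' \<star> g) \<cdot> (f \<star> g'))" "msrc f' = mtgt f" "law_homog A 0 g"
 shows "(f' \<star> g) \<cdot> (f \<star> g') \<approx> (f' \<cdot> f) \<star> (g \<cdot> g')"
proof -
 obtain f0 f1 where f: "law_homog A 0 f0" "law_homog A 1 f1" "f \<approx> Add f0 f1"
  using mwt_decomposes[of f] assms(1) by (auto simp: decomposes_def)
 note t = leq_typed[OF f(3)] assms(1,2)
 have "(f' \<star> g) \<cdot> (f \<star> g') \<approx> (f' \<star> g) \<cdot> (Add f0 f1 \<star> g')"
  using t f by (intro comp_cong tens_cong lrefl) auto
 also have "... \<approx> (f' \<star> g) \<cdot> Add (f0 \<star> g') (f1 \<star> g')"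
  using t by (intro comp_cong add_tens lrefl) auto
 also have "... \<approx> Add ((f' \<star> g) \<cdot> (f0 \<star> g')) ((f' \<star> g) \<cdot> (f1 \<star> g'))"
  using t by (intro comp_add) auto
 also have "... \<approx> Add ((f' \<cdot> f0) \<star> (g \<cdot> g')) ((f' \<cdot> f1) \<star> (g \<cdot> g'))"
  using t by (intro add_cong interchange_homog[OF _ _ f(1) assms(3)] interchange_homog[OF _ _ f(2) assms(3)]) auto
 also have "... \<approx> Add (f' \<cdot> f0) (f' \<cdot> f1) \<star> (g \<cdot> g')"
  using t by (intro lsym[OF add_tens]) auto
 also have "... \<approx> (f' \<cdot> Add f0 f1) \<star> (g \<cdot> g')"
  using t by (intro tens_cong lrefl lsym[OF comp_add]) auto
 also have "... \<approx> (f' \<cdot> f) \<star> (g \<cdot> g')"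
  using t by (intro tens_cong lrefl comp_cong lsym[OF f(3)]) auto
 finally show ?thesis .
qed

lemma tens_split:
 assumes "mwt A f" "mwt A g" "msrc f = u" "mtgt g = v"
 shows "f \<star> g \<approx> (f \<star> Ident v) \<cdot> (Ident u \<star> g)"
proof -
 have "(f \<star> Ident v) \<cdot> (Ident u \<star> g) \<approx> (f \<cdot> Ident u) \<star> (Ident v \<cdot> g)"
  using assms by (intro interchange_even_left) (auto intro: law_homog.intros)
 also have "... \<approx> f \<star> g" using assms by (intro tens_cong comp_id id_comp) auto
 finally show ?thesis by (rule lsym)
qed

subsection \<open>Whiskering\<close>

definition wh :: "('k, 'a) word => ('k, 'a) mor => ('k, 'a) word => ('k, 'a) mor" where
 "wh l f r = Ident l \<star> f \<star> Ident r"

lemma wh_typed [simp]: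
 "mwt A (wh l f r) \<longleftrightarrow> l \<in> Ob \<and> mwt A f \<and> r \<in> Ob"
 "msrc (wh l f r) = l @ msrc f @ r" "mtgt (wh l f r) = l @ mtgt f @ r"
 by (auto simp: wh_def)

lemma wh_homog: "law_homog A p f ==> law_homog A p (wh l f r)"
 using law_homog.intros(8)[OF law_homog.intros(8)[OF law_homog.intros(1)[of A l], of p f] law_homog.intros(1)[of A r]]
 by (simp add: wh_def)

lemma wh_cong: "f \<approx> g ==> l \<in> Ob ==> r \<in> Ob ==> wh l f r \<approx> wh l g r"
 unfolding wh_def by (intro tens_cong lrefl) auto

lemma wh_comp:
 assumes "mwt A (g \<cdot> f)" "l \<in> Ob" "r \<in> Ob"
 shows "wh l (g \<cdot> f) r \<approx> wh l g r \<cdot> wh l f r"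
proof -
 have "wh l g r \<cdot> wh l f r \<approx> ((Ident l \<star> g) \<cdot> (Ident l \<star> f)) \<star> (Ident r \<cdot> Ident r)"
  unfolding wh_def using assms by (intro interchange_even_right) (auto intro: law_homog.intros)
 also have "... \<approx> ((Ident l \<cdot> Ident l) \<star> (g \<cdot> f)) \<star> (Ident r \<cdot> Ident r)"
  using assms by (intro tens_cong interchange_even_left lrefl) (auto intro: law_homog.intros)
 also have "... \<approx> wh l (g \<cdot> f) r"
  unfolding wh_def using assms by (intro tens_cong id_comp lrefl) auto
 finally show ?thesis by (rule lsym)
qed

lemma wh_add:
 assumes "mwt A (Add f g)" "l \<in> Ob" "r \<in> Ob"
 shows "wh l (Add f g) r \<approx> Add (wh l f r) (wh l g r)"
proof -
 have "wh l (Add f g) r \<approx> Add (Ident l \<star> f) (Ident l \<star> g) \<star> Ident r"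
  unfolding wh_def using assms by (intro tens_cong tens_add lrefl) auto
 also have "... \<approx> Add (wh l f r) (wh l g r)" unfolding wh_def using assms by (intro add_tens) auto
 finally show ?thesis .
qed

lemma wh_smul:
 assumes "mwt A f" "l \<in> Ob" "r \<in> Ob"
 shows "wh l (Smul c f) r \<approx> Smul c (wh l f r)"
proof -
 have "wh l (Smul c f) r \<approx> Smul c (Ident l \<star> f) \<star> Ident r"
  unfolding wh_def using assms by (intro tens_cong tens_smul lrefl) auto
 also have "... \<approx> Smul c (wh l f r)" unfolding wh_def using assms by (intro smul_tens) auto
 finally show ?thesis .
qed

lemma wh_zero:
 assumes "u \<in> Ob" "v \<in> Ob" "l \<in> Ob" "r \<in> Ob"
 shows "wh l (Zero u v) r \<approx> Zero (l @ u @ r) (l @ v @ r)"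
proof -
 have "wh l (Zero u v) r \<approx> wh l (Smul 0 (Zero u v)) r" using assms by (intro wh_cong lsym[OF zero_smul]) auto
 also have "... \<approx> Smul 0 (wh l (Zero u v) r)" using assms by (intro wh_smul) auto
 also have "... \<approx> Zero (l @ u @ r) (l @ v @ r)" using assms by (intro zero_smul) auto
 finally show ?thesis .
qed

lemma wh_ident:
 assumes "m \<in> Ob" "l \<in> Ob" "r \<in> Ob"
 shows "wh l (Ident m) r \<approx> Ident (l @ m @ r)"
proof -
 have "wh l (Ident m) r \<approx> Ident (l @ m) \<star> Ident r" unfolding wh_def using assms by (intro tens_cong ident_tens lrefl) auto
 also have "... \<approx> Ident ((l @ m) @ r)" using assms by (intro ident_tens) auto
 finally show ?thesis by simp
qed

lemma wh_assoc: "mwt A f ==> l \<in> Ob ==> r \<in> Ob ==> wh l f r \<approx> Ident l \<star> (f \<star> Ident r)"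
 unfolding wh_def by (intro tens_assoc) auto

lemma wh_split_right:
 assumes "mwt A f" "l \<in> Ob" "r \<in> Ob" "w \<in> Ob"
 shows "wh l f (w @ r) \<approx> wh l f w \<star> Ident r"
proof -
 have "wh l f (w @ r) \<approx> Ident l \<star> f \<star> (Ident w \<star> Ident r)"
  unfolding wh_def using assms by (intro tens_cong lsym[OF ident_tens] lrefl) auto
 also have "... \<approx> wh l f w \<star> Ident r"
  unfolding wh_def using assms by (intro lsym[OF tens_assoc]) auto
 finally show ?thesis .
qed

lemma wh_tens:
 assumes "mwt A f" "mwt A g" "l \<in> Ob" "r \<in> Ob"
 shows "wh l (f \<star> g) r \<approx> wh l f (mtgt g @ r) \<cdot> wh (l @ msrc f) g r"
proof -
 have "wh l (f \<star> g) r \<approx> wh l ((f \<star> Ident (mtgt g)) \<cdot> (Ident (msrc f) \<star> g)) r"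
  using assms by (intro wh_cong tens_split) auto
 also have "... \<approx> wh l (f \<star> Ident (mtgt g)) r \<cdot> wh l (Ident (msrc f) \<star> g) r"
  using assms by (intro wh_comp) auto
 also have "... \<approx> wh l f (mtgt g @ r) \<cdot> wh (l @ msrc f) g r"
 proof (intro comp_cong)
  have "wh l (f \<star> Ident (mtgt g)) r \<approx> wh l f (mtgt g) \<star> Ident r"
   unfolding wh_def using assms by (intro tens_cong lsym[OF tens_assoc] lrefl) auto
  also have "... \<approx> wh l f (mtgt g @ r)" using assms by (intro lsym[OF wh_split_right]) auto
  finally show "wh l (f \<star> Ident (mtgt g)) r \<approx> wh l f (mtgt g @ r)" .
  have "wh l (Ident (msrc f) \<star> g) r \<approx> Ident l \<star> Ident (msrc f) \<star> g \<star> Ident r"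
   unfolding wh_def using assms by (intro tens_cong lsym[OF tens_assoc] lrefl) auto
  also have "... \<approx> wh (l @ msrc f) g r"
   unfolding wh_def using assms by (intro tens_cong ident_tens lrefl) auto
  finally show "wh l (Ident (msrc f) \<star> g) r \<approx> wh (l @ msrc f) g r" .
 qed (use assms in auto)
 finally show ?thesis .
qed

lemma wh_factor:
 assumes f: "mwt A f" "msrc f = u" "mtgt f = u'" and g: "mwt A g" "msrc g = v" "mtgt g = v'"
  and o: "l \<in> Ob" "m \<in> Ob" "r \<in> Ob"
 shows "wh l f (m @ v' @ r) \<cdot> wh (l @ u @ m) g r \<approx> wh l f m \<star> (g \<star> Ident r)"
  "wh (l @ u' @ m) g r \<cdot> wh l f (m @ v @ r)
   \<approx> (Ident (l @ u' @ m) \<star> (g \<star> Ident r)) \<cdot> (wh l f m \<star> Ident (v @ r))"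
proof -
 have o': "u \<in> Ob" "u' \<in> Ob" "v \<in> Ob" "v' \<in> Ob"
  using f g by auto
 have "wh l f (m @ v' @ r) \<cdot> wh (l @ u @ m) g r
  \<approx> (wh l f m \<star> Ident (v' @ r)) \<cdot> (Ident (l @ u @ m) \<star> (g \<star> Ident r))"
  using assms o' by (intro comp_cong wh_assoc wh_split_right[of f l "v' @ r" m]) auto
 also have "... \<approx> wh l f m \<star> (g \<star> Ident r)" using assms by (intro lsym[OF tens_split]) auto
 finally show "wh l f (m @ v' @ r) \<cdot> wh (l @ u @ m) g r \<approx> wh l f m \<star> (g \<star> Ident r)" .
 show "wh (l @ u' @ m) g r \<cdot> wh l f (m @ v @ r)
   \<approx> (Ident (l @ u' @ m) \<star> (g \<star> Ident r)) \<cdot> (wh l f m \<star> Ident (v @ r))"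
  using assms o' by (intro comp_cong wh_assoc wh_split_right[of f l "v @ r" m]) auto
qed

text \<open>One order of the two factors is their tensor product on the nose, the other one is the
  same up to the Koszul sign, which squares to one.\<close>

lemma wh_exchange:
 assumes f: "mwt A f" "msrc f = u" "mtgt f = u'" and g: "mwt A g" "msrc g = v" "mtgt g = v'"
  and o: "l \<in> Ob" "m \<in> Ob" "r \<in> Ob"
  and h: "law_homog A p f" "law_homog A q g"
 shows "wh l f (m @ v' @ r) \<cdot> wh (l @ u @ m) g r
  \<approx> Smul (koszul (p * q)) (wh (l @ u' @ m) g r \<cdot> wh l f (m @ v @ r))"
proof -
 let ?F = "wh l f m" and ?G = "g \<star> Ident r" and ?k = "koszul (p * q) :: 'k"
 have o': "u' \<in> Ob" "v \<in> Ob" using f g by auto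
 have G: "law_homog A q ?G" using law_homog.intros(8)[OF h(2) law_homog.intros(1)[of A r]] by simp
 have "wh (l @ u' @ m) g r \<cdot> wh l f (m @ v @ r) \<approx> Smul ?k ((Ident (l @ u' @ m) \<cdot> ?F) \<star> (?G \<cdot> Ident (v @ r)))"
  using assms o' by (intro ltrans[OF wh_factor(2)[OF f g o] super_interchange] wh_homog G) auto
 also have "... \<approx> Smul ?k (?F \<star> ?G)" using assms o' by (intro smul_cong tens_cong id_comp comp_id) auto
 finally have "Smul ?k (wh (l @ u' @ m) g r \<cdot> wh l f (m @ v @ r)) \<approx> Smul ?k (Smul ?k (?F \<star> ?G))"
  by (rule smul_cong)
 also have "... \<approx> Smul (?k * ?k) (?F \<star> ?G)" using assms by (intro smul_smul) auto
 also have "?k * ?k = 1" by (simp add: koszul_def)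
 also have "Smul 1 (?F \<star> ?G) \<approx> ?F \<star> ?G" using assms by (intro one_smul) auto
 also note lsym[OF wh_factor(1)[OF f g o]]
 finally show ?thesis by (rule lsym)
qed

text \<open>With one factor even, the other may be inhomogeneous, as a token for an arbitrary
  element is.\<close>

lemma wh_exchange_even:
 assumes f: "mwt A f" "msrc f = u" "mtgt f = u'" and g: "mwt A g" "msrc g = v" "mtgt g = v'"
  and o: "l \<in> Ob" "m \<in> Ob" "r \<in> Ob"
  and h: "law_homog A 0 f \<or> law_homog A 0 g"
 shows "wh l f (m @ v' @ r) \<cdot> wh (l @ u @ m) g r \<approx> wh (l @ u' @ m) g r \<cdot> wh l f (m @ v @ r)"
proof -
 let ?F = "wh l f m" and ?G = "g \<star> Ident r"
 have o': "u' \<in> Ob" "v \<in> Ob" using f g by auto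
 have G: "law_homog A 0 g ==> law_homog A 0 ?G" using law_homog.intros(8)[OF _ law_homog.intros(1)[of A r], of 0 g] by simp
 note wh_factor(2)[OF f g o]
 also have "(Ident (l @ u' @ m) \<star> ?G) \<cdot> (?F \<star> Ident (v @ r)) \<approx> (Ident (l @ u' @ m) \<cdot> ?F) \<star> (?G \<cdot> Ident (v @ r))"
 proof (cases "law_homog A 0 g")
  case True
  then show ?thesis using assms o' by (intro interchange_even_right G) auto
 next
  case False
  then show ?thesis using assms o' by (intro interchange_even_left wh_homog) auto
 qed
 also have "... \<approx> ?F \<star> ?G" using assms o' by (intro tens_cong id_comp comp_id) auto
 also note lsym[OF wh_factor(1)[OF f g o]]
 finally show ?thesis by (rule lsym)
qed

end

subsection \<open>Tokens and dots on black strands\<close>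

lemma length_filter_nth: "length (filter (\<lambda>p. P (xs ! p)) [0..<length xs]) = length (filter P xs)"
proof -
 have "filter P (map ((!) xs) [0..<length xs]) = map ((!) xs) (filter (\<lambda>p. P (xs ! p)) [0..<length xs])"
  by (simp add: filter_map o_def)
 then show ?thesis by (metis length_map map_nth)
qed

text \<open>The letters of \<open>l\<close> contribute the first \<open>nb l\<close> entries of the
  list of black positions. From here on strands are addressed by splitting the word instead of by
  positions.\<close>

lemma black_position: "filter (\<lambda>p. (l @ None # r) ! p = None) [0..<length (l @ None # r)] ! nb l = length l"
proof -
 let ?P = "\<lambda>p. (l @ None # r) ! p = None"
 have "[0..<length (l @ None # r)] = [0..<length l] @ [length l..<length (l @ None # r)]"
  using upt_add_eq_append[of 0 "length l" "Suc (length r)"] by simp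
 also have "[length l..<length (l @ None # r)] = length l # [Suc (length l)..<length (l @ None # r)]"
  by (rule upt_conv_Cons) simp
 finally have "filter ?P [0..<length (l @ None # r)]
  = filter ?P [0..<length l] @ length l # filter ?P [Suc (length l)..<length (l @ None # r)]"
  by simp
 moreover have "filter ?P [0..<length l] = filter (\<lambda>p. l ! p = None) [0..<length l]"
  by (rule filter_cong) (auto simp: nth_append)
 then have "length (filter ?P [0..<length l]) = nb l"
  using length_filter_nth[of "\<lambda>x. x = None" l] by (simp add: nb_filter)
 ultimately show ?thesis by (metis nth_append_length)
qed

lemma black_split: "k \<in> {1..nb v} ==> \<exists>l r. v = l @ None # r \<and> k = Suc (nb l)"
proof (induction v arbitrary: k)
 case (Cons x v)
 show ?case
 proof (cases "x = None \<and> k = 1")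
  case True
  then show ?thesis by (intro exI[of _ "[]"] exI[of _ v]) simp
 next
  case False
  define j where "j = (if x = None then k - 1 else k)"
  have "j \<in> {1..nb v}" using Cons.prems False by (auto simp: j_def split: if_splits)
  then obtain l r where "v = l @ None # r" "j = Suc (nb l)" using Cons.IH by blast
  then show ?thesis using Cons.prems False by (intro exI[of _ "x # l"] exI[of _ r]) (auto simp: j_def split: if_splits)
 qed
qed simp

lemma black_split2:
 assumes "k \<in> {1..nb v}" "k' \<in> {1..nb v}" "k < k'"
 obtains l m r where "v = l @ None # m @ None # r" "k = Suc (nb l)" "k' = Suc (nb (l @ None # m))"
proof -
 obtain l' r where l': "v = l' @ None # r" "k' = Suc (nb l')" using black_split assms(2) by blast
 then have "k \<in> {1..nb l'}" using assms by auto
 then obtain l m where "l' = l @ None # m" "k = Suc (nb l)" using black_split by blast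
 then show ?thesis using that[of l m r] l' by simp
qed

context frobenius_superalgebra
begin

lemma wh_tens_ident:
 assumes "mwt A f" "l \<in> Ob" "r \<in> Ob" "w \<in> Ob"
 shows "wh l (f \<star> Ident w) r \<approx> wh l f (w @ r)" "wh l (Ident w \<star> f) r \<approx> wh (l @ w) f r"
proof -
 have "wh l (f \<star> Ident w) r \<approx> wh l f w \<star> Ident r"
  unfolding wh_def using assms by (intro tens_cong lsym[OF tens_assoc] lrefl) auto
 also have "... \<approx> wh l f (w @ r)" using assms by (intro lsym[OF wh_split_right]) auto
 finally show "wh l (f \<star> Ident w) r \<approx> wh l f (w @ r)" .
 have "wh l (Ident w \<star> f) r \<approx> Ident l \<star> Ident w \<star> f \<star> Ident r"
  unfolding wh_def using assms by (intro tens_cong lsym[OF tens_assoc] lrefl) auto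
 also have "... \<approx> wh (l @ w) f r"
  unfolding wh_def using assms by (intro tens_cong ident_tens lrefl) auto
 finally show "wh l (Ident w \<star> f) r \<approx> wh (l @ w) f r" .
qed

lemma on_black_wh: "on_black (l @ None # r) (Suc (nb l)) f = wh l f r"
 unfolding on_black_def Let_def diff_Suc_1 black_position wh_def by simp

lemma on_black_typed:
 assumes "k \<in> {1..nb v}" "v \<in> Ob" "mwt A f" "msrc f = [None]" "mtgt f = [None]"
 shows "mwt A (on_black v k f) \<and> msrc (on_black v k f) = v \<and> mtgt (on_black v k f) = v"
 using black_split[OF assms(1)] assms(2-5) by (auto simp: on_black_wh)

lemma on_black_cong: "k \<in> {1..nb v} ==> v \<in> Ob ==> f \<approx> g ==> on_black v k f \<approx> on_black v k g"
 using black_split[of k v] by (auto simp: on_black_wh intro!: wh_cong)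

lemma on_black_comp:
 "k \<in> {1..nb v} ==> v \<in> Ob ==> mwt A (g \<cdot> f) ==> on_black v k (g \<cdot> f) \<approx> on_black v k g \<cdot> on_black v k f"
 using black_split[of k v] by (auto simp: on_black_wh intro!: wh_comp)

lemma on_black_add:
 "k \<in> {1..nb v} ==> v \<in> Ob ==> mwt A (Add f g) ==> on_black v k (Add f g) \<approx> Add (on_black v k f) (on_black v k g)"
 using black_split[of k v] by (auto simp: on_black_wh intro!: wh_add)

lemma on_black_smul:
 "k \<in> {1..nb v} ==> v \<in> Ob ==> mwt A f ==> on_black v k (Smul c f) \<approx> Smul c (on_black v k f)"
 using black_split[of k v] by (auto simp: on_black_wh intro!: wh_smul)

lemma on_black_ident: "k \<in> {1..nb v} ==> v \<in> Ob ==> on_black v k Ident_I \<approx> Ident v"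
 using black_split[of k v] wh_ident[of "[None]"] by (auto simp: on_black_wh)

lemma on_black_exchange:
 assumes k: "k \<in> {1..nb v}" "k' \<in> {1..nb v}" "k \<noteq> k'" and v: "v \<in> Ob"
  and f: "mwt A f" "msrc f = [None]" "mtgt f = [None]" "law_homog A p f"
  and g: "mwt A g" "msrc g = [None]" "mtgt g = [None]" "law_homog A q g"
 shows "on_black v k f \<cdot> on_black v k' g \<approx> Smul (koszul (p * q)) (on_black v k' g \<cdot> on_black v k f)"
proof -
 have less: "on_black v k f \<cdot> on_black v k' g \<approx> Smul (koszul (p * q)) (on_black v k' g \<cdot> on_black v k f)"
  if k: "k \<in> {1..nb v}" "k' \<in> {1..nb v}" "k < k'"
   and f: "mwt A f" "msrc f = [None]" "mtgt f = [None]" "law_homog A p f"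
   and g: "mwt A g" "msrc g = [None]" "mtgt g = [None]" "law_homog A q g" for k k' f g p q
 proof -
  obtain l m r where *: "v = l @ None # m @ None # r" "k = Suc (nb l)" "k' = Suc (nb (l @ None # m))"
   using black_split2[OF k] by blast
  then have "on_black v k F = wh l F (m @ [None] @ r)" "on_black v k' F = wh (l @ [None] @ m) F r" for F
   using on_black_wh[of l "m @ None # r" F] on_black_wh[of "l @ None # m" r F] by simp_all
  then show ?thesis using wh_exchange[of f _ _ g _ _ l m r p q] f g v * by simp
 qed
 show ?thesis
 proof (cases "k < k'")
  case True
  then show ?thesis using less k f g by blast
 next
  case False
  let ?f = "on_black v k f" and ?g = "on_black v k' g"
  have t: "mwt A (?f \<cdot> ?g)" using on_black_typed[of k v f] on_black_typed[of k' v g] k v f g by auto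
  have "Smul (koszul (p * q)) (?g \<cdot> ?f) \<approx> Smul (koszul (p * q)) (Smul (koszul (q * p)) (?f \<cdot> ?g))"
   using False k f g by (intro smul_cong less) auto
  also have "... \<approx> Smul (koszul (p * q) * koszul (q * p)) (?f \<cdot> ?g)" using t by (rule smul_smul)
  also have "koszul (p * q) * koszul (q * p) = (1 :: 'k)" by (simp add: koszul_def mult.commute)
  also have "Smul 1 (?f \<cdot> ?g) \<approx> ?f \<cdot> ?g" using t by (rule one_smul)
  finally show ?thesis by (rule lsym)
 qed
qed

primrec Iv :: "('k, 'a) word => ('k, 'a) pterm => ('k, 'a) mor" where
 "Iv v (PTok k a) = on_black v k (Tok a)"
| "Iv v (PX k) = on_black v k Dot"
| "Iv v PZero = Zero v v"
| "Iv v POne = Ident v"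
| "Iv v (PAdd f g) = Add (Iv v f) (Iv v g)"
| "Iv v (PMul f g) = Iv v f \<cdot> Iv v g"
| "Iv v (PSmul c f) = Smul c (Iv v f)"

lemma Iv_typed [simp]:
 assumes "f \<in> pol_terms (nb v)" "v \<in> Ob"
 shows "mwt A (Iv v f)" "msrc (Iv v f) = v" "mtgt (Iv v f) = v"
 using assms by (induction rule: pol_terms.induct) (auto simp: on_black_typed simp del: atLeastAtMost_iff)

text \<open>Relations on one strand are those of tokens and dots, and relations between different
  strands are instances of super interchange. Thus \<open>Pol\<^sub>d(A)\<close> acts on every word
  with \<open>d\<close> black strands.\<close>

lemma Iv_cong: "pol_eq A (nb v) f g ==> v \<in> Ob ==> Iv v f \<approx> Iv v g"
proof (induction rule: pol_eq.induct)
 case (pol_sym f g)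
 then show ?case using lsym by blast
next
 case (pol_trans f g h)
 then show ?case using ltrans by blast
next
 case (pol_cong_add f f' g g')
 then have "f \<in> pol_terms (nb v)" "g \<in> pol_terms (nb v)" using pol_eq_terms by blast+
 then show ?case using pol_cong_add by (auto intro!: add_cong)
next
 case (pol_cong_mul f f' g g')
 then have "f \<in> pol_terms (nb v)" "g \<in> pol_terms (nb v)" using pol_eq_terms by blast+
 then show ?case using pol_cong_mul by (auto intro!: comp_cong)
next
 case (pol_tok_one i)
 then show ?case using ltrans[OF on_black_cong[OF _ _ leqI[OF law_tok_one]] on_black_ident] by simp
next
 case (pol_tok_linear i c a d b)
 then have "on_black v i (Tok (smul A c a + smul A d b)) \<approx> on_black v i (Add (Smul c (Tok a)) (Smul d (Tok b)))"
  by (intro on_black_cong lsym[OF leqI[OF law_tok_linear]]) auto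
 also have "... \<approx> Add (on_black v i (Smul c (Tok a))) (on_black v i (Smul d (Tok b)))"
  using pol_tok_linear by (intro on_black_add) auto
 also have "... \<approx> Add (Smul c (on_black v i (Tok a))) (Smul d (on_black v i (Tok b)))"
  using pol_tok_linear on_black_typed[of i v "Smul c (Tok a)"] on_black_typed[of i v "Smul d (Tok b)"]
  by (intro add_cong on_black_smul) auto
 finally show ?case by simp
next
 case (pol_tok_mult i a b)
 then have "on_black v i (Tok a) \<cdot> on_black v i (Tok b) \<approx> on_black v i (Tok a \<cdot> Tok b)"
  by (intro lsym[OF on_black_comp]) auto
 also have "... \<approx> on_black v i (Tok (a * b))" using pol_tok_mult by (intro on_black_cong leqI[OF law_tok_mult])
 finally show ?case by simp
next
 case (pol_tok_commute i j a p b q)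
 then show ?case by (simp, intro on_black_exchange) (auto intro: law_homog.intros)
next
 case (pol_x_commute i j)
 have "eps A * eps A = eps A" by (cases "eps A") auto
 then show ?case using pol_x_commute on_black_exchange[of i v j Dot "eps A" Dot "eps A"] by (auto intro: law_homog.intros)
next
 case (pol_tok_x i j a p)
 show ?case
 proof (cases "j = i")
  case True
  have "on_black v i (Tok a) \<cdot> on_black v i Dot \<approx> on_black v i (Tok a \<cdot> Dot)"
   using pol_tok_x by (intro lsym[OF on_black_comp]) auto
  also have "... \<approx> on_black v i (Smul (koszul (eps A * p)) (Dot \<cdot> Tok (nak A a)))"
   using pol_tok_x by (intro on_black_cong leqI[OF law_tok_dot])
  also have "... \<approx> Smul (koszul (eps A * p)) (on_black v i (Dot \<cdot> Tok (nak A a)))"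
   using pol_tok_x by (intro on_black_smul) auto
  also have "... \<approx> Smul (koszul (eps A * p)) (on_black v i Dot \<cdot> on_black v i (Tok (nak A a)))"
   using pol_tok_x by (intro smul_cong on_black_comp) auto
  finally show ?thesis using True by simp
 next
  case False
  then show ?thesis using pol_tok_x on_black_exchange[of j v i "Tok a" p Dot "eps A"]
   by (auto intro: law_homog.intros simp: mult.commute)
 qed
qed (auto intro!: lrefl smul_cong add_assoc add_comm add_zero add_neg smul_add add_smul smul_smul one_smul
  comp_assoc id_comp comp_id comp_add add_comp smul_comp comp_smul)

lemma Iv_tokens: "Iv v (ptokens bs) = tokens v bs"
proof -
 have "Iv v (foldr PMul (map f ks) POne) = mprod v (map (\<lambda>k. Iv v (f k)) ks)" for f :: "nat => ('k, 'a) pterm" and ks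
  by (induction ks) auto
 from this[of "\<lambda>k. PTok k (bs ! (k - 1))"] show ?thesis by (simp add: ptokens_def tokens_def del: upt_Suc)
qed

lemma Iv_dots: "Iv v (pdots \<alpha>) = dots v \<alpha>"
proof -
 have "Iv v (foldr PMul (map f ks) POne) = mprod v (map (\<lambda>k. Iv v (f k)) ks)" for f :: "nat => ('k, 'a) pterm" and ks
  by (induction ks) auto
 moreover have "Iv v (ppow f r) = mpow (Iv v f) v r" for f r by (induction r) auto
 ultimately show ?thesis by (simp add: pdots_def dots_def del: upt_Suc)
qed

subsection \<open>The filtration by the number of crossings\<close>

text \<open>A bound read off the term and not an invariant of the morphism: a double crossing equals
  a morphism with bound 0.\<close>

primrec cr :: "('k, 'a) mor => nat" where
 "cr (Ident u) = 0"
| "cr Cross = 1"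
| "cr (Tok a) = 0"
| "cr Dot = 0"
| "cr (Rho Q) = 1"
| "cr (Lam Q) = 1"
| "cr (g \<cdot> f) = cr f + cr g"
| "cr (f \<star> g) = cr f + cr g"
| "cr (Zero u v) = 0"
| "cr (Add f g) = max (cr f) (cr g)"
| "cr (Smul c f) = cr f"

lemma cr_wh [simp]: "cr (wh l f r) = cr f"
 by (simp add: wh_def)

lemma cr_msum: "(\<And>f. f \<in> set fs ==> cr f = 0) ==> cr (msum u v fs) = 0"
 by (induction fs) auto

lemma cr_mpow [simp]: "cr (mpow Dot u r) = 0"
 by (induction r) auto

lemma cr_bracket [simp]: "cr (bracket as) = 0" "cr (bracket2 Q ms) = 0"
 by (auto simp: bracket_def bracket2_def intro!: cr_msum)

lemma crossing_typed:
 "a = None \<or> b = None ==> [a, b] \<in> Ob ==>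
  mwt A (crossing a b) \<and> msrc (crossing a b) = [a, b] \<and> mtgt (crossing a b) = [b, a] \<and> law_homog A 0 (crossing a b)
   \<and> cr (crossing a b) = 1"
 by (cases a; cases b) (auto intro: law_homog.intros)

lemma word_split_at:
 assumes "Suc p < length u"
 obtains l a b r where "u = l @ a # b # r" "p = length l"
proof
 show "u = take p u @ u ! p # u ! Suc p # drop (Suc (Suc p)) u" using swap_at_split(1)[OF assms] by simp
 show "p = length (take p u)" using assms by simp
qed

lemma swap_at_length: "swap_at (length l) (l @ a # b # r) = l @ b # a # r"
 using swap_at_append[of l a b r] by simp

lemma object_Cons: "x # u \<in> Ob \<longleftrightarrow> x \<in> insert None (Some ` pol_E A 1) \<and> u \<in> Ob"
 by (simp add: law_objects_def)

lemma diagram_mor_step: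
 "diagram_mor (l @ a # b # r) (length l # ps) = diagram_mor (l @ b # a # r) ps \<cdot> wh l (crossing a b) r"
 by (simp add: wh_def nth_append swap_at_length)

lemma is_diagram_step:
 "is_diagram (l @ a # b # r) (length l # ps) v \<longleftrightarrow> (a = None \<or> b = None) \<and> is_diagram (l @ b # a # r) ps v"
 by (simp add: nth_append swap_at_length)

lemma diagram_typed:
 "is_diagram u ps v ==> u \<in> Ob ==>
  mwt A (diagram_mor u ps) \<and> msrc (diagram_mor u ps) = u \<and> mtgt (diagram_mor u ps) = v \<and> cr (diagram_mor u ps) = length ps"
proof (induction ps arbitrary: u)
 case (Cons p ps)
 then obtain l a b r where u: "u = l @ a # b # r" "p = length l" using word_split_at[of p u] by (metis is_diagram.simps(2))
 have *: "a = None \<or> b = None" "is_diagram (l @ b # a # r) ps v"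
  using Cons.prems(1) unfolding u is_diagram_step by auto
 have o: "l @ b # a # r \<in> Ob" "[a, b] \<in> Ob" "l \<in> Ob" "r \<in> Ob"
  using Cons.prems(2) u by (auto simp: object_Cons)
 show ?case using Cons.IH[OF *(2) o(1)] crossing_typed[OF *(1) o(2)] o unfolding u diagram_mor_step by auto
qed simp

lemma comp_left: "f \<cdot> g \<approx> k ==> mwt A h ==> msrc g = mtgt h ==> f \<cdot> (g \<cdot> h) \<approx> k \<cdot> h"
 using leq_typed[of "f \<cdot> g" k]
 by (intro ltrans[OF lsym[OF comp_assoc] comp_cong[OF _ lrefl]]) auto

lemma diagram_mor_append:
 "is_diagram u (ps @ qs) v ==> u \<in> Ob ==>
  diagram_mor u (ps @ qs) \<approx> diagram_mor (papply ps u) qs \<cdot> diagram_mor u ps"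
proof (induction ps arbitrary: u)
 case Nil
 then show ?case using diagram_typed[of u qs v] by (auto intro!: lsym[OF comp_id])
next
 case (Cons p ps)
 then obtain l a b r where u: "u = l @ a # b # r" "p = length l"
  using word_split_at[of p u] by (metis is_diagram.simps(2) append_Cons)
 have s: "swap_at p u = l @ b # a # r" unfolding u by (rule swap_at_length)
 have *: "a = None \<or> b = None" "is_diagram (l @ b # a # r) (ps @ qs) v"
  using Cons.prems(1) unfolding u append_Cons is_diagram_step by auto
 have o: "l @ b # a # r \<in> Ob" "[a, b] \<in> Ob" "l \<in> Ob" "r \<in> Ob"
  using Cons.prems(2) u by (auto simp: object_Cons)
 note t = crossing_typed[OF *(1) o(2)]
 have d: "is_diagram (l @ b # a # r) ps (papply (p # ps) u)" "is_diagram (papply (p # ps) u) qs v"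
  using *(2) s unfolding is_diagram_append by auto
 have o': "papply (p # ps) u \<in> Ob" using diagram_typed[OF d(1) o(1)] by (metis mtgt_object)
 note t' = diagram_typed[OF d(1) o(1)] diagram_typed[OF d(2) o'] diagram_typed[OF *(2) o(1)]
 have "diagram_mor u ((p # ps) @ qs) = diagram_mor (l @ b # a # r) (ps @ qs) \<cdot> wh l (crossing a b) r"
  unfolding u append_Cons diagram_mor_step ..
 also have "... \<approx> diagram_mor (papply (p # ps) u) qs \<cdot> diagram_mor (l @ b # a # r) ps \<cdot> wh l (crossing a b) r"
  using Cons.IH[OF *(2) o(1)] t t' s o by (intro comp_cong lrefl) auto
 also have "... \<approx> diagram_mor (papply (p # ps) u) qs \<cdot> (diagram_mor (l @ b # a # r) ps \<cdot> wh l (crossing a b) r)"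
  using t t' s o by (intro comp_assoc) auto
 also have "diagram_mor (l @ b # a # r) ps \<cdot> wh l (crossing a b) r = diagram_mor u (p # ps)"
  unfolding u diagram_mor_step ..
 finally show ?case .
qed

text \<open>The bound on the number of crossings is strict, so that nothing but zero has degree 0.
  Tokens and dots are added only on top, at the target word, where \<open>Iv\<close> puts them in
  normal form.\<close>

inductive Gf :: "('k, 'a) word => nat => ('k, 'a) word => ('k, 'a) mor => bool" for i n v where
 Gf_diagram: "is_diagram i ps v ==> length ps < n ==> Gf i n v (diagram_mor i ps)"
| Gf_generator: "Gf i n v h ==> v = l @ None # r ==> T = Dot \<or> (\<exists>a. T = Tok a) ==> Gf i n v (wh l T r \<cdot> h)"
| Gf_zero: "v \<in> Ob ==> Gf i n v (Zero i v)"
| Gf_add: "Gf i n v f ==> Gf i n v g ==> Gf i n v (Add f g)"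
| Gf_smul: "Gf i n v f ==> Gf i n v (Smul c f)"
| Gf_eq: "Gf i n v f ==> f \<approx> g ==> Gf i n v g"

lemma Gf_typed: "Gf i n v h ==> i \<in> Ob ==> mwt A h \<and> msrc h = i \<and> mtgt h = v"
proof (induction rule: Gf.induct)
 case (Gf_generator h l r T)
 then have "v \<in> Ob" using mtgt_object by metis
 then show ?case using Gf_generator by auto
qed (auto simp: diagram_typed dest: leq_typed)

lemma Gf_mono: "Gf i n v h ==> n \<le> m ==> Gf i m v h"
proof (induction rule: Gf.induct)
 case (Gf_diagram ps)
 then show ?case by (intro Gf.Gf_diagram) auto
next
 case (Gf_eq f g)
 then show ?case using Gf.Gf_eq by blast
qed (auto intro: Gf.intros)

text \<open>The given relation conjugated by the crossing, which is its own inverse.\<close>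

lemma sigma_tok_right: "Cross \<cdot> (Ident_I \<star> Tok a) \<approx> (Tok a \<star> Ident_I) \<cdot> Cross"
proof -
 let ?R = "Ident_I \<star> Tok a" and ?L = "Tok a \<star> Ident_I"
 note ss = leqI[OF law_sigma_sigma]
 have "Cross \<cdot> ?R \<approx> Cross \<cdot> (?R \<cdot> (Cross \<cdot> Cross))"
  by (intro comp_cong lrefl ltrans[OF lsym[OF comp_id] comp_cong[OF lrefl lsym[OF ss]]]) auto
 also have "... \<approx> Cross \<cdot> (Cross \<cdot> ?L \<cdot> Cross)"
  by (intro comp_cong lrefl comp_left lsym[OF leqI[OF law_sigma_tok]]) auto
 also have "... \<approx> Cross \<cdot> (Cross \<cdot> (?L \<cdot> Cross))"
  by (intro comp_cong lrefl comp_assoc) auto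
 also have "... \<approx> Ident [None, None] \<cdot> (?L \<cdot> Cross)" by (intro comp_left ss) auto
 also have "... \<approx> ?L \<cdot> Cross" by (intro id_comp) auto
 finally show ?thesis .
qed

lemma sigma_sandwich:
 "Cross \<cdot> ((Tok b \<star> Tok c) \<cdot> Cross) \<approx> (Ident_I \<star> Tok b) \<cdot> (Tok c \<star> Ident_I)"
proof -
 let ?b = "Tok b \<star> Ident_I" and ?c = "Ident_I \<star> Tok c" and ?b' = "Ident_I \<star> Tok b" and ?c' = "Tok c \<star> Ident_I"
 note ss = leqI[OF law_sigma_sigma]
 have "Cross \<cdot> ((Tok b \<star> Tok c) \<cdot> Cross) \<approx> Cross \<cdot> (?b \<cdot> ?c \<cdot> Cross)"
  by (intro comp_cong lrefl tens_split) auto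
 also have "... \<approx> Cross \<cdot> (?b \<cdot> (?c \<cdot> Cross))" by (intro comp_cong lrefl comp_assoc) auto
 also have "... \<approx> ?b' \<cdot> Cross \<cdot> (?c \<cdot> Cross)" by (intro comp_left leqI[OF law_sigma_tok]) auto
 also have "... \<approx> ?b' \<cdot> (Cross \<cdot> (?c \<cdot> Cross))" by (intro comp_assoc) auto
 also have "... \<approx> ?b' \<cdot> (?c' \<cdot> Cross \<cdot> Cross)" by (intro comp_cong lrefl comp_left sigma_tok_right) auto
 also have "... \<approx> ?b' \<cdot> (?c' \<cdot> (Cross \<cdot> Cross))" by (intro comp_cong lrefl comp_assoc) auto
 also have "... \<approx> ?b' \<cdot> ?c'"
  by (intro comp_cong lrefl ltrans[OF comp_cong[OF lrefl ss] comp_id]) auto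
 finally show ?thesis .
qed

text \<open>The error must be free of crossings: then it costs nothing in the filtration, while the
  crossing itself would have raised the degree.\<close>

definition slides :: "('k, 'a) mor => ('k, 'a) mor => ('k, 'a) mor => bool" where
 "slides c s t \<longleftrightarrow> (\<exists>e. c \<cdot> s \<approx> Add (t \<cdot> c) e \<and> cr e = 0)"

lemma slides_exact: "c \<cdot> s \<approx> t \<cdot> c ==> slides c s t"
proof -
 assume *: "c \<cdot> s \<approx> t \<cdot> c"
 have "c \<cdot> s \<approx> Add (t \<cdot> c) (Zero (msrc c) (mtgt t))"
  using leq_typed[OF *] by (intro ltrans[OF * lsym[OF add_zero]]) auto
 then show ?thesis unfolding slides_def by (intro exI[of _ "Zero (msrc c) (mtgt t)"]) auto
qed

text \<open>Between two crossings the tokens trade strands and the crossings cancel. This controls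
  the error when the dot relation is conjugated by a crossing.\<close>

lemma sandwich_msum:
 "\<exists>e. cr e = 0 \<and> Cross \<cdot> (msum [None, None] [None, None] (map (\<lambda>b. Smul (c b) (Tok b \<star> Tok (g b))) bs) \<cdot> Cross) \<approx> e"
proof (induction bs)
 case Nil
 have "Cross \<cdot> (Zero [None, None] [None, None] \<cdot> Cross) \<approx> Cross \<cdot> Zero [None, None] [None, None]"
  by (intro comp_cong lrefl zero_comp) auto
 also have "... \<approx> Zero [None, None] [None, None]" by (intro comp_zero) auto
 finally show ?case by (intro exI[of _ "Zero [None, None] [None, None]"]) simp
next
 case (Cons b bs)
 let ?m = "msum [None, None] [None, None] (map (\<lambda>b. Smul (c b) (Tok b \<star> Tok (g b))) bs)"
 let ?t = "Tok b \<star> Tok (g b) :: ('k, 'a) mor"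
 obtain e where e: "cr e = 0" "Cross \<cdot> (?m \<cdot> Cross) \<approx> e" using Cons by blast
 note t = sigma_dot_typed[of A c g bs] leq_typed[OF e(2)]
 have "Cross \<cdot> (Add (Smul (c b) ?t) ?m \<cdot> Cross) \<approx> Cross \<cdot> Add (Smul (c b) ?t \<cdot> Cross) (?m \<cdot> Cross)"
  using t by (intro comp_cong lrefl add_comp) auto
 also have "... \<approx> Add (Cross \<cdot> (Smul (c b) ?t \<cdot> Cross)) (Cross \<cdot> (?m \<cdot> Cross))"
  using t by (intro comp_add) auto
 also have "... \<approx> Add (Cross \<cdot> Smul (c b) (?t \<cdot> Cross)) e"
  using t by (intro add_cong e(2) comp_cong lrefl smul_comp) auto
 also have "... \<approx> Add (Smul (c b) (Cross \<cdot> (?t \<cdot> Cross))) e"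
  using t by (intro add_cong lrefl comp_smul) auto
 also have "... \<approx> Add (Smul (c b) ((Ident_I \<star> Tok b) \<cdot> (Tok (g b) \<star> Ident_I))) e"
  using t by (intro add_cong lrefl smul_cong sigma_sandwich) auto
 finally show ?case using e(1) by (intro exI conjI) auto
qed

lemma slide_left:
 assumes "T = Dot \<or> (\<exists>a. T = Tok a)" "[b] \<in> Ob"
 shows "slides (crossing None b) (T \<star> Ident [b]) (Ident [b] \<star> T)"
proof (cases b)
 case (Some Q)
 then have "Q \<in> pol_E A 1" using assms(2) by simp
 then show ?thesis using assms(1) Some
  by (auto intro!: slides_exact leqI[OF law_lam_tok] leqI[OF law_lam_dot])
next
 case None
 show ?thesis
 proof (cases "T = Dot")
  case True
  then show ?thesis unfolding None slides_def crossing.simps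
   using leqI[OF law_sigma_dot] by (intro exI conjI) (auto intro!: cr_msum)
 next
  case False
  then show ?thesis using assms(1) None by (auto intro!: slides_exact leqI[OF law_sigma_tok])
 qed
qed

lemma slide_right:
 assumes "T = Dot \<or> (\<exists>a. T = Tok a)" "[b] \<in> Ob"
 shows "slides (crossing b None) (Ident [b] \<star> T) (T \<star> Ident [b])"
proof (cases b)
 case (Some Q)
 then have "Q \<in> pol_E A 1" using assms(2) by simp
 then show ?thesis using assms(1) Some
  by (auto intro!: slides_exact leqI[OF law_rho_tok] leqI[OF law_rho_dot])
next
 case None
 show ?thesis
 proof (cases "T = Dot")
  case True
  let ?w = "[None, None] :: ('k, 'a) word"
  let ?m = "msum ?w ?w (map (\<lambda>b. Smul (koszul (eps A * parity A b)) (Tok b \<star> Tok (dual A b))) (basis A))"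
  let ?R = "Ident_I \<star> Dot" and ?L = "Dot \<star> Ident_I"
  have tm: "mwt A ?m" "msrc ?m = ?w" "mtgt ?m = ?w"
   using sigma_dot_typed[of A "\<lambda>b. koszul (eps A * parity A b)" "dual A" "basis A"] by simp_all
  note ss = leqI[OF law_sigma_sigma]
  have sd: "Cross \<cdot> ?L \<approx> Add (?R \<cdot> Cross) (Smul (- 1) ?m)" by (rule leqI[OF law_sigma_dot])
  \<comment> \<open>The dot relation is solved for the dot on the right strand and then conjugated
    by the crossing; the conjugated teleporter is the crossingless \<open>e\<close>.\<close>
  have R: "?R \<cdot> Cross \<approx> Add (Cross \<cdot> ?L) ?m"
  proof -
   have "Add (Cross \<cdot> ?L) ?m \<approx> Add (Add (?R \<cdot> Cross) (Smul (- 1) ?m)) ?m"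
    using tm by (intro add_cong sd lrefl) auto
   also have "... \<approx> ?R \<cdot> Cross"
    using tm by (intro leqI[OF term_module.cancel[OF law_module[of ?w ?w]]]) (auto simp: law_term_iff)
   finally show ?thesis by (rule lsym)
  qed
  obtain e where e: "cr e = 0" "Cross \<cdot> (?m \<cdot> Cross) \<approx> e"
   using sandwich_msum[of "\<lambda>b. koszul (eps A * parity A b)" "dual A" "basis A"] by blast
  note t = tm leq_typed[OF e(2)]
  have "Cross \<cdot> ?R \<approx> Cross \<cdot> (?R \<cdot> (Cross \<cdot> Cross))"
   by (intro comp_cong lrefl ltrans[OF lsym[OF comp_id] comp_cong[OF lrefl lsym[OF ss]]]) auto
  also have "... \<approx> Cross \<cdot> (Add (Cross \<cdot> ?L) ?m \<cdot> Cross)"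
   by (intro comp_cong lrefl comp_left R) auto
  also have "... \<approx> Cross \<cdot> Add (Cross \<cdot> ?L \<cdot> Cross) (?m \<cdot> Cross)"
   using t by (intro comp_cong lrefl add_comp) auto
  also have "... \<approx> Add (Cross \<cdot> (Cross \<cdot> ?L \<cdot> Cross)) (Cross \<cdot> (?m \<cdot> Cross))"
   using t by (intro comp_add) auto
  also have "... \<approx> Add (?L \<cdot> Cross) e"
  proof (intro add_cong e(2))
   have "Cross \<cdot> (Cross \<cdot> ?L \<cdot> Cross) \<approx> Cross \<cdot> (Cross \<cdot> (?L \<cdot> Cross))"
    by (intro comp_cong lrefl comp_assoc) auto
   also have "... \<approx> Ident ?w \<cdot> (?L \<cdot> Cross)" by (intro comp_left ss) auto
   also have "... \<approx> ?L \<cdot> Cross" by (intro id_comp) auto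
   finally show "Cross \<cdot> (Cross \<cdot> ?L \<cdot> Cross) \<approx> ?L \<cdot> Cross" .
  qed (use t in auto)
  finally show ?thesis unfolding slides_def using True None e(1) by auto
 next
  case False
  then show ?thesis using assms(1) None by (auto intro!: slides_exact sigma_tok_right)
 qed
qed

lemma wh_slide:
 assumes "slides c s t" "l \<in> Ob" "r \<in> Ob" "mwt A h" "mtgt h = l @ msrc s @ r"
 obtains e where "cr e = 0" "mwt A e" "msrc e = msrc s" "mtgt e = mtgt t"
  "wh l c r \<cdot> (wh l s r \<cdot> h) \<approx> Add (wh l t r \<cdot> (wh l c r \<cdot> h)) (wh l e r \<cdot> h)"
proof -
 obtain e where e: "c \<cdot> s \<approx> Add (t \<cdot> c) e" "cr e = 0" using assms(1) unfolding slides_def by blast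
 note t = leq_typed[OF e(1)] assms(2-5)
 have "wh l c r \<cdot> (wh l s r \<cdot> h) \<approx> wh l (c \<cdot> s) r \<cdot> h"
  using t by (intro comp_left lsym[OF wh_comp]) auto
 also have "... \<approx> wh l (Add (t \<cdot> c) e) r \<cdot> h" using t e by (intro comp_cong lrefl wh_cong) auto
 also have "... \<approx> Add (wh l (t \<cdot> c) r) (wh l e r) \<cdot> h" using t by (intro comp_cong lrefl wh_add) auto
 also have "... \<approx> Add (wh l (t \<cdot> c) r \<cdot> h) (wh l e r \<cdot> h)" using t by (intro add_comp) auto
 also have "... \<approx> Add (wh l t r \<cdot> (wh l c r \<cdot> h)) (wh l e r \<cdot> h)"
 proof (intro add_cong lrefl)
  have "wh l (t \<cdot> c) r \<cdot> h \<approx> wh l t r \<cdot> wh l c r \<cdot> h" using t by (intro comp_cong lrefl wh_comp) auto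
  also have "... \<approx> wh l t r \<cdot> (wh l c r \<cdot> h)" using t by (intro comp_assoc) auto
  finally show "wh l (t \<cdot> c) r \<cdot> h \<approx> wh l t r \<cdot> (wh l c r \<cdot> h)" .
 qed (use t in auto)
 finally show ?thesis using that[of e] e t by auto
qed

definition crossing_stable :: "('k, 'a) word => bool" where
 "crossing_stable i \<longleftrightarrow> (\<forall>l a b r n h. (a = None \<or> b = None) \<longrightarrow> Gf i n (l @ a # b # r) h \<longrightarrow>
  Gf i (Suc n) (l @ b # a # r) (wh l (crossing a b) r \<cdot> h))"

lemma crossing_stableD:
 "crossing_stable i ==> a = None \<or> b = None ==> Gf i n (l @ a # b # r) h ==>
  Gf i (Suc n) (l @ b # a # r) (wh l (crossing a b) r \<cdot> h)"
 unfolding crossing_stable_def by blast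

text \<open>
 The alternative in the first assumption allows the lemma to be used, for terms without
 crossings, in the proof that crossings raise the filtration degree by one.
\<close>

lemma Gf_whisker:
 assumes "cr f = 0 \<or> crossing_stable i"
  and "i \<in> Ob" "mwt A f" "Gf i n (l @ msrc f @ r) h"
 shows "Gf i (n + cr f) (l @ mtgt f @ r) (wh l f r \<cdot> h)"
 using assms
proof (induction f arbitrary: n l r h)
 case (Ident u)
 have t: "mwt A h" "mtgt h = l @ u @ r" "l @ u @ r \<in> Ob"
  using Gf_typed[OF Ident(4,2)] mtgt_object[of A h] by auto
 have "wh l (Ident u) r \<cdot> h \<approx> h"
  using t by (intro ltrans[OF comp_cong[OF wh_ident lrefl] id_comp]) auto
 then show ?case using Gf_eq[OF _ lsym] Ident(4) by simp
next
 case Cross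
 then show ?case using crossing_stableD[of i None None n l r h] by simp
next
 case (Tok a)
 then show ?case using Gf_generator[of i n "l @ None # r" h l r "Tok a"] by simp
next
 case Dot
 then show ?case using Gf_generator[of i n "l @ None # r" h l r Dot] by simp
next
 case (Rho Q)
 then show ?case using crossing_stableD[of i "Some Q" None n l r h] by simp
next
 case (Lam Q)
 then show ?case using crossing_stableD[of i None "Some Q" n l r h] by simp
next
 case (Comp g f)
 have t: "mwt A h" "mtgt h = l @ msrc f @ r" "l \<in> Ob" "r \<in> Ob"
  using Gf_typed[OF Comp(6,4)] mtgt_object[of A h] by auto
 have "Gf i (n + cr f) (l @ mtgt f @ r) (wh l f r \<cdot> h)"
  using Comp.prems by (intro Comp.IH(2)) auto
 then have "Gf i (n + cr f + cr g) (l @ mtgt g @ r) (wh l g r \<cdot> (wh l f r \<cdot> h))"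
  using Comp.prems by (intro Comp.IH(1)) auto
 moreover have "wh l g r \<cdot> (wh l f r \<cdot> h) \<approx> wh l (g \<cdot> f) r \<cdot> h"
  using t Comp.prems by (intro comp_left lsym[OF wh_comp]) auto
 ultimately show ?case using Gf_eq by (auto simp: add.assoc)
next
 case (Tens f g)
 have t: "mwt A h" "mtgt h = l @ msrc f @ msrc g @ r" "l \<in> Ob" "r \<in> Ob"
  using Gf_typed[OF Tens(6,4)] mtgt_object[of A h] by auto
 have "Gf i (n + cr g) ((l @ msrc f) @ mtgt g @ r) (wh (l @ msrc f) g r \<cdot> h)"
  using Tens.prems by (intro Tens.IH(2)) auto
 then have "Gf i (n + cr g + cr f) (l @ mtgt f @ mtgt g @ r) (wh l f (mtgt g @ r) \<cdot> (wh (l @ msrc f) g r \<cdot> h))"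
  using Tens.prems by (intro Tens.IH(1)) auto
 moreover have "wh l f (mtgt g @ r) \<cdot> (wh (l @ msrc f) g r \<cdot> h) \<approx> wh l (f \<star> g) r \<cdot> h"
  using t Tens.prems by (intro comp_left lsym[OF wh_tens]) auto
 ultimately have "Gf i (n + cr g + cr f) (l @ mtgt f @ mtgt g @ r) (wh l (f \<star> g) r \<cdot> h)" by (rule Gf_eq)
 then show ?case by (simp add: ac_simps)
next
 case (Zero u v)
 have t: "mwt A h" "mtgt h = l @ u @ r" "msrc h = i" "l \<in> Ob" "r \<in> Ob"
  using Gf_typed[OF Zero(4,2)] mtgt_object[of A h] by auto
 have "Zero i (l @ v @ r) \<approx> Zero (l @ u @ r) (l @ v @ r) \<cdot> h"
  using t Zero by (intro lsym[OF zero_comp]) auto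
 also have "... \<approx> wh l (Zero u v) r \<cdot> h" using t Zero by (intro comp_cong lrefl lsym[OF wh_zero]) auto
 finally have "Zero i (l @ v @ r) \<approx> wh l (Zero u v) r \<cdot> h" .
 moreover have "Gf i n (l @ v @ r) (Zero i (l @ v @ r))" using t Zero by (intro Gf_zero) auto
 ultimately show ?case using Gf_eq by simp
next
 case (Add f g)
 have t: "mwt A h" "mtgt h = l @ msrc f @ r" "l \<in> Ob" "r \<in> Ob"
  using Gf_typed[OF Add(6,4)] mtgt_object[of A h] by auto
 have "Gf i (n + cr f) (l @ mtgt f @ r) (wh l f r \<cdot> h)" "Gf i (n + cr g) (l @ mtgt f @ r) (wh l g r \<cdot> h)"
  using Add.IH(1)[of n l r h] Add.IH(2)[of n l r h] Add.prems by auto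
 then have "Gf i (n + cr (Add f g)) (l @ mtgt f @ r) (Add (wh l f r \<cdot> h) (wh l g r \<cdot> h))"
  by (auto intro!: Gf_add elim!: Gf_mono)
 moreover have "Add (wh l f r \<cdot> h) (wh l g r \<cdot> h) \<approx> Add (wh l f r) (wh l g r) \<cdot> h"
  using t Add.prems by (intro lsym[OF add_comp]) auto
 then have "Add (wh l f r \<cdot> h) (wh l g r \<cdot> h) \<approx> wh l (Add f g) r \<cdot> h"
  by (rule ltrans) (use t Add.prems in \<open>intro comp_cong lrefl lsym[OF wh_add]; auto\<close>)
 ultimately show ?case using Gf_eq by auto
next
 case (Smul c f)
 have t: "mwt A h" "mtgt h = l @ msrc f @ r" "l \<in> Ob" "r \<in> Ob"
  using Gf_typed[OF Smul(5,3)] mtgt_object[of A h] by auto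
 have "Gf i (n + cr f) (l @ mtgt f @ r) (Smul c (wh l f r \<cdot> h))"
  using Smul.IH[of n l r h] Smul.prems by (auto intro: Gf_smul)
 moreover have "Smul c (wh l f r \<cdot> h) \<approx> Smul c (wh l f r) \<cdot> h"
  using t Smul.prems by (intro lsym[OF smul_comp]) auto
 then have "Smul c (wh l f r \<cdot> h) \<approx> wh l (Smul c f) r \<cdot> h"
  by (rule ltrans) (use t Smul.prems in \<open>intro comp_cong lrefl lsym[OF wh_smul]; auto\<close>)
 ultimately show ?case using Gf_eq by auto
qed

lemma position_cases:
 assumes "l' @ x # r' = l @ a # b # r"
 obtains m where "l = l' @ x # m" "r' = m @ a # b # r"
  | "l' = l" "x = a" "r' = b # r" | "l' = l @ [a]" "x = b" "r' = r"
  | m where "l' = l @ a # b # m" "r = m @ x # r'"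
 using assms by (auto simp: append_eq_append_conv2 append_eq_Cons_conv Cons_eq_append_conv)

text \<open>On a bare diagram the crossing adds one letter. Past a token or dot on top it moves by
  interchange if they lie on other strands, and by sliding otherwise; \<open>Gf_whisker\<close>, for
  terms without crossings, takes care of the error.\<close>

lemma Gf_crossing:
 assumes i: "i \<in> Ob" and ab: "a = None \<or> b = None"
 shows "Gf i n v h ==> v = l @ a # b # r ==> Gf i (Suc n) (l @ b # a # r) (wh l (crossing a b) r \<cdot> h)"
proof (induction rule: Gf.induct)
 case (Gf_diagram ps)
 have m: "is_diagram i (ps @ [length l]) (l @ b # a # r)"
  unfolding is_diagram_append using Gf_diagram ab is_diagram_papply[OF Gf_diagram(1)] is_diagram_step[of l a b r "[]"]
  by simp
 have o: "l @ a # b # r \<in> Ob" using diagram_typed[OF Gf_diagram(1) i] Gf_diagram(3) by (metis mtgt_object)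
 then have o': "l \<in> Ob" "r \<in> Ob" "[a, b] \<in> Ob" "l @ b # a # r \<in> Ob"
  by (auto simp: object_Cons)
 note t = crossing_typed[OF ab o'(3)] diagram_typed[OF Gf_diagram(1) i]
 have "papply ps i = l @ a # b # r" using is_diagram_papply[OF Gf_diagram(1)] Gf_diagram(3) by simp
 then have "diagram_mor (papply ps i) [length l] = Ident (l @ b # a # r) \<cdot> wh l (crossing a b) r"
  using diagram_mor_step[of l a b r "[]"] by simp
 then have "diagram_mor i (ps @ [length l]) \<approx> Ident (l @ b # a # r) \<cdot> wh l (crossing a b) r \<cdot> diagram_mor i ps"
  using diagram_mor_append[OF m i] by simp
 also have "... \<approx> wh l (crossing a b) r \<cdot> diagram_mor i ps"
  using t o' Gf_diagram(3) by (intro comp_cong lrefl id_comp) auto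
 finally show ?case using Gf.Gf_diagram[OF m, of "Suc n"] Gf_diagram(2) Gf_eq by simp
next
 case (Gf_generator h l' r' T)
 have T: "mwt A T" "msrc T = [None]" "mtgt T = [None]" "cr T = 0" using Gf_generator(3) by auto
 have h: "mwt A h" "mtgt h = l @ a # b # r" using Gf_typed[OF Gf_generator(1) i] Gf_generator(5) by auto
 have o: "l @ a # b # r \<in> Ob" using h by (metis mtgt_object)
 then have o': "l \<in> Ob" "r \<in> Ob" "[a, b] \<in> Ob" "l @ b # a # r \<in> Ob"
  "[a] \<in> Ob" "[b] \<in> Ob"
  by (auto simp: object_Cons)
 let ?c = "crossing a b"
 note t = crossing_typed[OF ab o'(3)]
 have IH: "Gf i (Suc n) (l @ b # a # r) (wh l ?c r \<cdot> h)" using Gf_generator by blast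
 have slide: "Gf i (Suc n) (l @ b # a # r) (wh l ?c r \<cdot> (wh l' T r' \<cdot> h))"
  if sl: "slides ?c s t" and s: "mwt A s" "msrc s = [a, b]" "mtgt s = [a, b]" "wh l s r \<approx> wh l' T r'"
   and t': "mwt A t" "msrc t = [b, a]" "mtgt t = [b, a]" "cr t = 0" for s t
 proof -
  have hm: "mtgt h = l @ msrc s @ r" using h(2) s(2) by simp
  obtain e where e: "cr e = 0" "mwt A e" "msrc e = msrc s" "mtgt e = mtgt t"
   "wh l ?c r \<cdot> (wh l s r \<cdot> h) \<approx> Add (wh l t r \<cdot> (wh l ?c r \<cdot> h)) (wh l e r \<cdot> h)"
   using wh_slide[OF sl o'(1,2) h(1) hm] .
  have "Gf i (n + cr e) (l @ mtgt e @ r) (wh l e r \<cdot> h)"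
   using Gf_generator(1,5) e(1-3) s(2) by (intro Gf_whisker i) auto
  then have "Gf i (Suc n) (l @ b # a # r) (wh l e r \<cdot> h)" using e(1,4) t'(3) by (auto elim: Gf_mono)
  moreover have "Gf i (Suc n + cr t) (l @ mtgt t @ r) (wh l t r \<cdot> (wh l ?c r \<cdot> h))"
   using IH t' by (intro Gf_whisker i) auto
  ultimately have G: "Gf i (Suc n) (l @ b # a # r) (Add (wh l t r \<cdot> (wh l ?c r \<cdot> h)) (wh l e r \<cdot> h))"
   using t'(3,4) by (intro Gf_add) auto
  have "wh l ?c r \<cdot> (wh l s r \<cdot> h) \<approx> wh l ?c r \<cdot> (wh l' T r' \<cdot> h)"
   using s t o' h by (intro comp_cong lrefl s(4)) auto
  then show ?thesis using Gf_eq[OF Gf_eq[OF G lsym[OF e(5)]]] by blast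
 qed
 have "l' @ None # r' = l @ a # b # r" using Gf_generator(2,5) by simp
 then show ?case
 proof (cases rule: position_cases)
  case (1 m)
  then have o'': "l' \<in> Ob" "m \<in> Ob" using o' by auto
  have c: "wh (l' @ [None] @ m) ?c r = wh l ?c r" "wh l' T (m @ [a, b] @ r) = wh l' T r'" using 1 by simp_all
  have ex: "wh l' T (m @ [b, a] @ r) \<cdot> wh l ?c r \<approx> wh l ?c r \<cdot> wh l' T r'"
   using wh_exchange_even[of T "[None]" "[None]" ?c "[a, b]" "[b, a]" l' m r] T t o' o'' unfolding c by simp
  have "wh l ?c r \<cdot> (wh l' T r' \<cdot> h) \<approx> wh l' T (m @ [b, a] @ r) \<cdot> wh l ?c r \<cdot> h"
   by (rule comp_left[OF lsym[OF ex]]) (use h 1 T in auto)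
  also have "... \<approx> wh l' T (m @ [b, a] @ r) \<cdot> (wh l ?c r \<cdot> h)"
   using 1 h T t o' o'' by (intro comp_assoc) (auto simp: object_Cons)
  finally show ?thesis using Gf.Gf_generator[OF IH, of l' "m @ [b, a] @ r" T] Gf_generator(3) 1 Gf_eq[OF _ lsym] by simp
 next
  case 2
  then have "slides ?c (T \<star> Ident [b]) (Ident [b] \<star> T)" using slide_left[OF Gf_generator(3) o'(6)] by simp
  then show ?thesis by (rule slide) (use wh_tens_ident(1)[OF T(1) o'(1,2,6)] T 2 o' in auto)
 next
  case 3
  then have "slides ?c (Ident [a] \<star> T) (T \<star> Ident [a])" using slide_right[OF Gf_generator(3) o'(5)] by simp
  then show ?thesis by (rule slide) (use wh_tens_ident(2)[OF T(1) o'(1,2,5)] T 3 o' in auto)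
 next
  case (4 m)
  then have o'': "r' \<in> Ob" "m \<in> Ob" using o' by auto
  have c: "wh l ?c (m @ [None] @ r') = wh l ?c r" "wh (l @ [a, b] @ m) T r' = wh l' T r'" using 4 by simp_all
  have ex: "wh l ?c r \<cdot> wh l' T r' \<approx> wh (l @ [b, a] @ m) T r' \<cdot> wh l ?c r"
   using wh_exchange_even[of ?c "[a, b]" "[b, a]" T "[None]" "[None]" l m r'] T t o' o'' unfolding c by simp
  have "wh l ?c r \<cdot> (wh l' T r' \<cdot> h) \<approx> wh (l @ [b, a] @ m) T r' \<cdot> wh l ?c r \<cdot> h"
   by (rule comp_left[OF ex]) (use h 4 T in auto)
  also have "... \<approx> wh (l @ [b, a] @ m) T r' \<cdot> (wh l ?c r \<cdot> h)"
   using 4 h T t o' o'' by (intro comp_assoc) (auto simp: object_Cons)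
  finally show ?thesis using Gf.Gf_generator[OF IH, of "l @ [b, a] @ m" r' T] Gf_generator(3) 4 Gf_eq[OF _ lsym] by simp
 qed
next
 case Gf_zero
 then have "l \<in> Ob" "r \<in> Ob" "[a, b] \<in> Ob" "l @ b # a # r \<in> Ob"
  by (auto simp: object_Cons)
 moreover note crossing_typed[OF ab this(3)]
 ultimately have "wh l (crossing a b) r \<cdot> Zero i v \<approx> Zero i (l @ b # a # r)"
  using i Gf_zero by (intro comp_zero) auto
 then show ?case using Gf.Gf_zero[of "l @ b # a # r" i "Suc n"] \<open>l @ b # a # r \<in> Ob\<close> Gf_eq[OF _ lsym] by blast
next
 case (Gf_add f g)
 have *: "mwt A f" "mwt A g" "msrc f = i" "msrc g = i" "mtgt f = v" "mtgt g = v"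
  using Gf_typed[OF Gf_add(1) i] Gf_typed[OF Gf_add(2) i] by auto
 then have "v \<in> Ob" by auto
 then have o: "l \<in> Ob" "r \<in> Ob" "[a, b] \<in> Ob"
  using Gf_add(5) by (auto simp: object_Cons)
 have "wh l (crossing a b) r \<cdot> Add f g \<approx> Add (wh l (crossing a b) r \<cdot> f) (wh l (crossing a b) r \<cdot> g)"
  using * o crossing_typed[OF ab o(3)] Gf_add(5) by (intro comp_add) auto
 then show ?case using Gf.Gf_add Gf_add Gf_eq[OF _ lsym] by blast
next
 case (Gf_smul f c)
 have *: "mwt A f" "msrc f = i" "mtgt f = v" using Gf_typed[OF Gf_smul(1) i] by auto
 then have "v \<in> Ob" by auto
 then have o: "l \<in> Ob" "r \<in> Ob" "[a, b] \<in> Ob"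
  using Gf_smul(3) by (auto simp: object_Cons)
 have "wh l (crossing a b) r \<cdot> Smul c f \<approx> Smul c (wh l (crossing a b) r \<cdot> f)"
  using * o crossing_typed[OF ab o(3)] Gf_smul(3) by (intro comp_smul) auto
 then show ?case using Gf.Gf_smul Gf_smul Gf_eq[OF _ lsym] by blast
next
 case (Gf_eq f g)
 have *: "mwt A f" "msrc f = i" "mtgt f = v" using Gf_typed[OF Gf_eq(1) i] by auto
 then have "v \<in> Ob" by auto
 then have o: "l \<in> Ob" "r \<in> Ob" "[a, b] \<in> Ob"
  using Gf_eq(4) by (auto simp: object_Cons)
 have "wh l (crossing a b) r \<cdot> f \<approx> wh l (crossing a b) r \<cdot> g"
  using * o crossing_typed[OF ab o(3)] Gf_eq by (intro comp_cong lrefl) auto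
 then show ?case using Gf_eq Gf.Gf_eq by blast
qed

lemma Gf_wh: "i \<in> Ob ==> mwt A f ==> Gf i n (l @ msrc f @ r) h ==> Gf i (n + cr f) (l @ mtgt f @ r) (wh l f r \<cdot> h)"
 using Gf_whisker[of f i n l r h] Gf_crossing unfolding crossing_stable_def by blast

lemma wh_empty: "mwt A f ==> wh [] f [] \<approx> f"
 unfolding wh_def using ltrans[OF tens_unit unit_tens] by simp

lemma Gf_comp:
 assumes "i \<in> Ob" "mwt A f" "msrc f = v" "Gf i n v h"
 shows "Gf i (n + cr f) (mtgt f) (f \<cdot> h)"
proof -
 have "wh [] f [] \<cdot> h \<approx> f \<cdot> h"
  using Gf_typed[OF assms(4,1)] assms by (intro comp_cong wh_empty lrefl) auto
 then show ?thesis using Gf_eq Gf_wh[of i f n "[]" "[]" h] assms by simp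
qed

end

section \<open>Coefficient lists, braid moves and spanning\<close>

subsection \<open>Coefficient lists\<close>

context frobenius_superalgebra
begin

text \<open>By faithfulness, identities in \<open>Pol\<^sub>n(A)\<close> may be verified on
  operators, where ring automation is available.\<close>

lemma pol_eqI:
 assumes "f \<in> pol_terms n" "g \<in> pol_terms n" "pint0 n f = pint0 n g"
 shows "pol_eq A n f g"
proof -
 have "pol_eq A n (PAdd f (PSmul (- 1) g)) PZero"
 proof (rule pol_faithful)
  show "PAdd f (PSmul (- 1) g) \<in> pol_terms n" using assms(1,2) by (intro pol_terms.intros)
  have "pint0 n (PAdd f (PSmul (- 1) g)) = 0" using assms(3) by (simp add: sm_simps)
  then show "app (pint0 n (PAdd f (PSmul (- 1) g))) (vac n) \<iota> = 0" for \<iota> by (simp add: app_simps)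
 qed
 then have "pol_eq A n (PAdd (PAdd f (PSmul (- 1) g)) g) (PAdd PZero g)"
  using assms(2) by (intro pol_cong_add pol_refl)
 moreover have "pol_eq A n (PAdd PZero g) g" using assms(2) by (rule pol.zero_ad)
 ultimately show ?thesis using pol.cancel[OF assms(1,2)] pol.eq_sym pol_trans by blast
qed

lemma pol_coeffs_terms: "i \<in> {1..n} ==> (pol_coeffs i as :: ('k, 'a) pterm) \<in> pol_terms n"
 unfolding pol_coeffs_def by (intro psum_terms) (auto intro!: pol_terms.intros ppow_terms simp del: atLeastAtMost_iff)

text \<open>The relations for double red-black crossings require \<open>Q\<close> as a list of
  coefficients. A normal form is collected by powers of \<open>x\<close>, and the calculation takes
  place among operators.\<close>

lemma pol1_coeffs_exist:
 assumes "f \<in> pol_terms 1"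
 obtains as where "pol_eq A 1 f (pol_coeffs 1 as)"
proof -
 interpret R: polrep A 1 "E0 1" "tok0 1" "x0 1" by (rule polrep0)
 have one: "(1::nat) \<in> {1..1}" by simp
 obtain ms c where ms: "distinct ms" "set ms \<subseteq> mono_indices 1"
  "pol_eq A 1 f (psum (map (\<lambda>m. PSmul (c m) (pmon (fst m) (snd m))) ms))"
  using pol_normal_form_list[OF assms] .
 obtain N where N: "\<And>m. m \<in> set ms ==> snd m ! 0 < N"
  using finite_nat_set_iff_bounded[of "(\<lambda>m. snd m ! 0) ` set ms"] by auto
 let ?X = "\<lambda>k. pint0 1 (ppow (PX 1) k)"
 have eX: "E0 1 * ?X k = ?X k" "?X k * E0 1 = ?X k" for k
  using R.pint_e[OF ppow_terms[OF pol_terms.intros(2)[OF one]]] by auto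
 have "\<exists>g. pint0 1 (psum (map (\<lambda>m. PSmul (c m) (pmon (fst m) (snd m))) ms)) = (\<Sum>k<N. tok0 1 1 (g k) * ?X k)"
  using ms(2) N
 proof (induction ms)
  case Nil
  have "tok0 1 1 0 = 0" using R.tok_add[OF one, of 0 0] by simp
  then show ?case by (intro exI[of _ "\<lambda>_. 0"]) simp
 next
  case (Cons m ms)
  then obtain g where g: "pint0 1 (psum (map (\<lambda>m. PSmul (c m) (pmon (fst m) (snd m))) ms)) = (\<Sum>k<N. tok0 1 1 (g k) * ?X k)"
   by auto
  have "length (fst m) = 1" "length (snd m) = 1" using Cons.prems(1) by (auto simp: mono_indices_def)
  then obtain b r where m: "m = ([b], [r])"
   by (metis One_nat_def length_0_conv length_Suc_conv prod.collapse)
  have r: "r < N" using Cons.prems(2)[of m] m by simp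
  have "pint0 1 (pmon [b] [r]) = tok0 1 1 b * ?X r"
   using eX R.tok_e[OF one] by (simp add: pmono_def ptokens_def pdots_def)
  then have "sm (c m) (pint0 1 (pmon [b] [r])) = tok0 1 1 (smul A (c m) b) * ?X r"
   using R.tok_smul[OF one] by (simp add: sm_simps)
  also have "... = (\<Sum>k<N. if k = r then tok0 1 1 (smul A (c m) b) * ?X k else 0)" using r by simp
  finally have "pint0 1 (psum (map (\<lambda>m. PSmul (c m) (pmon (fst m) (snd m))) (m # ms)))
   = (\<Sum>k<N. (if k = r then tok0 1 1 (smul A (c m) b) * ?X k else 0) + tok0 1 1 (g k) * ?X k)"
   using g m by (simp add: sum.distrib)
  also have "... = (\<Sum>k<N. tok0 1 1 ((g(r := smul A (c m) b + g r)) k) * ?X k)"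
   using R.tok_add[OF one] by (intro sum.cong) (auto simp: algebra_simps)
  finally show ?case by blast
 qed
 then obtain g where g: "pint0 1 f = (\<Sum>k<N. tok0 1 1 (g k) * ?X k)"
  using R.pint_cong[OF ms(3)] by auto
 have "pint0 1 (pol_coeffs 1 (map g [0..<N])) = sum_list (map (\<lambda>k. tok0 1 1 (map g [0..<N] ! k) * ?X k) [0..<N])"
  by (simp add: pol_coeffs_def pint_psum o_def)
 also have "... = (\<Sum>k<N. tok0 1 1 (map g [0..<N] ! k) * ?X k)"
  by (simp add: sum_list_distinct_conv_sum_set atLeast0LessThan)
 also have "... = pint0 1 f" unfolding g by (intro sum.cong) auto
 finally have "pint0 1 f = pint0 1 (pol_coeffs 1 (map g [0..<N]))" by (rule sym)
 then show ?thesis by (rule that[OF pol_eqI[OF assms pol_coeffs_terms[OF one]]])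
qed

lemma pol2_coeffs_exist:
 assumes "f \<in> pol_terms 2"
 obtains ms where "\<forall>(\<mu>, b, c, r, s) \<in> set ms. b \<in> set (basis A) \<and> c \<in> set (basis A)"
  "pol_eq A 2 f (pol2_coeffs ms)"
proof -
 interpret R: polrep A 2 "E0 2" "tok0 2" "x0 2" by (rule polrep0)
 have i: "1 \<in> {1..2::nat}" "2 \<in> {1..2::nat}" by auto
 obtain ms c where ms: "distinct ms" "set ms \<subseteq> mono_indices 2"
  "pol_eq A 2 f (psum (map (\<lambda>m. PSmul (c m) (pmon (fst m) (snd m))) ms))"
  using pol_normal_form_list[OF assms] .
 define ns where "ns = map (\<lambda>m. (c m, fst m ! 0, fst m ! 1, snd m ! 0, snd m ! 1)) ms"
 have pX: "ppow (PX j) k \<in> pol_terms 2" if "j \<in> {1..2}" for j k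
  using that by (intro ppow_terms pol_terms.intros)
 have eX: "pint0 2 (ppow (PX j) k) * E0 2 = pint0 2 (ppow (PX j) k)" if "j \<in> {1..2}" for j k
  using R.pint_e[OF pX[OF that]] by auto
 have mono: "pint0 2 (pmon (fst m) (snd m))
  = pint0 2 (PMul (PMul (PTok 1 (fst m ! 0)) (PTok 2 (fst m ! 1))) (PMul (ppow (PX 1) (snd m ! 0)) (ppow (PX 2) (snd m ! 1))))"
  if "m \<in> mono_indices 2" for m
 proof -
  have "length (fst m) = 2" "length (snd m) = 2" using that by (auto simp: mono_indices_def)
  then obtain b b' r r' where m: "m = ([b, b'], [r, r'])"
   by (cases m) (auto simp: numeral_2_eq_2 length_Suc_conv)
  show ?thesis
   using eX[OF i(2)] R.tok_e[OF i(2)] unfolding m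
   by (simp add: pmono_def ptokens_def pdots_def numeral_2_eq_2 upt_rec)
 qed
 have t: "pol2_coeffs ns \<in> pol_terms 2"
  unfolding pol2_coeffs_def by (intro psum_terms) (use i in \<open>auto intro!: pol_terms.intros pX simp del: atLeastAtMost_iff\<close>)
 have "pint0 2 f = pint0 2 (pol2_coeffs ns)"
  unfolding R.pint_cong[OF ms(3)] pol2_coeffs_def ns_def pint_psum map_map
  by (rule arg_cong[of _ _ sum_list], rule map_cong[OF refl]) (use mono ms(2) in \<open>auto simp: o_def\<close>)
 then have "pol_eq A 2 f (pol2_coeffs ns)" using pol_eqI[OF assms t] by simp
 moreover have "\<forall>(\<mu>, b, c, r, s) \<in> set ns. b \<in> set (basis A) \<and> c \<in> set (basis A)"
  using ms(2) by (auto simp: ns_def mono_indices_def subset_iff)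
 ultimately show ?thesis using that by blast
qed

lemma pol_E_coeffs:
 assumes "Q \<in> pol_E A 1"
 obtains as where "Q = pol_class A 1 (pol_coeffs 1 as)"
proof -
 obtain f where f: "f \<in> pol_terms 1" "Q = pol_class A 1 f" using assms unfolding pol_E_def by blast
 obtain as where "pol_eq A 1 f (pol_coeffs 1 as)" using pol1_coeffs_exist[OF f(1)] .
 then have "pol_class A 1 f = pol_class A 1 (pol_coeffs 1 as)"
  unfolding pol_class_def using pol_sym pol_trans by blast
 then show ?thesis using that f by simp
qed

subsection \<open>Braid moves modulo diagrams with fewer crossings\<close>

text \<open>A uniform shape for the three-strand relations, whatever the colors of the
  strands.\<close>

definition braid_left :: "('k, 'a) letter => ('k, 'a) letter => ('k, 'a) letter => ('k, 'a) mor" where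
 "braid_left a b c = (crossing b c \<star> Ident [a]) \<cdot> (Ident [b] \<star> crossing a c) \<cdot> (crossing a b \<star> Ident [c])"

definition braid_right :: "('k, 'a) letter => ('k, 'a) letter => ('k, 'a) letter => ('k, 'a) mor" where
 "braid_right a b c = (Ident [c] \<star> crossing a b) \<cdot> (crossing a c \<star> Ident [b]) \<cdot> (Ident [a] \<star> crossing b c)"

lemma leq_exact: "f \<approx> g ==> \<exists>e. cr e = 0 \<and> f \<approx> Add g e"
proof -
 assume *: "f \<approx> g"
 have "f \<approx> Add g (Zero (msrc g) (mtgt g))"
  using leq_typed[OF *] by (intro ltrans[OF * lsym[OF add_zero]]) auto
 then show ?thesis by (intro exI[of _ "Zero (msrc g) (mtgt g)"]) simp
qed

text \<open>At most one strand is red, since red strands do not cross. The relation is exact unless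
  the red strand is the middle one; then the bracket of a Demazure operator is the error.\<close>

lemma braid_local:
 assumes "[a, b, c] \<in> Ob" "a = None \<or> b = None" "a = None \<or> c = None" "b = None \<or> c = None"
 shows "\<exists>e. cr e = 0 \<and> braid_left a b c \<approx> Add (braid_right a b c) e"
proof -
 consider "a = None" "b = None" "c = None" | Q where "a = Some Q" "b = None" "c = None"
  | Q where "b = Some Q" "a = None" "c = None" | Q where "c = Some Q" "a = None" "b = None"
  using assms(2-4) by auto
 then show ?thesis
 proof cases
  case 1
  then show ?thesis unfolding braid_left_def braid_right_def using leqI[OF law_braid] by (intro leq_exact) simp
 next
  case 2
  then have "Q \<in> pol_E A 1" using assms(1) by simp
  from leqI[OF law_sigma_rho[OF this]] 2 show ?thesis
   unfolding braid_left_def braid_right_def by (intro leq_exact) simp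
 next
  case 4
  then have "Q \<in> pol_E A 1" using assms(1) by simp
  from leqI[OF law_lam_sigma[OF this]] 4 show ?thesis
   unfolding braid_left_def braid_right_def by (intro leq_exact) simp
 next
  case 3
  then have Q: "Q \<in> pol_E A 1" using assms(1) by simp
  obtain as where as: "Q = pol_class A 1 (pol_coeffs 1 as)" using pol_E_coeffs[OF Q] .
  have "(1::nat) \<in> {1..<2}" "(1::nat) \<in> {1..2}" by auto
  then obtain ms where ms: "\<forall>(\<mu>, b, c, r, s) \<in> set ms. b \<in> set (basis A) \<and> c \<in> set (basis A)"
   "pol_eq A 2 (demazure A 1 (pol_coeffs 1 as)) (pol2_coeffs ms)"
   using pol2_coeffs_exist[OF demazure_terms[OF _ pol_coeffs_terms]] by metis
  show ?thesis using leqI[OF law_rho_sigma_lam[OF Q as ms]] 3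
   unfolding braid_left_def braid_right_def by (intro exI[of _ "Smul (- 1) (bracket2 Q ms)"]) simp
 qed
qed

lemma square_local:
 assumes "[a, b] \<in> Ob" "a = None \<or> b = None"
 shows "\<exists>e. cr e = 0 \<and> crossing b a \<cdot> crossing a b \<approx> e"
proof -
 consider "a = None" "b = None" | Q where "a = Some Q" "b = None" | Q where "b = Some Q" "a = None"
  using assms(2) by auto
 then show ?thesis
 proof cases
  case 1
  then show ?thesis using leqI[OF law_sigma_sigma] by (intro exI[of _ "Ident [None, None]"]) simp
 next
  case 2
  then have Q: "Q \<in> pol_E A 1" using assms(1) by simp
  obtain as where "Q = pol_class A 1 (pol_coeffs 1 as)" using pol_E_coeffs[OF Q] .
  then show ?thesis using leqI[OF law_lam_rho[OF Q]] 2 by (intro exI[of _ "Ident_red Q \<star> bracket as"]) simp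
 next
  case 3
  then have Q: "Q \<in> pol_E A 1" using assms(1) by simp
  obtain as where "Q = pol_class A 1 (pol_coeffs 1 as)" using pol_E_coeffs[OF Q] .
  then show ?thesis using leqI[OF law_rho_lam[OF Q]] 3 by (intro exI[of _ "bracket as \<star> Ident_red Q"]) simp
 qed
qed

lemma diagram_pair:
 assumes "is_diagram w [p, q] w'" "w \<in> Ob"
 shows "diagram_mor w [p, q] \<approx> diagram_mor (swap_at p w) [q] \<cdot> diagram_mor w [p]"
 using diagram_mor_append[of w "[p]" "[q]" w'] assms by simp

lemma diagram_single:
 assumes "l @ a # b # r \<in> Ob" "a = None \<or> b = None"
 shows "diagram_mor (l @ a # b # r) [length l] \<approx> wh l (crossing a b) r"
proof -
 have o: "l \<in> Ob" "r \<in> Ob" "[a, b] \<in> Ob" "l @ b # a # r \<in> Ob"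
  using assms(1) by (auto simp: object_Cons)
 show ?thesis unfolding diagram_mor_step using o crossing_typed[OF assms(2) o(3)] by (auto intro!: id_comp)
qed

lemma comm_diagram:
 assumes "is_diagram w [p, q] w'" "w \<in> Ob" "Suc p < q"
 shows "diagram_mor w [p, q] \<approx> diagram_mor w [q, p]"
proof -
 have "Suc q < length w" using assms(1) by simp
 then obtain k c d r where k: "w = k @ c # d # r" "q = length k" using word_split_at by blast
 then have "Suc p < length k" using assms(3) by simp
 then obtain l a b m where l: "k = l @ a # b # m" "p = length l" using word_split_at by blast
 have w: "w = l @ a # b # m @ c # d # r" "w = (l @ a # b # m) @ c # d # r" using k l by simp_all
 have sp: "swap_at p w = (l @ b # a # m) @ c # d # r" using w(1) l(2) swap_at_length[of l a b] by simp
 have sq: "swap_at q w = l @ a # b # m @ d # c # r" using w(2) k(2) l(1) swap_at_length[of "l @ a # b # m" c d] by simp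
 have len: "q = length (l @ a # b # m)" "q = length (l @ b # a # m)" using k l by simp_all
 have ab: "a = None \<or> b = None" and cd: "c = None \<or> d = None"
  using assms(1) is_diagram_step[of l a b "m @ c # d # r" "[q]" w'] is_diagram_step[of "l @ b # a # m" c d r "[]" w']
  unfolding w(1) l(2) len(2) by auto
 have o: "l \<in> Ob" "m \<in> Ob" "r \<in> Ob" "[a, b] \<in> Ob" "[c, d] \<in> Ob"
  "[b, a] \<in> Ob" "[d, c] \<in> Ob"
  using assms(2) unfolding w(1) by (auto simp: object_Cons)
 note t = crossing_typed[OF ab o(4)] crossing_typed[OF cd o(5)]
 have d': "is_diagram w [q, p] w'"
  using beq_is_diagram[OF beq_comm[OF assms(3), of "[]" "[]"], of w w'] assms(1) unfolding append_Nil append_Nil2 by blast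
 have dp: "is_diagram w [p] (swap_at p w)" "is_diagram (swap_at p w) [q] w'" using assms(1) by auto
 have os: "swap_at p w \<in> Ob" using diagram_typed[OF dp(1) assms(2)] mtgt_object by metis
 have "diagram_mor w [p, q] \<approx> diagram_mor (swap_at p w) [q] \<cdot> diagram_mor w [p]"
  by (rule diagram_pair[OF assms(1,2)])
 also have "... \<approx> wh (l @ b # a # m) (crossing c d) r \<cdot> wh l (crossing a b) (m @ c # d # r)"
 proof (intro comp_cong)
  show "diagram_mor (swap_at p w) [q] \<approx> wh (l @ b # a # m) (crossing c d) r"
   unfolding sp len(2) using o cd by (intro diagram_single) (auto simp: object_Cons)
  show "diagram_mor w [p] \<approx> wh l (crossing a b) (m @ c # d # r)"
   unfolding w(1) l(2) using o ab by (intro diagram_single) (auto simp: object_Cons)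
  show "msrc (diagram_mor (swap_at p w) [q]) = mtgt (diagram_mor w [p])"
   using diagram_typed[OF dp(1) assms(2)] diagram_typed[OF dp(2) os] by simp
 qed
 also have "... \<approx> wh l (crossing a b) (m @ d # c # r) \<cdot> wh (l @ a # b # m) (crossing c d) r"
  using lsym[OF wh_exchange_even[of "crossing a b" "[a, b]" "[b, a]" "crossing c d" "[c, d]" "[d, c]" l m r]] t o
  by simp
 also have "... \<approx> diagram_mor (swap_at q w) [p] \<cdot> diagram_mor w [q]"
 proof (intro comp_cong)
  show "wh l (crossing a b) (m @ d # c # r) \<approx> diagram_mor (swap_at q w) [p]"
   unfolding sq l(2) using o ab by (intro lsym[OF diagram_single]) (auto simp: object_Cons)
  show "wh (l @ a # b # m) (crossing c d) r \<approx> diagram_mor w [q]"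
   unfolding w(2) len(1) using o cd by (intro lsym[OF diagram_single]) (auto simp: object_Cons)
 qed (use t in auto)
 also have "... \<approx> diagram_mor w [q, p]"
  by (rule lsym[OF diagram_pair[OF d' assms(2)]])
 finally show ?thesis .
qed

lemma braid_diagram:
 assumes "is_diagram w [p, Suc p, p] w'" "w \<in> Ob"
 shows "\<exists>e. cr e = 0 \<and> diagram_mor w [p, Suc p, p] \<approx> Add (diagram_mor w [Suc p, p, Suc p]) e"
proof -
 have "Suc (Suc p) < length w" using assms(1) by simp
 then have "Suc p < length w" by simp
 then obtain l a b r' where l: "w = l @ a # b # r'" "p = length l" using word_split_at by blast
 then obtain c r where "r' = c # r" using \<open>Suc (Suc p) < length w\<close> by (cases r') auto
 then have w: "w = l @ a # b # c # r" "w = (l @ [a]) @ b # c # r" using l by simp_all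
 have n: "a = None \<or> b = None" "a = None \<or> c = None" "b = None \<or> c = None"
  using assms(1) is_diagram_step[of l a b "c # r" "[Suc p, p]" w'] is_diagram_step[of "l @ [b]" a c r "[p]" w']
   is_diagram_step[of l b c "a # r" "[]" w'] unfolding w(1) l(2) by auto
 have o: "l \<in> Ob" "r \<in> Ob" "[a, b] \<in> Ob" "[a, c] \<in> Ob" "[b, c] \<in> Ob"
  "[a, b, c] \<in> Ob" "[a] \<in> Ob" "[b] \<in> Ob" "[c] \<in> Ob"
  using assms(2) unfolding w(1) by (auto simp: object_Cons)
 note t = crossing_typed[OF n(1) o(3)] crossing_typed[OF n(2) o(4)] crossing_typed[OF n(3) o(5)]
 have L: "diagram_mor w [p, Suc p, p] = Ident (l @ c # b # a # r) \<cdot> wh l (crossing b c) (a # r)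
   \<cdot> wh (l @ [b]) (crossing a c) r \<cdot> wh l (crossing a b) (c # r)"
  using diagram_mor_step[of l a b "c # r" "[Suc p, p]"] diagram_mor_step[of "l @ [b]" a c r "[p]"]
   diagram_mor_step[of l b c "a # r" "[]"] unfolding w(1) l(2) by simp
 have R: "diagram_mor w [Suc p, p, Suc p] = Ident (l @ c # b # a # r) \<cdot> wh (l @ [c]) (crossing a b) r
   \<cdot> wh l (crossing a c) (b # r) \<cdot> wh (l @ [a]) (crossing b c) r"
  using diagram_mor_step[of "l @ [a]" b c r "[p, Suc p]"] diagram_mor_step[of l a c "b # r" "[Suc p]"]
   diagram_mor_step[of "l @ [c]" a b r "[]"] unfolding w(1) l(2) by simp
 have e: "wh l (crossing b c) (a # r) \<approx> wh l (crossing b c \<star> Ident [a]) r"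
  "wh (l @ [b]) (crossing a c) r \<approx> wh l (Ident [b] \<star> crossing a c) r"
  "wh l (crossing a b) (c # r) \<approx> wh l (crossing a b \<star> Ident [c]) r"
  "wh (l @ [c]) (crossing a b) r \<approx> wh l (Ident [c] \<star> crossing a b) r"
  "wh l (crossing a c) (b # r) \<approx> wh l (crossing a c \<star> Ident [b]) r"
  "wh (l @ [a]) (crossing b c) r \<approx> wh l (Ident [a] \<star> crossing b c) r"
  using o t lsym[OF wh_tens_ident(1)[of "crossing b c" l r "[a]"]] lsym[OF wh_tens_ident(2)[of "crossing a c" l r "[b]"]]
   lsym[OF wh_tens_ident(1)[of "crossing a b" l r "[c]"]] lsym[OF wh_tens_ident(2)[of "crossing a b" l r "[c]"]]
   lsym[OF wh_tens_ident(1)[of "crossing a c" l r "[b]"]] lsym[OF wh_tens_ident(2)[of "crossing b c" l r "[a]"]]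
  by simp_all
 have "diagram_mor w [p, Suc p, p] \<approx> wh l (crossing b c \<star> Ident [a]) r
   \<cdot> wh l (Ident [b] \<star> crossing a c) r \<cdot> wh l (crossing a b \<star> Ident [c]) r"
  unfolding L by (intro comp_cong ltrans[OF id_comp] e) (use o t in \<open>auto simp: object_Cons\<close>)
 also have "... \<approx> wh l (braid_left a b c) r"
  unfolding braid_left_def using o t by (intro lsym[OF ltrans[OF wh_comp comp_cong[OF wh_comp lrefl]]]) auto
 finally have 1: "diagram_mor w [p, Suc p, p] \<approx> wh l (braid_left a b c) r" .
 have "diagram_mor w [Suc p, p, Suc p] \<approx> wh l (Ident [c] \<star> crossing a b) r
   \<cdot> wh l (crossing a c \<star> Ident [b]) r \<cdot> wh l (Ident [a] \<star> crossing b c) r"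
  unfolding R by (intro comp_cong ltrans[OF id_comp] e) (use o t in \<open>auto simp: object_Cons\<close>)
 also have "... \<approx> wh l (braid_right a b c) r"
  unfolding braid_right_def using o t by (intro lsym[OF ltrans[OF wh_comp comp_cong[OF wh_comp lrefl]]]) auto
 finally have 2: "diagram_mor w [Suc p, p, Suc p] \<approx> wh l (braid_right a b c) r" .
 obtain z where z: "cr z = 0" "braid_left a b c \<approx> Add (braid_right a b c) z"
  using braid_local[OF o(6) n] by blast
 note te = leq_typed[OF z(2)]
 have "diagram_mor w [p, Suc p, p] \<approx> wh l (Add (braid_right a b c) z) r"
  using o by (intro ltrans[OF 1 wh_cong] z(2))
 also have "... \<approx> Add (wh l (braid_right a b c) r) (wh l z r)" using te o by (intro wh_add) auto
 also have "... \<approx> Add (diagram_mor w [Suc p, p, Suc p]) (wh l z r)"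
  using te o by (intro add_cong lsym[OF 2] lrefl) auto
 finally show ?thesis using z(1) by (intro exI[of _ "wh l z r"]) simp
qed

lemma square_diagram:
 assumes "is_diagram w [p, p] w'" "w \<in> Ob"
 shows "\<exists>e. cr e = 0 \<and> diagram_mor w [p, p] \<approx> e"
proof -
 have "Suc p < length w" using assms(1) by simp
 then obtain l a b r where l: "w = l @ a # b # r" "p = length l" using word_split_at by blast
 have n: "a = None \<or> b = None" using assms(1) is_diagram_step[of l a b r "[p]" w'] unfolding l by blast
 have o: "l \<in> Ob" "r \<in> Ob" "[a, b] \<in> Ob" "[b, a] \<in> Ob"
  using assms(2) unfolding l(1) by (auto simp: object_Cons)
 have n': "b = None \<or> a = None" using n by blast
 note t = crossing_typed[OF n o(3)] crossing_typed[OF n' o(4)]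
 obtain e where e: "cr e = 0" "crossing b a \<cdot> crossing a b \<approx> e" using square_local[OF o(3) n] by blast
 have "diagram_mor w [p, p] = Ident (l @ a # b # r) \<cdot> wh l (crossing b a) r \<cdot> wh l (crossing a b) r"
  using diagram_mor_step[of l a b r "[p]"] diagram_mor_step[of l b a r "[]"] unfolding l by simp
 also have "... \<approx> wh l (crossing b a) r \<cdot> wh l (crossing a b) r"
  using o t by (intro comp_cong lrefl id_comp) auto
 also have "... \<approx> wh l (crossing b a \<cdot> crossing a b) r" using o t by (intro lsym[OF wh_comp]) auto
 also have "... \<approx> wh l e r" using o by (intro wh_cong e(2))
 finally show ?thesis using e(1) by (intro exI[of _ "wh l e r"]) simp
qed

lemma diagram_three:
 assumes "is_diagram i (as @ xs @ bs) v" "i \<in> Ob"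
 shows "diagram_mor i (as @ xs @ bs) \<approx>
  diagram_mor (papply xs (papply as i)) bs \<cdot> (diagram_mor (papply as i) xs \<cdot> diagram_mor i as)"
proof -
 let ?w = "papply as i" and ?w' = "papply xs (papply as i)"
 have d: "is_diagram i as ?w" "is_diagram ?w (xs @ bs) v" "is_diagram ?w xs ?w'" "is_diagram ?w' bs v"
  using assms(1) unfolding is_diagram_append by auto
 have o: "?w \<in> Ob" "?w' \<in> Ob"
  using diagram_typed[OF d(1) assms(2)] diagram_typed[OF d(3)] mtgt_object by metis+
 note t = diagram_typed[OF d(1) assms(2)] diagram_typed[OF d(3) o(1)] diagram_typed[OF d(4) o(2)] diagram_typed[OF d(2) o(1)]
 have "diagram_mor i (as @ xs @ bs) \<approx> diagram_mor ?w (xs @ bs) \<cdot> diagram_mor i as"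
  by (rule diagram_mor_append[OF assms])
 also have "... \<approx> diagram_mor ?w' bs \<cdot> diagram_mor ?w xs \<cdot> diagram_mor i as"
  using t by (intro comp_cong lrefl diagram_mor_append[OF d(2) o(1)]) auto
 also have "... \<approx> diagram_mor ?w' bs \<cdot> (diagram_mor ?w xs \<cdot> diagram_mor i as)"
  using t by (intro comp_assoc) auto
 finally show ?thesis .
qed

lemma Gf_context:
 assumes d: "is_diagram i as w" "is_diagram w' bs v" and o: "i \<in> Ob" "w' \<in> Ob"
  and e: "cr e = 0" "mwt A e" "msrc e = w" "mtgt e = w'" and n: "length as + length bs < n"
 shows "Gf i n v (diagram_mor w' bs \<cdot> (e \<cdot> diagram_mor i as))"
proof -
 have "Gf i (Suc (length as)) w (diagram_mor i as)" using d(1) by (intro Gf_diagram) auto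
 then have "Gf i (Suc (length as)) w' (e \<cdot> diagram_mor i as)" using Gf_comp[OF o(1) e(2,3)] e(1,4) by force
 then have "Gf i (Suc (length as) + length bs) v (diagram_mor w' bs \<cdot> (e \<cdot> diagram_mor i as))"
  using Gf_comp[OF o(1), of "diagram_mor w' bs" w'] diagram_typed[OF d(2) o(2)] by force
 then show ?thesis by (rule Gf_mono) (use n in simp)
qed

text \<open>In the error all crossings of the nonempty part \<open>xs\<close> are lost, so its
  diagrams have fewer crossings than the given one. This is what the strict bound in
  \<open>Gf\<close> records.\<close>

lemma move_context:
 assumes d: "is_diagram i (as @ xs @ bs) v" "is_diagram i (as @ ys @ bs) v" and o: "i \<in> Ob"
  and pa: "papply ys (papply as i) = papply xs (papply as i)"
  and e: "diagram_mor (papply as i) xs \<approx> Add (diagram_mor (papply as i) ys) e" "cr e = 0" "xs \<noteq> []"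
 shows "\<exists>E. Gf i (length (as @ xs @ bs)) v E \<and> diagram_mor i (as @ xs @ bs) \<approx> Add (diagram_mor i (as @ ys @ bs)) E"
proof -
 let ?w = "papply as i" and ?w' = "papply xs (papply as i)"
 have d': "is_diagram i as ?w" "is_diagram ?w xs ?w'" "is_diagram ?w ys ?w'" "is_diagram ?w' bs v"
  using d pa unfolding is_diagram_append by auto
 have ow: "?w \<in> Ob" "?w' \<in> Ob"
  using diagram_typed[OF d'(1) o] diagram_typed[OF d'(2)] mtgt_object by metis+
 let ?A = "diagram_mor i as" and ?B = "diagram_mor ?w' bs" and ?X = "diagram_mor ?w xs" and ?Y = "diagram_mor ?w ys"
 note t = diagram_typed[OF d'(1) o] diagram_typed[OF d'(2) ow(1)] diagram_typed[OF d'(3) ow(1)]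
  diagram_typed[OF d'(4) ow(2)] leq_typed[OF e(1)]
 have "diagram_mor i (as @ xs @ bs) \<approx> ?B \<cdot> (?X \<cdot> ?A)" by (rule diagram_three[OF d(1) o])
 also have "... \<approx> ?B \<cdot> (Add ?Y e \<cdot> ?A)" using t by (intro comp_cong lrefl e(1)) auto
 also have "... \<approx> ?B \<cdot> Add (?Y \<cdot> ?A) (e \<cdot> ?A)" using t by (intro comp_cong lrefl add_comp) auto
 also have "... \<approx> Add (?B \<cdot> (?Y \<cdot> ?A)) (?B \<cdot> (e \<cdot> ?A))" using t by (intro comp_add) auto
 also have "... \<approx> Add (diagram_mor i (as @ ys @ bs)) (?B \<cdot> (e \<cdot> ?A))"
  using t diagram_three[OF d(2) o] unfolding pa by (intro add_cong lrefl lsym[of "diagram_mor i (as @ ys @ bs)"]) auto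
 finally show ?thesis using Gf_context[OF d'(1,4) o ow(2) e(2)] t e(3) by (intro exI conjI) (auto simp: Suc_le_eq)
qed

lemma black_word_set:
 assumes "is_diagram u ps v"
 shows "set (black_word u ps) \<subseteq> {1..<nb u}"
proof -
 let ?L = "zip [0..<length u] u"
 have L: "map snd ?L = u" by simp
 have "length (blacks ?L) = length (filter (\<lambda>x. x = None) (map snd ?L))"
  by (simp add: blacks_def filter_map o_def del: map_snd_zip)
 then have b: "length (blacks ?L) = nb u" by (simp add: nb_filter)
 show ?thesis using black_word_range[of ?L ps v] assms unfolding L b by blast
qed

lemma add_move:
 assumes "f \<approx> Add g e"
 shows "g \<approx> Add f (Smul (- 1) e)"
proof -
 note t = leq_typed[OF assms]
 have neg: "Add e (Smul (- 1) e) \<approx> Zero (msrc g) (mtgt g)"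
  using t by (intro add_neg) auto
 have "Add f (Smul (- 1) e) \<approx> Add (Add g e) (Smul (- 1) e)" using t by (intro add_cong assms lrefl) auto
 also have "... \<approx> Add g (Add e (Smul (- 1) e))" using t by (intro add_assoc) auto
 also have "... \<approx> Add g (Zero (msrc g) (mtgt g))" using t by (intro add_cong lrefl neg) auto
 also have "... \<approx> g" using t by (intro add_zero) auto
 finally show ?thesis by (rule lsym)
qed

lemma diagram_object: "is_diagram i ps v ==> i \<in> Ob ==> v \<in> Ob"
 using diagram_typed mtgt_object by metis

text \<open>A single move contributes an error of lower degree. Since all moves keep the length, the
  errors of reversed and successive moves are measured by the same bound and can be added.\<close>

lemma beq_diagram:
 assumes "beq ps qs" "is_diagram i ps v" "i \<in> Ob"
 shows "\<exists>E. Gf i (length ps) v E \<and> diagram_mor i ps \<approx> Add (diagram_mor i qs) E"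
 using assms
proof (induction rule: beq.induct)
 case (beq_refl w)
 then have v: "v \<in> Ob" using diagram_object by blast
 have "diagram_mor i w \<approx> Add (diagram_mor i w) (Zero i v)"
  using diagram_typed[OF beq_refl] by (intro lsym[OF add_zero]) auto
 then show ?case using Gf_zero[OF v] by blast
next
 case (beq_sym w w')
 have d: "is_diagram i w v" using beq_is_diagram[OF beq_sym(1)] beq_sym(3) by blast
 then obtain E where "Gf i (length w) v E" "diagram_mor i w \<approx> Add (diagram_mor i w') E"
  using beq_sym by blast
 then show ?case using add_move Gf_smul beq_length[OF beq_sym(1)] by metis
next
 case (beq_trans w w' w'')
 have d: "is_diagram i w' v" using beq_is_diagram[OF beq_trans(1)] beq_trans(5) by blast
 obtain E where E: "Gf i (length w) v E" "diagram_mor i w \<approx> Add (diagram_mor i w') E"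
  using beq_trans by blast
 obtain E' where E': "Gf i (length w') v E'" "diagram_mor i w' \<approx> Add (diagram_mor i w'') E'"
  using beq_trans d by blast
 note t = leq_typed[OF E(2)] leq_typed[OF E'(2)]
 have "diagram_mor i w \<approx> Add (Add (diagram_mor i w'') E') E" using t by (intro ltrans[OF E(2) add_cong] E'(2) lrefl) auto
 also have "... \<approx> Add (diagram_mor i w'') (Add E' E)" using t by (intro add_assoc) auto
 finally show ?case using E(1) E'(1) beq_length[OF beq_trans(1)] Gf_add by metis
next
 case (beq_comm p q xs ys)
 have d': "is_diagram i (xs @ [q, p] @ ys) v"
  using beq_is_diagram[OF beq.beq_comm[OF beq_comm(1)]] beq_comm(2) by blast
 have d: "is_diagram i xs (papply xs i)" "is_diagram (papply xs i) [p, q] (papply [p, q] (papply xs i))"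
  using beq_comm(2) unfolding is_diagram_append by auto
 have o: "papply xs i \<in> Ob" using diagram_object[OF d(1) beq_comm(3)] .
 obtain e where e: "cr e = 0" "diagram_mor (papply xs i) [p, q] \<approx> Add (diagram_mor (papply xs i) [q, p]) e"
  using leq_exact[OF comm_diagram[OF d(2) o beq_comm(1)]] by blast
 have "papply [q, p] (papply xs i) = papply [p, q] (papply xs i)"
  using swap_at_comm[OF beq_comm(1), of "papply xs i"] d(2) by simp
 then show ?case using move_context[OF beq_comm(2) d' beq_comm(3) _ e(2,1)] by blast
next
 case (beq_braid xs p ys)
 have d': "is_diagram i (xs @ [Suc p, p, Suc p] @ ys) v"
  using beq_is_diagram[OF beq.beq_braid] beq_braid(1) by blast
 have d: "is_diagram i xs (papply xs i)" "is_diagram (papply xs i) [p, Suc p, p] (papply [p, Suc p, p] (papply xs i))"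
  using beq_braid(1) unfolding is_diagram_append by auto
 have o: "papply xs i \<in> Ob" using diagram_object[OF d(1) beq_braid(2)] .
 obtain e where e: "cr e = 0"
  "diagram_mor (papply xs i) [p, Suc p, p] \<approx> Add (diagram_mor (papply xs i) [Suc p, p, Suc p]) e"
  using braid_diagram[OF d(2) o] by blast
 have "papply [Suc p, p, Suc p] (papply xs i) = papply [p, Suc p, p] (papply xs i)"
  using swap_at_braid[of p "papply xs i"] d(2) by simp
 then show ?case using move_context[OF beq_braid(1) d' beq_braid(2) _ e(2,1)] by blast
qed

text \<open>Two strands that cross twice in a row give a morphism without crossings, so two
  crossings disappear.\<close>

lemma square_lower:
 assumes "square ps" "is_diagram i ps v" "i \<in> Ob"
 shows "Gf i (length ps) v (diagram_mor i ps)"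
proof -
 obtain xs q ys where b: "beq ps (xs @ [q, q] @ ys)" using assms(1) unfolding square_def by blast
 let ?w = "papply xs i" and ?w' = "papply [q, q] (papply xs i)"
 have d0: "is_diagram i (xs @ [q, q] @ ys) v" using beq_is_diagram[OF b] assms(2) by blast
 then have d: "is_diagram i xs ?w" "is_diagram ?w [q, q] ?w'" "is_diagram ?w' ys v"
  unfolding is_diagram_append by auto
 have o: "?w \<in> Ob" "?w' \<in> Ob"
  using diagram_object[OF d(1) assms(3)] diagram_object[OF d(2)] by auto
 obtain E where E: "Gf i (length ps) v E" "diagram_mor i ps \<approx> Add (diagram_mor i (xs @ [q, q] @ ys)) E"
  using beq_diagram[OF b assms(2,3)] by blast
 obtain e where e: "cr e = 0" "diagram_mor ?w [q, q] \<approx> e" using square_diagram[OF d(2) o(1)] by blast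
 note t = diagram_typed[OF d(1) assms(3)] diagram_typed[OF d(2) o(1)] diagram_typed[OF d(3) o(2)] leq_typed[OF e(2)]
 have "diagram_mor i (xs @ [q, q] @ ys) \<approx> diagram_mor ?w' ys \<cdot> (diagram_mor ?w [q, q] \<cdot> diagram_mor i xs)"
  by (rule diagram_three[OF d0 assms(3)])
 also have "... \<approx> diagram_mor ?w' ys \<cdot> (e \<cdot> diagram_mor i xs)"
  using t by (intro comp_cong lrefl e(2)) auto
 finally have 1: "diagram_mor i (xs @ [q, q] @ ys) \<approx> diagram_mor ?w' ys \<cdot> (e \<cdot> diagram_mor i xs)" .
 have 2: "Gf i (length ps) v (diagram_mor ?w' ys \<cdot> (e \<cdot> diagram_mor i xs))"
  using beq_length[OF b] t by (intro Gf_context[OF d(1,3) assms(3) o(2) e(1)]) auto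
 have "Gf i (length ps) v (diagram_mor i (xs @ [q, q] @ ys))" by (rule Gf_eq[OF 2 lsym[OF 1]])
 then have "Gf i (length ps) v (Add (diagram_mor i (xs @ [q, q] @ ys)) E)" using E(1) by (rule Gf_add)
 then show ?thesis by (rule Gf_eq[OF _ lsym[OF E(2)]])
qed

subsection \<open>The spanning property\<close>

definition basis_term ::
 "('k, 'a) word => ('k, 'a) word => ((nat => nat) => nat list) => 'a list \<times> nat list \<times> (nat => nat) => ('k, 'a) mor" where
 "basis_term j i D = (\<lambda>(bs, \<alpha>, w). tokens j bs \<cdot> dots j \<alpha> \<cdot> diagram_mor i (D w))"

lemma Iv_pmon: "Iv v (pmon bs \<alpha>) = tokens v bs \<cdot> dots v \<alpha>"
 by (simp add: pmono_def Iv_tokens Iv_dots)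

lemma basis_index_iff: "(bs, \<alpha>, w) \<in> basis_index A d \<longleftrightarrow> (bs, \<alpha>) \<in> mono_indices d \<and> w permutes {1..d}"
 by (auto simp: basis_index_def mono_indices_def)

context
 fixes i j :: "('k, 'a) word" and d :: nat and D :: "(nat => nat) => nat list"
 assumes i: "i \<in> Ob" "nb i = d" and j: "j \<in> Ob" "nb j = d"
  and D: "\<And>w. w permutes {1..d} ==> chosen_diagram d j i w (D w)"
begin

interpretation N: term_module "{f. law_term A i j f}" "law_eq A i j" Add Smul "Zero i j"
 using i(1) j(1) by (rule law_module)

abbreviation M where "M \<equiv> N.span (basis_term j i D ` basis_index A d)"

lemma D_diagram: "w permutes {1..d} ==> is_diagram i (D w) j"
 using D unfolding chosen_diagram_def by blast

lemma D_typed: "w permutes {1..d} ==> mwt A (diagram_mor i (D w)) \<and> msrc (diagram_mor i (D w)) = i \<and> mtgt (diagram_mor i (D w)) = j"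
 using diagram_typed[OF D_diagram i(1)] by blast

lemma basis_term_typed:
 assumes "m \<in> basis_index A d"
 shows "law_term A i j (basis_term j i D m)"
proof -
 obtain bs \<alpha> w where m: "m = (bs, \<alpha>, w)" by (metis prod_cases3)
 then have *: "(bs, \<alpha>) \<in> mono_indices d" "w permutes {1..d}" using assms basis_index_iff by auto
 have "pmon bs \<alpha> \<in> pol_terms (nb j)" using pmono_terms[OF *(1)] j(2) by simp
 then have "law_term A i j (Iv j (pmon bs \<alpha>) \<cdot> diagram_mor i (D w))"
  using Iv_typed[of "pmon bs \<alpha>" j] j(1) D_typed[OF *(2)] unfolding law_term_iff by auto
 then show ?thesis unfolding m basis_term_def Iv_pmon by simp
qed

lemma basis_terms_typed: "basis_term j i D ` basis_index A d \<subseteq> {f. law_term A i j f}"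
 using basis_term_typed by blast

lemma M_typed: "f \<in> M ==> mwt A f \<and> msrc f = i \<and> mtgt f = j"
 using N.span_T[OF _ basis_terms_typed] by (auto simp: law_term_iff)

lemma M_eq: "f \<in> M ==> f \<approx> g ==> g \<in> M"
 using N.span_eq M_typed leqD by blast

text \<open>The normal form in \<open>Pol\<^sub>d(A)\<close>, transported by \<open>Iv_cong\<close>
  to the polynomials on top of a chosen diagram.\<close>

lemma Iv_M:
 assumes f: "f \<in> pol_terms d" and w: "w permutes {1..d}"
 shows "Iv j f \<cdot> diagram_mor i (D w) \<in> M"
proof -
 let ?D = "diagram_mor i (D w)"
 note t = D_typed[OF w]
 obtain ms c where ms: "distinct ms" "set ms \<subseteq> mono_indices d"
  "pol_eq A d f (psum (map (\<lambda>m. PSmul (c m) (pmon (fst m) (snd m))) ms))"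
  using pol_normal_form_list[OF f] .
 have "Iv j (psum (map (\<lambda>m. PSmul (c m) (pmon (fst m) (snd m))) ms)) \<cdot> ?D \<in> M"
  using ms(2)
 proof (induction ms)
  case Nil
  have "Zero i j \<approx> Zero j j \<cdot> ?D" using t j by (intro lsym[OF zero_comp]) auto
  then show ?case using M_eq[OF N.span_zero] by simp
 next
  case (Cons m ms)
  let ?s = "psum (map (\<lambda>m. PSmul (c m) (pmon (fst m) (snd m))) ms)" and ?m = "pmon (fst m) (snd m)"
  have m: "(fst m, snd m) \<in> mono_indices d" using Cons.prems by simp
  have "?m \<in> pol_terms (nb j)" using pmono_terms[OF m] j(2) by simp
  moreover have "?s \<in> pol_terms (nb j)"
   using Cons.prems pmono_terms j(2) by (intro psum_terms) (auto intro!: pol_terms.intros)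
  ultimately have tt: "mwt A (Iv j ?m)" "msrc (Iv j ?m) = j" "mtgt (Iv j ?m) = j" "mwt A (Iv j ?s)" "msrc (Iv j ?s) = j" "mtgt (Iv j ?s) = j"
   using Iv_typed j(1) by auto
  have "Iv j ?m \<cdot> ?D = basis_term j i D (fst m, snd m, w)" by (simp add: basis_term_def Iv_pmon)
  then have "Iv j ?m \<cdot> ?D \<in> M" using m w basis_index_iff by (auto intro!: N.span_base)
  then have "Add (Smul (c m) (Iv j ?m \<cdot> ?D)) (Iv j ?s \<cdot> ?D) \<in> M"
   using Cons by (intro N.span_ad N.span_sc) auto
  moreover have "Add (Smul (c m) (Iv j ?m \<cdot> ?D)) (Iv j ?s \<cdot> ?D) \<approx> Add (Smul (c m) (Iv j ?m) \<cdot> ?D) (Iv j ?s \<cdot> ?D)"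
   using t tt by (intro add_cong lsym[OF smul_comp] lrefl) auto
  moreover have "... \<approx> Add (Smul (c m) (Iv j ?m)) (Iv j ?s) \<cdot> ?D"
   using t tt by (intro lsym[OF add_comp]) auto
  ultimately show ?case using M_eq by auto
 qed
 moreover have "Iv j f \<approx> Iv j (psum (map (\<lambda>m. PSmul (c m) (pmon (fst m) (snd m))) ms))"
  using ms(3) j by (intro Iv_cong) auto
 then have "Iv j f \<cdot> ?D \<approx> Iv j (psum (map (\<lambda>m. PSmul (c m) (pmon (fst m) (snd m))) ms)) \<cdot> ?D"
  using t Iv_typed[of f j] f j by (intro comp_cong lrefl) auto
 ultimately show ?thesis using M_eq lsym by blast
qed

lemma M_generator:
 assumes "h \<in> M" "j = l @ None # r" "T = Dot \<or> (\<exists>a. T = Tok a)"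
 shows "wh l T r \<cdot> h \<in> M"
 using assms(1)
proof (induction rule: N.span.induct)
 case (span_base h)
 then obtain bs \<alpha> w where h: "h = basis_term j i D (bs, \<alpha>, w)" "(bs, \<alpha>) \<in> mono_indices d" "w permutes {1..d}"
  using basis_index_iff by auto
 have k: "Suc (nb l) \<in> {1..d}" using assms(2) j(2) by auto
 obtain g where g: "g \<in> pol_terms d" "Iv j g = wh l T r"
 proof (cases "T = Dot")
  case True
  then show ?thesis using k assms(2) by (intro that[of "PX (Suc (nb l))"] pol_terms.intros) (simp_all add: on_black_wh)
 next
  case False
  then obtain a where "T = Tok a" using assms(3) by blast
  then show ?thesis using k assms(2) by (intro that[of "PTok (Suc (nb l)) a"] pol_terms.intros) (simp_all add: on_black_wh)
 qed
 have p: "pmon bs \<alpha> \<in> pol_terms d" by (rule pmono_terms[OF h(2)])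
 have "Iv j (PMul g (pmon bs \<alpha>)) \<cdot> diagram_mor i (D w) \<in> M"
  by (intro Iv_M pol_terms.intros g p h(3))
 moreover have "Iv j (PMul g (pmon bs \<alpha>)) \<cdot> diagram_mor i (D w) \<approx> Iv j g \<cdot> (Iv j (pmon bs \<alpha>) \<cdot> diagram_mor i (D w))"
  using g p Iv_typed[of g j] Iv_typed[of "pmon bs \<alpha>" j] j D_typed[OF h(3)] by (auto intro!: comp_assoc)
 ultimately have "Iv j g \<cdot> (Iv j (pmon bs \<alpha>) \<cdot> diagram_mor i (D w)) \<in> M" by (rule M_eq)
 then show ?case unfolding h(1) g(2) Iv_pmon by (simp add: basis_term_def)
next
 case span_zero
 have "wh l T r \<cdot> Zero i j \<approx> Zero i j" using assms(2,3) i j by (intro comp_zero) auto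
 then show ?case using M_eq[OF N.span_zero lsym] by blast
next
 case (span_ad f g)
 have "wh l T r \<cdot> Add f g \<approx> Add (wh l T r \<cdot> f) (wh l T r \<cdot> g)"
  using assms(2,3) i j M_typed[OF span_ad(1)] M_typed[OF span_ad(2)] by (intro comp_add) auto
 then show ?case using M_eq[OF N.span_ad lsym] span_ad by blast
next
 case (span_sc f c)
 have "wh l T r \<cdot> Smul c f \<approx> Smul c (wh l T r \<cdot> f)"
  using assms(2,3) i j M_typed[OF span_sc(1)] by (intro comp_smul) auto
 then show ?case using M_eq[OF N.span_sc lsym] span_sc by blast
next
 case (span_eq f g)
 have "wh l T r \<cdot> f \<approx> wh l T r \<cdot> g"
  using assms(2,3) i j M_typed[OF span_eq(1)] leqI[OF span_eq(2)] by (intro comp_cong lrefl) auto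
 then show ?case using M_eq span_eq by blast
qed

text \<open>The outer induction on the degree disposes of all errors, the inner one follows the
  construction of \<open>h\<close>. Only a bare diagram needs the comparison with the chosen
  one.\<close>

lemma Gf_M: "Gf i n j h ==> h \<in> M"
proof (induction n arbitrary: h rule: less_induct)
 case (less n)
 from less.prems show ?case
 proof (induction rule: Gf.induct)
  case (Gf_diagram ps)
  let ?w = "word_perm (black_word i ps)"
  let ?L = "zip [0..<length i] i"
  have "set (black_word i ps) \<subseteq> {1..<d}" using black_word_set[OF Gf_diagram(1)] i(2) by simp
  then have w: "?w permutes {1..d}" by (rule word_perm_permutes)
  have c: "is_diagram i (D ?w) j" "distinct (red_black_crossings ?L (D ?w))"
   "reduced_expression (nb i) (black_word i (D ?w)) ?w"
   using D[OF w] i(2) unfolding chosen_diagram_def by auto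
  from diagram_braid_chosen[OF c Gf_diagram(1) refl] show ?case
  proof
   assume "beq ps (D ?w)"
   then obtain E where E: "Gf i (length ps) j E" "diagram_mor i ps \<approx> Add (diagram_mor i (D ?w)) E"
    using beq_diagram Gf_diagram(1) i(1) by blast
   have "Iv j POne \<cdot> diagram_mor i (D ?w) \<in> M" by (intro Iv_M pol_terms.intros w)
   moreover have "Ident j \<cdot> diagram_mor i (D ?w) \<approx> diagram_mor i (D ?w)"
    using D_typed[OF w] by (intro id_comp) auto
   ultimately have "diagram_mor i (D ?w) \<in> M" using M_eq by simp
   moreover have "E \<in> M" using less.IH[OF Gf_diagram(2) E(1)] .
   ultimately show ?case using M_eq[OF N.span_ad lsym[OF E(2)]] by blast
  next
   assume "square ps"
   then show ?case using less.IH[OF Gf_diagram(2)] square_lower[OF _ Gf_diagram(1) i(1)] by blast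
  qed
 next
  case (Gf_generator h l r T)
  then show ?case using M_generator by blast
 next
  case (Gf_eq f g)
  then show ?case using M_eq by blast
 qed (auto intro: N.span.intros)
qed

lemma hom_spanned: "law_term A i j f ==> f \<in> M"
proof -
 assume f: "law_term A i j f"
 \<comment> \<open>The identity is the empty diagram, and \<open>f\<close> is applied on top of it;
   so every morphism has some finite degree.\<close>
 have "Gf i 1 i (diagram_mor i [])" by (intro Gf_diagram) auto
 then have "Gf i (1 + cr f) j (f \<cdot> Ident i)"
  using Gf_comp[of i f i 1 "Ident i"] i(1) f unfolding law_term_iff by auto
 moreover have "f \<cdot> Ident i \<approx> f" using f unfolding law_term_iff by (intro comp_id) auto
 ultimately show ?thesis using Gf_M M_eq by blast
qed

lemma hom_expand:
 assumes "law_term A i j f"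
 shows "\<exists>ms c. distinct ms \<and> set ms \<subseteq> basis_index A d \<and>
  law_eq A i j f (msum i j (map (\<lambda>m. Smul (c m) (basis_term j i D m)) ms))"
proof -
 have "N.lsum fs = msum i j fs" for fs by (induction fs) auto
 then show ?thesis using N.span_expand[OF hom_spanned[OF assms] basis_terms_typed] by simp
qed

end

end

section \<open>Cancellation of the elements \<open>Q\<close> and linear independence\<close>

subsection \<open>Injectivity of the red-black crossings\<close>

lemma finite_kernel_mult:
 assumes "finite_kernel f" "finite_kernel g"
 shows "finite_kernel (f * g)"
proof -
 obtain S K where f: "\<And>m. finite (S m)" "\<And>v m. app f v m = (\<Sum>m'\<in>S m. K m m' * v m')"
  using assms(1) unfolding finite_kernel_def by blast
 obtain S' K' where g: "\<And>m. finite (S' m)" "\<And>v m. app g v m = (\<Sum>m'\<in>S' m. K' m m' * v m')"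
  using assms(2) unfolding finite_kernel_def by blast
 let ?U = "\<lambda>m. \<Union>m'\<in>S m. S' m'"
 show ?thesis
 proof (rule finite_kernelI)
  show "finite (?U m)" for m using f(1) g(1) by blast
  fix v m
  have "app (f * g) v m = (\<Sum>m'\<in>S m. K m m' * (\<Sum>m''\<in>S' m'. K' m' m'' * v m''))"
   by (simp add: f(2) g(2))
  also have "... = (\<Sum>m'\<in>S m. \<Sum>m''\<in>?U m. if m'' \<in> S' m' then K m m' * K' m' m'' * v m'' else 0)"
  proof (intro sum.cong refl)
   fix m' assume m': "m' \<in> S m"
   have "(\<Sum>m''\<in>?U m. if m'' \<in> S' m' then K m m' * K' m' m'' * v m'' else 0)
    = (\<Sum>m''\<in>?U m \<inter> S' m'. K m m' * K' m' m'' * v m'')"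
    using f(1) g(1) by (intro sum.inter_restrict[symmetric]) auto
   also have "?U m \<inter> S' m' = S' m'" using m' by blast
   finally show "K m m' * (\<Sum>m''\<in>S' m'. K' m' m'' * v m'')
    = (\<Sum>m''\<in>?U m. if m'' \<in> S' m' then K m m' * K' m' m'' * v m'' else 0)"
    by (simp add: sum_distrib_left mult.assoc)
  qed
  also have "... = (\<Sum>m''\<in>?U m. (\<Sum>m'\<in>S m. if m'' \<in> S' m' then K m m' * K' m' m'' else 0) * v m'')"
   by (subst sum.swap) (auto simp: sum_distrib_right intro!: sum.cong)
  finally show "app (f * g) v m
   = (\<Sum>m''\<in>?U m. (\<lambda>m m''. \<Sum>m'\<in>S m. if m'' \<in> S' m' then K m m' * K' m' m'' else 0) m m'' * v m'')" .
 qed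
qed

lemma finite_kernel_add:
 assumes "finite_kernel f" "finite_kernel g"
 shows "finite_kernel (f + g)"
proof -
 obtain S K where f: "\<And>m. finite (S m)" "\<And>v m. app f v m = (\<Sum>m'\<in>S m. K m m' * v m')"
  using assms(1) unfolding finite_kernel_def by blast
 obtain S' K' where g: "\<And>m. finite (S' m)" "\<And>v m. app g v m = (\<Sum>m'\<in>S' m. K' m m' * v m')"
  using assms(2) unfolding finite_kernel_def by blast
 have *: "(\<Sum>x\<in>T. h x * v x) = (\<Sum>x\<in>U. (if x \<in> T then h x else 0) * v x)" if "finite U" "T \<subseteq> U"
  for h v :: "'a => 'b" and T U
  using that by (intro sum.mono_neutral_cong_left) auto
 show ?thesis
 proof (rule finite_kernelI)
  show "finite (S m \<union> S' m)" for m using f(1) g(1) by blast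
  fix v m
  show "app (f + g) v m = (\<Sum>m'\<in>S m \<union> S' m.
   (\<lambda>m m'. (if m' \<in> S m then K m m' else 0) + (if m' \<in> S' m then K' m m' else 0)) m m' * v m')"
   using *[of "S m \<union> S' m" "S m" "K m" v] *[of "S m \<union> S' m" "S' m" "K' m" v] f g
   by (simp add: distrib_right sum.distrib)
 qed
qed

lemma finite_kernel_sm: "finite_kernel f ==> finite_kernel (sm c f)"
proof -
 assume "finite_kernel f"
 then obtain S K where f: "\<And>m. finite (S m)" "\<And>v m. app f v m = (\<Sum>m'\<in>S m. K m m' * v m')"
  unfolding finite_kernel_def by blast
 show ?thesis
  by (rule finite_kernelI[of S _ "\<lambda>m m'. c * K m m'"]) (auto simp: f sum_distrib_left mult.assoc)
qed

lemma finite_kernel_zero: "finite_kernel 0"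
 by (rule finite_kernelI[of "\<lambda>_. {}" _ "\<lambda>_ _. 0"]) auto

lemma pint_perm: "pint e t y (pol_perm w f) = pint e (\<lambda>i. t (w i)) (\<lambda>i. y (w i)) f"
 by (induction f) auto

lemma pint_local:
 assumes "f \<in> pol_terms 1" "t 1 = t' 1" "y 1 = y' 1"
 shows "pint e t y f = pint e t' y' f"
 using assms(1)
proof (induction rule: pol_terms.induct)
 case (1 i a)
 then have "i = 1" by simp
 then show ?case using assms(2) by simp
next
 case (2 i)
 then have "i = 1" by simp
 then show ?case using assms(3) by simp
qed auto

context frobenius_superalgebra
begin

text \<open>The one-strand representation, free of strings. Regularity of \<open>Q\<close> is a
  statement about \<open>Pol\<^sub>1(A)\<close> and is exploited here.\<close>

abbreviation hat :: "('k, 'a) pterm => ('a \<times> nat, 'k) lop" where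
 "hat \<equiv> pint Eop (\<lambda>i. Mop) (\<lambda>i. Nop)"

lemma goodop_mult: "goodop p f ==> goodop q g ==> goodop (p + q) (f * g)"
proof -
 assume f: "goodop p f" and g: "goodop q g"
 have "Jop r * (f * g) = sm (koszul (r * (p + q))) (f * g * Jop r)" for r
 proof -
  have "Jop r * (f * g) = sm (koszul (r * p)) (f * (Jop r * g))"
   using f unfolding goodop_def by (simp add: mult.assoc[symmetric])
  also have "... = sm (koszul (r * (p + q))) (f * g * Jop r)"
   using g unfolding goodop_def by (simp add: mult.assoc koszul_add distrib_left)
  finally show ?thesis .
 qed
 moreover have "Eop * (f * g) = f * g" "f * g * Eop = f * g"
  using f g unfolding goodop_def by (simp_all add: mult.assoc[symmetric]) (simp add: mult.assoc)
 ultimately show ?thesis using f g finite_kernel_mult unfolding goodop_def by blast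
qed

lemma goodop_add: "goodop p f ==> goodop p g ==> goodop p (f + g)"
 unfolding goodop_def by (auto simp: finite_kernel_add distrib_left distrib_right sm_distrib)

lemma goodop_sm: "goodop p f ==> goodop p (sm c f)"
 unfolding goodop_def by (auto simp: finite_kernel_sm mult.commute)

lemma goodop_zero: "goodop p 0"
 unfolding goodop_def by (auto simp: finite_kernel_zero)

lemma goodop_E: "goodop 0 Eop"
 unfolding goodop_def by (auto simp: kernel_ops koszul_def)

text \<open>Strings on the same factors multiply and their parities add. A homogeneous polynomial in
  one variable therefore acts on the strand \<open>k\<close> through its one-strand operator under a
  single string.\<close>

lemma hat_gop:
 assumes "pol_homog A p f" "k \<in> {1..d}"
 shows "pint (E0 d) (\<lambda>i. tok0 d k) (\<lambda>i. x0 d k) f = gop d k p (hat f) \<and> goodop p (hat f)"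
 using assms(1)
proof (induction rule: pol_homog.induct)
 case (1 a p i)
 then show ?case using tok0_homog goodop_M by simp
next
 case (2 i)
 then show ?case using goodop_N by (simp add: x0_def)
next
 case (3 p)
 then show ?case using goodop_zero by (simp add: gop_linear)
next
 case 4
 then show ?case using goodop_E assms(2) by (simp add: gop_E)
next
 case (5 p f g)
 then show ?case using goodop_add by (simp add: gop_linear)
next
 case (6 p f q g)
 then show ?case using goodop_mult gop_mult by simp
next
 case (7 p f c)
 then show ?case using goodop_sm by (simp add: gop_linear)
qed

lemma hat_monomial: "app (hat (PMul (PTok 1 b) (ppow (PX 1) r))) (factor 1 0) = factor b r"
proof -
 have "app (hat (ppow (PX 1) r)) (factor 1 0) = factor 1 r"
 proof (induction r)
  case 0
  show ?case by (simp add: ext[OF Eop_factor])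
 next
  case (Suc r)
  then show ?case by (simp add: ext[OF Nop_factor])
 qed
 then show ?thesis by (simp add: ext[OF Mop_factor])
qed

text \<open>On the vector of the unit, \<open>b x^r\<close> yields the coordinates of
  \<open>b\<close> in degree \<open>r\<close>; so all coefficients can be read off.\<close>

lemma hat_faithful:
 assumes "f \<in> pol_terms 1" "app (hat f) (factor 1 0) = (\<lambda>_. 0)"
 shows "pol_eq A 1 f PZero"
proof -
 interpret H: polrep A 1 Eop "\<lambda>i. Mop" "\<lambda>i. Nop" by (rule polrep1)
 interpret R: polrep A 1 "E0 1" "tok0 1" "x0 1" by (rule polrep0)
 obtain as where as: "pol_eq A 1 f (pol_coeffs 1 as)" using pol1_coeffs_exist[OF assms(1)] .
 have sum: "pint e t y (pol_coeffs 1 as) = (\<Sum>k<length as. pint e t y (PMul (PTok 1 (as ! k)) (ppow (PX 1) k)))"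
  for e :: "('x, 'k) lop" and t y
  by (simp add: pol_coeffs_def pint_psum o_def sum_list_distinct_conv_sum_set atLeast0LessThan)
 have zero: "as ! r = 0" if r: "r < length as" for r
 proof -
  have "tr (dl b * as ! r) = 0" if b: "b \<in> BB" for b
  proof -
   have "0 = app (hat (pol_coeffs 1 as)) (factor 1 0) (b, r)"
    using H.pint_cong[OF as] assms(2) by simp
   also have "... = (\<Sum>k<length as. factor (as ! k) k (b, r))"
    unfolding sum app_sum hat_monomial ..
   also have "... = (\<Sum>k<length as. if k = r then tr (dl b * as ! r) else 0)"
    using b by (intro sum.cong) (auto simp: factor_def)
   also have "... = tr (dl b * as ! r)" using r by simp
   finally show ?thesis by simp
  qed
  then have "(\<Sum>b\<in>BB. smul A (tr (dl b * as ! r)) b) = 0" by simp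
  then show ?thesis using basis_expand[of "as ! r"] by simp
 qed
 have one: "(1::nat) \<in> {1..1}" by simp
 have "tok0 1 1 0 = 0" using R.tok_add[OF one, of 0 0] by simp
 then have "pint0 1 (pol_coeffs 1 as) = 0" unfolding sum using zero by simp
 then have "pint0 1 f = pint0 1 PZero" using R.pint_cong[OF as] by simp
 then show ?thesis by (intro pol_eqI assms(1) pol_terms.intros)
qed

text \<open>A finitely supported vector is the coordinate vector of a polynomial \<open>g\<close>.
  Faithfulness turns the hypothesis into the vanishing of the product of \<open>Q\<close> and
  \<open>g\<close>, and regularity gives that \<open>g\<close> is zero.\<close>

lemma hat_injective:
 assumes Q: "Q \<in> pol_E A 1" and y: "finite {m. y m \<noteq> 0}" "\<And>m. fst m \<notin> BB ==> y m = 0"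
  and z: "app (hat (qrep Q)) y = (\<lambda>_. 0)"
 shows "y = (\<lambda>_. 0)"
proof -
 interpret H: polrep A 1 Eop "\<lambda>i. Mop" "\<lambda>i. Nop" by (rule polrep1)
 have one: "(1::nat) \<in> {1..1}" by simp
 obtain ms where ms: "distinct ms" "set ms = {m. y m \<noteq> 0}" using finite_distinct_list[OF y(1)] by blast
 define g :: "('k, 'a) pterm" where
  "g = psum (map (\<lambda>m. PSmul (y m) (PMul (PTok 1 (fst m)) (ppow (PX 1) (snd m)))) ms)"
 have g: "g \<in> pol_terms 1"
  unfolding g_def using one by (intro psum_terms) (auto intro!: pol_terms.intros ppow_terms simp del: atLeastAtMost_iff)
 have "app (hat g) (factor 1 0) m' = y m'" for m'
 proof -
  have "app (hat g) (factor 1 0) m'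
   = (\<Sum>m\<in>set ms. y m * app (hat (PMul (PTok 1 (fst m)) (ppow (PX 1) (snd m)))) (factor 1 0) m')"
   unfolding g_def using ms(1) by (simp add: pint_psum o_def sum_list_distinct_conv_sum_set app_sum)
  also have "... = (\<Sum>m\<in>set ms. y m * factor (fst m) (snd m) m')" by (simp only: hat_monomial)
  also have "... = (\<Sum>m\<in>set ms. if m = m' then y m else 0)"
  proof (intro sum.cong refl)
   fix m assume "m \<in> set ms"
   then have "fst m \<in> BB" using y(2)[of m] ms(2) by auto
   then show "y m * factor (fst m) (snd m) m' = (if m = m' then y m else 0)"
    by (cases m; cases m') (auto simp: factor_def dual_basis)
  qed
  also have "... = (if m' \<in> set ms then y m' else 0)" by simp
  also have "... = y m'" using ms(2) by simp
  finally show ?thesis .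
 qed
 then have gy: "app (hat g) (factor 1 0) = y" by blast
 have "app (hat (PMul (qrep Q) g)) (factor 1 0) = (\<lambda>_. 0)" using gy z by simp
 then have "pol_eq A 1 (PMul (qrep Q) g) PZero"
  using g qrep(2)[OF Q] by (intro hat_faithful pol_terms.intros)
 then have "pol_eq A 1 g PZero" using qrep(5)[OF Q] g unfolding pol_regular_def by blast
 then have "hat g = 0" using H.pint_cong by fastforce
 then show ?thesis using gy by (simp add: fun_eq_iff)
qed

text \<open>The constant map renames the only variable of \<open>Q\<close> to \<open>k\<close>; here
  \<open>pol_perm\<close> is used as a substitution and not as a permutation.\<close>

definition qk :: "nat => ('k, 'a) pterm set => ('k, 'a) pterm" where
 "qk k Q = pol_perm (\<lambda>_. k) (qrep Q)"

lemma qk_terms: "Q \<in> pol_E A 1 ==> k \<in> {1..d} ==> qk k Q \<in> pol_terms d"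
 unfolding qk_def by (rule pol_perm_terms[OF qrep(2)]) auto

lemma pint_qk:
 assumes "Q \<in> pol_E A 1" "w (Suc l) = k"
 shows "pint (E0 d) (\<lambda>i. tok0 d (w (l + i))) (\<lambda>i. x0 d (w (l + i))) (qrep Q) = pint0 d (qk k Q)"
 unfolding qk_def pint_perm using assms by (intro pint_local qrep(2)) auto

text \<open>Freezing all coordinates but the \<open>k\<close>-th leaves a finitely supported vector
  of one strand, on which \<open>Q\<close> acts by the one-strand operator once the signs are
  stripped off.\<close>

lemma qk_injective:
 assumes Q: "Q \<in> pol_E A 1" and k: "k \<in> {1..d}"
  and z: "finite {\<iota>. z \<iota> \<noteq> 0}" "app (E0 d) z = z" and 0: "app (pint0 d (qk k Q)) z = (\<lambda>_. 0)"
 shows "z = (\<lambda>_. 0)"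
proof
 fix \<iota>
 interpret R: polrep A d "E0 d" "tok0 d" "x0 d" by (rule polrep0)
 interpret H: polrep A 1 Eop "\<lambda>i. Mop" "\<lambda>i. Nop" by (rule polrep1)
 have "(k - 1) + 1 \<le> d" using k by auto
 from polrep_shift[OF polrep0 this] interpret K: polrep A 1 "E0 d" "\<lambda>i. tok0 d (k - 1 + i)" "\<lambda>i. x0 d (k - 1 + i)" .
 obtain f' where f': "pol_eq A 1 (qrep Q) f'" "pol_homog A 0 f'"
  using qrep(3)[OF Q] unfolding pol_even_def by blast
 have ft: "f' \<in> pol_terms 1" using pol_eq_terms[OF f'(1)] by simp
 have "pint0 d (qk k Q) = pint (E0 d) (\<lambda>i. tok0 d (k - 1 + i)) (\<lambda>i. x0 d (k - 1 + i)) (qrep Q)"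
  unfolding qk_def pint_perm using k by (intro pint_local qrep(2)[OF Q]) auto
 also have "... = pint (E0 d) (\<lambda>i. tok0 d (k - 1 + i)) (\<lambda>i. x0 d (k - 1 + i)) f'"
  by (rule K.pint_cong[OF f'(1)])
 also have "... = pint (E0 d) (\<lambda>i. tok0 d k) (\<lambda>i. x0 d k) f'"
  using k by (intro pint_local ft) auto
 also have "... = gop d k 0 (hat f')" using hat_gop[OF f'(2) k] by blast
 finally have "app (gop d k 0 (hat f')) z = (\<lambda>_. 0)" using 0 by simp
 then have L: "app (Lop k (hat f')) z = (\<lambda>_. 0)"
  using hat_gop[OF f'(2) k] z(2) by (intro gop_kernel[of 0]) auto
 let ?y = "\<lambda>m. z (\<iota>(k := m))"
 have "app (hat f') ?y m = 0" for m
  using fun_cong[OF L, of "\<iota>(k := m)"] by (simp add: Lop.rep_eq)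
 then have h: "app (hat (qrep Q)) ?y = (\<lambda>_. 0)" using H.pint_cong[OF f'(1)] by (simp add: fun_eq_iff)
 have "inj (\<lambda>m. \<iota>(k := m))" by (rule injI) (metis fun_upd_same)
 then have "finite ((\<lambda>m. \<iota>(k := m)) -` {\<iota>. z \<iota> \<noteq> 0})" using z(1) by (intro finite_vimageI)
 then have fin: "finite {m. ?y m \<noteq> 0}" by (simp add: vimage_def)
 have bad: "?y m = 0" if "fst m \<notin> BB" for m
  using E0_bad[OF k, of "\<iota>(k := m)" z] that z(2) by simp
 have "?y = (\<lambda>_. 0)" by (rule hat_injective[OF Q fin bad h])
 then show "z \<iota> = 0" using fun_cong[of ?y "\<lambda>_. 0" "\<iota> k"] by simp
qed

text \<open>The leading coefficient that the crossings \<open>Rho\<close> along a diagram leave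
  behind.\<close>

inductive redterm :: "nat => ('k, 'a) pterm => bool" for d where
 redterm_one: "redterm d POne"
| redterm_mul: "redterm d p ==> k \<in> {1..d} ==> Q \<in> pol_E A 1 ==> redterm d (PMul p (qk k Q))"

lemma redterm_terms: "redterm d p ==> p \<in> pol_terms d"
proof (induction rule: redterm.induct)
 case (redterm_mul p k Q)
 then show ?case by (intro pol_terms.intros qk_terms)
qed (rule pol_terms.intros)

text \<open>Commutation is already known for the operators on the symmetric group; evaluated at the
  identity permutation it holds in the regular representation.\<close>

lemma qk_commute:
 assumes Q: "Q \<in> pol_E A 1" and k: "k \<in> {1..d}" and F: "F \<in> pol_terms d"
 shows "pint0 d (qk k Q) * pint0 d F = pint0 d F * pint0 d (qk k Q)"
proof (rule lop_eqI)
 fix v :: "(nat => 'a \<times> nat) => 'k" and \<iota> :: "nat => 'a \<times> nat"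
 let ?\<phi> = "\<lambda>(u :: nat => nat, \<iota> :: nat => 'a \<times> nat). v \<iota>"
 have l: "k - 1 < d" using k by auto
 have q: "app (Qv d (k - 1) Q) \<phi> (id, \<iota>) = app (pint0 d (qk k Q)) (\<lambda>\<iota>'. \<phi> (id, \<iota>')) \<iota>" for \<phi> \<iota>
  unfolding Qv_def pv_id using pint_qk[OF Q, of "\<lambda>i. i" "k - 1" k d] k by simp
 have f: "app (pv d 0 F) \<phi> (id, \<iota>) = app (pint0 d F) (\<lambda>\<iota>'. \<phi> (id, \<iota>')) \<iota>" for \<phi> \<iota>
  unfolding pv_id by simp
 have "app (Qv d (k - 1) Q * pv d 0 F) ?\<phi> (id, \<iota>) = app (pv d 0 F * Qv d (k - 1) Q) ?\<phi> (id, \<iota>)"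
  using Qv_pv[OF Q l F, of 0] by simp
 then show "app (pint0 d (qk k Q) * pint0 d F) v \<iota> = app (pint0 d F * pint0 d (qk k Q)) v \<iota>"
  by (simp only: times_lop.rep_eq q f prod.case)
qed

lemma redterm_commute: "redterm d p ==> F \<in> pol_terms d ==> pint0 d p * pint0 d F = pint0 d F * pint0 d p"
proof (induction rule: redterm.induct)
 case redterm_one
 interpret R: polrep A d "E0 d" "tok0 d" "x0 d" by (rule polrep0)
 show ?case using R.pint_e[OF redterm_one] by simp
next
 case (redterm_mul p k Q)
 then have "pint0 d p * pint0 d F = pint0 d F * pint0 d p" by blast
 then show ?case using qk_commute[OF redterm_mul(3,2,5)] by (simp add: mult.assoc) (simp add: mult.assoc[symmetric])
qed

text \<open>Each monomial of a normal form sends the vacuum vector to a multiple of a point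
  function. This provides the finite support for \<open>qk_injective\<close>.\<close>

lemma pint0_vac_finite:
 assumes "F \<in> pol_terms d"
 shows "finite {\<iota>. app (pint0 d F) (vac d) \<iota> \<noteq> 0}"
proof -
 interpret R: polrep A d "E0 d" "tok0 d" "x0 d" by (rule polrep0)
 obtain ms c where ms: "distinct ms" "set ms \<subseteq> mono_indices d"
  "pol_eq A d F (psum (map (\<lambda>m. PSmul (c m) (pmon (fst m) (snd m))) ms))"
  using pol_normal_form_list[OF assms] .
 have "app (pint0 d F) (vac d) \<iota> = (\<Sum>m\<in>set ms. c m * app (pint0 d (pmon (fst m) (snd m))) (vac d) \<iota>)" for \<iota>
  using R.pint_cong[OF ms(3)] ms(1) by (simp add: pint_psum o_def sum_list_distinct_conv_sum_set app_sum)
 moreover have "app (pint0 d (pmon (fst m) (snd m))) (vac d) \<iota> = 0"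
  if "m \<in> set ms" "\<iota> \<noteq> mono_index d (fst m) (snd m)" for m \<iota>
 proof -
  have "(fst m, snd m) \<in> mono_indices d" using that ms(2) by auto
  from pmono_vac[OF this] show ?thesis using that(2) by auto
 qed
 ultimately have "app (pint0 d F) (vac d) \<iota> = 0" if "\<iota> \<notin> (\<lambda>m. mono_index d (fst m) (snd m)) ` set ms" for \<iota>
  using that by (metis (no_types, lifting) imageI mult_zero_right sum.neutral)
 then have "{\<iota>. app (pint0 d F) (vac d) \<iota> \<noteq> 0} \<subseteq> (\<lambda>m. mono_index d (fst m) (snd m)) ` set ms" by blast
 then show ?thesis by (rule finite_subset) simp
qed

lemma redterm_injective:
 "redterm d p ==> F \<in> pol_terms d ==> app (pint0 d p * pint0 d F) (vac d) = (\<lambda>_. 0) ==>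
  app (pint0 d F) (vac d) = (\<lambda>_. 0)"
proof (induction arbitrary: F rule: redterm.induct)
 case redterm_one
 interpret R: polrep A d "E0 d" "tok0 d" "x0 d" by (rule polrep0)
 show ?case using R.pint_e[OF redterm_one(1)] redterm_one(2) by simp
next
 case (redterm_mul p k Q)
 interpret R: polrep A d "E0 d" "tok0 d" "x0 d" by (rule polrep0)
 have t: "PMul (qk k Q) F \<in> pol_terms d" using redterm_mul qk_terms by (intro pol_terms.intros) auto
 have "app (pint0 d p * pint0 d (PMul (qk k Q) F)) (vac d) = (\<lambda>_. 0)"
  using redterm_mul(6) by (simp add: mult.assoc)
 then have 0: "app (pint0 d (PMul (qk k Q) F)) (vac d) = (\<lambda>_. 0)" by (rule redterm_mul(4)[OF t])
 show ?case
 proof (rule qk_injective[OF redterm_mul(3,2)])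
  show "finite {\<iota>. app (pint0 d F) (vac d) \<iota> \<noteq> 0}" by (rule pint0_vac_finite[OF redterm_mul(5)])
  have "E0 d * pint0 d F = pint0 d F" using R.pint_e[OF redterm_mul(5)] by simp
  then show "app (E0 d) (app (pint0 d F) (vac d)) = app (pint0 d F) (vac d)" by (metis times_lop.rep_eq)
  show "app (pint0 d (qk k Q)) (app (pint0 d F) (vac d)) = (\<lambda>_. 0)" using 0 by simp
 qed
qed

end

subsection \<open>Triangularity of diagrams\<close>

text \<open>The strong exchange property of the symmetric group.\<close>

lemma word_perm_exchange:
 "l < j ==> word_perm rs j < word_perm rs l ==>
  \<exists>rs'. set rs' \<subseteq> set rs \<and> length rs' < length rs \<and> word_perm rs' = word_perm rs \<circ> transpose l j"
proof (induction rs arbitrary: l j)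
 case (Cons r rs)
 let ?s = "transpose r (Suc r)"
 show ?case
 proof (cases "l = r \<and> j = Suc r")
  case True
  then have "word_perm rs = word_perm (r # rs) \<circ> transpose l j" by (simp add: fun_eq_iff)
  then show ?thesis by (intro exI[of _ rs]) (auto simp del: word_perm.simps)
 next
  case False
  then have "?s l < ?s j" using transpose_less[of l j r] Cons.prems(1) by auto
  moreover have "word_perm rs (?s j) < word_perm rs (?s l)" using Cons.prems(2) by simp
  ultimately obtain rs' where rs': "set rs' \<subseteq> set rs" "length rs' < length rs"
   "word_perm rs' = word_perm rs \<circ> transpose (?s l) (?s j)" using Cons.IH by blast
  have "transpose (?s l) (?s j) \<circ> ?s = ?s \<circ> transpose l j"
   by (rule ext) (auto simp: transpose_def)
  then have "word_perm (r # rs') = word_perm (r # rs) \<circ> transpose l j"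
   using rs'(3) by (simp add: comp_assoc)
  then show ?thesis using rs' by (intro exI[of _ "r # rs'"]) auto
 qed
qed simp

context frobenius_superalgebra
begin

text \<open>
  The words \<open>rs\<close> need not be reduced, so that being reached by a word of length less than \<open>n\<close>
  replaces the length function of the symmetric group.
\<close>

definition vanishes :: "nat => nat => ((nat => nat) \<times> (nat => 'a \<times> nat) => 'k) => bool" where
 "vanishes d n \<phi> \<longleftrightarrow> (\<forall>rs \<iota>. set rs \<subseteq> {1..<d} \<longrightarrow> length rs < n \<longrightarrow> \<phi> (word_perm rs, \<iota>) = 0)"

lemma vanishes_mono: "vanishes d n \<phi> ==> m \<le> n ==> vanishes d m \<phi>"
 unfolding vanishes_def by simp

lemma vanishesD: "vanishes d n \<phi> ==> set rs \<subseteq> {1..<d} ==> length rs < n ==> (\<lambda>\<iota>. \<phi> (word_perm rs, \<iota>)) = (\<lambda>_. 0)"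
 unfolding vanishes_def by (simp add: fun_eq_iff)

text \<open>A nonzero Dunkl term looks at the product of the permutation with the transposition of
  an inverted pair. By the exchange property a shorter word reaches it, and there the function
  vanishes.\<close>

lemma xv_triangular:
 assumes rs: "set rs \<subseteq> {1..<d}" and v: "vanishes d (length rs) \<phi>"
 shows "app (xv d j) \<phi> (word_perm rs, \<iota>) = app (x0 d (word_perm rs j)) (\<lambda>\<iota>'. \<phi> (word_perm rs, \<iota>')) \<iota>"
proof -
 let ?u = "word_perm rs"
 have u: "?u permutes {1..d}" by (rule word_perm_permutes[OF rs])
 have "app (xterm d j l) \<phi> (?u, \<iota>) = 0" for l
 proof (cases "eta l j ?u = 0")
  case True
  then show ?thesis unfolding xterm_def using u by (subst app_Dg_Sh) auto
 next
  case False
  then have "(l < j \<and> ?u j < ?u l) \<or> (j < l \<and> ?u l < ?u j)" by (auto simp: eta_def split: if_splits)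
  then obtain rs' where rs': "set rs' \<subseteq> set rs" "length rs' < length rs" "word_perm rs' = ?u \<circ> transpose l j"
   using word_perm_exchange[of l j rs] word_perm_exchange[of j l rs] transpose_commute by metis
  then have "(\<lambda>\<iota>'. \<phi> (?u \<circ> transpose l j, \<iota>')) = (\<lambda>_. 0)"
   using vanishesD[OF v, of rs'] rs by auto
  then show ?thesis unfolding xterm_def using u by (subst app_Dg_Sh) (auto simp: app_zero simp del: app_simps)
 qed
 then show ?thesis using u by (simp add: xv_def app_sum Dg.rep_eq)
qed

text \<open>Vanishing at everything reached by shorter words is itself preserved by these operators,
  so the case of a single dot can be iterated along products.\<close>

lemma pv_triangular:
 "set rs \<subseteq> {1..<d} ==> vanishes d (length rs) \<phi> ==>
  app (pv d l f) \<phi> (word_perm rs, \<iota>)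
  = app (pint (E0 d) (\<lambda>i. tok0 d (word_perm rs (l + i))) (\<lambda>i. x0 d (word_perm rs (l + i))) f) (\<lambda>\<iota>'. \<phi> (word_perm rs, \<iota>')) \<iota>"
proof (induction f arbitrary: \<phi> rs \<iota>)
 case (PTok i a)
 then show ?case using word_perm_permutes by (simp add: tokv_def Dg.rep_eq)
next
 case (PX i)
 then show ?case using xv_triangular by simp
next
 case POne
 then show ?case using word_perm_permutes by (simp add: ev_def Dg.rep_eq)
next
 case (PMul f g)
 have "vanishes d (length rs) (app (pv d l g) \<phi>)"
  unfolding vanishes_def
 proof (intro allI impI)
  fix rs' \<iota> assume rs': "set rs' \<subseteq> {1..<d}" "length rs' < length rs"
  have "vanishes d (length rs') \<phi>" using vanishes_mono[OF PMul.prems(2)] rs'(2) by simp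
  from PMul.IH(2)[OF rs'(1) this] show "app (pv d l g) \<phi> (word_perm rs', \<iota>) = 0"
   using vanishesD[OF PMul.prems(2) rs'] by (simp add: app_zero)
 qed
 then show ?case using PMul.IH(1)[OF PMul.prems(1)] PMul.IH(2)[OF PMul.prems] by simp
qed (simp_all)

text \<open>Induction from the bottom crossing: a black crossing translates by one letter of the
  word, \<open>Rho\<close> contributes a copy of \<open>Q\<close>, and \<open>Lam\<close>
  contributes nothing. The vanishing hypothesis has to be passed on to the rest of the diagram in
  each case.\<close>

lemma diagram_triangular:
 assumes "is_diagram u ps v" "u \<in> Ob" "nb u = d"
 shows "\<exists>p. redterm d p \<and> (\<forall>\<phi> \<iota>. vanishes d (length (black_word u ps)) \<phi> \<longrightarrow>
  app (Fi d (diagram_mor u ps) 0) \<phi> (id, \<iota>)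
  = app (pint0 d p) (\<lambda>\<iota>'. \<phi> (word_perm (black_word u ps), \<iota>')) \<iota>)"
 using assms
proof (induction ps arbitrary: u)
 case Nil
 have *: "app (ev d) \<phi> (id, \<iota>) = app (E0 d) (\<lambda>\<iota>'. \<phi> (id, \<iota>')) \<iota>" for \<phi> \<iota>
  by (simp add: ev_def Dg.rep_eq permutes_id)
 show ?case
  by (intro exI[of _ POne] conjI allI impI redterm_one)
   (simp only: diagram_mor.simps Fi.simps black_word.simps word_perm.simps pint.simps *)
next
 case (Cons p ps)
 interpret R: polrep A d "E0 d" "tok0 d" "x0 d" by (rule polrep0)
 interpret V: polrep A d "ev d" "tokv d" "xv d" by (rule polrepv)
 obtain l a b r where u: "u = l @ a # b # r" "p = length l"
  using Cons.prems(1) word_split_at[of p u] by (metis is_diagram.simps(2))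
 let ?u = "l @ b # a # r"
 have *: "a = None \<or> b = None" "is_diagram ?u ps v"
  using Cons.prems(1) unfolding u is_diagram_step by auto
 have o: "?u \<in> Ob" "nb ?u = d" "[a, b] \<in> Ob" using Cons.prems(2,3) u by (auto simp: object_Cons)
 let ?rs = "black_word ?u ps" and ?F = "Fi d (diagram_mor ?u ps) 0"
 let ?w = "word_perm ?rs"
 have rs: "set ?rs \<subseteq> {1..<d}" using black_word_set[OF *(2)] o(2) by simp
 have w: "?w permutes {1..d}" by (rule word_perm_permutes[OF rs])
 obtain q where q: "redterm d q" "\<And>\<phi> \<iota>. vanishes d (length ?rs) \<phi> ==>
  app ?F \<phi> (id, \<iota>) = app (pint0 d q) (\<lambda>\<iota>'. \<phi> (?w, \<iota>')) \<iota>"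
  using Cons.IH[OF *(2) o(1,2)] by blast
 have qE: "pint0 d q * E0 d = pint0 d q" using R.pint_e[OF redterm_terms[OF q(1)]] by simp
 have bw: "black_word u (p # ps) = (if a = None \<and> b = None then [Suc (nb l)] else []) @ ?rs"
  unfolding u by (simp add: nth_append swap_at_length nb_filter)
 have F: "Fi d (diagram_mor u (p # ps)) 0 = ?F * (ev d * Fi d (crossing a b) (nb l) * ev d)"
  unfolding u diagram_mor_step by (simp add: wh_def mult.assoc)
 consider "a = None" "b = None" | Q where "a = Some Q" "b = None" | Q where "a = None" "b = Some Q"
  using *(1) by (cases a; cases b) auto
 then show ?case
 proof cases
  case 1
  let ?k = "Suc (nb l)"
  have k: "?k \<in> {1..<d}" using o(2) 1 by auto
  have F': "Fi d (diagram_mor u (p # ps)) 0 = ?F * Tv d ?k"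
   unfolding F using 1 Tv_ev(1)[OF k] Tv_ev(2)[of d ?k] by (simp add: mult.assoc)
  have T: "(\<lambda>\<iota>. app (Tv d ?k) \<phi> (word_perm rs', \<iota>)) = app (E0 d) (\<lambda>\<iota>'. \<phi> (word_perm (?k # rs'), \<iota>'))"
   if "set rs' \<subseteq> {1..<d}" for \<phi> rs'
  proof -
   have "set (?k # rs') \<subseteq> {1..<d}" using that k by auto
   then have "word_perm rs' \<circ> st ?k permutes {1..d}" using word_perm_permutes[of "?k # rs'" d] by simp
   then show ?thesis by (simp add: Tv_def Sh.rep_eq ev_def Dg.rep_eq fun_eq_iff)
  qed
  have key: "app (Fi d (diagram_mor u (p # ps)) 0) \<phi> (id, \<iota>) = app (pint0 d q) (\<lambda>\<iota>'. \<phi> (word_perm (?k # ?rs), \<iota>')) \<iota>"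
   if v: "vanishes d (length (?k # ?rs)) \<phi>" for \<phi> \<iota>
  proof -
   have "vanishes d (length ?rs) (app (Tv d ?k) \<phi>)"
    unfolding vanishes_def
   proof (intro allI impI)
    fix rs' \<iota> assume rs': "set rs' \<subseteq> {1..<d}" "length rs' < length ?rs"
    then have "set (?k # rs') \<subseteq> {1..<d}" "length (?k # rs') < length (?k # ?rs)" using k by auto
    from vanishesD[OF v this] show "app (Tv d ?k) \<phi> (word_perm rs', \<iota>) = 0"
     using fun_cong[OF T[OF rs'(1), of \<phi>], of \<iota>] by (simp add: app_zero)
   qed
   then have "app (?F * Tv d ?k) \<phi> (id, \<iota>) = app (pint0 d q) (\<lambda>\<iota>'. app (Tv d ?k) \<phi> (?w, \<iota>')) \<iota>"
    using q(2) by simp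
   also have "... = app (pint0 d q * E0 d) (\<lambda>\<iota>'. \<phi> (word_perm (?k # ?rs), \<iota>')) \<iota>"
    unfolding T[OF rs] by simp
   finally show ?thesis unfolding F' qE .
  qed
  have bw': "black_word u (p # ps) = ?k # ?rs" unfolding bw using 1 by simp
  show ?thesis
   by (intro exI[of _ "q"] conjI allI impI q(1)) (simp only: bw' key)
 next
  case (2 Q)
  then have Q: "Q \<in> pol_E A 1" using o(3) by simp
  have l: "nb l < d" using o(2) 2 by auto
  have F': "Fi d (diagram_mor u (p # ps)) 0 = ?F * Qv d (nb l) Q"
   unfolding F using 2 Qv_ev[OF Q l] by (simp add: mult.assoc)
  \<comment> \<open>The black strand of this crossing is number \<open>nb l + 1\<close> here; the
    remaining crossings take it to the position \<open>?k\<close> at the top, which names the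
    variable.\<close>
  let ?k = "?w (Suc (nb l))"
  have k: "?k \<in> {1..d}" using w l permutes_in_image[OF w, of "Suc (nb l)"] by auto
  have key: "app (Fi d (diagram_mor u (p # ps)) 0) \<phi> (id, \<iota>) = app (pint0 d (PMul q (qk ?k Q))) (\<lambda>\<iota>'. \<phi> (?w, \<iota>')) \<iota>"
   if v: "vanishes d (length ?rs) \<phi>" for \<phi> \<iota>
  proof -
   have "vanishes d (length ?rs) (app (Qv d (nb l) Q) \<phi>)"
    unfolding vanishes_def
   proof (intro allI impI)
    fix rs' \<iota> assume rs': "set rs' \<subseteq> {1..<d}" "length rs' < length ?rs"
    have "vanishes d (length rs') \<phi>" using vanishes_mono[OF v] rs'(2) by simp
    from pv_triangular[OF rs'(1) this] show "app (Qv d (nb l) Q) \<phi> (word_perm rs', \<iota>) = 0"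
     unfolding Qv_def using vanishesD[OF v rs'] by (simp add: app_zero)
   qed
   then have "app (?F * Qv d (nb l) Q) \<phi> (id, \<iota>) = app (pint0 d q) (\<lambda>\<iota>'. app (Qv d (nb l) Q) \<phi> (?w, \<iota>')) \<iota>"
    using q(2) by simp
   also have "(\<lambda>\<iota>'. app (Qv d (nb l) Q) \<phi> (?w, \<iota>')) = app (pint0 d (qk ?k Q)) (\<lambda>\<iota>'. \<phi> (?w, \<iota>'))"
    unfolding Qv_def using pv_triangular[OF rs v] pint_qk[OF Q refl, of d ?w "nb l"] by (simp add: fun_eq_iff)
   finally show ?thesis unfolding F' by (simp only: pint.simps times_lop.rep_eq)
  qed
  have bw': "black_word u (p # ps) = ?rs" unfolding bw using 2 by simp
  show ?thesis
   by (intro exI[of _ "PMul q (qk ?k Q)"] conjI allI impI redterm_mul[OF q(1) k Q]) (simp only: bw' key)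
 next
  case (3 Q)
  have F': "Fi d (diagram_mor u (p # ps)) 0 = ?F * ev d"
   unfolding F using 3 by (simp add: V.e_idem)
  have E: "(\<lambda>\<iota>. app (ev d) \<phi> (word_perm rs', \<iota>)) = app (E0 d) (\<lambda>\<iota>'. \<phi> (word_perm rs', \<iota>'))"
   if "set rs' \<subseteq> {1..<d}" for \<phi> rs'
   using word_perm_permutes[OF that] by (simp add: ev_def Dg.rep_eq fun_eq_iff)
  have key: "app (Fi d (diagram_mor u (p # ps)) 0) \<phi> (id, \<iota>) = app (pint0 d q) (\<lambda>\<iota>'. \<phi> (?w, \<iota>')) \<iota>"
   if v: "vanishes d (length ?rs) \<phi>" for \<phi> \<iota>
  proof -
   have "vanishes d (length ?rs) (app (ev d) \<phi>)"
    unfolding vanishes_def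
   proof (intro allI impI)
    fix rs' \<iota> assume rs': "set rs' \<subseteq> {1..<d}" "length rs' < length ?rs"
    from vanishesD[OF v rs'] show "app (ev d) \<phi> (word_perm rs', \<iota>) = 0"
     using fun_cong[OF E[OF rs'(1), of \<phi>], of \<iota>] by (simp add: app_zero)
   qed
   then have "app (?F * ev d) \<phi> (id, \<iota>) = app (pint0 d q) (\<lambda>\<iota>'. app (ev d) \<phi> (?w, \<iota>')) \<iota>"
    using q(2) by simp
   also have "... = app (pint0 d q * E0 d) (\<lambda>\<iota>'. \<phi> (?w, \<iota>')) \<iota>" unfolding E[OF rs] by simp
   finally show ?thesis unfolding F' qE .
  qed
  have bw': "black_word u (p # ps) = ?rs" unfolding bw using 3 by simp
  show ?thesis
   by (intro exI[of _ "q"] conjI allI impI q(1)) (simp only: bw' key)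
 qed
qed

subsection \<open>Linear independence\<close>

lemma Fi_Iv: "f \<in> pol_terms d ==> nb v = d ==> Fi d (Iv v f) 0 = pv d 0 f"
proof (induction rule: pol_terms.induct)
 case (1 k a)
 interpret V: polrep A d "ev d" "tokv d" "xv d" by (rule polrepv)
 obtain l r where "v = l @ None # r" "k = Suc (nb l)" using black_split 1 by blast
 then show ?case using 1 by (simp add: on_black_wh wh_def V.e_tok V.tok_e)
next
 case (2 k)
 interpret V: polrep A d "ev d" "tokv d" "xv d" by (rule polrepv)
 obtain l r where "v = l @ None # r" "k = Suc (nb l)" using black_split 2 by blast
 then show ?case using 2 by (simp add: on_black_wh wh_def V.e_x V.x_e)
qed auto

lemma basis_terms_independent:
 assumes i: "i \<in> Ob" "nb i = d" and j: "j \<in> Ob" "nb j = d"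
  and D: "\<And>w. w permutes {1..d} ==> chosen_diagram d j i w (D w)"
  and ms: "distinct ms" "set ms \<subseteq> basis_index A d"
  and zero: "law_eq A i j (msum i j (map (\<lambda>m. Smul (c m) (basis_term j i D m)) ms)) (Zero i j)"
  and m: "m \<in> set ms"
 shows "c m = 0"
proof (rule ccontr)
 assume "c m \<noteq> 0"
 let ?S = "{m \<in> set ms. c m \<noteq> 0}"
 let ?len = "\<lambda>w. length (black_word i (D w))"
 let ?perm = "\<lambda>m :: 'a list \<times> nat list \<times> (nat => nat). snd (snd m)"
 let ?mon = "\<lambda>m :: 'a list \<times> nat list \<times> (nat => nat). pmon (fst m) (fst (snd m)) :: ('k, 'a) pterm"
 let ?f = "\<lambda>m'. ?len (?perm m')"
 have fin: "finite (?f ` ?S)" by simp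
 have "m \<in> ?S" using m \<open>c m \<noteq> 0\<close> by simp
 then have "?f m \<in> ?f ` ?S" by (rule imageI)
 then have "?f ` ?S \<noteq> {}" by (metis empty_iff)
 then have "Max (?f ` ?S) \<in> ?f ` ?S" by (rule Max_in[OF fin])
 then obtain m0 where m0: "Max (?f ` ?S) = ?f m0" "m0 \<in> ?S" by (rule imageE)
 have max: "?f m' \<le> ?f m0" if "m' \<in> ?S" for m'
  unfolding m0(1)[symmetric] by (rule Max_ge[OF fin imageI[OF that]])
 define w where "w = ?perm m0"
 have idx: "(fst m', fst (snd m')) \<in> mono_indices d \<and> ?perm m' permutes {1..d}" if "m' \<in> set ms" for m'
  using that ms(2) basis_index_iff[of "fst m'" "fst (snd m')" "?perm m'" d] by auto
 have w: "w permutes {1..d}" using idx m0(2) unfolding w_def by blast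
 have red: "word_perm (black_word i (D w')) = w'" "set (black_word i (D w')) \<subseteq> {1..<d}"
  "\<And>rs. set rs \<subseteq> {1..<d} ==> word_perm rs = w' ==> ?len w' \<le> length rs"
  if "w' permutes {1..d}" for w'
  using D[OF that] unfolding chosen_diagram_def reduced_expression_def by auto
 have "\<exists>p. redterm d p \<and> (\<forall>\<phi> \<iota>. vanishes d (?len w') \<phi> \<longrightarrow>
   app (Fi d (diagram_mor i (D w')) 0) \<phi> (id, \<iota>) = app (pint0 d p) (\<lambda>\<iota>'. \<phi> (w', \<iota>')) \<iota>)"
  if "w' permutes {1..d}" for w'
  using diagram_triangular[of i "D w'" j d] D[OF that] i red(1)[OF that] unfolding chosen_diagram_def by auto
 then obtain p where p: "\<And>w'. w' permutes {1..d} ==> redterm d (p w')"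
  "\<And>w' \<phi> \<iota>. w' permutes {1..d} ==> vanishes d (?len w') \<phi> ==>
   app (Fi d (diagram_mor i (D w')) 0) \<phi> (id, \<iota>) = app (pint0 d (p w')) (\<lambda>\<iota>'. \<phi> (w', \<iota>')) \<iota>"
  by metis
 \<comment> \<open>Supported at the single permutation \<open>w\<close>. The value
   \<open>vac d\<close> there lets the vanishing of an operator value be turned into the vanishing
   of an element.\<close>
 define \<phi> where "\<phi> = (\<lambda>(u, \<iota>). if u = w then vac d \<iota> else 0)"
 \<comment> \<open>No word shorter than a reduced one reaches \<open>w\<close>, so the test function
   vanishes at whatever shorter words reach.\<close>
 have van: "vanishes d (?len w') \<phi>" if "?len w' \<le> ?len w" for w'
  unfolding vanishes_def \<phi>_def using red(3)[OF w] that by force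
 have summand: "app (Fi d (basis_term j i D m') 0) \<phi> (id, \<iota>)
  = (if ?perm m' = w then app (pint0 d (?mon m') * pint0 d (p w)) (vac d) \<iota> else 0)" if m': "m' \<in> ?S" for m' \<iota>
 proof -
  have F: "Fi d (basis_term j i D m') 0 = pv d 0 (?mon m') * Fi d (diagram_mor i (D (?perm m'))) 0"
   using Fi_Iv[of "?mon m'" d j] pmono_terms[of "fst m'" "fst (snd m')" d] idx[of m'] m' j(2)
   by (simp add: basis_term_def Iv_pmon split_def)
  have pm: "?perm m' permutes {1..d}" using idx m' by blast
  have "vanishes d (?len (?perm m')) \<phi>" by (rule van) (use max[OF m'] in \<open>simp add: w_def\<close>)
  then have "app (Fi d (diagram_mor i (D (?perm m'))) 0) \<phi> (id, \<iota>')
   = (if ?perm m' = w then app (pint0 d (p w)) (vac d) \<iota>' else 0)" for \<iota>'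
   using p(2)[OF pm] by (auto simp: \<phi>_def app_zero)
  then show ?thesis unfolding F by (simp add: pv_id app_zero)
 qed
 define ns where "ns = filter (\<lambda>m'. ?perm m' = w) ms"
 have ns: "distinct ns" "set ns \<subseteq> set ms" "m0 \<in> set ns" using ms(1) m0(2) by (auto simp: ns_def w_def)
 define F where "F = psum (map (\<lambda>m'. PSmul (c m') (?mon m')) ns)"
 have mon: "?mon m' \<in> pol_terms d" if "m' \<in> set ms" for m' using idx[OF that] pmono_terms by blast
 have F: "F \<in> pol_terms d"
  unfolding F_def using ns(2) mon by (intro psum_terms) (auto intro!: pol_terms.intros)
 have pF: "pint0 d F = (\<Sum>m'\<in>set ns. sm (c m') (pint0 d (?mon m')))"
  unfolding F_def using ns(1) by (simp add: pint_psum o_def sum_list_distinct_conv_sum_set)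
 have sum0: "(\<Sum>m'\<in>set ms. c m' * app (Fi d (basis_term j i D m') 0) \<phi> (id, \<iota>)) = 0" for \<iota>
 proof -
  have "Fi d (msum i j (map (\<lambda>m. Smul (c m) (basis_term j i D m)) ms)) 0 = Fi d (Zero i j) 0"
   using zero i j by (intro Fi_sound[of i j]) auto
  then have "(\<Sum>m'\<in>set ms. sm (c m') (Fi d (basis_term j i D m') 0)) = 0"
   using ms(1) by (simp add: Fi_msum o_def sum_list_distinct_conv_sum_set)
  then have "app (\<Sum>m'\<in>set ms. sm (c m') (Fi d (basis_term j i D m') 0)) \<phi> (id, \<iota>) = 0" by simp
  then show ?thesis by (simp add: app_sum)
 qed
 have "app (pint0 d F * pint0 d (p w)) (vac d) \<iota> = 0" for \<iota>
 proof -
  have "app (pint0 d F * pint0 d (p w)) (vac d) \<iota>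
   = (\<Sum>m'\<in>set ns. c m' * app (pint0 d (?mon m') * pint0 d (p w)) (vac d) \<iota>)"
   unfolding pF by (simp add: app_sum)
  also have "... = (\<Sum>m'\<in>set ms. if ?perm m' = w then c m' * app (pint0 d (?mon m') * pint0 d (p w)) (vac d) \<iota> else 0)"
   unfolding ns_def set_filter by (intro sum.inter_filter) simp
  also have "... = (\<Sum>m'\<in>set ms. c m' * app (Fi d (basis_term j i D m') 0) \<phi> (id, \<iota>))"
  proof (intro sum.cong refl)
   fix m' assume "m' \<in> set ms"
   then show "(if ?perm m' = w then c m' * app (pint0 d (?mon m') * pint0 d (p w)) (vac d) \<iota> else 0)
    = c m' * app (Fi d (basis_term j i D m') 0) \<phi> (id, \<iota>)"
    by (cases "c m' = 0") (use summand[of m' \<iota>] in auto)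
  qed
  finally show ?thesis using sum0 by simp
 qed
 \<comment> \<open>The product of the \<open>Q\<close> stands next to the vector; it commutes with
   \<open>F\<close> and is moved to the left, where \<open>redterm_injective\<close> cancels
   it.\<close>
 then have "app (pint0 d (p w) * pint0 d F) (vac d) = (\<lambda>_. 0)"
  using redterm_commute[OF p(1)[OF w] F] by (simp add: fun_eq_iff)
 then have F0: "app (pint0 d F) (vac d) = (\<lambda>_. 0)"
  by (rule redterm_injective[OF p(1)[OF w] F])
 let ?T = "(\<lambda>m'. (fst m', fst (snd m'))) ` set ns"
 have "(\<Sum>(bs, \<alpha>)\<in>?T. sm (c (bs, \<alpha>, w)) (pint0 d (pmon bs \<alpha>))) = pint0 d F"
  unfolding pF
 proof (subst sum.reindex)
  show "inj_on (\<lambda>m'. (fst m', fst (snd m'))) (set ns)"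
   by (rule inj_onI) (auto simp: ns_def prod_eq_iff)
  show "sum ((\<lambda>(bs, \<alpha>). sm (c (bs, \<alpha>, w)) (pint0 d (pmon bs \<alpha>))) \<circ> (\<lambda>m'. (fst m', fst (snd m')))) (set ns)
   = (\<Sum>m'\<in>set ns. sm (c m') (pint0 d (?mon m')))"
   by (intro sum.cong) (auto simp: ns_def)
 qed
 then have "c (fst m0, fst (snd m0), w) = 0"
  using monomials_independent[of ?T d "\<lambda>bs \<alpha>. c (bs, \<alpha>, w)" "fst m0" "fst (snd m0)"] F0 ns(2,3) idx by fastforce
 then show False using m0(2) by (simp add: w_def)
qed

section \<open>From terms to the module of morphisms\<close>

subsection \<open>The module of morphisms\<close>

context
 fixes i j :: "('k, 'a) word"
 assumes i: "i \<in> Ob" and j: "j \<in> Ob"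
begin

interpretation N: term_module "{f. law_term A i j f}" "law_eq A i j" Add Smul "Zero i j"
 using i j by (rule law_module)

abbreviation cls where "cls \<equiv> law_class A i j"

lemma cls_eq: "law_term A i j f ==> cls f = cls g \<longleftrightarrow> law_eq A i j f g"
 unfolding law_class_def using law_refl law_sym law_trans by blast

lemma hom_add: "law_term A i j f ==> law_term A i j g ==> cls f \<oplus>\<^bsub>law_hom A i j\<^esub> cls g = cls (Add f g)"
 unfolding law_hom_def law_class_def using law_cong_add law_refl law_trans law_sym by simp blast

lemma hom_smult: "law_term A i j f ==> c \<odot>\<^bsub>law_hom A i j\<^esub> cls f = cls (Smul c f)"
 unfolding law_hom_def law_class_def using law_cong_smul law_refl law_trans law_sym by simp blast

lemma hom_zero: "\<zero>\<^bsub>law_hom A i j\<^esub> = cls (Zero i j)"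
 by (simp add: law_hom_def)

lemma hom_carrier: "carrier (law_hom A i j) = cls ` {f. law_term A i j f}"
 by (simp add: law_hom_def)

lemma hom_abelian: "abelian_monoid (law_hom A i j)"
proof (rule abelian_monoidI)
 show "\<zero>\<^bsub>law_hom A i j\<^esub> \<in> carrier (law_hom A i j)"
  unfolding hom_zero hom_carrier using N.ze_T by blast
 fix x y z
 assume x: "x \<in> carrier (law_hom A i j)"
 then obtain f where f: "law_term A i j f" "x = cls f" unfolding hom_carrier by blast
 show "\<zero>\<^bsub>law_hom A i j\<^esub> \<oplus>\<^bsub>law_hom A i j\<^esub> x = x"
  unfolding f(2) hom_zero using f(1) N.ze_T N.ad_T N.zero_ad[of f] by (simp add: hom_add cls_eq)
 assume "y \<in> carrier (law_hom A i j)"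
 then obtain g where g: "law_term A i j g" "y = cls g" unfolding hom_carrier by blast
 show "x \<oplus>\<^bsub>law_hom A i j\<^esub> y \<in> carrier (law_hom A i j)"
  unfolding f(2) g(2) hom_add[OF f(1) g(1)] hom_carrier using N.ad_T f g by auto
 show "x \<oplus>\<^bsub>law_hom A i j\<^esub> y = y \<oplus>\<^bsub>law_hom A i j\<^esub> x"
  unfolding f(2) g(2) using f g N.ad_T N.ad_comm by (simp add: hom_add cls_eq)
 assume "z \<in> carrier (law_hom A i j)"
 then obtain h where h: "law_term A i j h" "z = cls h" unfolding hom_carrier by blast
 show "x \<oplus>\<^bsub>law_hom A i j\<^esub> y \<oplus>\<^bsub>law_hom A i j\<^esub> z = x \<oplus>\<^bsub>law_hom A i j\<^esub> (y \<oplus>\<^bsub>law_hom A i j\<^esub> z)"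
  unfolding f(2) g(2) h(2) using f g h N.ad_T N.ad_assoc by (simp add: hom_add cls_eq)
qed

interpretation H: abelian_monoid "law_hom A i j" by (rule hom_abelian)

lemma hom_finsum:
 assumes "distinct ms" "inj_on (\<lambda>m. cls (b m)) (set ms)" "\<And>m. m \<in> set ms ==> law_term A i j (b m)"
 shows "(\<Oplus>\<^bsub>law_hom A i j\<^esub>s\<in>(\<lambda>m. cls (b m)) ` set ms. c s \<odot>\<^bsub>law_hom A i j\<^esub> s)
  = cls (msum i j (map (\<lambda>m. Smul (c (cls (b m))) (b m)) ms))"
 using assms
proof (induction ms)
 case Nil
 then show ?case by (simp add: hom_zero)
next
 case (Cons m ms)
 let ?r = "msum i j (map (\<lambda>m. Smul (c (cls (b m))) (b m)) ms)"
 have lsum: "N.lsum fs = msum i j fs" for fs by (induction fs) auto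
 have r: "law_term A i j ?r"
  using N.lsum_T[of "map (\<lambda>m. Smul (c (cls (b m))) (b m)) ms"] N.sc_T Cons.prems(3) unfolding lsum by auto
 have t: "c (cls (b m')) \<odot>\<^bsub>law_hom A i j\<^esub> cls (b m') = cls (Smul (c (cls (b m'))) (b m'))"
  "law_term A i j (Smul (c (cls (b m'))) (b m'))" if "m' \<in> set (m # ms)" for m'
  using hom_smult N.sc_T Cons.prems(3)[OF that] by auto
 have "(\<Oplus>\<^bsub>law_hom A i j\<^esub>s\<in>insert (cls (b m)) ((\<lambda>m. cls (b m)) ` set ms). c s \<odot>\<^bsub>law_hom A i j\<^esub> s)
  = c (cls (b m)) \<odot>\<^bsub>law_hom A i j\<^esub> cls (b m)
   \<oplus>\<^bsub>law_hom A i j\<^esub> (\<Oplus>\<^bsub>law_hom A i j\<^esub>s\<in>(\<lambda>m. cls (b m)) ` set ms. c s \<odot>\<^bsub>law_hom A i j\<^esub> s)"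
 proof (rule H.finsum_insert)
  show "cls (b m) \<notin> (\<lambda>m. cls (b m)) ` set ms"
   using Cons.prems(1,2) by (auto dest: inj_onD)
  show "(\<lambda>s. c s \<odot>\<^bsub>law_hom A i j\<^esub> s) \<in> (\<lambda>m. cls (b m)) ` set ms \<rightarrow> carrier (law_hom A i j)"
   using t unfolding hom_carrier by auto
  show "c (cls (b m)) \<odot>\<^bsub>law_hom A i j\<^esub> cls (b m) \<in> carrier (law_hom A i j)"
   using t[of m] unfolding hom_carrier by auto
 qed simp
 also have "(\<Oplus>\<^bsub>law_hom A i j\<^esub>s\<in>(\<lambda>m. cls (b m)) ` set ms. c s \<odot>\<^bsub>law_hom A i j\<^esub> s) = cls ?r"
  using Cons by (simp add: inj_on_insert)
 also have "c (cls (b m)) \<odot>\<^bsub>law_hom A i j\<^esub> cls (b m) \<oplus>\<^bsub>law_hom A i j\<^esub> cls ?r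
  = cls (msum i j (map (\<lambda>m. Smul (c (cls (b m))) (b m)) (m # ms)))"
  using t[of m] r by (simp add: hom_add)
 finally show ?case by simp
qed

lemma lsum_filter:
 assumes "\<And>m. m \<in> set ms ==> law_term A i j (b m)"
 shows "law_eq A i j (msum i j (map (\<lambda>m. Smul (c m) (b m)) ms))
  (msum i j (map (\<lambda>m. Smul (c m) (b m)) (filter (\<lambda>m. c m \<noteq> 0) ms)))"
 using assms
proof (induction ms)
 case Nil
 then show ?case using N.eq_refl N.ze_T by simp
next
 case (Cons m ms)
 let ?f = "msum i j (map (\<lambda>m. Smul (c m) (b m)) (filter (\<lambda>m. c m \<noteq> 0) ms))"
 have IH: "law_eq A i j (msum i j (map (\<lambda>m. Smul (c m) (b m)) ms)) ?f" using Cons by simp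
 have m: "law_term A i j (b m)" using Cons.prems by simp
 have f: "law_term A i j ?f" using N.eq_T[OF IH] by simp
 show ?case
 proof (cases "c m = 0")
  case True
  have "law_eq A i j (Add (Smul 0 (b m)) (msum i j (map (\<lambda>m. Smul (c m) (b m)) ms))) (Add (Zero i j) ?f)"
   using m by (intro N.cong_ad IH N.zero_sc) auto
  also have "law_eq A i j ... ?f" using f by (intro N.zero_ad) auto
  finally show ?thesis using True by simp
 next
  case False
  then show ?thesis using N.cong_ad[OF N.eq_refl IH, of "Smul (c m) (b m)"] N.sc_T m by simp
 qed
qed

text \<open>Translates statements about lists of terms into sums over classes. Independence also
  separates the classes of different indices, so that summing over classes amounts to summing over
  indices.\<close>

theorem basis_criterion:
 assumes b: "\<And>m. m \<in> I ==> law_term A i j (b m)"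
  and span: "\<And>f. law_term A i j f ==> \<exists>ms c. distinct ms \<and> set ms \<subseteq> I \<and>
   law_eq A i j f (msum i j (map (\<lambda>m. Smul (c m) (b m)) ms))"
  and indep: "\<And>ms c m. distinct ms ==> set ms \<subseteq> I ==>
   law_eq A i j (msum i j (map (\<lambda>m. Smul (c m) (b m)) ms)) (Zero i j) ==> m \<in> set ms ==> c m = 0"
 shows "inj_on (\<lambda>m. cls (b m)) I \<and> is_basis (law_hom A i j) ((\<lambda>m. cls (b m)) ` I)"
proof
 have lsum: "N.lsum fs = msum i j fs" for fs by (induction fs) auto
 have sum_eq: "c1 m = c2 m" if ms: "distinct ms" "set ms \<subseteq> I" "m \<in> set ms"
  and e: "law_eq A i j (msum i j (map (\<lambda>m. Smul (c1 m) (b m)) ms)) (msum i j (map (\<lambda>m. Smul (c2 m) (b m)) ms))"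
  for ms m c1 c2
 proof -
  let ?s = "\<lambda>c. msum i j (map (\<lambda>m. Smul (c m) (b m)) ms)"
  have bT: "b m \<in> {f. law_term A i j f}" if "m \<in> set ms" for m using b that ms(2) by auto
  have T: "law_term A i j (?s c1)" "law_term A i j (?s c2)" using N.eq_T[OF e] by auto
  have "law_eq A i j (?s (\<lambda>m. c1 m - c2 m)) (N.lsum (map (\<lambda>m. Add (Smul (c1 m) (b m)) (Smul (- 1) (Smul (c2 m) (b m)))) ms))"
   unfolding lsum[symmetric]
  proof (rule N.lsum_cong)
   fix m assume m: "m \<in> set ms"
   have "law_eq A i j (Smul (c1 m + - 1 * c2 m) (b m)) (Add (Smul (c1 m) (b m)) (Smul (- 1 * c2 m) (b m)))"
    by (rule N.ad_sc[OF bT[OF m]])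
   also have "law_eq A i j ... (Add (Smul (c1 m) (b m)) (Smul (- 1) (Smul (c2 m) (b m))))"
    by (intro N.cong_ad N.eq_refl N.sc_T bT m N.eq_sym[OF N.sc_sc])
   finally show "law_eq A i j (Smul (c1 m - c2 m) (b m)) (Add (Smul (c1 m) (b m)) (Smul (- 1) (Smul (c2 m) (b m))))"
    by simp
  qed
  also have "law_eq A i j ... (Add (?s c1) (N.lsum (map (\<lambda>m. Smul (- 1) (Smul (c2 m) (b m))) ms)))"
   unfolding lsum[symmetric] by (intro N.eq_sym[OF N.lsum_add] conjI N.sc_T bT)
  also have "law_eq A i j ... (Add (?s c1) (Smul (- 1) (?s c2)))"
   using T(1) unfolding lsum[symmetric] by (intro N.cong_ad N.eq_refl N.eq_sym[OF N.lsum_sc] N.sc_T bT) simp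
  also have "law_eq A i j ... (Add (?s c1) (Smul (- 1) (?s c1)))"
   using T by (intro N.cong_ad N.eq_refl N.cong_sc law_sym[OF e]) auto
  also have "law_eq A i j ... (Zero i j)" using T by (intro N.ad_neg) auto
  finally have "c1 m - c2 m = 0" using indep[OF ms(1,2) _ ms(3), of "\<lambda>m. c1 m - c2 m"] by blast
  then show ?thesis by simp
 qed
 show inj: "inj_on (\<lambda>m. cls (b m)) I"
 proof (rule inj_onI, rule ccontr)
  fix m m' assume m: "m \<in> I" "m' \<in> I" "cls (b m) = cls (b m')" "m \<noteq> m'"
  have e: "law_eq A i j (b m) (b m')" using m b cls_eq by blast
  have T: "b m \<in> {f. law_term A i j f}" "b m' \<in> {f. law_term A i j f}" using b m by auto
  let ?s = "\<lambda>c. msum i j (map (\<lambda>m. Smul (c m) (b m)) [m, m'])"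
  \<comment> \<open>If two classes agreed, these coefficients would give a nontrivial
    relation.\<close>
  let ?c = "\<lambda>x. if x = m then 1 else - 1 :: 'k"
  have "law_eq A i j (?s ?c) (Add (Smul 1 (b m)) (Smul (- 1) (b m')))"
   using m(4) T by (simp, intro N.cong_ad N.eq_refl N.ad_zero N.sc_T) auto
  also have "law_eq A i j ... (Add (b m') (Smul (- 1) (b m')))"
   using T by (intro N.cong_ad N.eq_refl N.sc_T law_trans[OF N.one_sc e]) auto
  also have "law_eq A i j ... (Zero i j)" using T by (intro N.ad_neg) auto
  finally have "?c m = 0" using indep[of "[m, m']" ?c m] m by simp
  then show False by simp
 qed
 have fin: "(\<Oplus>\<^bsub>law_hom A i j\<^esub>s\<in>(\<lambda>m. cls (b m)) ` set ms. c s \<odot>\<^bsub>law_hom A i j\<^esub> s)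
  = cls (msum i j (map (\<lambda>m. Smul (c (cls (b m))) (b m)) ms))" if "distinct ms" "set ms \<subseteq> I" for ms c
  using that inj b by (intro hom_finsum) (auto elim: inj_on_subset)
 have list: "\<exists>ms. distinct ms \<and> set ms \<subseteq> I \<and> (\<lambda>m. cls (b m)) ` set ms = S"
  if S: "finite S" "S \<subseteq> (\<lambda>m. cls (b m)) ` I" for S
 proof -
  obtain J where J: "J \<subseteq> I" "finite J" "S = (\<lambda>m. cls (b m)) ` J" using finite_subset_image[OF S] by blast
  then show ?thesis using finite_distinct_list[OF J(2)] by metis
 qed
 show "is_basis (law_hom A i j) ((\<lambda>m. cls (b m)) ` I)"
  unfolding is_basis_def
 proof (intro conjI ballI)
  show "(\<lambda>m. cls (b m)) ` I \<subseteq> carrier (law_hom A i j)" unfolding hom_carrier using b by auto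
  fix v assume "v \<in> carrier (law_hom A i j)"
  then obtain f where f: "law_term A i j f" "v = cls f" unfolding hom_carrier by blast
  let ?P = "\<lambda>c. finite {s. c s \<noteq> 0} \<and> {s. c s \<noteq> 0} \<subseteq> (\<lambda>m. cls (b m)) ` I \<and>
   v = (\<Oplus>\<^bsub>law_hom A i j\<^esub>s\<in>{s. c s \<noteq> 0}. c s \<odot>\<^bsub>law_hom A i j\<^esub> s)"
  show "\<exists>!c. ?P c"
  proof (rule ex_ex1I)
   obtain ms0 c0 where ms0: "distinct ms0" "set ms0 \<subseteq> I"
    "law_eq A i j f (msum i j (map (\<lambda>m. Smul (c0 m) (b m)) ms0))" using span[OF f(1)] by blast
   \<comment> \<open>Zero coefficients are dropped, because \<open>is_basis\<close> sums over the
     exact support.\<close>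
   define ms where "ms = filter (\<lambda>m. c0 m \<noteq> 0) ms0"
   have ms: "distinct ms" "set ms \<subseteq> I" "\<And>m. m \<in> set ms ==> c0 m \<noteq> 0" using ms0 by (auto simp: ms_def)
   have e: "law_eq A i j f (msum i j (map (\<lambda>m. Smul (c0 m) (b m)) ms))"
    unfolding ms_def by (rule law_trans[OF ms0(3) lsum_filter]) (use b ms0(2) in auto)
   define c where "c s = (if s \<in> (\<lambda>m. cls (b m)) ` set ms then c0 (the_inv_into I (\<lambda>m. cls (b m)) s) else 0)" for s
   have c: "c (cls (b m)) = c0 m" if "m \<in> set ms" for m
    using that ms(2) the_inv_into_f_f[OF inj, of m] by (auto simp: c_def)
   have supp: "{s. c s \<noteq> 0} = (\<lambda>m. cls (b m)) ` set ms"
    using c ms(3) by (auto simp: c_def)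
   have cm: "map (\<lambda>m. Smul (c (cls (b m))) (b m)) ms = map (\<lambda>m. Smul (c0 m) (b m)) ms" using c by simp
   have "v = (\<Oplus>\<^bsub>law_hom A i j\<^esub>s\<in>{s. c s \<noteq> 0}. c s \<odot>\<^bsub>law_hom A i j\<^esub> s)"
    unfolding supp fin[OF ms(1,2)] cm f(2) cls_eq[OF f(1)] by (rule e)
   then show "\<exists>c. ?P c" unfolding supp[symmetric] using supp ms(2) by (intro exI[of _ c]) auto
  next
   fix c1 c2 assume c: "?P c1" "?P c2"
   \<comment> \<open>The two coefficient functions are compared over the union of their supports,
     listed by indices.\<close>
   have "finite ({s. c1 s \<noteq> 0} \<union> {s. c2 s \<noteq> 0})" "{s. c1 s \<noteq> 0} \<union> {s. c2 s \<noteq> 0} \<subseteq> (\<lambda>m. cls (b m)) ` I"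
    using c by auto
   from list[OF this] obtain ms where ms: "distinct ms" "set ms \<subseteq> I"
    "(\<lambda>m. cls (b m)) ` set ms = {s. c1 s \<noteq> 0} \<union> {s. c2 s \<noteq> 0}" by blast
   let ?s = "\<lambda>c. msum i j (map (\<lambda>m. Smul (c (cls (b m))) (b m)) ms)"
   have T: "law_term A i j (?s c)" for c
    using N.lsum_T[of "map (\<lambda>m. Smul (c (cls (b m))) (b m)) ms"] N.sc_T b ms(2) unfolding lsum by auto
   have v: "v = cls (?s c)" if P: "?P c" and sub: "{s. c s \<noteq> 0} \<subseteq> (\<lambda>m. cls (b m)) ` set ms" for c
   proof -
    let ?ns = "filter (\<lambda>m. c (cls (b m)) \<noteq> 0) ms"
    have "{s. c s \<noteq> 0} = (\<lambda>m. cls (b m)) ` set ?ns" using sub by auto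
    moreover have "distinct ?ns" "set ?ns \<subseteq> I" using ms by auto
    ultimately have "v = cls (msum i j (map (\<lambda>m. Smul (c (cls (b m))) (b m)) ?ns))" using P fin[of ?ns c] by metis
    also have "... = cls (?s c)"
     using lsum_filter[of ms b "\<lambda>m. c (cls (b m))"] T b ms(2) cls_eq law_sym N.eq_T by blast
    finally show ?thesis .
   qed
   have "cls (?s c1) = cls (?s c2)" using v[OF c(1)] v[OF c(2)] ms(3) by blast
   then have "law_eq A i j (?s c1) (?s c2)" using cls_eq[OF T] by blast
   then have "c1 (cls (b m)) = c2 (cls (b m))" if "m \<in> set ms" for m
    using sum_eq[OF ms(1,2) that, of "\<lambda>m. c1 (cls (b m))" "\<lambda>m. c2 (cls (b m))"] by blast
   then have "c1 s = c2 s" if "s \<in> {s. c1 s \<noteq> 0} \<union> {s. c2 s \<noteq> 0}" for s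
    using that unfolding ms(3)[symmetric] by blast
   then show "c1 = c2" by (intro ext) (metis (mono_tags, lifting) UnI1 UnI2 mem_Collect_eq)
  qed
 qed
qed

end

text \<open>The two subsequence conditions force at least \<open>d\<close> black and
  \<open>length Qs\<close> red letters, and the total length leaves room for no more.\<close>

lemma shuffle_words_nb:
 assumes "u \<in> shuffle_words A d Qs"
 shows "u \<in> Ob \<and> nb u = d"
proof -
 have u: "u \<in> Ob" "length u = d + length Qs" "subseq (replicate d None) u" "subseq (map Some Qs) u"
  using assms unfolding shuffle_words_def by auto
 have "subseq (filter (\<lambda>x. x = None) (replicate d None)) (filter (\<lambda>x. x = None) u)"
  using u(3) by (rule subseq_filter)
 then have "d \<le> nb u" using list_emb_length by (fastforce simp: nb_filter filter_replicate)
 moreover have "subseq (filter (\<lambda>x. x \<noteq> None) (map Some Qs)) (filter (\<lambda>x. x \<noteq> None) u)"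
  using u(4) by (rule subseq_filter)
 then have "length Qs \<le> length (filter (\<lambda>x. x \<noteq> None) u)"
  using list_emb_length by (fastforce simp: filter_map o_def)
 moreover have "length u = nb u + length (filter (\<lambda>x. x \<noteq> None) u)"
  unfolding nb_filter using sum_length_filter_compl[of "\<lambda>x. x = None" u] by simp
 ultimately show ?thesis using u by simp
qed

end

theorem theorem5p18:
  fixes A :: "('k::comm_ring_1, 'a::{ring,monoid_mult}) frob"
    and d :: nat
    and Qs :: "('k, 'a) pterm set list"
    and i j :: "('k, 'a) word"
    and \<sigma> :: "('k, 'a) word \<Rightarrow> (nat \<Rightarrow> nat) \<Rightarrow> ('k, 'a) word \<Rightarrow> nat list"
  assumes "frobenius_superalgebra A"
    and "set Qs \<subseteq> pol_E A 1"
    and "\<And>u v w. \<lbrakk>u \<in> shuffle_words A d Qs; v \<in> shuffle_words A d Qs; w permutes {1..d}\<rbrakk>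
      \<Longrightarrow> chosen_diagram d v u w (\<sigma> v w u)"
    and "i \<in> shuffle_words A d Qs"
    and "j \<in> shuffle_words A d Qs"
  shows "inj_on (basis_element A j i (\<lambda>w. \<sigma> j w i)) (basis_index A d) \<and>
    is_basis (law_hom A i j) (basis_element A j i (\<lambda>w. \<sigma> j w i) ` basis_index A d)"
proof -
 interpret frobenius_superalgebra A by fact
 let ?D = "\<lambda>w. \<sigma> j w i"
 have i: "i \<in> law_objects A" "nb i = d" and j: "j \<in> law_objects A" "nb j = d"
  using shuffle_words_nb[OF assms(4)] shuffle_words_nb[OF assms(5)] by auto
 have D: "chosen_diagram d j i w (?D w)" if "w permutes {1..d}" for w
  using assms(3)[OF assms(4,5) that] .
 have "basis_element A j i ?D = (\<lambda>m. law_class A i j (basis_term j i ?D m))"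
  by (auto simp: basis_element_def basis_term_def fun_eq_iff)
 then show ?thesis
  using basis_criterion[OF i(1) j(1), of "basis_index A d" "basis_term j i ?D"]
   basis_term_typed[OF i j D] hom_expand[OF i j D] basis_terms_independent[OF i j D]
  by simp
qed

end
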